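(* Let $T\in(0,\infty)$, $d\in\mathbb N$, $\mathbb S$ a Polish space and $\mathcal C=\mathbb C([0,T]:\mathbb R^d)$. Let $(\Omega,\mathcal F,\{\mathcal F_t\},\mathbf P)$ be a $\mathbf P$-complete filtered probability space carrying a $d$-dimensional standard $\mathcal F_t$-Brownian motion $B$ and an $\mathcal F_0$-measurable $\mathbb S$-valued random variable $X$ with law $\rho$. Let $f:\mathcal C\times\mathbb S\to\mathbb R$ be bounded and Borel measurable. Then $$-\log\mathbf E\big[\exp(-f(B,X))\big]=\inf_{\Pi,\Upsilon_\Pi}\ \inf_{\hat\psi\in\mathcal A(\Upsilon_\Pi)}\Big\{R(\Pi\|\rho)+\bar{\mathbf E}\Big[\tfrac12\int_0^T\|\hat\psi(s)\|^2ds+f\Big(\bar W+\int_0^\cdot\hat\psi(s)\,ds,\ \bar X\Big)\Big]\Big\},$$ where the outer infimum is over all $\Pi\in\mathcal P(\mathbb S)$ and all systems $\Upsilon_\Pi$.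
   Context: $\mathcal P(\mathbb S)$ is the set of Borel probability measures on $\mathbb S$; $R(\Pi\|\rho)=\int\log\frac{d\Pi}{d\rho}\,d\Pi$ if $\Pi\ll\rho$ and $\infty$ otherwise. For $\Pi\in\mathcal P(\mathbb S)$, a system $\Upsilon_\Pi=(\bar\Omega,\bar{\mathcal F},\{\hat{\mathcal F}_t\},\bar{\mathbf P})$ consists of a probability space $(\bar\Omega,\bar{\mathcal F},\bar{\mathbf P})$ on which are given a $d$-dimensional standard Brownian motion $\bar W$ (on $[0,T]$) and an $\mathbb S$-valued random variable $\bar X$, independent of $\bar W$, with law $\Pi$, together with any filtration $\{\hat{\mathcal F}_t\}$ satisfying the usual conditions such that $\bar W$ is a standard $d$-dimensional Brownian motion with respect to $\{\hat{\mathcal F}_t\}$ and $\bar X$ is $\hat{\mathcal F}_0$-measurable. $\bar{\mathbf E}$ is expectation under $\bar{\mathbf P}$. $\mathcal A(\Upsilon_\Pi)$ is the collection of $\mathbb R^d$-valued $\hat{\mathcal F}_t$-progressively measurable processes $\hat\psi$ on $[0,T]$ with $\bar{\mathbf E}\int_0^T\|\hat\psi(s)\|^2ds<\infty$. *)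

theory Defs
  imports "HOL-Probability.Probability"
begin

section \<open>Path space\<close>

definition borel_of :: "'a topology \<Rightarrow> 'a measure" where
  "borel_of X = sigma (topspace X) {U. openin X U}"

text \<open>The space of continuous paths on \<open>[0,T]\<close> with the supremum metric; a path is represented by
  the function that is \<^term>\<open>undefined\<close> outside \<open>[0,T]\<close>.\<close>

definition path_space :: "real \<Rightarrow> (real \<Rightarrow> real ^ 'n) metric" where
  "path_space T = cfunspace (top_of_set {0..T}) euclidean_metric"

definition path_init_topology :: "real \<Rightarrow> ((real \<Rightarrow> real ^ 'n) \<times> 'a::topological_space) topology" where
  "path_init_topology T = prod_topology (mtopology_of (path_space T)) euclidean"


section \<open>Relative entropy\<close>

text \<open>\<^term>\<open>absolutely_continuous \<rho> \<mu>\<close> means \<open>\<mu> \<ll> \<rho>\<close>.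
  For probability measures \<open>\<mu> \<ll> \<rho>\<close> the negative part of
  \<open>log (d\<mu>/d\<rho>)\<close> is always \<open>\<mu>\<close>-integrable, so that non-integrability means that the integral
  is \<open>\<infinity>\<close>, whereas the Bochner integral in \<^const>\<open>KL_divergence\<close> would return 0.\<close>

definition relative_entropy :: "'a measure \<Rightarrow> 'a measure \<Rightarrow> ereal" where
  "relative_entropy \<mu> \<rho> =
     (if absolutely_continuous \<rho> \<mu> \<and> integrable \<mu> (entropy_density (exp 1) \<rho> \<mu>)
      then ereal (KL_divergence (exp 1) \<rho> \<mu>) else \<infinity>)"


section \<open>Filtrations and Brownian motion on a finite horizon\<close>

text \<open>All processes and filtrations are indexed by \<^typ>\<open>real\<close>, but only times in \<open>[0,T]\<close> matter.\<close>

definition filtration_upto :: "real \<Rightarrow> 'w measure \<Rightarrow> (real \<Rightarrow> 'w measure) \<Rightarrow> bool" where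
  "filtration_upto T M F \<longleftrightarrow>
     (\<forall>t\<in>{0..T}. subalgebra M (F t)) \<and>
     (\<forall>s t. 0 \<le> s \<and> s \<le> t \<and> t \<le> T \<longrightarrow> sets (F s) \<subseteq> sets (F t))"

text \<open>All subsets of null sets belong to \<open>F 0\<close>; in particular \<open>M\<close> itself is complete.\<close>

definition complete_filtration :: "'w measure \<Rightarrow> (real \<Rightarrow> 'w measure) \<Rightarrow> bool" where
  "complete_filtration M F \<longleftrightarrow> (\<forall>N\<in>null_sets M. \<forall>A. A \<subseteq> N \<longrightarrow> A \<in> sets (F 0))"

definition usual_conditions :: "real \<Rightarrow> 'w measure \<Rightarrow> (real \<Rightarrow> 'w measure) \<Rightarrow> bool" where
  "usual_conditions T M F \<longleftrightarrow>
     complete_filtration M F \<and>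
     (\<forall>t\<in>{0..<T}. sets (F t) = (\<Inter>u\<in>{t<..T}. sets (F u)))"

definition brownian_motion ::
    "real \<Rightarrow> 'w measure \<Rightarrow> (real \<Rightarrow> 'w measure) \<Rightarrow> (real \<Rightarrow> 'w \<Rightarrow> real ^ 'n) \<Rightarrow> bool" where
  "brownian_motion T M F W \<longleftrightarrow>
     (\<forall>t\<in>{0..T}. W t \<in> borel_measurable (F t)) \<and>
     (\<forall>\<omega>\<in>space M. W 0 \<omega> = 0 \<and> continuous_on {0..T} (\<lambda>t. W t \<omega>)) \<and>
     (\<forall>s t. 0 \<le> s \<and> s < t \<and> t \<le> T \<longrightarrow>
        prob_space.indep_set M (sets (F s))
          (sets (vimage_algebra (space M) (\<lambda>\<omega>. W t \<omega> - W s \<omega>) borel)) \<and>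
        distributed M lborel (\<lambda>\<omega>. W t \<omega> - W s \<omega>)
          (\<lambda>x. ennreal (\<Prod>i\<in>UNIV. normal_density 0 (sqrt (t - s)) (x $ i))))"


section \<open>Control systems\<close>

text \<open>The tuple \<open>(\<mu>, M, W, X, F)\<close> consists of the law \<open>\<mu>\<close> of the initial variable and a system
  for \<open>\<mu>\<close>, whose sample space is a subset of the type \<open>'w\<close>.\<close>

definition control_systems ::
    "real \<Rightarrow> ('a::topological_space measure \<times> 'w measure \<times> (real \<Rightarrow> 'w \<Rightarrow> real ^ 'n) \<times>
       ('w \<Rightarrow> 'a) \<times> (real \<Rightarrow> 'w measure)) set" where
  "control_systems T = {(\<mu>, M, W, X, F).
     prob_space \<mu> \<and> sets \<mu> = sets borel \<and>
     prob_space M \<and> filtration_upto T M F \<and> usual_conditions T M F \<and>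
     brownian_motion T M F W \<and>
     X \<in> borel_measurable (F 0) \<and> distr M borel X = \<mu> \<and>
     prob_space.indep_set M (sets (vimage_algebra (space M) X borel))
       (sets (vimage_algebra (space M) (\<lambda>\<omega>. \<lambda>t\<in>{0..T}. W t \<omega>) (\<Pi>\<^sub>M t\<in>{0..T}. borel)))}"

definition progressively_measurable ::
    "real \<Rightarrow> (real \<Rightarrow> 'w measure) \<Rightarrow> (real \<Rightarrow> 'w \<Rightarrow> real ^ 'n) \<Rightarrow> bool" where
  "progressively_measurable T F \<psi> \<longleftrightarrow>
     (\<forall>t\<in>{0..T}. (\<lambda>(s, \<omega>). \<psi> s \<omega>) \<in> borel_measurable (restrict_space borel {0..t} \<Otimes>\<^sub>M F t))"

definition controls ::
    "real \<Rightarrow> 'w measure \<Rightarrow> (real \<Rightarrow> 'w measure) \<Rightarrow> (real \<Rightarrow> 'w \<Rightarrow> real ^ 'n) set" where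
  "controls T M F = {\<psi>. progressively_measurable T F \<psi> \<and>
     (\<integral>\<^sup>+\<omega>. (\<integral>\<^sup>+s\<in>{0..T}. ennreal ((norm (\<psi> s \<omega>))\<^sup>2) \<partial>lborel) \<partial>M) < \<infinity>}"

text \<open>The path of \<open>W + \<integral>\<^sub>0 \<psi>(s) ds\<close>.  For \<open>\<psi> \<in> controls T M F\<close> it lies in \<open>path_space T\<close> for
  almost every \<open>\<omega>\<close>; the exceptional null set, on which \<open>\<psi>\<close> need not be integrable in time, does not
  affect expectations because the systems are complete.\<close>

definition controlled_path ::
    "real \<Rightarrow> (real \<Rightarrow> 'w \<Rightarrow> real ^ 'n) \<Rightarrow> (real \<Rightarrow> 'w \<Rightarrow> real ^ 'n) \<Rightarrow> 'w \<Rightarrow> real \<Rightarrow> real ^ 'n" where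
  "controlled_path T W \<psi> \<omega> = (\<lambda>t\<in>{0..T}. W t \<omega> + (LBINT s:{0..t}. \<psi> s \<omega>))"

definition control_cost ::
    "real \<Rightarrow> ((real \<Rightarrow> real ^ 'n) \<times> 'a \<Rightarrow> real) \<Rightarrow>
     'w measure \<Rightarrow> (real \<Rightarrow> 'w \<Rightarrow> real ^ 'n) \<Rightarrow> ('w \<Rightarrow> 'a) \<Rightarrow> (real \<Rightarrow> 'w \<Rightarrow> real ^ 'n) \<Rightarrow> real" where
  "control_cost T f M W X \<psi> =
     (\<integral>\<omega>. 1 / 2 * (LBINT s:{0..T}. (norm (\<psi> s \<omega>))\<^sup>2) + f (controlled_path T W \<psi> \<omega>, X \<omega>) \<partial>M)"

text \<open>HOL cannot quantify over the type of sample points inside a formula, hence the infimum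
  is taken over all systems whose sample space is a subset of one given type.\<close>

definition variational_value ::
    "'w itself \<Rightarrow> real \<Rightarrow> ((real \<Rightarrow> real ^ 'n) \<times> 'a::topological_space \<Rightarrow> real) \<Rightarrow> 'a measure \<Rightarrow> ereal" where
  "variational_value _ T f \<rho> =
     (INF (\<mu>, M :: 'w measure, W, X, F) \<in> control_systems T. INF \<psi> \<in> controls T M F.
        relative_entropy \<mu> \<rho> + ereal (control_cost T f M W X \<psi>))"

end

theory Submission
  imports Defs
begin

text \<open>
  The upper and the lower bound are first proved for functionals \<open>f = - ln g\<close> with \<open>g\<close> a strictly
  positive trigonometric function of finitely many values of the path, with coefficients that
  depend measurably on the initial point; these are dense in \<open>L\<^sup>1\<close> of any path measure.  For such
  \<open>g\<close> the conditional expectation \<open>G\<^sub>t\<close> of \<open>g\<close> under Wiener measure and its gradient are explicit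
  finite sums, so that Girsanov's theorem for the density \<open>G\<^sub>T / G\<^sub>0\<close> and the bounded drift
  \<open>\<nabla> ln G\<close> needs no stochastic integrals: the martingale property is checked on products of
  complex exponentials of Gaussian increments.

  The energy of a bounded drift never exceeds the relative entropy of the two laws.  Applied under
  the tilted measure, this shows that the drift \<open>\<nabla> ln G\<close> together with the initial law of density
  \<open>G\<^sub>0 / \<integral> G\<^sub>0 d\<rho>\<close> attains the infimum for \<open>g\<close>.  Applied under the measure of an arbitrary control
  system, in which \<open>\<nabla> ln G\<close> is evaluated along the controlled path, it bounds the cost of that
  system from below by \<open>\<integral> - ln G\<^sub>0\<close>, and the Gibbs variational principle on the space of initial
  points does the rest.
\<close>

section \<open>Density of function algebras\<close>

text \<open>For a merely measurable \<open>f\<close> the optimal feedback is known only through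
  martingale representation, which shows neither a bound nor any regularity in time. For a
  trigonometric \<open>g\<close> bounded below by \<open>\<delta> > 0\<close> the drift is a
  quotient of finite sums: bounded because \<open>G \<ge> \<delta>\<close>, and continuous in time
  off a finite set, as the Riemann-sum argument for the energy requires. Density in
  \<open>L^1\<close> suffices because the logarithm is Lipschitz above \<delta>. For the lower bound
  one \<open>g\<close> must be close to \<open>exp (- f)\<close> under the reference law and under
  the law of the controlled path at once, hence the pairs of measures in this part. Energy is
  compared with entropy by testing a change of measure against discretised exponential martingales
  through \<open>x + 1 \<le> exp x\<close>; with the roles of the two measures exchanged, the same
  inequality serves both bounds. The near-optimal system lives on the given sample space: only the
  measure changes and the filtration is made right-continuous, so no stochastic equation has to be
  solved and the infimum over systems on the type \<open>'w\<close> already has the right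
  value.\<close>

locale bounded_function_algebra =
  fixes \<Omega> :: "'a set" and \<A> :: "('a \<Rightarrow> real) set"
  assumes const: "(\<lambda>_. c) \<in> \<A>"
    and add: "g \<in> \<A> \<Longrightarrow> h \<in> \<A> \<Longrightarrow> (\<lambda>x. g x + h x) \<in> \<A>"
    and mult: "g \<in> \<A> \<Longrightarrow> h \<in> \<A> \<Longrightarrow> (\<lambda>x. g x * h x) \<in> \<A>"
    and bounded: "g \<in> \<A> \<Longrightarrow> \<exists>K. \<forall>x\<in>\<Omega>. \<bar>g x\<bar> \<le> K"
begin

lemma real_polynomial_comp:
  assumes "real_polynomial_function p" "g \<in> \<A>"
  shows "(\<lambda>x. p (g x)) \<in> \<A>"
  using assms
proof induction
  case (linear f)
  then obtain c where "f = (\<lambda>x. x * c)" by (auto simp: real_bounded_linear)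
  then show ?case using mult[OF linear(2) const[of c]] by simp
qed (auto intro: const add mult)

text \<open>The range of \<open>g\<close> lies in a compact interval, so Weierstrass approximation
  of \<open>h\<close> on that interval is enough, and polynomials in \<open>g\<close> stay in the
  algebra.\<close>

lemma continuous_comp:
  assumes g: "g \<in> \<A>" and h: "continuous_on UNIV h" and e: "0 < e"
  obtains k where "k \<in> \<A>" "\<And>x. x \<in> \<Omega> \<Longrightarrow> \<bar>k x - h (g x)\<bar> < e"
proof -
  obtain K where K: "\<And>x. x \<in> \<Omega> \<Longrightarrow> \<bar>g x\<bar> \<le> K" using bounded[OF g] by auto
  obtain p where p: "real_polynomial_function p" "\<And>x. x \<in> {-K..K} \<Longrightarrow> \<bar>h x - p x\<bar> < e"
    using Stone_Weierstrass_real_polynomial_function[of "{-K..K}" h e] e continuous_on_subset[OF h]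
    by auto
  show thesis
  proof (rule that[OF real_polynomial_comp[OF p(1) g]])
    fix x assume "x \<in> \<Omega>"
    then have "g x \<in> {-K..K}" using K[of x] by auto
    then show "\<bar>p (g x) - h (g x)\<bar> < e" using p(2)[of "g x"] by (simp add: abs_minus_commute)
  qed
qed

end

text \<open>The two measures share one \<sigma>-algebra, so that a single element of the algebra can
  approximate a function under both at once. \<open>generated\<close> is phrased with superlevel
  sets because these are the sets that ramp functions of algebra elements reach in
  \<open>L1_limit_indicator\<close>.\<close>

locale measured_function_algebra = bounded_function_algebra \<Omega> \<A>
  for \<Omega> :: "'a set" and \<A> :: "('a \<Rightarrow> real) set" +
  fixes m1 m2 :: "'a measure"
  assumes finite1: "finite_measure m1" and finite2: "finite_measure m2"
    and space1: "space m1 = \<Omega>" and sets2: "sets m2 = sets m1"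
    and measurable: "g \<in> \<A> \<Longrightarrow> g \<in> borel_measurable m1"
    and generated: "sets m1 \<subseteq> sigma_sets \<Omega> {{x\<in>\<Omega>. c < g x} | g c. g \<in> \<A>}"
begin

lemma space2: "space m2 = \<Omega>"
  using sets_eq_imp_space_eq[OF sets2] space1 by simp

lemma measurable_eq2: "borel_measurable m2 = borel_measurable m1"
  by (rule measurable_cong_sets) (auto simp: sets2)

definition bdd_meas :: "('a \<Rightarrow> real) \<Rightarrow> bool" where
  "bdd_meas f \<longleftrightarrow> f \<in> borel_measurable m1 \<and> (\<exists>K. \<forall>x\<in>\<Omega>. \<bar>f x\<bar> \<le> K)"

text \<open>The closure of the algebra for the two \<open>L^1\<close> distances with a common
  approximant. Including \<open>bdd_meas\<close> makes all integrals genuine rather than the default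
  value 0 of a non-integrable function.\<close>

definition L1_limit :: "('a \<Rightarrow> real) \<Rightarrow> bool" where
  "L1_limit f \<longleftrightarrow> bdd_meas f \<and>
     (\<forall>e>0. \<exists>g\<in>\<A>. (\<integral>x. \<bar>f x - g x\<bar> \<partial>m1) < e \<and> (\<integral>x. \<bar>f x - g x\<bar> \<partial>m2) < e)"

lemma bdd_meas_algebra: "g \<in> \<A> \<Longrightarrow> bdd_meas g"
  using measurable bounded by (auto simp: bdd_meas_def)

lemma bdd_meas_integrable:
  assumes "bdd_meas f" shows "integrable m1 f" "integrable m2 f"
proof -
  obtain K where K: "\<And>x. x \<in> \<Omega> \<Longrightarrow> \<bar>f x\<bar> \<le> K" and f: "f \<in> borel_measurable m1"
    using assms by (auto simp: bdd_meas_def)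
  show "integrable m1 f"
    by (rule finite_measure.integrable_const_bound[OF finite1, of _ K]) (use K f in \<open>auto simp: space1\<close>)
  show "integrable m2 f"
    by (rule finite_measure.integrable_const_bound[OF finite2, of _ K])
       (use K f in \<open>auto simp: space2 measurable_eq2\<close>)
qed

lemma bdd_meas_abs_diff: "bdd_meas f \<Longrightarrow> bdd_meas g \<Longrightarrow> bdd_meas (\<lambda>x. \<bar>f x - g x\<bar>)"
proof -
  assume f: "bdd_meas f" and g: "bdd_meas g"
  obtain K L where "\<forall>x\<in>\<Omega>. \<bar>f x\<bar> \<le> K" "\<forall>x\<in>\<Omega>. \<bar>g x\<bar> \<le> L" using f g unfolding bdd_meas_def by blast
  then have "\<forall>x\<in>\<Omega>. \<bar>\<bar>f x - g x\<bar>\<bar> \<le> K + L" by (auto simp: abs_le_iff) (smt (verit))+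
  then show ?thesis using f g unfolding bdd_meas_def by auto
qed

lemma bdd_meas_add: "bdd_meas f \<Longrightarrow> bdd_meas g \<Longrightarrow> bdd_meas (\<lambda>x. f x + g x)"
proof -
  assume f: "bdd_meas f" and g: "bdd_meas g"
  obtain K L where KL: "\<forall>x\<in>\<Omega>. \<bar>f x\<bar> \<le> K" "\<forall>x\<in>\<Omega>. \<bar>g x\<bar> \<le> L" using f g unfolding bdd_meas_def by blast
  have "\<forall>x\<in>\<Omega>. \<bar>f x + g x\<bar> \<le> K + L"
  proof
    fix x assume "x \<in> \<Omega>"
    then show "\<bar>f x + g x\<bar> \<le> K + L" using KL abs_triangle_ineq[of "f x" "g x"] by fastforce
  qed
  then show ?thesis using f g unfolding bdd_meas_def by auto
qed

lemma bdd_meas_mult: "bdd_meas f \<Longrightarrow> bdd_meas g \<Longrightarrow> bdd_meas (\<lambda>x. f x * g x)"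
proof -
  assume f: "bdd_meas f" and g: "bdd_meas g"
  obtain K L where KL: "\<forall>x\<in>\<Omega>. \<bar>f x\<bar> \<le> K" "\<forall>x\<in>\<Omega>. \<bar>g x\<bar> \<le> L" using f g unfolding bdd_meas_def by blast
  have "\<forall>x\<in>\<Omega>. \<bar>f x * g x\<bar> \<le> K * L"
  proof
    fix x assume "x \<in> \<Omega>"
    then show "\<bar>f x * g x\<bar> \<le> K * L"
      using KL by (fastforce simp: abs_mult intro!: mult_mono intro: order_trans[OF abs_ge_zero])
  qed
  then show ?thesis using f g unfolding bdd_meas_def by auto
qed

lemma L1_limit_L1:
  assumes f: "bdd_meas f"
    and *: "\<And>e. 0 < e \<Longrightarrow> \<exists>g. L1_limit g \<and> (\<integral>x. \<bar>f x - g x\<bar> \<partial>m1) < e \<and> (\<integral>x. \<bar>f x - g x\<bar> \<partial>m2) < e"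
  shows "L1_limit f"
  unfolding L1_limit_def
proof (intro conjI allI impI f)
  fix e :: real assume e: "0 < e"
  obtain g where g: "L1_limit g" "(\<integral>x. \<bar>f x - g x\<bar> \<partial>m1) < e / 2" "(\<integral>x. \<bar>f x - g x\<bar> \<partial>m2) < e / 2"
    using *[of "e / 2"] e by auto
  have g': "bdd_meas g" using g(1) by (simp add: L1_limit_def)
  obtain h where h: "h \<in> \<A>" "(\<integral>x. \<bar>g x - h x\<bar> \<partial>m1) < e / 2" "(\<integral>x. \<bar>g x - h x\<bar> \<partial>m2) < e / 2"
    using g(1) e unfolding L1_limit_def by (meson half_gt_zero)
  note h' = bdd_meas_algebra[OF h(1)]
  have tri: "(\<integral>x. \<bar>f x - h x\<bar> \<partial>m) \<le> (\<integral>x. \<bar>f x - g x\<bar> \<partial>m) + (\<integral>x. \<bar>g x - h x\<bar> \<partial>m)"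
    if "m = m1 \<or> m = m2" for m
  proof -
    have i: "integrable m (\<lambda>x. \<bar>u x - v x\<bar>)" if "bdd_meas u" "bdd_meas v" for u v
      using bdd_meas_integrable[OF bdd_meas_abs_diff[OF that]] \<open>m = m1 \<or> m = m2\<close> by auto
    have "(\<integral>x. \<bar>f x - h x\<bar> \<partial>m) \<le> (\<integral>x. \<bar>f x - g x\<bar> + \<bar>g x - h x\<bar> \<partial>m)"
      by (intro integral_mono Bochner_Integration.integrable_add i f g' h') auto
    also have "\<dots> = (\<integral>x. \<bar>f x - g x\<bar> \<partial>m) + (\<integral>x. \<bar>g x - h x\<bar> \<partial>m)"
      by (intro Bochner_Integration.integral_add i f g' h')
    finally show ?thesis .
  qed
  show "\<exists>g\<in>\<A>. (\<integral>x. \<bar>f x - g x\<bar> \<partial>m1) < e \<and> (\<integral>x. \<bar>f x - g x\<bar> \<partial>m2) < e"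
    using tri[of m1] tri[of m2] g h by (intro bexI[of _ h]) auto
qed

lemma L1_limit_algebra: "g \<in> \<A> \<Longrightarrow> L1_limit g"
  unfolding L1_limit_def using bdd_meas_algebra by (auto intro!: bexI[of _ g])

text \<open>Dominated convergence turns a uniformly bounded pointwise limit into an
  \<open>L^1\<close> limit under each measure, and the closure is stable under \<open>L^1\<close>
  limits.\<close>

lemma L1_limit_pointwise:
  assumes f: "bdd_meas f" and g: "\<And>n. L1_limit (g n)"
    and lim: "\<And>x. x \<in> \<Omega> \<Longrightarrow> (\<lambda>n. g n x) \<longlonglongrightarrow> f x"
    and bnd: "\<And>n x. x \<in> \<Omega> \<Longrightarrow> \<bar>g n x\<bar> \<le> K"
  shows "L1_limit f"
proof (rule L1_limit_L1[OF f])
  fix e :: real assume e: "0 < e"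
  obtain L where L: "\<And>x. x \<in> \<Omega> \<Longrightarrow> \<bar>f x\<bar> \<le> L" using f unfolding bdd_meas_def by auto
  have g': "bdd_meas (g n)" for n using g by (simp add: L1_limit_def)
  have "(\<lambda>n. \<integral>x. \<bar>f x - g n x\<bar> \<partial>m) \<longlonglongrightarrow> 0" if m: "m = m1 \<or> m = m2" for m
  proof -
    have fm: "finite_measure m" and sp: "space m = \<Omega>" and bm: "borel_measurable m = borel_measurable m1"
      using m finite1 finite2 space1 space2 measurable_eq2 by auto
    have "(\<lambda>n. \<integral>x. \<bar>f x - g n x\<bar> \<partial>m) \<longlonglongrightarrow> (\<integral>x. 0 \<partial>m)"
    proof (rule integral_dominated_convergence[where w="\<lambda>_. L + K"])
      show "AE x in m. (\<lambda>n. \<bar>f x - g n x\<bar>) \<longlonglongrightarrow> 0"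
      proof (rule AE_I2)
        fix x assume "x \<in> space m"
        then have "(\<lambda>n. \<bar>f x - g n x\<bar>) \<longlonglongrightarrow> \<bar>f x - f x\<bar>"
          by (intro tendsto_intros lim) (simp add: sp)
        then show "(\<lambda>n. \<bar>f x - g n x\<bar>) \<longlonglongrightarrow> 0" by simp
      qed
      show "AE x in m. norm \<bar>f x - g n x\<bar> \<le> L + K" for n
      proof (rule AE_I2)
        fix x assume "x \<in> space m"
        then show "norm \<bar>f x - g n x\<bar> \<le> L + K"
          using L[of x] bnd[of x n] by (simp add: sp)
      qed
      show "integrable m (\<lambda>_. L + K)" by (simp add: finite_measure.integrable_const[OF fm])
      show "(\<lambda>x. \<bar>f x - g n x\<bar>) \<in> borel_measurable m" for n
        using f g'[of n] by (auto simp: bm bdd_meas_def)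
    qed (simp add: bm)
    then show ?thesis by simp
  qed
  then have "\<forall>\<^sub>F n in sequentially. (\<integral>x. \<bar>f x - g n x\<bar> \<partial>m1) < e" "\<forall>\<^sub>F n in sequentially. (\<integral>x. \<bar>f x - g n x\<bar> \<partial>m2) < e"
    using e order_tendstoD(2) by blast+
  then have "\<forall>\<^sub>F n in sequentially. (\<integral>x. \<bar>f x - g n x\<bar> \<partial>m1) < e \<and> (\<integral>x. \<bar>f x - g n x\<bar> \<partial>m2) < e"
    by (rule eventually_conj)
  then show "\<exists>g. L1_limit g \<and> (\<integral>x. \<bar>f x - g x\<bar> \<partial>m1) < e \<and> (\<integral>x. \<bar>f x - g x\<bar> \<partial>m2) < e"
    using g eventually_happens'[OF sequentially_bot] by blast
qed

lemma L1_limit_add: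
  assumes f: "L1_limit f" and g: "L1_limit g" shows "L1_limit (\<lambda>x. f x + g x)"
proof (rule L1_limit_L1)
  have f': "bdd_meas f" and g': "bdd_meas g" using f g by (auto simp: L1_limit_def)
  show "bdd_meas (\<lambda>x. f x + g x)" by (rule bdd_meas_add[OF f' g'])
  fix e :: real assume e: "0 < e"
  obtain h k where h: "h \<in> \<A>" "(\<integral>x. \<bar>f x - h x\<bar> \<partial>m1) < e / 2" "(\<integral>x. \<bar>f x - h x\<bar> \<partial>m2) < e / 2"
    and k: "k \<in> \<A>" "(\<integral>x. \<bar>g x - k x\<bar> \<partial>m1) < e / 2" "(\<integral>x. \<bar>g x - k x\<bar> \<partial>m2) < e / 2"
    using f g e unfolding L1_limit_def by (meson half_gt_zero)
  note h' = bdd_meas_algebra[OF h(1)] note k' = bdd_meas_algebra[OF k(1)]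
  have tri: "(\<integral>x. \<bar>f x + g x - (h x + k x)\<bar> \<partial>m) \<le> (\<integral>x. \<bar>f x - h x\<bar> \<partial>m) + (\<integral>x. \<bar>g x - k x\<bar> \<partial>m)"
    if "m = m1 \<or> m = m2" for m
  proof -
    have i: "integrable m (\<lambda>x. \<bar>u x - v x\<bar>)" if "bdd_meas u" "bdd_meas v" for u v
      using bdd_meas_integrable[OF bdd_meas_abs_diff[OF that]] \<open>m = m1 \<or> m = m2\<close> by auto
    have "(\<integral>x. \<bar>f x + g x - (h x + k x)\<bar> \<partial>m) \<le> (\<integral>x. \<bar>f x - h x\<bar> + \<bar>g x - k x\<bar> \<partial>m)"
      by (intro integral_mono Bochner_Integration.integrable_add i bdd_meas_add f' g' h' k') auto
    also have "\<dots> = (\<integral>x. \<bar>f x - h x\<bar> \<partial>m) + (\<integral>x. \<bar>g x - k x\<bar> \<partial>m)"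
      by (intro Bochner_Integration.integral_add i f' g' h' k')
    finally show ?thesis .
  qed
  show "\<exists>ga. L1_limit ga \<and> (\<integral>x. \<bar>f x + g x - ga x\<bar> \<partial>m1) < e \<and> (\<integral>x. \<bar>f x + g x - ga x\<bar> \<partial>m2) < e"
    using L1_limit_algebra[OF add[OF h(1) k(1)]] h k tri[of m1] tri[of m2]
    by (intro exI[of _ "\<lambda>x. h x + k x"]) auto
qed

lemma L1_limit_mult:
  assumes f: "L1_limit f" and g: "L1_limit g" shows "L1_limit (\<lambda>x. f x * g x)"
proof -
  have f': "bdd_meas f" and g': "bdd_meas g" using f g by (auto simp: L1_limit_def)
  \<comment> \<open>An \<open>L^1\<close> approximant comes without a uniform bound, so both factors
    cannot be replaced at once. Here \<open>u\<close> stays fixed and bounded while \<open>v\<close>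
    is replaced; this is used first with \<open>u\<close> in the algebra and then with
    \<open>u = f\<close>.\<close>
  have half: "L1_limit (\<lambda>x. u x * v x)"
    if u: "bdd_meas u" and v: "L1_limit v" and uv: "\<And>h. h \<in> \<A> \<Longrightarrow> L1_limit (\<lambda>x. u x * h x)" for u v
  proof (rule L1_limit_L1)
    have v': "bdd_meas v" using v by (auto simp: L1_limit_def)
    show "bdd_meas (\<lambda>x. u x * v x)" by (rule bdd_meas_mult[OF u v'])
    obtain K where K: "\<And>x. x \<in> \<Omega> \<Longrightarrow> \<bar>u x\<bar> \<le> K" using u by (auto simp: bdd_meas_def)
    define K' where "K' = max K 1"
    have K': "\<And>x. x \<in> \<Omega> \<Longrightarrow> \<bar>u x\<bar> \<le> K'" "0 < K'" using K by (fastforce simp: K'_def)+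
    fix e :: real assume e: "0 < e"
    obtain h where h: "h \<in> \<A>" "(\<integral>x. \<bar>v x - h x\<bar> \<partial>m1) < e / K'" "(\<integral>x. \<bar>v x - h x\<bar> \<partial>m2) < e / K'"
      using v e K'(2) unfolding L1_limit_def by (meson divide_pos_pos)
    note h' = bdd_meas_algebra[OF h(1)]
    have est: "(\<integral>x. \<bar>u x * v x - u x * h x\<bar> \<partial>m) < e"
      if m: "m = m1 \<or> m = m2" and *: "(\<integral>x. \<bar>v x - h x\<bar> \<partial>m) < e / K'" for m
    proof -
      have i: "integrable m (\<lambda>x. \<bar>u x - v x\<bar>)" if "bdd_meas u" "bdd_meas v" for u v
        using bdd_meas_integrable[OF bdd_meas_abs_diff[OF that]] m by auto
      have sp: "space m = \<Omega>" using m space1 space2 by auto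
      have "(\<integral>x. \<bar>u x * v x - u x * h x\<bar> \<partial>m) \<le> (\<integral>x. K' * \<bar>v x - h x\<bar> \<partial>m)"
        by (intro integral_mono i integrable_mult_right u v' h' bdd_meas_mult)
           (auto simp: sp K' abs_mult simp flip: right_diff_distrib intro!: mult_right_mono)
      also have "\<dots> = K' * (\<integral>x. \<bar>v x - h x\<bar> \<partial>m)" by simp
      also have "\<dots> < e" using * K'(2) by (simp add: field_simps)
      finally show ?thesis .
    qed
    show "\<exists>ga. L1_limit ga \<and> (\<integral>x. \<bar>u x * v x - ga x\<bar> \<partial>m1) < e \<and> (\<integral>x. \<bar>u x * v x - ga x\<bar> \<partial>m2) < e"
      using uv[OF h(1)] est[of m1] est[of m2] h by (intro exI[of _ "\<lambda>x. u x * h x"]) auto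
  qed
  have "L1_limit (\<lambda>x. f x * h x)" if h: "h \<in> \<A>" for h
    using half[OF bdd_meas_algebra[OF h] f] L1_limit_algebra mult[OF h] by (simp add: mult.commute)
  from half[OF f' g this] show ?thesis .
qed

lemma L1_limit_const: "L1_limit (\<lambda>_. c)"
  by (rule L1_limit_algebra[OF const])

lemma L1_limit_continuous_comp:
  assumes g: "g \<in> \<A>" and h: "continuous_on UNIV h"
  shows "L1_limit (\<lambda>x. h (g x))"
proof -
  obtain K where K: "\<And>x. x \<in> \<Omega> \<Longrightarrow> \<bar>g x\<bar> \<le> K" using bounded[OF g] by auto
  have "compact (h ` {-K..K})" by (intro compact_continuous_image continuous_on_subset[OF h]) auto
  then obtain L where L: "\<And>y. y \<in> {-K..K} \<Longrightarrow> \<bar>h y\<bar> \<le> L"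
  proof -
    assume *: "compact (h ` {- K..K})" "\<And>L. (\<And>y. y \<in> {- K..K} \<Longrightarrow> \<bar>h y\<bar> \<le> L) \<Longrightarrow> thesis"
    obtain L where "\<forall>z\<in>h ` {- K..K}. norm z \<le> L"
      using compact_imp_bounded[OF *(1)] unfolding bounded_iff by blast
    then show thesis by (intro *(2)[of L]) auto
  qed
  have "L1_limit (\<lambda>x. h (g x))" if L: "\<forall>x\<in>\<Omega>. \<bar>h (g x)\<bar> \<le> L" for L
  proof -
    have "\<exists>k. k \<in> \<A> \<and> (\<forall>x\<in>\<Omega>. \<bar>k x - h (g x)\<bar> < 1 / Suc n)" for n
      using continuous_comp[OF g h, of "1 / Suc n"] by (metis of_nat_0_less_iff zero_less_Suc zero_less_divide_1_iff)
    then obtain k where k: "\<And>n. k n \<in> \<A>" "\<And>n x. x \<in> \<Omega> \<Longrightarrow> \<bar>k n x - h (g x)\<bar> < 1 / Suc n" by metis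
    show ?thesis
    proof (rule L1_limit_pointwise[of _ k "L + 1"])
      show "bdd_meas (\<lambda>x. h (g x))"
        using L measurable[OF g] h
        by (auto simp: bdd_meas_def intro!: measurable_compose[of g m1 borel h] borel_measurable_continuous_onI)
      show "L1_limit (k n)" for n by (rule L1_limit_algebra[OF k(1)])
      fix x assume x: "x \<in> \<Omega>"
      have "(\<lambda>n. k n x - h (g x)) \<longlonglongrightarrow> 0"
        by (rule Lim_null_comparison[OF _ LIMSEQ_inverse_real_of_nat])
           (use k(2)[OF x] in \<open>auto simp: inverse_eq_divide intro!: always_eventually less_imp_le\<close>)
      then show "(\<lambda>n. k n x) \<longlonglongrightarrow> h (g x)" by (rule LIM_zero_cancel)
      fix n
      have "1 / real (Suc n) \<le> 1" by simp
      then show "\<bar>k n x\<bar> \<le> L + 1" using k(2)[OF x, of n] bspec[OF L x] by linarith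
    qed
  qed
  from this[of L] show ?thesis using L K by (metis abs_le_iff atLeastAtMost_iff minus_le_iff)
qed

text \<open>Induction over the generated \<sigma>-algebra: superlevel sets come from ramps,
  complements from \<open>1 - x\<close>, and countable unions from finite products of complements
  followed by a bounded pointwise limit.\<close>

lemma L1_limit_indicator:
  assumes "S \<in> sets m1" shows "L1_limit (indicator S)"
proof -
  have sub: "S \<subseteq> \<Omega>" if "S \<in> sets m1" for S using sets.sets_into_space[OF that] space1 by simp
  have bi: "bdd_meas (indicator S)" if "S \<in> sets m1" for S
    using that by (auto simp: bdd_meas_def intro!: exI[of _ 1] split: split_indicator)
  \<comment> \<open>\<open>L1_limit\<close> sees functions only on \<Omega>, while
    \<open>indicator (\<Omega> - a)\<close> and \<open>1 - indicator a\<close> differ outside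
    it.\<close>
  have cong: "L1_limit g" if "L1_limit f" "\<And>x. x \<in> \<Omega> \<Longrightarrow> f x = g x" "bdd_meas g" for f g
  proof (rule L1_limit_L1[OF that(3)])
    fix e :: real assume "0 < e"
    moreover have "(\<integral>x. \<bar>g x - f x\<bar> \<partial>m1) = (\<integral>x. 0 \<partial>m1)" "(\<integral>x. \<bar>g x - f x\<bar> \<partial>m2) = (\<integral>x. 0 \<partial>m2)"
      by (intro Bochner_Integration.integral_cong refl; simp add: space1 space2 that(2))+
    ultimately show "\<exists>h. L1_limit h \<and> (\<integral>x. \<bar>g x - h x\<bar> \<partial>m1) < e \<and> (\<integral>x. \<bar>g x - h x\<bar> \<partial>m2) < e"
      using that(1) by auto
  qed
  have gt: "L1_limit (indicator {x\<in>\<Omega>. c < g x})" "{x\<in>\<Omega>. c < g x} \<in> sets m1" if g: "g \<in> \<A>" for g c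
  proof -
    have [measurable]: "g \<in> borel_measurable m1" by (rule measurable[OF g])
    have "{x\<in>space m1. c < g x} \<in> sets m1" by measurable
    then show s: "{x\<in>\<Omega>. c < g x} \<in> sets m1" by (simp add: space1)
    show "L1_limit (indicator {x\<in>\<Omega>. c < g x})"
    \<comment> \<open>The ramps vanish where \<open>g x \<le> c\<close> and equal 1 as soon as
      \<open>n * (g x - c) \<ge> 1\<close>, so they converge to the indicator of the strict
      superlevel set.\<close>
    proof (rule L1_limit_pointwise[of _ "\<lambda>n x. min 1 (max 0 (real n * (g x - c)))" 1])
      show "bdd_meas (indicator {x\<in>\<Omega>. c < g x})" by (rule bi[OF s])
      show "L1_limit (\<lambda>x. min 1 (max 0 (real n * (g x - c))))" for n
        by (rule L1_limit_continuous_comp[OF g, of "\<lambda>y. min 1 (max 0 (real n * (y - c)))"])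
           (intro continuous_intros)
      fix x assume "x \<in> \<Omega>"
      show "(\<lambda>n. min 1 (max 0 (real n * (g x - c)))) \<longlonglongrightarrow> indicator {x\<in>\<Omega>. c < g x} x"
      proof (cases "c < g x")
        case True
        then obtain n0 :: nat where n0: "1 / (g x - c) < n0" using reals_Archimedean2 by blast
        have "\<forall>n\<ge>n0. min 1 (max 0 (real n * (g x - c))) = 1"
        proof (intro allI impI)
          fix n assume "n0 \<le> n"
          then have "1 / (g x - c) \<le> n" using n0 by linarith
          then have "1 \<le> real n * (g x - c)" using True by (simp add: field_simps)
          then show "min 1 (max 0 (real n * (g x - c))) = 1" by simp
        qed
        then have "\<forall>\<^sub>F n in sequentially. min 1 (max 0 (real n * (g x - c))) = 1"
          by (auto simp: eventually_sequentially)
        then show ?thesis using True \<open>x \<in> \<Omega>\<close> by (auto intro: tendsto_eventually)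
      next
        case False
        then have "real n * (g x - c) \<le> 0" for n by (simp add: mult_nonneg_nonpos)
        then have "min 1 (max 0 (real n * (g x - c))) = 0" for n by (metis max.absorb1 min.absorb2 zero_le_one)
        then show ?thesis using False by simp
      qed
    qed simp
  qed
  have "S \<in> sigma_sets \<Omega> {{x\<in>\<Omega>. c < g x} | g c. g \<in> \<A>}" using assms generated by auto
  then have "S \<in> sets m1 \<and> L1_limit (indicator S)"
  proof induction
    case (Basic a)
    then show ?case using gt by auto
  next
    case Empty
    then show ?case using L1_limit_const[of 0] by (simp add: indicator_def)
  next
    case (Compl a)
    have "L1_limit (\<lambda>x. 1 + (-1) * indicator a x)"
      using Compl by (intro L1_limit_add L1_limit_mult L1_limit_const) auto
    moreover have s: "\<Omega> - a \<in> sets m1" using Compl space1 by auto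
    ultimately show ?case
      by (auto intro!: cong[of "\<lambda>x. 1 + (-1) * indicator a x" "indicator (\<Omega> - a)"] bi[OF s]
          split: split_indicator)
  next
    case (Union a)
    have [simp]: "a i \<in> sets m1" for i using Union by auto
    have prd: "L1_limit (\<lambda>x. \<Prod>i<n. 1 + (-1) * indicator (a i) x)" for n :: nat
    proof (induction n)
      case 0 then show ?case using L1_limit_const[of 1] by simp
    next
      case (Suc n)
      show ?case unfolding prod.lessThan_Suc
        using Union by (intro L1_limit_add L1_limit_mult L1_limit_const Suc) auto
    qed
    have prd_eq: "(\<Prod>i<n. 1 + (-1) * indicator (a i) x) = (1 - indicator (\<Union>i<n. a i) x :: real)" for n x
      by (induction n) (auto simp: lessThan_Suc split: split_indicator)
    have "L1_limit (indicator (\<Union>i. a i))"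
    proof (rule L1_limit_pointwise[of _ "\<lambda>n x. 1 + (-1) * (\<Prod>i<n. 1 + (-1) * indicator (a i) x)" 1])
      show "bdd_meas (indicator (\<Union>i. a i))" by (rule bi) auto
      show "L1_limit (\<lambda>x. 1 + (-1) * (\<Prod>i<n. 1 + (-1) * indicator (a i) x))" for n
        by (intro L1_limit_add L1_limit_mult[OF L1_limit_const] L1_limit_const prd)
      show "(\<lambda>n. 1 + (-1) * (\<Prod>i<n. 1 + (-1) * indicator (a i) x)) \<longlonglongrightarrow> (indicator (\<Union>i. a i) x :: real)" for x
        unfolding prd_eq using LIMSEQ_indicator_UN[where 'a=real, of a x] by simp
      show "\<bar>1 + (-1) * (\<Prod>i<n. 1 + (-1) * indicator (a i) x)\<bar> \<le> (1::real)" for n x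
        unfolding prd_eq by (simp split: split_indicator)
    qed
    then show ?case by auto
  qed
  then show ?thesis ..
qed

lemma L1_limit_bdd_meas:
  assumes "bdd_meas f" shows "L1_limit f"
proof -
  obtain K where K: "\<And>x. x \<in> \<Omega> \<Longrightarrow> \<bar>f x\<bar> \<le> K" and f: "f \<in> borel_measurable m1"
    using assms by (auto simp: bdd_meas_def)
  \<comment> \<open>Shifting by \<open>K\<close> makes the function nonnegative on the space, and
    the value 0 elsewhere keeps it nonnegative everywhere, as the induction principle
    requires.\<close>
  define u where "u x = (if x \<in> space m1 then f x + K else 0)" for x
  have u: "u \<in> borel_measurable m1" unfolding u_def using f by measurable
  have u0: "0 \<le> u x" for x using K[of x] by (auto simp: u_def space1 abs_le_iff)
  have ub: "\<exists>L. \<forall>x\<in>\<Omega>. \<bar>u x\<bar> \<le> L"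
    by (rule exI[of _ "K + K"]) (use K in \<open>fastforce simp: u_def space1 abs_le_iff\<close>)
  \<comment> \<open>Boundedness is carried as a premise through the induction: nonnegative summands
    and increasing approximants of a bounded function inherit its bound.\<close>
  from u u0 have "(\<exists>L. \<forall>x\<in>\<Omega>. \<bar>u x\<bar> \<le> L) \<longrightarrow> L1_limit u"
  proof (induction rule: borel_measurable_induct_real)
    case (set A)
    then show ?case using L1_limit_indicator by auto
  next
    case (mult u c)
    show ?case
    proof (intro impI, cases "c = 0")
      case True
      then show "L1_limit (\<lambda>x. c * u x)" using L1_limit_const[of 0] by simp
    next
      case False
      assume "\<exists>L. \<forall>x\<in>\<Omega>. \<bar>c * u x\<bar> \<le> L"
      then obtain L where L: "\<forall>x\<in>\<Omega>. \<bar>c * u x\<bar> \<le> L" by auto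
      have "\<forall>x\<in>\<Omega>. \<bar>u x\<bar> \<le> L / \<bar>c\<bar>" using L False by (simp add: abs_mult field_simps)
      then show "L1_limit (\<lambda>x. c * u x)" using mult by (intro L1_limit_mult L1_limit_const) auto
    qed
  next
    case (add u v)
    show ?case
    proof
      assume "\<exists>L. \<forall>x\<in>\<Omega>. \<bar>v x + u x\<bar> \<le> L"
      then obtain L where L: "\<forall>x\<in>\<Omega>. \<bar>v x + u x\<bar> \<le> L" by auto
      have "\<bar>u x\<bar> \<le> L" "\<bar>v x\<bar> \<le> L" if "x \<in> \<Omega>" for x
        using bspec[OF L that] \<open>\<And>x. 0 \<le> u x\<close>[of x] \<open>\<And>x. 0 \<le> v x\<close>[of x] by linarith+
      then have "\<exists>L. \<forall>x\<in>\<Omega>. \<bar>u x\<bar> \<le> L" "\<exists>L. \<forall>x\<in>\<Omega>. \<bar>v x\<bar> \<le> L" by auto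
      then show "L1_limit (\<lambda>x. v x + u x)" using add by (intro L1_limit_add) auto
    qed
  next
    case (seq U)
    show ?case
    proof
      assume "\<exists>L. \<forall>x\<in>\<Omega>. \<bar>u x\<bar> \<le> L"
      then obtain L where L: "\<And>x. x \<in> \<Omega> \<Longrightarrow> \<bar>u x\<bar> \<le> L" by auto
      have le: "U n x \<le> u x" if "x \<in> \<Omega>" for n x
        using seq that by (intro incseq_le) (auto simp: incseq_def le_fun_def space1)
      have b: "\<bar>U n x\<bar> \<le> L" if "x \<in> \<Omega>" for n x
        using le[OF that, of n] L[OF that] seq(2)[of n x] by auto
      show "L1_limit u"
      proof (rule L1_limit_pointwise[of _ U L])
        show "bdd_meas u" using L u seq by (auto simp: bdd_meas_def space1 intro!: borel_measurable_LIMSEQ_real[of m1 U u])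
        show "L1_limit (U n)" for n using seq.IH[of n] b by blast
      qed (use seq b in \<open>auto simp: space1\<close>)
    qed
  qed
  then have "L1_limit u" using ub by blast
  then have *: "L1_limit (\<lambda>x. u x + (- K))" by (intro L1_limit_add L1_limit_const)
  show ?thesis
  proof (rule L1_limit_L1[OF assms])
    fix e :: real assume "0 < e"
    moreover have "(\<integral>x. \<bar>f x - (u x + (- K))\<bar> \<partial>m1) = (\<integral>x. 0 \<partial>m1)"
      "(\<integral>x. \<bar>f x - (u x + (- K))\<bar> \<partial>m2) = (\<integral>x. 0 \<partial>m2)"
      by (intro Bochner_Integration.integral_cong refl; simp add: space1 space2 u_def)+
    ultimately show "\<exists>h. L1_limit h \<and> (\<integral>x. \<bar>f x - h x\<bar> \<partial>m1) < e \<and> (\<integral>x. \<bar>f x - h x\<bar> \<partial>m2) < e"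
      using * by auto
  qed
qed

text \<open>The pointwise bounds are what later allows logarithms to be taken. Clamping an
  \<open>L^1\<close> approximant \<open>h\<close> to \<open>[a, b]\<close> does not increase its
  distance to \<open>f\<close>, and the clamp is a continuous function of \<open>h\<close>, hence
  uniformly close to an element of the algebra; only this last error \<open>d\<close> leaks out of
  \<open>[a, b]\<close>.\<close>

theorem L1_approximation:
  assumes f: "f \<in> borel_measurable m1" and ab: "\<And>x. x \<in> \<Omega> \<Longrightarrow> a \<le> f x" "\<And>x. x \<in> \<Omega> \<Longrightarrow> f x \<le> b"
    and "a \<le> b" and e: "0 < e"
  obtains g where "g \<in> \<A>" "\<And>x. x \<in> \<Omega> \<Longrightarrow> a - e \<le> g x" "\<And>x. x \<in> \<Omega> \<Longrightarrow> g x \<le> b + e"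
    "(\<integral>x. \<bar>f x - g x\<bar> \<partial>m1) < e" "(\<integral>x. \<bar>f x - g x\<bar> \<partial>m2) < e"
proof -
  \<comment> \<open>Half of \<open>e\<close> is spent on \<open>h\<close>; the mass of either
    measure times \<open>d\<close> fits into the other half, and \<open>d \<le> e\<close>.\<close>
  define d where "d = e / (2 * (1 + measure m1 \<Omega> + measure m2 \<Omega>))"
  have den: "0 < 2 * (1 + measure m1 \<Omega> + measure m2 \<Omega>)" by (simp add: add_pos_nonneg)
  have d: "0 < d" "d \<le> e" "d * measure m1 \<Omega> \<le> e / 2" "d * measure m2 \<Omega> \<le> e / 2"
  proof -
    show d0: "0 < d" unfolding d_def using e den by simp
    have eq: "d * (1 + measure m1 \<Omega> + measure m2 \<Omega>) = e / 2" using den unfolding d_def by (simp add: divide_simps)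
    have nn: "0 \<le> d * measure m1 \<Omega>" "0 \<le> d * measure m2 \<Omega>" using d0 by auto
    show "d \<le> e" "d * measure m1 \<Omega> \<le> e / 2" "d * measure m2 \<Omega> \<le> e / 2"
      using eq nn d0 e unfolding distrib_left by linarith+
  qed
  have f': "bdd_meas f"
    unfolding bdd_meas_def
  proof (intro conjI f exI[of _ "max \<bar>a\<bar> \<bar>b\<bar>"] ballI)
    fix x assume "x \<in> \<Omega>"
    from ab[OF this] show "\<bar>f x\<bar> \<le> max \<bar>a\<bar> \<bar>b\<bar>" by linarith
  qed
  obtain h where h: "h \<in> \<A>" "(\<integral>x. \<bar>f x - h x\<bar> \<partial>m1) < e / 2" "(\<integral>x. \<bar>f x - h x\<bar> \<partial>m2) < e / 2"
    using L1_limit_bdd_meas[OF f'] e unfolding L1_limit_def by (meson half_gt_zero)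
  obtain g where g: "g \<in> \<A>" "\<And>x. x \<in> \<Omega> \<Longrightarrow> \<bar>g x - max a (min b (h x))\<bar> < d"
  proof -
    have "continuous_on UNIV (\<lambda>y::real. max a (min b y))" by (intro continuous_intros)
    from continuous_comp[OF h(1) this d(1)] show thesis using that by blast
  qed
  have est: "(\<integral>x. \<bar>f x - g x\<bar> \<partial>m) < e"
    if m: "m = m1 \<or> m = m2" and *: "(\<integral>x. \<bar>f x - h x\<bar> \<partial>m) < e / 2" "d * measure m \<Omega> \<le> e / 2" for m
  proof -
    have i: "integrable m (\<lambda>x. \<bar>u x - v x\<bar>)" if "bdd_meas u" "bdd_meas v" for u v
      using bdd_meas_integrable[OF bdd_meas_abs_diff[OF that]] m by auto
    have sp: "space m = \<Omega>" and fm: "finite_measure m" using m space1 space2 finite1 finite2 by auto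
    have "(\<integral>x. \<bar>f x - g x\<bar> \<partial>m) \<le> (\<integral>x. \<bar>f x - h x\<bar> + d \<partial>m)"
    proof (intro integral_mono i Bochner_Integration.integrable_add f' bdd_meas_algebra h g
        finite_measure.integrable_const[OF fm])
      fix x assume "x \<in> space m"
      then have "x \<in> \<Omega>" by (simp add: sp)
      then show "\<bar>f x - g x\<bar> \<le> \<bar>f x - h x\<bar> + d" using g(2)[of x] ab[of x] \<open>a \<le> b\<close> by linarith
    qed
    also have "\<dots> = (\<integral>x. \<bar>f x - h x\<bar> \<partial>m) + d * measure m \<Omega>"
      by (subst Bochner_Integration.integral_add[OF i[OF f' bdd_meas_algebra[OF h(1)]]
            finite_measure.integrable_const[OF fm]]) (simp add: sp)
    also have "\<dots> < e" using * by linarith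
    finally show ?thesis .
  qed
  show thesis
  proof (rule that[OF g(1) _ _ est[OF _ h(2) d(3)] est[OF _ h(3) d(4)]])
    fix x assume "x \<in> \<Omega>"
    from g(2)[OF this] d(2) \<open>a \<le> b\<close> show "a - e \<le> g x" "g x \<le> b + e" by linarith+
  qed auto
qed

text \<open>An indicator is an \<open>L^1\<close> limit of the same algebra elements under both
  measures, so equality of integrals passes from the algebra to sets.\<close>

theorem measure_eqI_algebra:
  assumes eq: "\<And>g. g \<in> \<A> \<Longrightarrow> (\<integral>x. g x \<partial>m1) = (\<integral>x. g x \<partial>m2)"
  shows "m1 = m2"
proof (rule measure_eqI)
  show "sets m1 = sets m2" by (simp add: sets2)
  fix S assume S: "S \<in> sets m1"
  have L: "L1_limit (indicator S)" by (rule L1_limit_indicator[OF S])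
  then have b: "bdd_meas (indicator S)" by (simp add: L1_limit_def)
  have "\<bar>measure m1 S - measure m2 S\<bar> \<le> 0 + e" if e: "0 < e" for e
  proof -
    obtain g where g: "g \<in> \<A>" "(\<integral>x. \<bar>indicator S x - g x\<bar> \<partial>m1) < e / 2" "(\<integral>x. \<bar>indicator S x - g x\<bar> \<partial>m2) < e / 2"
      using L e unfolding L1_limit_def by (meson half_gt_zero)
    have *: "\<bar>measure m S - (\<integral>x. g x \<partial>m)\<bar> \<le> (\<integral>x. \<bar>indicator S x - g x\<bar> \<partial>m)" if m: "m = m1 \<or> m = m2" for m
    proof -
      have i: "integrable m u" if "bdd_meas u" for u
        using bdd_meas_integrable[OF that] m by auto
      have "S \<in> sets m" using m S sets2 by auto
      then have "measure m S = (\<integral>x. indicator S x \<partial>m)" by (simp add: Int_absorb2 sets.sets_into_space)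
      then have "measure m S - (\<integral>x. g x \<partial>m) = (\<integral>x. indicator S x - g x \<partial>m)"
        using i[OF b] i[OF bdd_meas_algebra[OF g(1)]] by simp
      then show ?thesis by (simp add: integral_abs_bound)
    qed
    show ?thesis using *[OF disjI1[OF refl]] *[OF disjI2[OF refl]] g(2,3) eq[OF g(1)] by linarith
  qed
  then have "\<bar>measure m1 S - measure m2 S\<bar> \<le> 0" by (rule field_le_epsilon)
  then show "emeasure m1 S = emeasure m2 S"
    by (simp add: finite_measure.emeasure_eq_measure[OF finite1] finite_measure.emeasure_eq_measure[OF finite2])
qed

end

section \<open>Trigonometric functions on path space\<close>

text \<open>A linear functional of finitely many path values, coded by pairs of a frequency and a
  time; \<open>cis (phase l x)\<close> is the integrand of a finite-dimensional characteristic
  function.\<close>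

definition phase :: "((real ^ 'n) \<times> real) list \<Rightarrow> (real \<Rightarrow> real ^ 'n) \<Rightarrow> real" where
  "phase l x = (\<Sum>(v, r)\<leftarrow>l. v \<bullet> x r)"

text \<open>The shift \<open>b\<close> lets cosines alone produce sines and stay closed under
  products. The coefficients are functions of the initial point, so indicators of sets of initial
  points are included.\<close>

definition trig_fun ::
    "(('a \<Rightarrow> real) \<times> real \<times> ((real ^ 'n) \<times> real) list) list \<Rightarrow> (real \<Rightarrow> real ^ 'n) \<times> 'a \<Rightarrow> real" where
  "trig_fun ts p = (\<Sum>(a, b, l)\<leftarrow>ts. a (snd p) * cos (b + phase l (fst p)))"

definition trig_valid ::
    "real \<Rightarrow> (('a::topological_space \<Rightarrow> real) \<times> real \<times> ((real ^ 'n) \<times> real) list) list \<Rightarrow> bool" where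
  "trig_valid T ts \<longleftrightarrow> (\<forall>(a, b, l)\<in>set ts.
     a \<in> borel_measurable borel \<and> bounded (range a) \<and> snd ` set l \<subseteq> {0..T})"

definition trig_functions :: "real \<Rightarrow> ((real \<Rightarrow> real ^ 'n) \<times> 'a::topological_space \<Rightarrow> real) set" where
  "trig_functions T = {trig_fun ts | ts. trig_valid T ts}"

lemma phase_append: "phase (l @ k) x = phase l x + phase k x"
  by (simp add: phase_def)

lemma phase_uminus: "phase (map (\<lambda>(v, r). (- v, r)) l) x = - phase l x"
  by (induction l) (auto simp: phase_def)

lemma trig_fun_append: "trig_fun (ts @ us) p = trig_fun ts p + trig_fun us p"
  by (simp add: trig_fun_def)

lemma trig_fun_Nil [simp]: "trig_fun [] p = 0"
  by (simp add: trig_fun_def)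

lemma trig_fun_Cons: "trig_fun ((a, b, l) # ts) p = a (snd p) * cos (b + phase l (fst p)) + trig_fun ts p"
  by (simp add: trig_fun_def)

lemma trig_valid_Cons: "trig_valid T ((a, b, l) # ts) \<longleftrightarrow>
    a \<in> borel_measurable borel \<and> bounded (range a) \<and> snd ` set l \<subseteq> {0..T} \<and> trig_valid T ts"
  by (auto simp: trig_valid_def)

lemma trig_valid_Nil [simp]: "trig_valid T []"
  by (simp add: trig_valid_def)

lemma trig_functions_single:
  assumes "a \<in> borel_measurable borel" "bounded (range a)" "snd ` set l \<subseteq> {0..T}"
  shows "(\<lambda>p. a (snd p) * cos (b + phase l (fst p))) \<in> trig_functions T"
proof -
  have "(\<lambda>p. a (snd p) * cos (b + phase l (fst p))) = trig_fun [(a, b, l)]" "trig_valid T [(a, b, l)]"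
    using assms by (auto simp add: trig_fun_def trig_valid_def)
  then show ?thesis unfolding trig_functions_def by blast
qed

lemma trig_functions_add:
  assumes "g \<in> trig_functions T" "h \<in> trig_functions T"
  shows "(\<lambda>p. g p + h p) \<in> trig_functions T"
proof -
  obtain ts us where "g = trig_fun ts" "h = trig_fun us" "trig_valid T ts" "trig_valid T us"
    using assms by (auto simp: trig_functions_def)
  then have "(\<lambda>p. g p + h p) = trig_fun (ts @ us)" "trig_valid T (ts @ us)"
    by (simp_all add: trig_fun_append fun_eq_iff trig_valid_def ball_Un)
  then show ?thesis unfolding trig_functions_def by blast
qed

lemma trig_functions_zero: "(\<lambda>_. 0) \<in> trig_functions T"
proof -
  have "(\<lambda>_. 0) = trig_fun []" by auto
  then show ?thesis unfolding trig_functions_def using trig_valid_Nil by blast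
qed

lemma bounded_range_times:
  fixes a c :: "'a \<Rightarrow> real"
  assumes "bounded (range a)" "bounded (range c)"
  shows "bounded (range (\<lambda>x. a x * c x / 2))"
proof -
  obtain A C where "\<And>x. \<bar>a x\<bar> \<le> A" "\<And>x. \<bar>c x\<bar> \<le> C" using assms by (auto simp: bounded_iff)
  then have "\<bar>a x * c x / 2\<bar> \<le> A * C / 2" for x
    by (auto simp: abs_mult intro!: mult_mono intro: order_trans[OF abs_ge_zero])
  then show ?thesis unfolding bounded_iff real_norm_def by blast
qed

lemma trig_functions_mult:
  fixes g h :: "(real \<Rightarrow> real ^ 'n) \<times> 'a::topological_space \<Rightarrow> real"
  assumes "g \<in> trig_functions T" "h \<in> trig_functions T"
  shows "(\<lambda>p. g p * h p) \<in> trig_functions T"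
proof -
  have single: "(\<lambda>p. (a (snd p) * cos (b + phase l (fst p))) * (c (snd p) * cos (d + phase k (fst p)))) \<in> trig_functions T"
    if "a \<in> borel_measurable borel" "bounded (range a)" "snd ` set l \<subseteq> {0..T}"
       "c \<in> borel_measurable borel" "bounded (range c)" "snd ` set k \<subseteq> {0..T}"
    for a c :: "'a \<Rightarrow> real" and b d and l k :: "((real ^ 'n) \<times> real) list"
  proof -
    \<comment> \<open>\<open>2 cos x cos y = cos (x + y) + cos (x - y)\<close>; negating the
      frequencies of \<open>k\<close> yields the difference of the two phases.\<close>
    let ?k = "map (\<lambda>(v, r). (- v, r)) k"
    have k: "snd ` set ?k \<subseteq> {0..T}" using that(6) by force
    have "(\<lambda>p. (a (snd p) * c (snd p) / 2) * cos ((b + d) + phase (l @ k) (fst p)) +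
        (a (snd p) * c (snd p) / 2) * cos ((b - d) + phase (l @ ?k) (fst p))) \<in> trig_functions T"
      using that k by (intro trig_functions_add trig_functions_single[of "\<lambda>x. a x * c x / 2"] bounded_range_times) auto
    also have "(\<lambda>p. (a (snd p) * c (snd p) / 2) * cos ((b + d) + phase (l @ k) (fst p)) +
        (a (snd p) * c (snd p) / 2) * cos ((b - d) + phase (l @ ?k) (fst p))) =
        (\<lambda>p. (a (snd p) * cos (b + phase l (fst p))) * (c (snd p) * cos (d + phase k (fst p))))"
    proof
      fix p :: "(real \<Rightarrow> real ^ 'n) \<times> 'a"
      have e: "b + d + phase (l @ k) (fst p) = (b + phase l (fst p)) + (d + phase k (fst p))"
        "b - d + phase (l @ ?k) (fst p) = (b + phase l (fst p)) - (d + phase k (fst p))"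
        by (simp_all only: phase_append phase_uminus)
      show "(a (snd p) * c (snd p) / 2) * cos ((b + d) + phase (l @ k) (fst p)) +
        (a (snd p) * c (snd p) / 2) * cos ((b - d) + phase (l @ ?k) (fst p)) =
        (a (snd p) * cos (b + phase l (fst p))) * (c (snd p) * cos (d + phase k (fst p)))"
        unfolding e cos_add cos_diff by (simp add: algebra_simps)
    qed
    finally show ?thesis .
  qed
  obtain ts us where g: "g = trig_fun ts" "trig_valid T ts" and h: "h = trig_fun us" "trig_valid T us"
    using assms by (auto simp: trig_functions_def)
  have 1: "(\<lambda>p. (a (snd p) * cos (b + phase l (fst p))) * trig_fun us p) \<in> trig_functions T"
    if a: "a \<in> borel_measurable borel" "bounded (range a)" "snd ` set l \<subseteq> {0..T}" for a b l
    using h(2)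
  proof (induction us)
    case Nil
    then show ?case by (simp add: trig_functions_zero)
  next
    case (Cons u us)
    obtain c d k where u: "u = (c, d, k)" by (cases u)
    show ?case
      unfolding u trig_fun_Cons distrib_left
      by (intro trig_functions_add single a Cons.IH) (use Cons.prems in \<open>auto simp: u trig_valid_Cons\<close>)
  qed
  have "(\<lambda>p. trig_fun ts p * trig_fun us p) \<in> trig_functions T"
    using g(2)
  proof (induction ts)
    case Nil
    then show ?case by (simp add: trig_functions_zero)
  next
    case (Cons u us)
    obtain c d k where u: "u = (c, d, k)" by (cases u)
    show ?case
      unfolding u trig_fun_Cons distrib_right
      by (intro trig_functions_add 1 Cons.IH) (use Cons.prems in \<open>auto simp: u trig_valid_Cons\<close>)
  qed
  then show ?thesis by (simp add: g h)
qed

lemma trig_fun_bounded: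
  assumes "trig_valid T ts"
  shows "\<exists>K. \<forall>p. \<bar>trig_fun ts p\<bar> \<le> K"
  using assms
proof (induction ts)
  case Nil
  then show ?case by auto
next
  case (Cons u us)
  obtain a b l where u: "u = (a, b, l)" by (cases u)
  obtain K where K: "\<And>p. \<bar>trig_fun us p\<bar> \<le> K" using Cons by (auto simp: u trig_valid_Cons)
  obtain A where A: "\<And>x. \<bar>a x\<bar> \<le> A" using Cons.prems by (auto simp: u trig_valid_Cons bounded_iff)
  have "\<bar>trig_fun (u # us) p\<bar> \<le> A + K" for p
  proof -
    have "\<bar>a (snd p) * cos (b + phase l (fst p))\<bar> \<le> \<bar>a (snd p)\<bar> * 1"
      unfolding abs_mult by (intro mult_left_mono abs_cos_le_one) auto
    then show ?thesis using A[of "snd p"] K[of p] unfolding u trig_fun_Cons by linarith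
  qed
  then show ?case by auto
qed

interpretation trig: bounded_function_algebra Q "trig_functions T" for Q T
proof
  show "(\<lambda>_. c) \<in> trig_functions T" for c
    using trig_functions_single[of "\<lambda>_. c" "[]" T 0] by (simp add: phase_def)
  show "\<exists>K. \<forall>x\<in>Q. \<bar>g x\<bar> \<le> K" if "g \<in> trig_functions T" for g
    using that trig_fun_bounded by (fastforce simp: trig_functions_def)
qed (auto intro: trig_functions_add trig_functions_mult)

text \<open>The product \<sigma>-algebra on all extensional functions. Its trace on continuous paths
  contains the Borel sets of the supremum metric, by \<open>openin_path_init_measurable\<close>, so
  the given functional is measurable for it.\<close>

definition path_sigma :: "real \<Rightarrow> ((real \<Rightarrow> real ^ 'n) \<times> 'a::topological_space) measure" where
  "path_sigma T = (\<Pi>\<^sub>M t\<in>{0..T}. borel) \<Otimes>\<^sub>M borel"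

lemma space_path_sigma: "space (path_sigma T) = ({0..T} \<rightarrow>\<^sub>E UNIV) \<times> UNIV"
  by (simp add: path_sigma_def space_pair_measure space_PiM)

lemma measurable_path_sigmaI:
  assumes "\<And>t. t \<in> {0..T} \<Longrightarrow> (\<lambda>w. Y w t) \<in> borel_measurable N" "X \<in> borel_measurable N"
    "\<And>w. w \<in> space N \<Longrightarrow> Y w \<in> extensional {0..T}"
  shows "(\<lambda>w. (Y w, X w)) \<in> measurable N (path_sigma T)"
  unfolding path_sigma_def
  by (intro measurable_Pair measurable_PiM_single' assms) (use assms(3) in \<open>auto simp: PiE_def\<close>)

lemma measurable_phase [measurable]:
  fixes l :: "((real ^ 'n) \<times> real) list"
  assumes "snd ` set l \<subseteq> {0..T}"
  shows "(\<lambda>p. phase l (fst p)) \<in> borel_measurable (path_sigma T :: ((real \<Rightarrow> real ^ 'n) \<times> 'a::topological_space) measure)"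
  using assms
proof (induction l)
  case Nil
  then show ?case by (simp add: phase_def)
next
  case (Cons u l)
  obtain v r where u: "u = (v, r)" by (cases u)
  have r: "r \<in> {0..T}" using Cons.prems by (simp add: u)
  have "(\<lambda>p. fst p r) \<in> borel_measurable (path_sigma T :: ((real \<Rightarrow> real ^ 'n) \<times> 'a) measure)"
    unfolding path_sigma_def
    by (rule measurable_compose[OF measurable_fst measurable_component_singleton[OF r]])
  then have "(\<lambda>p. v \<bullet> fst p r + phase l (fst p)) \<in> borel_measurable (path_sigma T :: ((real \<Rightarrow> real ^ 'n) \<times> 'a) measure)"
    using Cons by (intro borel_measurable_add borel_measurable_inner) (auto simp: u)
  then show ?case by (simp add: phase_def u)
qed

lemma measurable_trig_functions:
  fixes g :: "(real \<Rightarrow> real ^ 'n) \<times> 'a::topological_space \<Rightarrow> real"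
  assumes "g \<in> trig_functions T"
  shows "g \<in> borel_measurable (path_sigma T)"
proof -
  obtain ts where g: "g = trig_fun ts" and "trig_valid T ts" using assms by (auto simp: trig_functions_def)
  from this(2) have "(\<lambda>p. trig_fun ts p) \<in> borel_measurable (path_sigma T)"
  proof (induction ts)
    case Nil
    then show ?case by simp
  next
    case (Cons u us)
    obtain a b l where u: "u = (a, b, l)" by (cases u)
    have [measurable]: "a \<in> borel_measurable borel" and l: "snd ` set l \<subseteq> {0..T}" and "trig_valid T us"
      using Cons.prems by (auto simp: u trig_valid_Cons)
    then have [measurable]: "(\<lambda>p. trig_fun us p) \<in> borel_measurable (path_sigma T)" using Cons by auto
    have [measurable]: "snd \<in> borel_measurable (path_sigma T :: ((real \<Rightarrow> real ^ 'n) \<times> 'a) measure)"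
      unfolding path_sigma_def by measurable
    note [measurable] = measurable_phase[OF l]
    show ?case unfolding u trig_fun_Cons by measurable
  qed
  then show ?thesis by (simp add: g)
qed

text \<open>Recovers an unbounded coordinate as a limit of bounded trigonometric functions.\<close>

lemma sin_scaled_limit:
  fixes x :: real
  shows "(\<lambda>n. real n * sin (x / real n)) \<longlonglongrightarrow> x"
  by real_asymp

text \<open>Path coordinates are limits of \<open>n * sin (x / n)\<close>, and sets of initial
  points are read off from an indicator coefficient with empty phase. The subset \<open>Q\<close>
  covers both uses: all paths, and continuous paths only.\<close>

lemma path_sigma_generated:
  fixes Q :: "((real \<Rightarrow> real ^ 'n) \<times> 'a::topological_space) set"
  assumes Q: "Q \<subseteq> space (path_sigma T)"
  shows "sets (restrict_space (path_sigma T) Q) \<subseteq> sigma_sets Q {{x\<in>Q. c < g x} | g c. g \<in> trig_functions T}"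
proof -
  let ?G = "{{x\<in>Q. c < g x} | g c. g \<in> trig_functions T}"
  define G where "G = sigma Q ?G"
  have G: "?G \<subseteq> Pow Q" by auto
  then have sp: "space G = Q" and st: "sets G = sigma_sets Q ?G" by (auto simp: G_def)
  have trig [measurable]: "g \<in> borel_measurable G" if "g \<in> trig_functions T" for g
    unfolding borel_measurable_iff_greater sp st using that by auto
  have inner: "(\<lambda>p. fst p r \<bullet> i) \<in> borel_measurable G" if r: "r \<in> {0..T}" for r i
  proof (rule borel_measurable_LIMSEQ_real)
    fix n :: nat
    \<comment> \<open>The shift by \<open>- pi / 2\<close> turns the cosine into a sine.\<close>
    have *: "sin (fst p r \<bullet> i / real n) = 1 * cos (- (pi / 2) + phase [(i /\<^sub>R real n, r)] (fst p))"
      for p :: "(real \<Rightarrow> real ^ 'n) \<times> 'a"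
    proof -
      have "phase [(i /\<^sub>R real n, r)] (fst p) = fst p r \<bullet> i / real n"
        by (simp add: phase_def inner_commute divide_inverse_commute)
      then show ?thesis by (simp add: cos_diff)
    qed
    have "(\<lambda>p. sin (fst p r \<bullet> i / real n)) \<in> borel_measurable G"
      unfolding * by (intro trig trig_functions_single) (use r in auto)
    then show "(\<lambda>p. real n * sin (fst p r \<bullet> i / real n)) \<in> borel_measurable G" by measurable
  qed (rule sin_scaled_limit)
  have coord: "(\<lambda>p. fst p r) \<in> borel_measurable G" if "r \<in> {0..T}" for r
    using inner[OF that] by (subst borel_measurable_euclidean_space) auto
  have snd: "snd \<in> borel_measurable G"
  proof (rule measurableI)
    fix A :: "'a set" assume A: "A \<in> sets borel"
    \<comment> \<open>An empty phase makes the cosine equal to 1 and leaves the indicator of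
      \<open>A\<close>.\<close>
    define g :: "(real \<Rightarrow> real ^ 'n) \<times> 'a \<Rightarrow> real" where
      "g = (\<lambda>p. indicator A (snd p) * cos (0 + phase [] (fst p)))"
    have "g \<in> trig_functions T" unfolding g_def
      by (rule trig_functions_single) (use A in \<open>auto simp: bounded_iff intro!: exI[of _ 1] split: split_indicator\<close>)
    then have "{p\<in>Q. 1/2 < g p} \<in> ?G" by blast
    also have "{p\<in>Q. 1/2 < g p} = snd -` A \<inter> space G"
      by (auto simp: g_def phase_def sp split: split_indicator_asm split_indicator)
    finally show "snd -` A \<inter> space G \<in> sets G" by (simp add: st)
  qed auto
  have "(\<lambda>p. (fst p, snd p)) \<in> measurable G (path_sigma T)"
    by (rule measurable_path_sigmaI) (use coord snd Q in \<open>auto simp: sp space_path_sigma PiE_def\<close>)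
  then have id: "(\<lambda>p. p) \<in> measurable G (path_sigma T)" by simp
  show ?thesis
  proof
    fix B assume "B \<in> sets (restrict_space (path_sigma T) Q)"
    then obtain A where A: "A \<in> sets (path_sigma T)" "B = Q \<inter> A"
      using Q by (auto simp: sets_restrict_space)
    from measurable_sets[OF id A(1)] show "B \<in> sigma_sets Q ?G"
      by (simp add: sp st A(2) Int_commute)
  qed
qed

lemma trig_measured_algebra:
  fixes Q :: "((real \<Rightarrow> real ^ 'n) \<times> 'a::topological_space) set"
  assumes Q: "Q \<subseteq> space (path_sigma T)"
    and "finite_measure m1" "finite_measure m2"
    and s1: "sets m1 = sets (restrict_space (path_sigma T) Q)"
    and s2: "sets m2 = sets (restrict_space (path_sigma T) Q)"
  shows "measured_function_algebra Q (trig_functions T) m1 m2"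
proof (intro measured_function_algebra.intro measured_function_algebra_axioms.intro assms
    trig.bounded_function_algebra_axioms)
  show "space m1 = Q" using sets_eq_imp_space_eq[OF s1] Q by (auto simp: space_restrict_space)
  show "sets m2 = sets m1" by (simp add: s1 s2)
  show "sets m1 \<subseteq> sigma_sets Q {{x\<in>Q. c < g x} | g c. g \<in> trig_functions T}"
    using path_sigma_generated[OF Q] s1 by simp
  fix g :: "(real \<Rightarrow> real ^ 'n) \<times> 'a \<Rightarrow> real" assume "g \<in> trig_functions T"
  then have "g \<in> borel_measurable (restrict_space (path_sigma T) Q)"
    by (intro measurable_restrict_space1 measurable_trig_functions)
  then show "g \<in> borel_measurable m1" by (simp cong: measurable_cong_sets add: s1)
qed


section \<open>Borel sets of path space\<close>

definition cpaths :: "real \<Rightarrow> (real \<Rightarrow> real ^ 'n) set" where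
  "cpaths T = {x \<in> extensional {0..T}. continuous_on {0..T} x}"

lemma mspace_path_space: "mspace (path_space T) = cpaths T"
  unfolding path_space_def cpaths_def
  by (subst compactin_mspace_cfunspace) (auto simp: continuous_map_iff_continuous compactin_subtopology)

lemma topspace_path_init: "topspace (path_init_topology T) = cpaths T \<times> UNIV"
  by (simp add: path_init_topology_def mspace_path_space)

lemma cpaths_subset: "cpaths T \<times> UNIV \<subseteq> space (path_sigma T)"
  by (auto simp: space_path_sigma cpaths_def PiE_def)

lemma dense_rationals_interval:
  fixes T :: real assumes "0 < T"
  shows "closure ({0<..<T} \<inter> \<rat>) = {0..T}"
  using closure_open_Int_superset[of "{0<..<T}" \<rat>] assms by (simp add: Rats_closure_real)

text \<open>Uniform continuity gives a grid of mesh \<open>1 / N\<close>, and the values at the grid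
  points are moved into the dense set \<open>E\<close>. Coding the step function as a list over
  \<open>E\<close> leaves only countably many of them when \<open>E\<close> is countable.\<close>

lemma step_approximation:
  fixes x :: "real \<Rightarrow> real ^ 'n"
  assumes x: "continuous_on {0..T} x" and e: "0 < e"
    and E: "\<And>X. open X \<Longrightarrow> X \<noteq> {} \<Longrightarrow> \<exists>d\<in>E. d \<in> X"
  obtains N :: nat and q where "q \<in> lists E" "\<And>t. t \<in> {0..T} \<Longrightarrow> dist (x t) (q ! nat \<lfloor>real N * t\<rfloor>) < e"
proof -
  have "uniformly_continuous_on {0..T} x" by (rule compact_uniformly_continuous[OF x compact_Icc])
  then obtain d where d: "0 < d" "\<And>s t. s \<in> {0..T} \<Longrightarrow> t \<in> {0..T} \<Longrightarrow> dist s t < d \<Longrightarrow> dist (x s) (x t) < e / 2"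
    using e unfolding uniformly_continuous_on_def by (metis half_gt_zero)
  obtain N :: nat where N: "1 / d < N" using reals_Archimedean2 by blast
  then have N0: "0 < real N" using d(1) by (meson less_trans zero_less_divide_1_iff)
  have "\<exists>q\<in>E. q \<in> ball y (e / 2)" for y using E[of "ball y (e / 2)"] e by auto
  then obtain c where c: "\<And>y. c y \<in> E" "\<And>y. dist y (c y) < e / 2" by (metis mem_ball)
  \<comment> \<open>The largest index that can occur is the floor of \<open>N * T\<close>, so the
    list has one entry more than that.\<close>
  let ?q = "map (\<lambda>k. c (x (real k / real N))) [0..<Suc (nat \<lfloor>real N * T\<rfloor>)]"
  show thesis
  proof
    show "?q \<in> lists E" using c by auto
    fix t assume t: "t \<in> {0..T}"
    let ?k = "nat \<lfloor>real N * t\<rfloor>"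
    have k: "real ?k \<le> real N * t" "real N * t < real ?k + 1" using t N0 by (auto simp: of_nat_nat)
    have "\<lfloor>real N * t\<rfloor> \<le> \<lfloor>real N * T\<rfloor>" using t N0 by (intro floor_mono) auto
    then have "?q ! ?k = c (x (real ?k / N))" by (subst nth_map) (auto simp del: upt_Suc)
    moreover have "dist t (real ?k / N) < d"
    proof -
      have "real ?k / N \<le> t" "t < real ?k / N + 1 / N" using k N0 by (auto simp: field_simps)
      moreover have "1 / N < d" using N N0 d(1) by (simp add: field_simps)
      ultimately show ?thesis by (simp add: dist_real_def)
    qed
    from t this have "dist (x t) (x (real ?k / N)) < e / 2"
    proof (intro d(2))
      have "real ?k / N \<le> t" using k N0 by (simp add: field_simps)
      then show "real ?k / N \<in> {0..T}" using t by simp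
    qed (use t in \<open>simp_all add: dist_commute\<close>)
    ultimately show "dist (x t) (?q ! ?k) < e"
      using c(2)[of "x (real ?k / N)"] dist_triangle[of "x t" "c (x (real ?k / N))" "x (real ?k / N)"] by simp
  qed
qed

text \<open>An open set is a countable union of products of a closed tube around a coded step
  function and a basic open set of initial points. Tubes are tested at rational times only, which
  makes them measurable; continuity extends the inequality to all of \<open>[0,T]\<close>.\<close>

lemma openin_path_init_measurable:
  fixes U :: "((real \<Rightarrow> real ^ 'n) \<times> 'a::second_countable_topology) set"
  assumes T: "0 < T" and U: "openin (path_init_topology T) U"
  shows "U \<in> sets (restrict_space (path_sigma T) (cpaths T \<times> UNIV))"
proof -
  let ?R = "restrict_space (path_sigma T) (cpaths T \<times> UNIV) :: ((real \<Rightarrow> real ^ 'n) \<times> 'a) measure"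
  let ?D = "{0<..<T} \<inter> \<rat>"
  obtain E :: "(real ^ 'n) set" where E: "countable E" "\<And>X. open X \<Longrightarrow> X \<noteq> {} \<Longrightarrow> \<exists>d\<in>E. d \<in> X"
    using countable_dense_exists by metis
  obtain \<B> :: "'a set set" where \<B>: "countable \<B>" "topological_basis \<B>"
    using ex_countable_basis by blast
  define C :: "(real ^ 'n) list \<Rightarrow> nat \<Rightarrow> nat \<Rightarrow> (real \<Rightarrow> real ^ 'n) set" where
    "C q N m = {y \<in> cpaths T. \<forall>t\<in>?D. dist (y t) (q ! nat \<lfloor>real N * t\<rfloor>) \<le> 1 / Suc m}" for q N m
  let ?I = "{(q, N, m, V). q \<in> lists E \<and> V \<in> \<B> \<and> C q N m \<times> V \<subseteq> U}"
  have spR: "space ?R = cpaths T \<times> UNIV" using cpaths_subset by (auto simp: space_restrict_space)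
  have [measurable]: "(\<lambda>p. fst p t) \<in> borel_measurable ?R" if "t \<in> {0..T}" for t
    unfolding path_sigma_def
    by (rule measurable_restrict_space1, rule measurable_compose[OF measurable_fst measurable_component_singleton[OF that]])
  have [measurable]: "snd \<in> borel_measurable ?R"
    unfolding path_sigma_def by (rule measurable_restrict_space1) simp
  have "countable ?D" by (auto intro: countable_rat)
  have meas: "C q N m \<times> V \<in> sets ?R" if "V \<in> \<B>" for q N m V
  proof -
    have [measurable]: "V \<in> sets borel" using topological_basis_open[OF \<B>(2) that] by simp
    have "{p \<in> space ?R. (\<forall>t\<in>?D. dist (fst p t) (q ! nat \<lfloor>real N * t\<rfloor>) \<le> 1 / Suc m) \<and> snd p \<in> V} \<in> sets ?R"
      using \<open>countable ?D\<close> by (intro sets.sets_Collect_conj sets.sets_Collect_countable_Ball) measurable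
    also have "{p \<in> space ?R. (\<forall>t\<in>?D. dist (fst p t) (q ! nat \<lfloor>real N * t\<rfloor>) \<le> 1 / Suc m) \<and> snd p \<in> V} = C q N m \<times> V"
      by (auto simp: C_def spR)
    finally show ?thesis .
  qed
  have "U = (\<Union>(q, N, m, V)\<in>?I. C q N m \<times> V)"
  proof (intro equalityI subsetI)
    fix p assume "p \<in> U"
    obtain x s where p: "p = (x, s)" by (cases p)
    obtain V B where V: "openin (mtopology_of (path_space T)) V" "x \<in> V" and B: "open B" "s \<in> B" "V \<times> B \<subseteq> U"
      using U \<open>p \<in> U\<close> unfolding path_init_topology_def openin_prod_topology_alt p open_openin[symmetric] by blast
    interpret PS: Metric_space "cpaths T" "mdist (path_space T)"
      using Metric_space_mspace_mdist[of "path_space T"] by (simp add: mspace_path_space)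
    have "openin PS.mtopology V" using V(1) by (simp add: mtopology_of_def mspace_path_space)
    then obtain e where e: "0 < e" "PS.mball x e \<subseteq> V" and xc: "x \<in> cpaths T"
      using V(2) unfolding PS.openin_mtopology by blast
    obtain W where W: "W \<in> \<B>" "s \<in> W" "W \<subseteq> B" using topological_basisE[OF \<B>(2) B(1,2)] by auto
    \<comment> \<open>Two paths in one tube are within \<open>2 / Suc m\<close> of each
      other.\<close>
    obtain m :: nat where m: "1 / Suc m < e / 2"
      using reals_Archimedean[of "e / 2"] e(1) by (auto simp: inverse_eq_divide)
    have xcont: "continuous_on {0..T} x" using xc by (simp add: cpaths_def)
    obtain N q where q: "q \<in> lists E" "\<And>t. t \<in> {0..T} \<Longrightarrow> dist (x t) (q ! nat \<lfloor>real N * t\<rfloor>) < 1 / Suc m"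
      using step_approximation[OF xcont _ E(2), of "1 / Suc m"] by (metis of_nat_0_less_iff zero_less_Suc zero_less_divide_1_iff)
    have "y \<in> V" if y: "y \<in> C q N m" for y
    proof -
      have yc: "y \<in> cpaths T" using y by (simp add: C_def)
      have "dist (x t) (y t) \<le> 2 / Suc m" if t: "t \<in> {0..T}" for t
      proof (rule continuous_le_on_closure[where f="\<lambda>t. dist (x t) (y t)" and S="?D"])
        show "continuous_on (closure ?D) (\<lambda>t. dist (x t) (y t))"
          using xcont yc unfolding dense_rationals_interval[OF T]
          by (intro continuous_on_dist) (auto simp: cpaths_def)
        show "t \<in> closure ?D" using t by (simp add: dense_rationals_interval[OF T])
        fix t assume t: "t \<in> ?D"
        then have "dist (y t) (q ! nat \<lfloor>real N * t\<rfloor>) \<le> 1 / Suc m" using y by (simp add: C_def)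
        then show "dist (x t) (y t) \<le> 2 / Suc m"
          using q(2)[of t] t dist_triangle2[of "x t" "y t" "q ! nat \<lfloor>real N * t\<rfloor>"] by auto
      qed
      then have "mdist (path_space T) x y \<le> 2 / Suc m"
        unfolding path_space_def by (intro mdist_cfunspace_le) auto
      also have "\<dots> < e" using m by simp
      finally show "y \<in> V" using e(2) xc yc by auto
    qed
    then have "(q, N, m, W) \<in> ?I" using W q B(3) by auto
    moreover have "p \<in> C q N m \<times> W"
      using xc q(2) W(2) by (fastforce simp: p C_def intro: less_imp_le)
    ultimately show "p \<in> (\<Union>(q, N, m, V)\<in>?I. C q N m \<times> V)" by blast
  qed auto
  moreover have "countable ?I"
  proof (rule countable_subset)
    show "?I \<subseteq> lists E \<times> UNIV \<times> UNIV \<times> \<B>" by auto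
    show "countable (lists E \<times> (UNIV :: nat set) \<times> (UNIV :: nat set) \<times> \<B>)"
      using E(1) \<B>(1) by (intro countable_SIGMA countable_lists) auto
  qed
  moreover have "(\<Union>(q, N, m, V)\<in>?I. C q N m \<times> V) \<in> sets ?R"
    by (rule sets.countable_UN''[OF \<open>countable ?I\<close>]) (auto intro: meas)
  ultimately show ?thesis by simp
qed

lemma borel_of_path_init_measurable:
  fixes f :: "(real \<Rightarrow> real ^ 'n) \<times> 'a::second_countable_topology \<Rightarrow> real"
  assumes "0 < T" and f: "f \<in> borel_measurable (borel_of (path_init_topology T))"
  shows "f \<in> borel_measurable (restrict_space (path_sigma T) (cpaths T \<times> UNIV))"
proof -
  let ?R = "restrict_space (path_sigma T) (cpaths T \<times> UNIV) :: ((real \<Rightarrow> real ^ 'n) \<times> 'a) measure"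
  let ?B = "borel_of (path_init_topology T) :: ((real \<Rightarrow> real ^ 'n) \<times> 'a) measure"
  have sub: "{U. openin (path_init_topology T) U} \<subseteq> Pow (topspace (path_init_topology T))"
    using openin_subset by auto
  have spR: "space ?R = cpaths T \<times> UNIV" using cpaths_subset by (auto simp: space_restrict_space)
  have sp: "space ?B = space ?R"
    unfolding borel_of_def space_measure_of[OF sub] spR unfolding topspace_path_init ..
  have "sigma_sets (space ?R) {U. openin (path_init_topology T) U} \<subseteq> sets ?R"
    by (rule sets.sigma_sets_subset) (use openin_path_init_measurable[OF assms(1)] in auto)
  then have "sets ?B \<subseteq> sets ?R"
    unfolding borel_of_def sets_measure_of[OF sub] spR unfolding topspace_path_init .
  then show ?thesis using f sp by (auto simp: measurable_def)
qed

section \<open>Uniqueness from characteristic functions\<close>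

lemma norm_integral_bounded_measurable:
  fixes f :: "'a \<Rightarrow> 'b::{banach, second_countable_topology}"
  assumes "finite_measure m" "f \<in> borel_measurable m" "\<And>x. x \<in> space m \<Longrightarrow> norm (f x) \<le> K"
  shows "integrable m f"
  using assms by (intro finite_measure.integrable_const_bound[of m f K]) auto

lemma borel_measurable_cis [measurable]:
  "f \<in> borel_measurable M \<Longrightarrow> (\<lambda>x. cis (f x)) \<in> borel_measurable M"
  by (simp add: borel_measurable_complex_iff)

text \<open>A trigonometric term is the real part of \<open>cis b\<close> times one of these
  exponentials, so the characteristic functions determine all integrals over the algebra.\<close>

lemma path_measure_eqI:
  fixes m1 m2 :: "((real \<Rightarrow> real ^ 'n) \<times> 'a::topological_space) measure"
  assumes fin: "finite_measure m1" "finite_measure m2"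
    and s1: "sets m1 = sets (path_sigma T)" and s2: "sets m2 = sets (path_sigma T)"
    and eq: "\<And>a l. a \<in> borel_measurable borel \<Longrightarrow> bounded (range a) \<Longrightarrow> snd ` set l \<subseteq> {0..T} \<Longrightarrow>
      (\<integral>p. complex_of_real (a (snd p)) * cis (phase l (fst p)) \<partial>m1) =
      (\<integral>p. complex_of_real (a (snd p)) * cis (phase l (fst p)) \<partial>m2)"
  shows "m1 = m2"
proof -
  let ?Q = "space (path_sigma T) :: ((real \<Rightarrow> real ^ 'n) \<times> 'a) set"
  have r: "sets (restrict_space (path_sigma T) ?Q) = sets (path_sigma T :: ((real \<Rightarrow> real ^ 'n) \<times> 'a) measure)"
    unfolding sets_restrict_space
    using image_cong[OF refl, of "sets (path_sigma T)" "(\<inter>) ?Q" "\<lambda>A. A"] by (simp add: Int_absorb1 sets.sets_into_space)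
  interpret A: measured_function_algebra ?Q "trig_functions T" m1 m2
    by (rule trig_measured_algebra) (use fin s1 s2 r in auto)
  have bm: "borel_measurable m1 = borel_measurable (path_sigma T)" "borel_measurable m2 = borel_measurable (path_sigma T)"
    by (intro measurable_cong_sets s1 s2 refl)+
  have snd [measurable]: "snd \<in> borel_measurable (path_sigma T :: ((real \<Rightarrow> real ^ 'n) \<times> 'a) measure)"
    unfolding path_sigma_def by measurable
  show ?thesis
  proof (rule A.measure_eqI_algebra)
    fix g :: "(real \<Rightarrow> real ^ 'n) \<times> 'a \<Rightarrow> real" assume "g \<in> trig_functions T"
    then obtain ts where g: "g = trig_fun ts" and "trig_valid T ts" by (auto simp: trig_functions_def)
    from this(2) have "(\<integral>p. trig_fun ts p \<partial>m1) = (\<integral>p. trig_fun ts p \<partial>m2)"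
    proof (induction ts)
      case Nil
      then show ?case by simp
    next
      case (Cons u us)
      obtain a b l where u: "u = (a, b, l)" by (cases u)
      have a [measurable]: "a \<in> borel_measurable borel" and l: "snd ` set l \<subseteq> {0..T}"
        and ba: "bounded (range a)" and v: "trig_valid T us"
        using Cons.prems by (auto simp: u trig_valid_Cons)
      obtain K where K: "\<And>x. \<bar>a x\<bar> \<le> K" using ba by (auto simp: bounded_iff)
      note [measurable] = measurable_phase[OF l]
      have i: "integrable m (\<lambda>p. complex_of_real (a (snd p)) * cis (phase l (fst p)))"
        "integrable m (\<lambda>p. a (snd p) * cos (b + phase l (fst p)))" "integrable m (trig_fun us)"
        if m: "m = m1 \<or> m = m2" for m
      proof -
        have fm: "finite_measure m" and bm: "borel_measurable m = borel_measurable (path_sigma T)"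
          and bmc: "(borel_measurable m :: (_ \<Rightarrow> complex) set) = borel_measurable (path_sigma T)"
          using m fin s1 s2 by (auto intro!: measurable_cong_sets)
        show "integrable m (\<lambda>p. complex_of_real (a (snd p)) * cis (phase l (fst p)))"
          by (rule norm_integral_bounded_measurable[OF fm, of _ K]) (use K in \<open>auto simp: bmc norm_mult\<close>)
        show "integrable m (\<lambda>p. a (snd p) * cos (b + phase l (fst p)))"
        proof (rule norm_integral_bounded_measurable[OF fm, of _ K])
          show "norm (a (snd p) * cos (b + phase l (fst p))) \<le> K" for p
            using mult_mono[OF K[of "snd p"] abs_cos_le_one[of "b + phase l (fst p)"]] K[of "snd p"]
            by (auto simp: abs_mult)
        qed (simp add: bm)
        show "integrable m (trig_fun us)"
          using A.bdd_meas_integrable[OF A.bdd_meas_algebra, of "trig_fun us"] m v by (auto simp: trig_functions_def)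
      qed
      have re: "(\<integral>p. a (snd p) * cos (b + phase l (fst p)) \<partial>m) =
          Re (cis b * (\<integral>p. complex_of_real (a (snd p)) * cis (phase l (fst p)) \<partial>m))"
        if m: "m = m1 \<or> m = m2" for m
      proof -
        have "(\<integral>p. a (snd p) * cos (b + phase l (fst p)) \<partial>m) =
            (\<integral>p. Re (cis b * (complex_of_real (a (snd p)) * cis (phase l (fst p)))) \<partial>m)"
          by (intro Bochner_Integration.integral_cong refl) (simp add: cos_add algebra_simps)
        also have "\<dots> = Re (\<integral>p. cis b * (complex_of_real (a (snd p)) * cis (phase l (fst p))) \<partial>m)"
          by (rule integral_Re) (intro integrable_mult_right i m)
        also have "\<dots> = Re (cis b * (\<integral>p. complex_of_real (a (snd p)) * cis (phase l (fst p)) \<partial>m))"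
          by simp
        finally show ?thesis .
      qed
      have "(\<integral>p. trig_fun (u # us) p \<partial>m) = (\<integral>p. a (snd p) * cos (b + phase l (fst p)) \<partial>m) + (\<integral>p. trig_fun us p \<partial>m)"
        if m: "m = m1 \<or> m = m2" for m
        unfolding u trig_fun_Cons by (rule Bochner_Integration.integral_add) (use i m in auto)
      then show ?case using Cons.IH[OF v] re eq[OF a ba l] by simp
    qed
    then show "integral\<^sup>L m1 g = integral\<^sup>L m2 g" by (simp add: g)
  qed
qed

text \<open>Vectors are embedded as constant paths on \<open>[0,1]\<close> with dummy initial point
  0, so that \<open>path_measure_eqI\<close> applies; evaluation at time 1 recovers the
  measure.\<close>

lemma finite_measure_eqI_char:
  fixes m1 m2 :: "(real ^ 'n) measure"
  assumes fin: "finite_measure m1" "finite_measure m2"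
    and s1: "sets m1 = sets borel" and s2: "sets m2 = sets borel"
    and eq: "\<And>\<eta>. (\<integral>y. cis (\<eta> \<bullet> y) \<partial>m1) = (\<integral>y. cis (\<eta> \<bullet> y) \<partial>m2)"
  shows "m1 = m2"
proof -
  define J :: "real ^ 'n \<Rightarrow> (real \<Rightarrow> real ^ 'n) \<times> real" where "J y = (\<lambda>t\<in>{0..1}. y, 0)" for y
  have J: "J \<in> measurable borel (path_sigma 1)"
    unfolding J_def by (rule measurable_path_sigmaI) auto
  have Jm: "J \<in> measurable m (path_sigma 1)" if "sets m = sets borel" for m
    using J by (simp cong: measurable_cong_sets add: that)
  have recover: "distr (distr m (path_sigma 1) J) borel (\<lambda>p. fst p 1) = m" if "sets m = sets borel" for m
  proof -
    have "(\<lambda>p. fst p 1) \<in> borel_measurable (path_sigma 1 :: ((real \<Rightarrow> real ^ 'n) \<times> real) measure)"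
      unfolding path_sigma_def
      by (rule measurable_compose[OF measurable_fst measurable_component_singleton]) simp
    then show ?thesis
      using that by (subst distr_distr[OF _ Jm]) (auto simp: J_def o_def intro: distr_id2)
  qed
  have ph: "phase l (fst (J y)) = sum_list (map fst l) \<bullet> y" if "snd ` set l \<subseteq> {0..1}" for l y
    using that by (induction l) (auto simp: phase_def J_def inner_add_left)
  have "distr m1 (path_sigma 1) J = distr m2 (path_sigma 1) J"
  proof (rule path_measure_eqI)
    show "finite_measure (distr m1 (path_sigma 1) J)" "finite_measure (distr m2 (path_sigma 1) J)"
      using fin Jm s1 s2 by (auto intro: finite_measure.finite_measure_distr)
    fix a :: "real \<Rightarrow> real" and l :: "((real ^ 'n) \<times> real) list"
    assume a [measurable]: "a \<in> borel_measurable borel" and l: "snd ` set l \<subseteq> {0..1}"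
    have [measurable]: "snd \<in> borel_measurable (path_sigma 1 :: ((real \<Rightarrow> real ^ 'n) \<times> real) measure)"
      unfolding path_sigma_def by measurable
    note [measurable] = measurable_phase[OF l]
    have *: "(\<integral>p. complex_of_real (a (snd p)) * cis (phase l (fst p)) \<partial>distr m (path_sigma 1) J) =
        complex_of_real (a 0) * (\<integral>y. cis (sum_list (map fst l) \<bullet> y) \<partial>m)" if "sets m = sets borel" for m
      by (subst integral_distr[OF Jm[OF that]]) (simp_all add: ph[OF l], simp add: J_def)
    show "(\<integral>p. complex_of_real (a (snd p)) * cis (phase l (fst p)) \<partial>distr m1 (path_sigma 1) J) =
        (\<integral>p. complex_of_real (a (snd p)) * cis (phase l (fst p)) \<partial>distr m2 (path_sigma 1) J)"
      by (simp only: *[OF s1] *[OF s2] eq)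
  qed auto
  then show ?thesis using recover[OF s1] recover[OF s2] by metis
qed


section \<open>Gaussian increments\<close>

definition gauss :: "real \<Rightarrow> (real ^ 'n) measure" where
  "gauss h = density lborel (\<lambda>x. ennreal (\<Prod>i\<in>UNIV. normal_density 0 (sqrt h) (x $ i)))"

lemma prod_Basis_vec:
  "(\<Prod>b\<in>(Basis :: (real ^ 'n) set). f b) = (\<Prod>i\<in>UNIV. f (axis i 1))"
proof -
  have B: "(Basis :: (real ^ 'n) set) = range (\<lambda>i. axis i 1)" by (auto simp: Basis_vec_def)
  have "inj (\<lambda>i. axis i 1 :: real ^ 'n)" by (auto simp: inj_on_def axis_eq_axis)
  then show ?thesis unfolding B by (subst prod.reindex) auto
qed

lemma gauss_Basis:
  "gauss h = density lborel (\<lambda>x :: real ^ 'n. ennreal (\<Prod>b\<in>Basis. normal_density 0 (sqrt h) (x \<bullet> b)))"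
  by (simp add: gauss_def prod_Basis_vec inner_axis)

lemma sets_gauss [simp, measurable_cong]: "sets (gauss h) = sets borel"
  by (simp add: gauss_def)

lemma space_gauss [simp]: "space (gauss h) = UNIV"
  by (simp add: gauss_def)

text \<open>Completing the square: the tilted density is again a Gaussian density, which is why
  \<open>gauss_exp\<close> has the value 1.\<close>

lemma normal_density_exp_shift:
  assumes "0 < h"
  shows "normal_density 0 (sqrt h) x * exp (u * x - h * u\<^sup>2 / 2) = normal_density (h * u) (sqrt h) x"
proof -
  have "- (x\<^sup>2) / (2 * h) + (u * x - h * u\<^sup>2 / 2) = - ((x - h * u)\<^sup>2) / (2 * h)"
    using assms by (simp add: field_simps power2_eq_square)
  then have e: "exp (- (x\<^sup>2) / (2 * h)) * exp (u * x - h * u\<^sup>2 / 2) = exp (- ((x - h * u)\<^sup>2) / (2 * h))"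
    by (metis exp_add)
  show ?thesis using assms e by (simp add: normal_density_def)
qed

lemma inner_Basis_square: "(\<Sum>b\<in>Basis. (x \<bullet> b)\<^sup>2) = (norm (x :: 'a::euclidean_space))\<^sup>2"
  by (simp add: power2_eq_square flip: euclidean_inner[of x x] power2_norm_eq_inner)

lemma gauss_exp:
  fixes u :: "real ^ 'n"
  assumes h: "0 < h"
  shows "(\<integral>\<^sup>+y. ennreal (exp (u \<bullet> y - h * (norm u)\<^sup>2 / 2)) \<partial>gauss h) = 1"
proof -
  have "(\<integral>\<^sup>+y. ennreal (exp (u \<bullet> y - h * (norm u)\<^sup>2 / 2)) \<partial>gauss h) =
      (\<integral>\<^sup>+y. ennreal (\<Prod>b\<in>Basis. normal_density 0 (sqrt h) (y \<bullet> b)) * ennreal (exp (u \<bullet> y - h * (norm u)\<^sup>2 / 2)) \<partial>lborel)"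
    unfolding gauss_Basis by (rule nn_integral_density) auto
  also have "\<dots> = (\<integral>\<^sup>+y. (\<Prod>b\<in>Basis. ennreal (normal_density (h * (u \<bullet> b)) (sqrt h) (y \<bullet> b))) \<partial>lborel)"
  proof (intro nn_integral_cong)
    fix y :: "real ^ 'n"
    have "u \<bullet> y - h * (norm u)\<^sup>2 / 2 = (\<Sum>b\<in>Basis. (u \<bullet> b) * (y \<bullet> b) - h * (u \<bullet> b)\<^sup>2 / 2)"
      by (simp add: euclidean_inner[of u y] sum_subtractf inner_Basis_square[symmetric] sum_distrib_left sum_divide_distrib)
    then have e: "exp (u \<bullet> y - h * (norm u)\<^sup>2 / 2) = (\<Prod>b\<in>Basis. exp ((u \<bullet> b) * (y \<bullet> b) - h * (u \<bullet> b)\<^sup>2 / 2))"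
      by (simp add: exp_sum)
    have "(\<Prod>b\<in>Basis. normal_density 0 (sqrt h) (y \<bullet> b)) * exp (u \<bullet> y - h * (norm u)\<^sup>2 / 2) =
        (\<Prod>b\<in>Basis. normal_density (h * (u \<bullet> b)) (sqrt h) (y \<bullet> b))"
      unfolding e prod.distrib[symmetric] normal_density_exp_shift[OF h] ..
    then show "ennreal (\<Prod>b\<in>Basis. normal_density 0 (sqrt h) (y \<bullet> b)) * ennreal (exp (u \<bullet> y - h * (norm u)\<^sup>2 / 2)) =
        (\<Prod>b\<in>Basis. ennreal (normal_density (h * (u \<bullet> b)) (sqrt h) (y \<bullet> b)))"
      by (subst ennreal_mult[symmetric]) (auto intro!: prod_nonneg simp: prod_ennreal)
  qed
  also have "\<dots> = (\<Prod>b\<in>(Basis :: (real ^ 'n) set). (\<integral>\<^sup>+x. ennreal (normal_density (h * (u \<bullet> b)) (sqrt h) x) \<partial>lborel))"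
    by (rule nn_integral_lborel_prod) auto
  also have "\<dots> = 1"
  proof (intro prod.neutral ballI)
    fix b :: "real ^ 'n"
    interpret prob_space "density lborel (normal_density (h * (u \<bullet> b)) (sqrt h))"
      by (rule prob_space_normal_density) (simp add: h)
    show "(\<integral>\<^sup>+x. ennreal (normal_density (h * (u \<bullet> b)) (sqrt h) x) \<partial>lborel) = 1"
      using emeasure_space_1 by (simp add: emeasure_density)
  qed
  finally show ?thesis .
qed

lemma prob_space_gauss: "0 < h \<Longrightarrow> prob_space (gauss h :: (real ^ 'n) measure)"
  using gauss_exp[of h "0 :: real ^ 'n"] by (intro prob_spaceI) simp

lemma lborel_integral_prod:
  fixes f :: "'a::euclidean_space \<Rightarrow> real \<Rightarrow> complex"
  assumes "\<And>b. b \<in> Basis \<Longrightarrow> integrable lborel (f b)"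
  shows "(\<integral>x. (\<Prod>b\<in>Basis. f b (x \<bullet> b)) \<partial>(lborel :: 'a measure)) = (\<Prod>b\<in>Basis. \<integral>x. f b x \<partial>lborel)"
proof -
  interpret product_sigma_finite "\<lambda>b :: 'a. interval_measure (\<lambda>x. x)"
    by (intro product_sigma_finite.intro) (metis lborel.sigma_finite_measure_axioms lborel_eq_real)
  have [measurable]: "f b \<in> borel_measurable borel" if "b \<in> Basis" for b
    using assms[OF that] by simp
  have "(\<integral>x. (\<Prod>b\<in>Basis. f b (x \<bullet> b)) \<partial>(lborel :: 'a measure)) =
      (\<integral>x. (\<Prod>b\<in>Basis. f b (x b)) \<partial>(\<Pi>\<^sub>M b\<in>(Basis :: 'a set). interval_measure (\<lambda>x. x)))"
    unfolding lborel_def by (subst integral_distr) (auto intro!: Bochner_Integration.integral_cong prod.cong)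
  also have "\<dots> = (\<Prod>b\<in>Basis. \<integral>x. f b x \<partial>lborel)"
    using assms by (subst product_integral_prod) (simp_all add: lborel_eq_real)
  finally show ?thesis .
qed

lemma normal_density_char:
  assumes h: "0 < h"
  shows "integrable lborel (\<lambda>x. complex_of_real (normal_density 0 (sqrt h) x) * cis (v * x))"
    and "(\<integral>x. complex_of_real (normal_density 0 (sqrt h) x) * cis (v * x) \<partial>lborel) = exp (- (h * v\<^sup>2 / 2))"
proof -
  have n: "integrable lborel (\<lambda>x. normal_density 0 (sqrt h) x)" using h by simp
  show "integrable lborel (\<lambda>x. complex_of_real (normal_density 0 (sqrt h) x) * cis (v * x))"
    by (rule Bochner_Integration.integrable_bound[OF n]) (auto simp: norm_mult)
  have s: "normal_density 0 (sqrt h) (sqrt h * x) = std_normal_density x / sqrt h" for x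
    using h by (simp add: normal_density_def real_sqrt_mult power_mult_distrib field_simps)
  have "(\<integral>x. complex_of_real (normal_density 0 (sqrt h) x) * cis (v * x) \<partial>lborel) =
      \<bar>sqrt h\<bar> *\<^sub>R (\<integral>x. complex_of_real (normal_density 0 (sqrt h) (0 + sqrt h * x)) * cis (v * (0 + sqrt h * x)) \<partial>lborel)"
    using h by (intro lborel_integral_real_affine) simp
  also have "\<dots> = (\<integral>x. \<bar>sqrt h\<bar> *\<^sub>R (complex_of_real (normal_density 0 (sqrt h) (0 + sqrt h * x)) * cis (v * (0 + sqrt h * x))) \<partial>lborel)"
    by simp
  also have "\<dots> = (\<integral>x. std_normal_density x *\<^sub>R iexp ((v * sqrt h) * x) \<partial>lborel)"
    using h by (intro Bochner_Integration.integral_cong refl)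
      (simp only: s add_0, simp add: scaleR_conv_of_real cis_conv_exp mult_ac)
  also have "\<dots> = char std_normal_distribution (v * sqrt h)"
    unfolding char_def by (subst integral_density) auto
  also have "\<dots> = exp (- (h * v\<^sup>2 / 2))"
    using h by (simp add: char_std_normal_distribution power_mult_distrib mult_ac)
  finally show "(\<integral>x. complex_of_real (normal_density 0 (sqrt h) x) * cis (v * x) \<partial>lborel) = exp (- (h * v\<^sup>2 / 2))" .
qed

lemma cis_sum: "finite A \<Longrightarrow> cis (\<Sum>i\<in>A. f i) = (\<Prod>i\<in>A. cis (f i))"
  by (induction A rule: finite_induct) (auto simp: cis_mult[symmetric])

lemma gauss_char:
  fixes \<eta> :: "real ^ 'n"
  assumes h: "0 < h"
  shows "(\<integral>y. cis (\<eta> \<bullet> y) \<partial>gauss h) = exp (- (h * (norm \<eta>)\<^sup>2 / 2))"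
proof -
  have "(\<integral>y. cis (\<eta> \<bullet> y) \<partial>gauss h) =
      (\<integral>y. (\<Prod>b\<in>Basis. normal_density 0 (sqrt h) (y \<bullet> b)) *\<^sub>R cis (\<eta> \<bullet> y) \<partial>lborel)"
    unfolding gauss_Basis by (subst integral_density) (auto intro!: prod_nonneg)
  also have "\<dots> = (\<integral>y. (\<Prod>b\<in>Basis. complex_of_real (normal_density 0 (sqrt h) (y \<bullet> b)) * cis ((\<eta> \<bullet> b) * (y \<bullet> b))) \<partial>lborel)"
  proof (intro Bochner_Integration.integral_cong refl)
    fix y :: "real ^ 'n"
    have "cis (\<eta> \<bullet> y) = (\<Prod>b\<in>Basis. cis ((\<eta> \<bullet> b) * (y \<bullet> b)))"
      unfolding euclidean_inner[of \<eta> y] by (rule cis_sum) simp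
    then show "(\<Prod>b\<in>Basis. normal_density 0 (sqrt h) (y \<bullet> b)) *\<^sub>R cis (\<eta> \<bullet> y) =
        (\<Prod>b\<in>Basis. complex_of_real (normal_density 0 (sqrt h) (y \<bullet> b)) * cis ((\<eta> \<bullet> b) * (y \<bullet> b)))"
      by (simp add: scaleR_conv_of_real prod.distrib)
  qed
  also have "\<dots> = (\<Prod>b\<in>Basis. \<integral>x. complex_of_real (normal_density 0 (sqrt h) x) * cis ((\<eta> \<bullet> b) * x) \<partial>lborel)"
    by (rule lborel_integral_prod) (rule normal_density_char(1)[OF h])
  also have "\<dots> = (\<Prod>b\<in>(Basis :: (real ^ 'n) set). complex_of_real (exp (- (h * (\<eta> \<bullet> b)\<^sup>2 / 2))))"
    by (simp add: normal_density_char(2)[OF h])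
  also have "\<dots> = complex_of_real (exp (\<Sum>b\<in>Basis. - (h * (\<eta> \<bullet> b)\<^sup>2 / 2)))"
    by (simp only: exp_sum finite_Basis of_real_prod)
  also have "(\<Sum>b\<in>Basis. - (h * (\<eta> \<bullet> b)\<^sup>2 / 2)) = - (h * (norm \<eta>)\<^sup>2 / 2)"
    by (simp add: sum_negf inner_Basis_square[symmetric] sum_distrib_left sum_divide_distrib)
  finally show ?thesis .
qed

section \<open>Brownian motion and characteristic functions\<close>

locale filtered_prob_space = prob_space M for M :: "'w measure" +
  fixes T :: real and F :: "real \<Rightarrow> 'w measure"
  assumes T_pos: "0 < T" and filtration: "filtration_upto T M F"
begin

lemma subalg: "t \<in> {0..T} \<Longrightarrow> subalgebra M (F t)"
  using filtration by (auto simp: filtration_upto_def)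

lemma space_F: "t \<in> {0..T} \<Longrightarrow> space (F t) = space M"
  using subalg by (auto simp: subalgebra_def)

lemma sets_F: "t \<in> {0..T} \<Longrightarrow> sets (F t) \<subseteq> sets M"
  using subalg by (auto simp: subalgebra_def)

lemma sets_F_mono: "0 \<le> s \<Longrightarrow> s \<le> t \<Longrightarrow> t \<le> T \<Longrightarrow> sets (F s) \<subseteq> sets (F t)"
  using filtration by (auto simp: filtration_upto_def)

lemma measurable_F_mono:
  assumes "f \<in> measurable (F s) N" "0 \<le> s" "s \<le> t" "t \<le> T"
  shows "f \<in> measurable (F t) N"
proof -
  have "subalgebra (F t) (F s)"
    using sets_F_mono[OF assms(2-)] space_F[of s] space_F[of t] assms(2-) by (auto simp: subalgebra_def)
  from measurable_from_subalg[OF this assms(1)] show ?thesis .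
qed

lemma measurable_F: "t \<in> {0..T} \<Longrightarrow> f \<in> measurable (F t) N \<Longrightarrow> f \<in> measurable M N"
  by (rule measurable_from_subalg[OF subalg])

text \<open>For fixed \<open>A\<close>, the hypothesis \<open>ch\<close> compares the characteristic
  functions of the law of the increment on \<open>A\<close> and of \<open>P(A)\<close> times the
  Gaussian law. Uniqueness then gives the probability of \<open>A\<close> intersected with an
  increment event as a product, which yields both the law of the increment (\<open>A\<close> the
  whole space) and its independence of the past.\<close>

lemma brownian_motionI:
  fixes W :: "real \<Rightarrow> 'w \<Rightarrow> real ^ 'n"
  assumes ad: "\<And>t. t \<in> {0..T} \<Longrightarrow> W t \<in> borel_measurable (F t)"
    and ct: "\<And>w. w \<in> space M \<Longrightarrow> W 0 w = 0 \<and> continuous_on {0..T} (\<lambda>t. W t w)"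
    and ch: "\<And>s t A \<eta>. 0 \<le> s \<Longrightarrow> s < t \<Longrightarrow> t \<le> T \<Longrightarrow> A \<in> sets (F s) \<Longrightarrow>
      (\<integral>w. indicator A w *\<^sub>R cis (\<eta> \<bullet> (W t w - W s w)) \<partial>M) =
      complex_of_real (measure M A) * exp (- ((t - s) * (norm \<eta>)\<^sup>2 / 2))"
  shows "brownian_motion T M F W"
  unfolding brownian_motion_def
proof (intro conjI allI impI ballI)
  fix s t assume st: "0 \<le> s \<and> s < t \<and> t \<le> T"
  let ?\<Delta> = "\<lambda>w. W t w - W s w"
  have [measurable]: "W t \<in> borel_measurable M" "W s \<in> borel_measurable M"
    using st by (auto intro!: measurable_F[OF _ ad])
  have law: "measure M (A \<inter> (?\<Delta> -` C \<inter> space M)) = measure M A * measure (gauss (t - s)) C"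
    if A: "A \<in> sets (F s)" and C: "C \<in> sets borel" for A C
  proof -
    have [measurable]: "A \<in> sets M" using A st sets_F[of s] by auto
    have pos: "0 < t - s" using st by simp
    interpret g: prob_space "gauss (t - s) :: (real ^ 'n) measure" by (rule prob_space_gauss[OF pos])
    let ?m1 = "distr (density M (indicator A)) borel ?\<Delta>"
    let ?m2 = "density (gauss (t - s) :: (real ^ 'n) measure) (\<lambda>_. ennreal (measure M A))"
    have fin1: "finite_measure (density M (indicator A))"
      by (rule finite_measureI) (simp add: emeasure_density emeasure_eq_measure)
    have "?m1 = ?m2"
    proof (rule finite_measure_eqI_char)
      show "finite_measure ?m1"
        by (rule finite_measure.finite_measure_distr[OF fin1]) simp
      show "finite_measure ?m2"
        by (intro finite_measureI)
          (simp add: emeasure_density nn_integral_cmult g.emeasure_eq_measure ennreal_mult_eq_top_iff)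
      fix \<eta> :: "real ^ 'n"
      have "(\<integral>y. cis (\<eta> \<bullet> y) \<partial>?m1) = (\<integral>w. cis (\<eta> \<bullet> ?\<Delta> w) \<partial>density M (\<lambda>w. ennreal (indicator A w)))"
        by (subst integral_distr) (auto simp: ennreal_indicator)
      also have "\<dots> = (\<integral>w. indicator A w *\<^sub>R cis (\<eta> \<bullet> ?\<Delta> w) \<partial>M)"
        by (subst integral_density) auto
      also have "\<dots> = complex_of_real (measure M A) * exp (- ((t - s) * (norm \<eta>)\<^sup>2 / 2))"
        using st A by (intro ch) auto
      also have "\<dots> = (\<integral>y. measure M A *\<^sub>R cis (\<eta> \<bullet> y) \<partial>gauss (t - s))"
        by (simp add: gauss_char[OF pos] scaleR_conv_of_real)
      also have "\<dots> = (\<integral>y. cis (\<eta> \<bullet> y) \<partial>?m2)"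
        by (subst integral_density) auto
      finally show "(\<integral>y. cis (\<eta> \<bullet> y) \<partial>?m1) = (\<integral>y. cis (\<eta> \<bullet> y) \<partial>?m2)" .
    qed auto
    then have "emeasure ?m1 C = emeasure ?m2 C" by simp
    moreover have "emeasure ?m1 C = emeasure M (A \<inter> (?\<Delta> -` C \<inter> space M))"
      using C by (simp add: emeasure_distr emeasure_density)
        (simp flip: indicator_inter_arith add: nn_integral_indicator measurable_sets)
    moreover have "emeasure ?m2 C = ennreal (measure M A) * emeasure (gauss (t - s)) C"
      using C by (simp add: emeasure_density nn_integral_cmult)
    ultimately show ?thesis
      by (simp add: emeasure_eq_measure g.emeasure_eq_measure flip: ennreal_mult)
  qed
  have law1: "measure M (?\<Delta> -` C \<inter> space M) = measure (gauss (t - s)) C" if "C \<in> sets borel" for C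
    using law[of "space M" C] that st space_F[of s] sets.top[of "F s"] by (simp add: prob_space Int_absorb1)
  show "indep_set (sets (F s)) (sets (vimage_algebra (space M) ?\<Delta> borel))"
  proof (rule indep_setI)
    show "sets (F s) \<subseteq> events" using sets_F[of s] st by auto
    show "sets (vimage_algebra (space M) ?\<Delta> borel) \<subseteq> events"
      by (auto simp: sets_vimage_algebra2)
    fix A D assume "A \<in> sets (F s)" "D \<in> sets (vimage_algebra (space M) ?\<Delta> borel)"
    then show "prob (A \<inter> D) = prob A * prob D"
      by (auto simp: sets_vimage_algebra2 law law1)
  qed
  have "distr M lborel ?\<Delta> = gauss (t - s)"
  proof (rule measure_eqI)
    fix C assume "C \<in> sets (distr M lborel ?\<Delta>)"
    then have C: "C \<in> sets borel" by simp
    interpret g: prob_space "gauss (t - s) :: (real ^ 'n) measure" using st by (intro prob_space_gauss) simp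
    show "emeasure (distr M lborel ?\<Delta>) C = emeasure (gauss (t - s)) C"
      using C law1[OF C] by (simp add: emeasure_distr emeasure_eq_measure g.emeasure_eq_measure)
  qed simp
  then show "distributed M lborel ?\<Delta> (\<lambda>x. ennreal (\<Prod>i\<in>UNIV. normal_density 0 (sqrt (t - s)) (x $ i)))"
    unfolding distributed_def by (simp add: gauss_def)
qed (use ad ct in auto)

end

locale brownian = filtered_prob_space M T F for M :: "'w measure" and T F +
  fixes W :: "real \<Rightarrow> 'w \<Rightarrow> real ^ 'n"
  assumes bm: "brownian_motion T M F W"
begin

lemma W_adapted: "t \<in> {0..T} \<Longrightarrow> W t \<in> borel_measurable (F t)"
  using bm by (auto simp: brownian_motion_def)

lemma W_measurable: "t \<in> {0..T} \<Longrightarrow> W t \<in> borel_measurable M"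
  by (rule measurable_F[OF _ W_adapted])

lemma W_zero: "w \<in> space M \<Longrightarrow> W 0 w = 0"
  using bm by (auto simp: brownian_motion_def)

lemma W_continuous: "w \<in> space M \<Longrightarrow> continuous_on {0..T} (\<lambda>t. W t w)"
  using bm by (auto simp: brownian_motion_def)

text \<open>Pairing the identity map into \<open>F s\<close> with the increment expresses
  independence of the whole past as a product measure, so any \<open>F s\<close>-measurable quantity
  can be frozen by Fubini.\<close>

lemma joint_law:
  assumes st: "0 \<le> s" "s < t" "t \<le> T"
  shows "distr M (F s \<Otimes>\<^sub>M borel) (\<lambda>w. (w, W t w - W s w)) = restr_to_subalg M (F s) \<Otimes>\<^sub>M gauss (t - s)"
proof -
  let ?\<Delta> = "\<lambda>w. W t w - W s w"
  have s: "s \<in> {0..T}" and t: "t \<in> {0..T}" using st by auto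
  have [measurable]: "W t \<in> borel_measurable M" "W s \<in> borel_measurable M"
    using W_measurable s t by auto
  have id: "(\<lambda>w. w) \<in> measurable M (F s)"
    by (rule measurable_F[OF s]) simp
  interpret R: prob_space "restr_to_subalg M (F s)"
    by (rule prob_space_restr_to_subalg[OF subalg[OF s]]) unfold_locales
  interpret g: prob_space "gauss (t - s) :: (real ^ 'n) measure" using st by (intro prob_space_gauss) simp
  have d: "distributed M lborel ?\<Delta> (\<lambda>x. ennreal (\<Prod>i\<in>UNIV. normal_density 0 (sqrt (t - s)) (x $ i)))"
    and ind: "indep_set (sets (F s)) (sets (vimage_algebra (space M) ?\<Delta> borel))"
    using bm st by (auto simp: brownian_motion_def)
  have "restr_to_subalg M (F s) \<Otimes>\<^sub>M gauss (t - s) = distr M (F s \<Otimes>\<^sub>M borel) (\<lambda>w. (w, ?\<Delta> w))"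
  proof (rule pair_measure_eqI)
    show "sets (restr_to_subalg M (F s) \<Otimes>\<^sub>M (gauss (t - s) :: (real ^ 'n) measure)) = sets (distr M (F s \<Otimes>\<^sub>M borel) (\<lambda>w. (w, ?\<Delta> w)))"
      by (simp cong: sets_pair_measure_cong add: sets_restr_to_subalg[OF subalg[OF s]])
    fix A and C :: "(real ^ 'n) set"
    assume "A \<in> sets (restr_to_subalg M (F s))" "C \<in> sets (gauss (t - s))"
    then have A: "A \<in> sets (F s)" and C: "C \<in> sets borel"
      by (auto simp: sets_restr_to_subalg[OF subalg[OF s]])
    have AM: "A \<in> sets M" using A sets_F[OF s] by auto
    have "emeasure (gauss (t - s)) C = emeasure (distr M lborel ?\<Delta>) C"
      using d by (simp add: distributed_def gauss_def)
    also have "\<dots> = emeasure M (?\<Delta> -` C \<inter> space M)"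
      using C by (simp add: emeasure_distr)
    finally have 1: "emeasure (gauss (t - s)) C = emeasure M (?\<Delta> -` C \<inter> space M)" .
    have "measure M (A \<inter> (?\<Delta> -` C \<inter> space M)) = measure M A * measure M (?\<Delta> -` C \<inter> space M)"
      using C by (intro indep_setD[OF ind A]) (auto simp: sets_vimage_algebra2)
    then have 2: "emeasure M (A \<inter> (?\<Delta> -` C \<inter> space M)) = emeasure M A * emeasure M (?\<Delta> -` C \<inter> space M)"
      by (simp add: emeasure_eq_measure ennreal_mult)
    have "emeasure (distr M (F s \<Otimes>\<^sub>M borel) (\<lambda>w. (w, ?\<Delta> w))) (A \<times> C) =
        emeasure M ((\<lambda>w. (w, ?\<Delta> w)) -` (A \<times> C) \<inter> space M)"
      by (rule emeasure_distr) (use id A C in \<open>auto intro!: measurable_Pair\<close>)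
    also have "(\<lambda>w. (w, ?\<Delta> w)) -` (A \<times> C) \<inter> space M = A \<inter> (?\<Delta> -` C \<inter> space M)" by auto
    finally show "emeasure (restr_to_subalg M (F s)) A * emeasure (gauss (t - s)) C =
        emeasure (distr M (F s \<Otimes>\<^sub>M borel) (\<lambda>w. (w, ?\<Delta> w))) (A \<times> C)"
      by (simp add: 1 2 emeasure_restr_to_subalg[OF subalg[OF s] A])
  qed unfold_locales
  then show ?thesis by simp
qed

text \<open>Freezing \<open>u\<close> through the joint law reduces the claim to
  \<open>gauss_exp\<close> for each fixed vector. Working with nonnegative integrals covers
  unbounded \<open>u\<close> and \<Xi>.\<close>

lemma nn_integral_exp_increment:
  assumes st: "0 \<le> s" "s < t" "t \<le> T"
    and u: "u \<in> borel_measurable (F s)" and \<Xi>: "\<Xi> \<in> borel_measurable (F s)"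
  shows "(\<integral>\<^sup>+w. \<Xi> w * ennreal (exp (u w \<bullet> (W t w - W s w) - (t - s) * (norm (u w))\<^sup>2 / 2)) \<partial>M) = (\<integral>\<^sup>+w. \<Xi> w \<partial>M)"
proof -
  have s: "s \<in> {0..T}" and t: "t \<in> {0..T}" using st by auto
  have [measurable]: "W t \<in> borel_measurable M" "W s \<in> borel_measurable M"
    using W_measurable s t by auto
  have id: "(\<lambda>w. w) \<in> measurable M (F s)" by (rule measurable_F[OF s]) simp
  note [measurable] = u \<Xi>
  interpret g: prob_space "gauss (t - s) :: (real ^ 'n) measure" using st by (intro prob_space_gauss) simp
  let ?\<Phi> = "\<lambda>(w, y). \<Xi> w * ennreal (exp (u w \<bullet> y - (t - s) * (norm (u w))\<^sup>2 / 2))"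
  have \<Phi>: "?\<Phi> \<in> borel_measurable (F s \<Otimes>\<^sub>M borel)" by measurable
  have "(\<integral>\<^sup>+w. \<Xi> w * ennreal (exp (u w \<bullet> (W t w - W s w) - (t - s) * (norm (u w))\<^sup>2 / 2)) \<partial>M) =
      (\<integral>\<^sup>+p. ?\<Phi> p \<partial>distr M (F s \<Otimes>\<^sub>M borel) (\<lambda>w. (w, W t w - W s w)))"
    by (subst nn_integral_distr) (use id \<Phi> in \<open>auto intro!: measurable_Pair\<close>)
  also have "\<dots> = (\<integral>\<^sup>+w. \<integral>\<^sup>+y. ?\<Phi> (w, y) \<partial>gauss (t - s) \<partial>restr_to_subalg M (F s))"
    unfolding joint_law[OF st]
    by (rule g.nn_integral_fst[symmetric])
       (use \<Phi> in \<open>simp cong: measurable_cong_sets sets_pair_measure_cong add: sets_restr_to_subalg[OF subalg[OF s]]\<close>)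
  also have "\<dots> = (\<integral>\<^sup>+w. \<Xi> w \<partial>restr_to_subalg M (F s))"
    using st by (intro nn_integral_cong) (simp add: nn_integral_cmult gauss_exp)
  also have "\<dots> = (\<integral>\<^sup>+w. \<Xi> w \<partial>M)"
    by (rule nn_integral_subalgebra2[OF subalg[OF s] \<Xi>])
  finally show ?thesis .
qed

text \<open>The oscillating counterpart of \<open>nn_integral_exp_increment\<close>, where Fubini
  asks for a bounded \<Xi>. The case \<open>s = t\<close> is treated apart because
  \<open>gauss\<close> is a probability measure only for positive variance.\<close>

lemma integral_cis_increment:
  assumes st: "0 \<le> s" "s \<le> t" "t \<le> T"
    and \<Xi>: "\<Xi> \<in> borel_measurable (F s)" "\<And>w. w \<in> space M \<Longrightarrow> norm (\<Xi> w) \<le> K"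
  shows "(\<integral>w. \<Xi> w * cis (\<eta> \<bullet> (W t w - W s w)) \<partial>M) = (\<integral>w. \<Xi> w \<partial>M) * exp (- ((t - s) * (norm \<eta>)\<^sup>2 / 2))"
proof (cases "s = t")
  case True
  then show ?thesis by simp
next
  case False
  then have st: "0 \<le> s" "s < t" "t \<le> T" using st by auto
  have s: "s \<in> {0..T}" and t: "t \<in> {0..T}" using st by auto
  have [measurable]: "W t \<in> borel_measurable M" "W s \<in> borel_measurable M"
    using W_measurable s t by auto
  have id: "(\<lambda>w. w) \<in> measurable M (F s)" by (rule measurable_F[OF s]) simp
  note [measurable] = \<Xi>(1)
  let ?R = "restr_to_subalg M (F s)"
  interpret g: prob_space "gauss (t - s) :: (real ^ 'n) measure" using st by (intro prob_space_gauss) simp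
  interpret R: prob_space ?R
    by (rule prob_space_restr_to_subalg[OF subalg[OF s]]) unfold_locales
  interpret P: pair_prob_space ?R "gauss (t - s) :: (real ^ 'n) measure" ..
  let ?\<Phi> = "\<lambda>(w, y). \<Xi> w * cis (\<eta> \<bullet> y)"
  have \<Phi>: "?\<Phi> \<in> borel_measurable (F s \<Otimes>\<^sub>M borel)" by measurable
  have \<Phi>': "?\<Phi> \<in> borel_measurable (?R \<Otimes>\<^sub>M gauss (t - s))"
    using \<Phi> by (simp cong: measurable_cong_sets sets_pair_measure_cong add: sets_restr_to_subalg[OF subalg[OF s]])
  have "(\<integral>w. \<Xi> w * cis (\<eta> \<bullet> (W t w - W s w)) \<partial>M) =
      (\<integral>p. ?\<Phi> p \<partial>distr M (F s \<Otimes>\<^sub>M borel) (\<lambda>w. (w, W t w - W s w)))"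
    by (subst integral_distr) (use id \<Phi> in \<open>auto intro!: measurable_Pair\<close>)
  also have "\<dots> = (\<integral>w. \<integral>y. ?\<Phi> (w, y) \<partial>gauss (t - s) \<partial>?R)"
    unfolding joint_law[OF st]
  proof (rule P.integral_fst'[symmetric])
    show "integrable (?R \<Otimes>\<^sub>M gauss (t - s)) ?\<Phi>"
    proof (rule norm_integral_bounded_measurable[OF P.P.finite_measure_axioms \<Phi>'])
      fix p assume "p \<in> space (?R \<Otimes>\<^sub>M (gauss (t - s) :: (real ^ 'n) measure))"
      then show "norm (?\<Phi> p) \<le> K" using \<Xi>(2) by (auto simp: space_pair_measure space_restr_to_subalg norm_mult)
    qed
  qed
  also have "\<dots> = (\<integral>w. \<Xi> w * exp (- ((t - s) * (norm \<eta>)\<^sup>2 / 2)) \<partial>?R)"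
    using st by (simp add: gauss_char)
  also have "\<dots> = (\<integral>w. \<Xi> w \<partial>M) * exp (- ((t - s) * (norm \<eta>)\<^sup>2 / 2))"
    by (simp add: integral_subalgebra2[OF subalg[OF s] \<Xi>(1)])
  finally show ?thesis .
qed

end

section \<open>Progressive processes\<close>

definition clip :: "real \<Rightarrow> real \<Rightarrow> real" where
  "clip t r = max 0 (min t r)"

lemma clip_id: "0 \<le> r \<Longrightarrow> r \<le> t \<Longrightarrow> clip t r = r"
  by (simp add: clip_def)

lemma clip_mem: "0 \<le> t \<Longrightarrow> clip t r \<in> {0..t}"
  by (simp add: clip_def)

lemma clip_measurable [measurable]: "clip t \<in> borel_measurable borel"
  unfolding clip_def[abs_def] by measurable

text \<open>Freezing the time argument at \<open>t\<close> replaces the restricted \<open>\<sigma>\<close>-algebra on \<open>[0,t]\<close> by the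
  Borel sets of the line.\<close>

definition progressive :: "real \<Rightarrow> (real \<Rightarrow> 'w measure) \<Rightarrow> (real \<Rightarrow> 'w \<Rightarrow> 'b::topological_space) \<Rightarrow> bool" where
  "progressive T F \<psi> \<longleftrightarrow>
     (\<forall>t\<in>{0..T}. (\<lambda>p. \<psi> (clip t (fst p)) (snd p)) \<in> borel_measurable (borel \<Otimes>\<^sub>M F t))"

lemma progressively_measurable_iff: "progressively_measurable T F \<psi> \<longleftrightarrow> progressive T F \<psi>"
proof -
  have "(\<lambda>(s, w). \<psi> s w) \<in> borel_measurable (restrict_space borel {0..t} \<Otimes>\<^sub>M F t) \<longleftrightarrow>
      (\<lambda>p. \<psi> (clip t (fst p)) (snd p)) \<in> borel_measurable (borel \<Otimes>\<^sub>M F t)" (is "?L \<longleftrightarrow> ?R") if t: "t \<in> {0..T}" for t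
  proof
    assume L: ?L
    have c: "(\<lambda>p. (clip t (fst p), snd p)) \<in> measurable (borel \<Otimes>\<^sub>M F t) (restrict_space borel {0..t} \<Otimes>\<^sub>M F t)"
      by (intro measurable_Pair measurable_restrict_space2) (use t in \<open>auto intro!: clip_mem simp: space_pair_measure\<close>)
    show ?R using measurable_compose[OF c L] by simp
  next
    assume R: ?R
    have "(\<lambda>p. p) \<in> measurable (restrict_space borel {0..t} \<Otimes>\<^sub>M F t) (borel \<Otimes>\<^sub>M F t)"
      using measurable_Pair[OF measurable_compose[OF measurable_fst measurable_restrict_space1[OF measurable_ident]] measurable_snd]
      by simp
    from measurable_compose[OF this R]
    show ?L
      by (rule measurable_cong[THEN iffD1, rotated]) (auto simp: space_pair_measure space_restrict_space clip_id)
  qed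
  then show ?thesis unfolding progressively_measurable_def progressive_def by auto
qed

lemma progressive_deterministic:
  "g \<in> borel_measurable borel \<Longrightarrow> progressive T F (\<lambda>r w. g r)"
  unfolding progressive_def by measurable

lemma progressive_compose:
  assumes "progressive T F \<psi>" "h \<in> borel_measurable borel"
  shows "progressive T F (\<lambda>r w. h (\<psi> r w))"
  using assms unfolding progressive_def by (auto intro: measurable_compose)

lemma progressive_compose2:
  assumes "progressive T F \<psi>" "progressive T F \<phi>"
    and h: "(\<lambda>p. h (fst p) (snd p)) \<in> borel_measurable (borel \<Otimes>\<^sub>M borel)"
  shows "progressive T F (\<lambda>r w. h (\<psi> r w) (\<phi> r w))"
  unfolding progressive_def
proof
  fix t assume t: "t \<in> {0..T}"
  have "(\<lambda>p. (\<psi> (clip t (fst p)) (snd p), \<phi> (clip t (fst p)) (snd p))) \<in> measurable (borel \<Otimes>\<^sub>M F t) (borel \<Otimes>\<^sub>M borel)"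
    using assms t unfolding progressive_def by (intro measurable_Pair) auto
  from measurable_compose[OF this h]
  show "(\<lambda>p. h (\<psi> (clip t (fst p)) (snd p)) (\<phi> (clip t (fst p)) (snd p))) \<in> borel_measurable (borel \<Otimes>\<^sub>M F t)"
    by simp
qed

context filtered_prob_space
begin

lemma progressive_adapted:
  assumes "progressive T F \<psi>" "t \<in> {0..T}"
  shows "\<psi> t \<in> borel_measurable (F t)"
proof -
  have "(\<lambda>w. (t, w)) \<in> measurable (F t) (borel \<Otimes>\<^sub>M F t)" by measurable
  from measurable_compose[OF this] assms
  have "(\<lambda>w. \<psi> (clip t (fst (t, w))) (snd (t, w))) \<in> borel_measurable (F t)"
    unfolding progressive_def by blast
  then show ?thesis using assms by (simp add: clip_id)
qed

lemma progressive_joint: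
  assumes "progressive T F \<psi>" and t: "t \<in> {0..T}"
  shows "(\<lambda>p. \<psi> (clip t (fst p)) (snd p)) \<in> borel_measurable (borel \<Otimes>\<^sub>M M)"
proof -
  have "(\<lambda>p. (fst p, snd p)) \<in> measurable (borel \<Otimes>\<^sub>M M) (borel \<Otimes>\<^sub>M F t)"
    using measurable_F[OF t, of "\<lambda>x. x" "F t"] by (intro measurable_Pair measurable_compose[OF measurable_snd]) auto
  then have "(\<lambda>p. (\<lambda>p. \<psi> (clip t (fst p)) (snd p)) (fst p, snd p)) \<in> borel_measurable (borel \<Otimes>\<^sub>M M)"
    by (rule measurable_compose) (use assms in \<open>auto simp: progressive_def\<close>)
  then show ?thesis by simp
qed

lemma progressive_section:
  assumes "progressive T F \<psi>" "t \<in> {0..T}" "w \<in> space M"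
  shows "(\<lambda>r. \<psi> (clip t r) w) \<in> borel_measurable borel"
proof -
  have "(\<lambda>r. (r, w)) \<in> measurable borel (borel \<Otimes>\<^sub>M M)" using assms by measurable
  from measurable_compose[OF this progressive_joint[OF assms(1,2)]] show ?thesis by simp
qed

text \<open>\<open>Y\<close> is evaluated at the grid point of mesh \<open>1 / Suc n\<close> below
  the given time; clipping keeps that time in \<open>[0,t]\<close>, so every approximant is
  measurable for \<open>F t\<close>, and path continuity gives the limit.\<close>

lemma progressive_continuous:
  fixes Y :: "real \<Rightarrow> 'w \<Rightarrow> 'b::metric_space"
  assumes ad: "\<And>t. t \<in> {0..T} \<Longrightarrow> Y t \<in> borel_measurable (F t)"
    and ct: "\<And>w. w \<in> space M \<Longrightarrow> continuous_on {0..T} (\<lambda>t. Y t w)"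
  shows "progressive T F Y"
  unfolding progressive_def
proof
  fix t assume t: "t \<in> {0..T}"
  show "(\<lambda>p. Y (clip t (fst p)) (snd p)) \<in> borel_measurable (borel \<Otimes>\<^sub>M F t)"
  proof (rule borel_measurable_LIMSEQ_metric)
    fix n :: nat
    let ?g = "\<lambda>k::int. \<lambda>p::real \<times> 'w. Y (clip t (real_of_int k / real (Suc n))) (snd p)"
    have "?g k \<in> borel_measurable (borel \<Otimes>\<^sub>M F t)" for k
    proof (rule measurable_compose[OF measurable_snd])
      have "clip t (real_of_int k / real (Suc n)) \<in> {0..t}" using t by (intro clip_mem) auto
      then show "Y (clip t (real_of_int k / real (Suc n))) \<in> borel_measurable (F t)"
        using t by (intro measurable_F_mono[OF ad]) auto
    qed
    then show "(\<lambda>p. ?g \<lfloor>real (Suc n) * fst p\<rfloor> p) \<in> borel_measurable (borel \<Otimes>\<^sub>M F t)"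
      by (rule measurable_compose_countable) measurable
  next
    fix p :: "real \<times> 'w" assume "p \<in> space (borel \<Otimes>\<^sub>M F t)"
    then have w: "snd p \<in> space M" by (simp add: space_pair_measure mem_Times_iff space_F[OF t])
    have "continuous_on UNIV (\<lambda>r. Y (clip t r) (snd p))"
      by (rule continuous_on_compose2[OF ct[OF w]])
         (use t in \<open>auto simp: clip_def intro!: continuous_intros\<close>)
    then have c: "isCont (\<lambda>r. Y (clip t r) (snd p)) (fst p)" by (simp add: continuous_on_eq_continuous_at)
    have "(\<lambda>n. real_of_int \<lfloor>real (Suc n) * fst p\<rfloor> / real (Suc n)) \<longlonglongrightarrow> fst p"
    proof (rule LIM_zero_cancel, rule Lim_null_comparison[OF _ LIMSEQ_inverse_real_of_nat], rule always_eventually, rule allI)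
      fix n :: nat
      have b: "real_of_int \<lfloor>real (Suc n) * fst p\<rfloor> \<le> real (Suc n) * fst p"
        "real (Suc n) * fst p \<le> real_of_int \<lfloor>real (Suc n) * fst p\<rfloor> + 1" by linarith+
      have "\<bar>real_of_int \<lfloor>real (Suc n) * fst p\<rfloor> - real (Suc n) * fst p\<bar> \<le> 1" using b by (simp only: abs_le_iff) linarith
      moreover have "real_of_int \<lfloor>real (Suc n) * fst p\<rfloor> / real (Suc n) - fst p =
          (real_of_int \<lfloor>real (Suc n) * fst p\<rfloor> - real (Suc n) * fst p) / real (Suc n)" by (simp add: diff_divide_distrib)
      ultimately show "norm (real_of_int \<lfloor>real (Suc n) * fst p\<rfloor> / real (Suc n) - fst p) \<le> inverse (real (Suc n))"
        by (simp add: abs_divide inverse_eq_divide divide_right_mono del: of_nat_Suc)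
    qed
    from isCont_tendsto_compose[OF c this]
    show "(\<lambda>n. Y (clip t (real_of_int \<lfloor>real (Suc n) * fst p\<rfloor> / real (Suc n))) (snd p)) \<longlonglongrightarrow> Y (clip t (fst p)) (snd p)" .
  qed
qed

end


section \<open>Time integrals\<close>

definition time_integral :: "(real \<Rightarrow> 'b::{banach, second_countable_topology}) \<Rightarrow> real \<Rightarrow> real \<Rightarrow> 'b" where
  "time_integral \<alpha> s t = (LBINT r:{s..t}. \<alpha> r)"

text \<open>Values of \<alpha> outside \<open>[0,T]\<close> are arbitrary, hence measurability is
  asked only after clipping the time.\<close>

definition bdd_path :: "real \<Rightarrow> real \<Rightarrow> (real \<Rightarrow> 'b::{banach, second_countable_topology}) \<Rightarrow> bool" where
  "bdd_path T K \<alpha> \<longleftrightarrow> (\<lambda>r. \<alpha> (clip T r)) \<in> borel_measurable borel \<and> (\<forall>r\<in>{0..T}. norm (\<alpha> r) \<le> K)"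

lemma bdd_path_indicator_measurable:
  assumes "bdd_path T K \<alpha>" "S \<in> sets borel" "S \<subseteq> {0..T}"
  shows "(\<lambda>r. indicator S r *\<^sub>R \<alpha> r) \<in> borel_measurable borel"
proof -
  have [measurable]: "(\<lambda>r. \<alpha> (clip T r)) \<in> borel_measurable borel" "S \<in> sets borel"
    using assms by (auto simp: bdd_path_def)
  have "(\<lambda>r. indicator S r *\<^sub>R \<alpha> r) = (\<lambda>r. indicator S r *\<^sub>R \<alpha> (clip T r))"
    using assms(3) by (auto simp: fun_eq_iff clip_id split: split_indicator)
  then show ?thesis by simp
qed

lemma bdd_path_integrable:
  assumes "bdd_path T K \<alpha>" "S \<in> sets borel" "S \<subseteq> {0..T}"
  shows "set_integrable lborel S \<alpha>"
  unfolding set_integrable_def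
proof (rule Bochner_Integration.integrable_bound)
  have [measurable]: "S \<in> sets borel" by fact
  have "emeasure lborel S \<le> emeasure lborel {0..T}" using assms by (intro emeasure_mono) auto
  also have "\<dots> < \<infinity>" by (cases "0 \<le> T") auto
  finally show "integrable lborel (\<lambda>r. K * indicator S r :: real)"
    by (intro integrable_mult_right integrable_real_indicator) auto
  show "(\<lambda>r. indicator S r *\<^sub>R \<alpha> r) \<in> borel_measurable lborel"
    using bdd_path_indicator_measurable[OF assms] by simp
  show "AE r in lborel. norm (indicator S r *\<^sub>R \<alpha> r) \<le> norm (K * indicator S r)"
    using assms by (auto simp: bdd_path_def split: split_indicator intro!: AE_I2 intro: order_trans[OF _ abs_ge_self])
qed

lemma bdd_path_mono: "bdd_path T K \<alpha> \<Longrightarrow> K \<le> L \<Longrightarrow> bdd_path T L \<alpha>"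
  by (auto simp: bdd_path_def intro: order_trans)

lemma time_integral_split:
  assumes "bdd_path T K \<alpha>" "0 \<le> s" "s \<le> u" "u \<le> t" "t \<le> T"
  shows "time_integral \<alpha> s t = time_integral \<alpha> s u + time_integral \<alpha> u t"
proof -
  have i: "set_integrable lborel {s..u} \<alpha>" "set_integrable lborel {u<..t} \<alpha>"
    by (rule bdd_path_integrable[OF assms(1)]; use assms in auto)+
  have "time_integral \<alpha> s t = (LBINT r:{s..u} \<union> {u<..t}. \<alpha> r)"
    unfolding time_integral_def using assms by (intro arg_cong2[where f="\<lambda>S f. set_lebesgue_integral lborel S f"]) auto
  also have "\<dots> = time_integral \<alpha> s u + (LBINT r:{u<..t}. \<alpha> r)"
    unfolding time_integral_def by (rule set_integral_Un[OF _ i]) auto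
  also have "(LBINT r:{u<..t}. \<alpha> r) = time_integral \<alpha> u t"
    unfolding time_integral_def
    unfolding set_lebesgue_integral_def
  proof (rule integral_cong_AE)
    show "AE r in lborel. indicator {u<..t} r *\<^sub>R \<alpha> r = indicator {u..t} r *\<^sub>R \<alpha> r"
      using AE_lborel_singleton[of u] by eventually_elim (auto split: split_indicator)
    show "(\<lambda>r. indicator {u<..t} r *\<^sub>R \<alpha> r) \<in> borel_measurable lborel"
      "(\<lambda>r. indicator {u..t} r *\<^sub>R \<alpha> r) \<in> borel_measurable lborel"
      using bdd_path_indicator_measurable[OF assms(1), of "{u<..t}"]
        bdd_path_indicator_measurable[OF assms(1), of "{u..t}"] assms by (auto simp: subset_iff)
  qed
  finally show ?thesis .
qed

lemma norm_time_integral_le: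
  assumes "bdd_path T K \<alpha>" "0 \<le> s" "s \<le> t" "t \<le> T"
  shows "norm (time_integral \<alpha> s t) \<le> K * (t - s)"
proof -
  have i: "set_integrable lborel {s..t} \<alpha>"
    by (rule bdd_path_integrable[OF assms(1)]) (use assms in auto)
  have "norm (time_integral \<alpha> s t) \<le> (\<integral>r. norm (indicator {s..t} r *\<^sub>R \<alpha> r) \<partial>lborel)"
    unfolding time_integral_def set_lebesgue_integral_def by (rule integral_norm_bound)
  also have "\<dots> \<le> (\<integral>r. K * indicator {s..t} r \<partial>lborel)"
    using i assms unfolding set_integrable_def
    by (intro integral_mono integrable_norm) (auto simp: bdd_path_def split: split_indicator)
  also have "\<dots> = K * (t - s)" using assms by simp
  finally show ?thesis .
qed

lemma time_integral_refl [simp]: "time_integral \<alpha> s s = 0"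
  unfolding time_integral_def set_lebesgue_integral_def
  by (rule integral_eq_zero_AE, use AE_lborel_singleton[of s] in eventually_elim) (auto split: split_indicator)

lemma time_integral_lipschitz:
  assumes "bdd_path T K \<alpha>" "s \<in> {0..T}" "t \<in> {0..T}"
  shows "norm (time_integral \<alpha> 0 t - time_integral \<alpha> 0 s) \<le> K * \<bar>t - s\<bar>"
proof (cases "s \<le> t")
  case True
  then show ?thesis
    using time_integral_split[OF assms(1), of 0 s t] norm_time_integral_le[OF assms(1), of s t] assms by simp
next
  case False
  then show ?thesis
    using time_integral_split[OF assms(1), of 0 t s] norm_time_integral_le[OF assms(1), of t s] assms
    by (simp add: norm_minus_commute)
qed

lemma time_integral_continuous:
  assumes "bdd_path T K \<alpha>"
  shows "continuous_on {0..T} (time_integral \<alpha> 0)"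
proof -
  have "(max K 0)-lipschitz_on {0..T} (time_integral \<alpha> 0)"
    using time_integral_lipschitz[OF bdd_path_mono[OF assms, of "max K 0"]]
    by (intro lipschitz_onI) (auto simp: dist_norm)
  then show ?thesis by (rule lipschitz_on_continuous_on)
qed

lemma time_integral_add:
  assumes "bdd_path T K \<alpha>" "bdd_path T L \<beta>" "0 \<le> s" "t \<le> T"
  shows "time_integral (\<lambda>r. \<alpha> r + \<beta> r) s t = time_integral \<alpha> s t + time_integral \<beta> s t"
  unfolding time_integral_def using assms
  by (intro set_integral_add) (auto intro!: bdd_path_integrable)

lemma time_integral_diff:
  assumes "bdd_path T K \<alpha>" "bdd_path T L \<beta>" "0 \<le> s" "t \<le> T"
  shows "time_integral (\<lambda>r. \<alpha> r - \<beta> r) s t = time_integral \<alpha> s t - time_integral \<beta> s t"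
  unfolding time_integral_def using assms
  by (intro set_integral_diff) (auto intro!: bdd_path_integrable)

lemma time_integral_mult_left:
  fixes c :: "'a::{real_normed_field, banach, second_countable_topology}"
  shows "time_integral (\<lambda>r. \<alpha> r * c) s t = time_integral \<alpha> s t * c"
  unfolding time_integral_def by simp

text \<open>Quadratic increments force a zero derivative. This takes the place of the fundamental
  theorem of calculus in \<open>exp_time_integral\<close>, where the integrand is only measurable
  and its integral need not be differentiable at every point.\<close>

lemma quadratic_bound_constant:
  fixes g :: "real \<Rightarrow> complex"
  assumes T: "0 \<le> T" and q: "\<And>s t. 0 \<le> s \<Longrightarrow> s \<le> t \<Longrightarrow> t \<le> T \<Longrightarrow> norm (g t - g s) \<le> C * (t - s)\<^sup>2"
    and t: "t \<in> {0..T}"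
  shows "g t = g 0"
proof -
  have "(g has_derivative (\<lambda>_. 0)) (at x within {0..T})" if x: "x \<in> {0..T}" for x
    unfolding has_derivative_within
  proof (intro conjI)
    show "bounded_linear (\<lambda>_. 0 :: complex)" by (rule bounded_linear_zero)
    have "((\<lambda>y. C * norm (y - x)) \<longlongrightarrow> C * norm (x - x)) (at x within {0..T})"
      by (intro tendsto_intros)
    then have l: "((\<lambda>y. C * norm (y - x)) \<longlongrightarrow> 0) (at x within {0..T})" by simp
    show "((\<lambda>y. (1 / norm (y - x)) *\<^sub>R (g y - (g x + 0))) \<longlongrightarrow> 0) (at x within {0..T})"
    proof (rule Lim_null_comparison[OF _ l])
      show "\<forall>\<^sub>F y in at x within {0..T}. norm ((1 / norm (y - x)) *\<^sub>R (g y - (g x + 0))) \<le> C * norm (y - x)"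
        unfolding eventually_at_filter
      proof (rule always_eventually, intro allI impI)
        fix y assume y: "y \<noteq> x" "y \<in> {0..T}"
        have "norm (g y - g x) \<le> C * (y - x)\<^sup>2"
          using q[of x y] q[of y x] x y by (cases "x \<le> y") (auto simp: norm_minus_commute power2_commute)
        also have "\<dots> = C * norm (y - x) * norm (y - x)" by (simp add: power2_eq_square)
        finally show "norm ((1 / norm (y - x)) *\<^sub>R (g y - (g x + 0))) \<le> C * norm (y - x)"
          using y by (simp add: divide_simps)
      qed
    qed
  qed
  then obtain c where "\<And>x. x \<in> {0..T} \<Longrightarrow> g x = c"
    using has_derivative_zero_constant[of "{0..T}" g] by auto
  then show ?thesis using t T by auto
qed

lemma exp_second_order:
  fixes z :: complex
  shows "norm (exp z - 1 - z) \<le> exp (norm z) * (norm z)\<^sup>2"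
proof -
  have "norm (exp z - (\<Sum>i\<le>1. z ^ i / fact i)) \<le> exp \<bar>Re z\<bar> * norm z ^ Suc 1 / fact 1"
    by (rule Taylor_exp)
  also have "\<dots> \<le> exp (norm z) * (norm z)\<^sup>2"
    using abs_Re_le_cmod[of z] by (simp add: power2_eq_square mult_right_mono)
  finally show ?thesis by (simp add: algebra_simps)
qed

text \<open>The chain rule for the exponential of an integral of a bounded measurable function. Over
  \<open>[u,v]\<close> both \<open>exp (I v) - exp (I u)\<close> and the integral on the right equal
  \<open>exp (I u)\<close> times the integral of \<alpha>, up to an error of order
  \<open>(v - u)^2\<close>; hence their difference is constant.\<close>

lemma exp_time_integral:
  fixes \<alpha> :: "real \<Rightarrow> complex"
  assumes T: "0 \<le> T" and \<alpha>: "bdd_path T K \<alpha>" and t: "0 \<le> s" "s \<le> t" "t \<le> T"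
  shows "exp (time_integral \<alpha> 0 t) - exp (time_integral \<alpha> 0 s) =
    time_integral (\<lambda>r. \<alpha> r * exp (time_integral \<alpha> 0 r)) s t"
proof -
  let ?I = "time_integral \<alpha> 0"
  have "norm (\<alpha> 0) \<le> K" using \<alpha> T by (auto simp: bdd_path_def)
  then have K: "0 \<le> K" using norm_ge_zero order_trans by blast
  have Ib: "norm (?I r) \<le> K * T" if "r \<in> {0..T}" for r
    using norm_time_integral_le[OF \<alpha>, of 0 r] that K by (auto intro: order_trans mult_left_mono)
  have eb: "norm (exp (?I r)) \<le> exp (K * T)" if "r \<in> {0..T}" for r
    using norm_exp[of "?I r"] Ib[OF that] by (meson exp_le_cancel_iff order_trans)
  have cont: "continuous_on {0..T} (\<lambda>r. exp (?I r))"
    by (intro continuous_intros time_integral_continuous[OF \<alpha>])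
  have ccl: "continuous_on UNIV (\<lambda>r. exp (?I (clip T r)))"
    by (rule continuous_on_compose2[OF cont]) (use T in \<open>auto simp: clip_def intro!: continuous_intros\<close>)
  have \<beta>: "bdd_path T (K * exp (K * T)) (\<lambda>r. \<alpha> r * exp (?I r))"
    unfolding bdd_path_def
  proof (intro conjI ballI)
    show "(\<lambda>r. \<alpha> (clip T r) * exp (?I (clip T r))) \<in> borel_measurable borel"
      using \<alpha> borel_measurable_continuous_onI[OF ccl] by (auto simp: bdd_path_def)
    fix r assume r: "r \<in> {0..T}"
    show "norm (\<alpha> r * exp (?I r)) \<le> K * exp (K * T)"
      unfolding norm_mult using \<alpha> eb[OF r] r K by (intro mult_mono) (auto simp: bdd_path_def)
  qed
  define g where "g r = exp (?I r) - time_integral (\<lambda>r. \<alpha> r * exp (?I r)) 0 r" for r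
  have "norm (g v - g u) \<le> (exp (K * T) * exp (K * T) * K\<^sup>2 + K * (exp (K * T) * exp (K * T) * K)) * (v - u)\<^sup>2"
    if uv: "0 \<le> u" "u \<le> v" "v \<le> T" for u v
  proof -
    let ?h = "v - u"
    have h: "0 \<le> ?h" using uv by simp
    have d: "norm (?I r - ?I u) \<le> K * (r - u)" if "u \<le> r" "r \<le> v" for r
      using time_integral_lipschitz[OF \<alpha>, of u r] uv that by simp
    have split1: "?I v = ?I u + time_integral \<alpha> u v"
      by (rule time_integral_split[OF \<alpha>]) (use uv in auto)
    have split2: "time_integral (\<lambda>r. \<alpha> r * exp (?I r)) 0 v =
        time_integral (\<lambda>r. \<alpha> r * exp (?I r)) 0 u + time_integral (\<lambda>r. \<alpha> r * exp (?I r)) u v"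
      by (rule time_integral_split[OF \<beta>]) (use uv in auto)
    let ?z = "time_integral \<alpha> u v"
    have z: "norm ?z \<le> K * ?h" by (rule norm_time_integral_le[OF \<alpha>]) (use uv in auto)
    have zT: "norm ?z \<le> K * T" using z mult_left_mono[OF _ K, of ?h T] uv by linarith
    have e1: "norm (exp ?z - 1 - ?z) \<le> exp (K * T) * (K * ?h)\<^sup>2"
    proof -
      have "norm (exp ?z - 1 - ?z) \<le> exp (norm ?z) * (norm ?z)\<^sup>2" by (rule exp_second_order)
      also have "\<dots> \<le> exp (K * T) * (K * ?h)\<^sup>2"
        using z zT by (intro mult_mono power_mono) auto
      finally show ?thesis .
    qed
    have \<gamma>: "bdd_path T (K * exp (K * T)) (\<lambda>r. \<alpha> r * exp (?I u))"
      unfolding bdd_path_def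
    proof (intro conjI ballI)
      show "(\<lambda>r. \<alpha> (clip T r) * exp (?I u)) \<in> borel_measurable borel"
        using \<alpha> by (auto simp: bdd_path_def)
      fix r assume r: "r \<in> {0..T}"
      show "norm (\<alpha> r * exp (?I u)) \<le> K * exp (K * T)"
        unfolding norm_mult using \<alpha> eb[of u] r K uv by (intro mult_mono) (auto simp: bdd_path_def)
    qed
    have diff: "time_integral (\<lambda>r. \<alpha> r * exp (?I r)) u v - ?z * exp (?I u) =
        time_integral (\<lambda>r. \<alpha> r * (exp (?I r) - exp (?I u))) u v"
    proof -
      have "time_integral (\<lambda>r. \<alpha> r * (exp (?I r) - exp (?I u))) u v =
          time_integral (\<lambda>r. \<alpha> r * exp (?I r) - \<alpha> r * exp (?I u)) u v"
        by (simp add: right_diff_distrib)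
      also have "\<dots> = time_integral (\<lambda>r. \<alpha> r * exp (?I r)) u v - time_integral (\<lambda>r. \<alpha> r * exp (?I u)) u v"
        by (rule time_integral_diff[OF \<beta> \<gamma>]) (use uv in auto)
      also have "time_integral (\<lambda>r. \<alpha> r * exp (?I u)) u v = ?z * exp (?I u)"
        by (rule time_integral_mult_left)
      finally show ?thesis by simp
    qed
    have e2: "norm (time_integral (\<lambda>r. \<alpha> r * (exp (?I r) - exp (?I u))) u v) \<le> K * (exp (K * T) * exp (K * T) * K) * ?h\<^sup>2"
    proof -
      have bnd: "norm (exp (?I r) - exp (?I u)) \<le> exp (K * T) * exp (K * T) * K * ?h" if r: "u \<le> r" "r \<le> v" for r
      proof -
        have "K * (r - u) \<le> K * ?h" using r K by (intro mult_left_mono) auto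
        then have dr: "norm (?I r - ?I u) \<le> K * ?h" using d[OF r] by linarith
        have hT: "K * ?h \<le> K * T" using K uv by (intro mult_left_mono) auto
        have "norm (exp (?I r - ?I u) - (\<Sum>i\<le>0. (?I r - ?I u) ^ i / fact i)) \<le>
            exp \<bar>Re (?I r - ?I u)\<bar> * norm (?I r - ?I u) ^ Suc 0 / fact 0"
          by (rule Taylor_exp)
        also have "\<dots> \<le> exp (K * T) * (K * ?h)"
          using dr hT abs_Re_le_cmod[of "?I r - ?I u"] by (auto intro!: mult_mono)
        finally have *: "norm (exp (?I r - ?I u) - 1) \<le> exp (K * T) * (K * ?h)" by simp
        have "exp (?I r) - exp (?I u) = exp (?I u) * (exp (?I r - ?I u) - 1)"
          by (simp add: exp_diff right_diff_distrib)
        then have "norm (exp (?I r) - exp (?I u)) = norm (exp (?I u)) * norm (exp (?I r - ?I u) - 1)"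
          by (simp add: norm_mult)
        also have "\<dots> \<le> exp (K * T) * (exp (K * T) * (K * ?h))"
          using eb[of u] uv * by (intro mult_mono) auto
        finally show ?thesis by (simp add: mult_ac)
      qed
      have meas: "(\<lambda>r. indicator {u..v} r *\<^sub>R (\<alpha> r * (exp (?I r) - exp (?I u)))) \<in> borel_measurable borel"
      proof -
        have "(\<lambda>r. indicator {u..v} r *\<^sub>R (\<alpha> r * exp (?I r)) - indicator {u..v} r *\<^sub>R (\<alpha> r * exp (?I u))) \<in> borel_measurable borel"
          by (intro borel_measurable_diff bdd_path_indicator_measurable[OF \<beta>] bdd_path_indicator_measurable[OF \<gamma>]) (use uv in auto)
        then show ?thesis by (simp add: right_diff_distrib scaleR_diff_right)
      qed
      have "norm (time_integral (\<lambda>r. \<alpha> r * (exp (?I r) - exp (?I u))) u v) \<le>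
          (\<integral>r. norm (indicator {u..v} r *\<^sub>R (\<alpha> r * (exp (?I r) - exp (?I u)))) \<partial>lborel)"
        unfolding time_integral_def set_lebesgue_integral_def by (rule integral_norm_bound)
      also have "\<dots> \<le> (\<integral>r. K * (exp (K * T) * exp (K * T) * K * ?h) * indicator {u..v} r \<partial>lborel)"
      proof (rule integral_mono')
        show "integrable lborel (\<lambda>r. K * (exp (K * T) * exp (K * T) * K * ?h) * indicator {u..v} r)"
          by (intro integrable_mult_right integrable_real_indicator) (use uv in auto)
        fix r
        show "norm (indicator {u..v} r *\<^sub>R (\<alpha> r * (exp (?I r) - exp (?I u)))) \<le> K * (exp (K * T) * exp (K * T) * K * ?h) * indicator {u..v} r"
          using bnd[of r] \<alpha> uv K
          by (auto simp: norm_mult bdd_path_def split: split_indicator intro!: mult_mono)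
      qed (use K h in auto)
      also have "\<dots> = K * (exp (K * T) * exp (K * T) * K) * ?h\<^sup>2" using uv by (simp add: power2_eq_square)
      finally show ?thesis .
    qed
    have "exp (?I v) - exp (?I u) = exp (?I u) * (exp ?z - 1)"
      unfolding split1 exp_add by (simp add: algebra_simps)
    then have "g v - g u = exp (?I u) * (exp ?z - 1 - ?z) - (time_integral (\<lambda>r. \<alpha> r * exp (?I r)) u v - ?z * exp (?I u))"
      unfolding g_def split2 by (simp add: algebra_simps)
    then have "norm (g v - g u) \<le> norm (exp (?I u)) * norm (exp ?z - 1 - ?z) + norm (time_integral (\<lambda>r. \<alpha> r * (exp (?I r) - exp (?I u))) u v)"
      unfolding diff by (metis norm_mult norm_triangle_ineq4)
    also have "\<dots> \<le> exp (K * T) * (exp (K * T) * (K * ?h)\<^sup>2) + K * (exp (K * T) * exp (K * T) * K) * ?h\<^sup>2"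
      using e1 e2 eb[of u] uv by (intro add_mono mult_mono) auto
    also have "\<dots> = (exp (K * T) * exp (K * T) * K\<^sup>2 + K * (exp (K * T) * exp (K * T) * K)) * ?h\<^sup>2"
      by (simp only: power_mult_distrib distrib_right distrib_left mult_ac)
    finally show ?thesis .
  qed
  note q = this
  have "g r = g 0" if "r \<in> {0..T}" for r
    by (rule quadratic_bound_constant[of T g
          "exp (K * T) * exp (K * T) * K\<^sup>2 + K * (exp (K * T) * exp (K * T) * K)", OF T q that])
  from this[of s] this[of t] have "g t = g s" using t by simp
  moreover have "time_integral (\<lambda>r. \<alpha> r * exp (?I r)) 0 t =
        time_integral (\<lambda>r. \<alpha> r * exp (?I r)) 0 s + time_integral (\<lambda>r. \<alpha> r * exp (?I r)) s t"
    by (rule time_integral_split[OF \<beta>]) (use t in auto)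
  ultimately show ?thesis by (simp add: g_def algebra_simps)
qed

context filtered_prob_space
begin

text \<open>Clipping at \<open>t\<close> rather than at \<open>T\<close> makes the integrand jointly
  measurable for the Borel sets and \<open>F t\<close>.\<close>

lemma time_integral_adapted:
  fixes \<alpha> :: "real \<Rightarrow> 'w \<Rightarrow> 'b::{banach, second_countable_topology}"
  assumes \<alpha>: "progressive T F \<alpha>" and t: "t \<in> {0..T}"
  shows "(\<lambda>w. time_integral (\<lambda>r. \<alpha> r w) 0 t) \<in> borel_measurable (F t)"
proof -
  have eq: "time_integral (\<lambda>r. \<alpha> r w) 0 t = (\<integral>r. indicator {0..t} r *\<^sub>R \<alpha> (clip t r) w \<partial>lborel)" for w
    unfolding time_integral_def set_lebesgue_integral_def
    by (intro Bochner_Integration.integral_cong refl) (auto simp: clip_id split: split_indicator)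
  have sw: "(\<lambda>p. (snd p, fst p)) \<in> measurable (F t \<Otimes>\<^sub>M borel) (borel \<Otimes>\<^sub>M F t)" by measurable
  have "(\<lambda>p. \<alpha> (clip t (fst (snd p, fst p))) (snd (snd p, fst p))) \<in> borel_measurable (F t \<Otimes>\<^sub>M borel)"
    using \<alpha> t by (intro measurable_compose[OF sw]) (auto simp: progressive_def)
  then have "(\<lambda>p. indicator {0..t} (snd p) *\<^sub>R \<alpha> (clip t (snd p)) (fst p)) \<in> borel_measurable (F t \<Otimes>\<^sub>M lborel)"
    by (simp add: measurable_cong_sets[OF sets_pair_measure_cong[OF refl sets_lborel] refl])
  then show ?thesis
    unfolding eq by (intro lborel.borel_measurable_lebesgue_integral) (simp add: split_beta')
qed

lemma progressive_bdd_path: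
  assumes "progressive T F \<alpha>" "w \<in> space M" "\<And>r. r \<in> {0..T} \<Longrightarrow> norm (\<alpha> r w) \<le> K"
  shows "bdd_path T K (\<lambda>r. \<alpha> r w)"
  using progressive_section[OF assms(1), of T w] assms T_pos by (auto simp: bdd_path_def)

end

section \<open>Complex exponentials of Brownian motion\<close>

text \<open>The frequency still active at time \<open>s\<close>: \<open>sphase\<close> moves by the
  inner product of \<open>lam l s\<close> with the increment of the path, since pairs whose time has
  passed no longer see it. The strict \<open>s < r\<close> makes \<open>lam\<close>
  right-continuous.\<close>

definition lam :: "((real ^ 'n) \<times> real) list \<Rightarrow> real \<Rightarrow> real ^ 'n" where
  "lam l s = (\<Sum>(v, r)\<leftarrow>l. if s < r then v else 0)"

definition sphase :: "((real ^ 'n) \<times> real) list \<Rightarrow> real \<Rightarrow> (real \<Rightarrow> real ^ 'n) \<Rightarrow> real" where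
  "sphase l t x = phase l (\<lambda>r. x (min r t))"

lemma lam_Nil [simp]: "lam [] s = 0" and lam_Cons: "lam ((v, r) # l) s = (if s < r then v else 0) + lam l s"
  by (simp_all add: lam_def)

lemma sphase_Nil [simp]: "sphase [] t x = 0"
  and sphase_Cons: "sphase ((v, r) # l) t x = v \<bullet> x (min r t) + sphase l t x"
  by (simp_all add: sphase_def phase_def)

lemma lam_measurable [measurable]: "lam l \<in> borel_measurable borel"
proof (induction l)
  case (Cons u l)
  obtain v r where u: "u = (v, r)" by (cases u)
  note [measurable] = Cons
  have "(\<lambda>s. (if s < r then v else 0) + lam l s) \<in> borel_measurable borel" by measurable
  then show ?case by (simp add: u lam_Cons cong: measurable_cong)
qed (simp add: lam_def[abs_def])

lemma lam_bounded: "\<exists>K. \<forall>s. norm (lam l s) \<le> K"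
proof (induction l)
  case (Cons u l)
  obtain v r where u: "u = (v, r)" by (cases u)
  obtain K where K: "\<And>s. norm (lam l s) \<le> K" using Cons by auto
  have "norm (lam (u # l) s) \<le> norm v + K" for s
    using K[of s] norm_triangle_ineq[of v "lam l s"] by (auto simp: u lam_Cons intro: add_increasing)
  then show ?case by blast
qed auto

lemma bdd_path_lam_square: "\<exists>K. bdd_path T K (\<lambda>r. (norm (lam l r))\<^sup>2)"
proof -
  obtain K where K: "\<And>s. norm (lam l s) \<le> K" using lam_bounded by blast
  have "(\<lambda>r. (norm (lam l (clip T r)))\<^sup>2) \<in> borel_measurable borel" by measurable
  moreover have "norm ((norm (lam l r))\<^sup>2) \<le> K\<^sup>2" for r using K[of r] by (simp add: power_mono)
  ultimately show ?thesis unfolding bdd_path_def by blast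
qed

lemma sphase_increment:
  assumes "s < t" "\<And>r. r \<in> snd ` set l \<Longrightarrow> r \<le> s \<or> t \<le> r"
  shows "sphase l t x - sphase l s x = lam l s \<bullet> (x t - x s)"
  using assms(2)
proof (induction l)
  case (Cons u l)
  obtain v r where u: "u = (v, r)" by (cases u)
  have IH: "sphase l t x - sphase l s x = lam l s \<bullet> (x t - x s)" using Cons by auto
  have "r \<le> s \<or> t \<le> r" using Cons.prems[of r] by (simp add: u)
  then have "v \<bullet> x (min r t) - v \<bullet> x (min r s) = (if s < r then v else 0) \<bullet> (x t - x s)"
    using assms(1) by (auto simp: min_def inner_diff_right)
  then show ?case using IH by (simp add: u sphase_Cons lam_Cons inner_add_left)
qed simp

lemma lam_eq:
  assumes "s \<le> r" "r < t" "\<And>q. q \<in> snd ` set l \<Longrightarrow> q \<le> s \<or> t \<le> q"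
  shows "lam l r = lam l s"
  using assms(3)
proof (induction l)
  case (Cons u l)
  obtain v q where u: "u = (v, q)" by (cases u)
  have "q \<le> s \<or> t \<le> q" using Cons.prems[of q] by (simp add: u)
  then have "r < q \<longleftrightarrow> s < q" using assms(1,2) by auto
  then show ?case using Cons by (auto simp: u lam_Cons)
qed simp

lemma sphase_continuous:
  assumes "continuous_on {0..T} x" "snd ` set l \<subseteq> {0..T}"
  shows "continuous_on {0..T} (\<lambda>t. sphase l t x)"
  using assms(2)
proof (induction l)
  case (Cons u l)
  obtain v r where u: "u = (v, r)" by (cases u)
  have "continuous_on {0..T} (\<lambda>t. x (min r t))"
    by (rule continuous_on_compose2[OF assms(1)]) (use Cons.prems in \<open>auto simp: u intro!: continuous_intros\<close>)
  then show ?case using Cons by (auto simp: u sphase_Cons intro!: continuous_intros)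
qed simp

text \<open>The exceptional point \<open>c\<close> is there for integrands such as
  \<open>lam\<close>, which may jump at an end of the interval.\<close>

lemma time_integral_cong_AE:
  assumes "bdd_path T K \<alpha>" "bdd_path T L \<beta>" "0 \<le> s" "t \<le> T" "\<And>r. s \<le> r \<Longrightarrow> r \<le> t \<Longrightarrow> r \<noteq> c \<Longrightarrow> \<alpha> r = \<beta> r"
  shows "time_integral \<alpha> s t = time_integral \<beta> s t"
  unfolding time_integral_def set_lebesgue_integral_def
proof (rule integral_cong_AE)
  show "AE r in lborel. indicator {s..t} r *\<^sub>R \<alpha> r = indicator {s..t} r *\<^sub>R \<beta> r"
    using AE_lborel_singleton[of c] by eventually_elim (use assms(5) in \<open>auto split: split_indicator\<close>)
  show "(\<lambda>r. indicator {s..t} r *\<^sub>R \<alpha> r) \<in> borel_measurable lborel"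
    "(\<lambda>r. indicator {s..t} r *\<^sub>R \<beta> r) \<in> borel_measurable lborel"
    using bdd_path_indicator_measurable[OF assms(1), of "{s..t}"]
      bdd_path_indicator_measurable[OF assms(2), of "{s..t}"] assms(3,4) by auto
qed

lemma bdd_path_const: "bdd_path T (norm c) (\<lambda>r. c)"
  by (auto simp: bdd_path_def)

lemma time_integral_const: "s \<le> t \<Longrightarrow> time_integral (\<lambda>r. c) s t = (t - s) *\<^sub>R c"
  by (simp add: time_integral_def set_integral_const)

section \<open>Weak Ito expansions\<close>

context filtered_prob_space
begin

text \<open>Joint measurability for the full \<sigma>-algebra only. Unlike
  \<open>progressive\<close> it admits factors that look into the future, such as \<open>N t\<close>
  inside an integral over earlier times in \<open>weak_ito_exp\<close>.\<close>

definition joint :: "(real \<Rightarrow> 'w \<Rightarrow> 'b::topological_space) \<Rightarrow> bool" where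
  "joint h \<longleftrightarrow> (\<lambda>p. h (clip T (fst p)) (snd p)) \<in> borel_measurable (borel \<Otimes>\<^sub>M M)"

lemma progressive_imp_joint: "progressive T F h \<Longrightarrow> joint h"
  unfolding joint_def using progressive_joint[of h T] T_pos by auto

lemma joint_random: "\<Xi> \<in> borel_measurable M \<Longrightarrow> joint (\<lambda>r. \<Xi>)"
  unfolding joint_def by (rule measurable_compose[OF measurable_snd])

lemma joint_times:
  fixes h k :: "real \<Rightarrow> 'w \<Rightarrow> 'b::{real_normed_algebra, second_countable_topology}"
  assumes "joint h" "joint k" shows "joint (\<lambda>r w. h r w * k r w)"
  using assms unfolding joint_def by (rule borel_measurable_times)

lemma fubini_time:
  fixes h :: "real \<Rightarrow> 'w \<Rightarrow> 'b::{banach, second_countable_topology}"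
  assumes h: "joint h" "\<And>r w. r \<in> {0..T} \<Longrightarrow> w \<in> space M \<Longrightarrow> norm (h r w) \<le> K"
    and st: "0 \<le> s" "t \<le> T"
  shows "(\<integral>w. time_integral (\<lambda>r. h r w) s t \<partial>M) = time_integral (\<lambda>r. \<integral>w. h r w \<partial>M) s t"
    and "(\<lambda>w. time_integral (\<lambda>r. h r w) s t) \<in> borel_measurable M"
proof -
  interpret P: pair_sigma_finite lborel M ..
  let ?g = "\<lambda>(r::real) w. indicator {s..t} r *\<^sub>R h (clip T r) w"
  have eq: "indicator {s..t} r *\<^sub>R h r w = ?g r w" for r w
    using st by (auto simp: clip_id split: split_indicator)
  have meas: "case_prod ?g \<in> borel_measurable (borel \<Otimes>\<^sub>M M)"
  proof -
    have "(\<lambda>p. indicator {s..t} (fst p) *\<^sub>R h (clip T (fst p)) (snd p)) \<in> borel_measurable (borel \<Otimes>\<^sub>M M)"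
      using h(1) unfolding joint_def by (intro borel_measurable_scaleR) measurable
    then show ?thesis by (simp add: split_beta')
  qed
  then have meas': "case_prod ?g \<in> borel_measurable (lborel \<Otimes>\<^sub>M M)"
    by (simp add: measurable_cong_sets[OF sets_pair_measure_cong[OF sets_lborel refl] refl])
  have int: "integrable (lborel \<Otimes>\<^sub>M M) (case_prod ?g)"
  proof (rule Bochner_Integration.integrable_bound[OF _ meas'])
    show "AE p in lborel \<Otimes>\<^sub>M M. norm (case p of (r, w) \<Rightarrow> ?g r w) \<le> norm (\<bar>K\<bar> * indicator ({s..t} \<times> space M) p)"
    proof (rule AE_I2)
      fix p :: "real \<times> 'w" assume p: "p \<in> space (lborel \<Otimes>\<^sub>M M)"
      obtain r w where rw: "p = (r, w)" by (cases p)
      then have w: "w \<in> space M" using p by (simp add: space_pair_measure)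
      have "clip T r \<in> {0..T}" using T_pos by (intro clip_mem) simp
      from h(2)[OF this w] w show "norm (case p of (r, w) \<Rightarrow> ?g r w) \<le> norm (\<bar>K\<bar> * indicator ({s..t} \<times> space M) p)"
        by (auto simp: rw split: split_indicator)
    qed
    have "emeasure (lborel \<Otimes>\<^sub>M M) ({s..t} \<times> space M) = emeasure lborel {s..t} * emeasure M (space M)"
      by (rule emeasure_pair_measure_Times) auto
    also have "\<dots> < \<infinity>" using emeasure_lborel_Icc_eq[of s t] by (simp add: emeasure_space_1)
    finally show "integrable (lborel \<Otimes>\<^sub>M M) (\<lambda>p. \<bar>K\<bar> * indicator ({s..t} \<times> space M) p)"
      by (intro integrable_mult_right integrable_real_indicator) auto
  qed
  have "(\<integral>w. time_integral (\<lambda>r. h r w) s t \<partial>M) = (\<integral>w. \<integral>r. ?g r w \<partial>lborel \<partial>M)"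
    unfolding time_integral_def set_lebesgue_integral_def eq ..
  also have "\<dots> = (\<integral>r. \<integral>w. ?g r w \<partial>M \<partial>lborel)"
    by (rule P.Fubini_integral[OF int])
  also have "\<dots> = time_integral (\<lambda>r. \<integral>w. h r w \<partial>M) s t"
    unfolding time_integral_def set_lebesgue_integral_def
    by (intro Bochner_Integration.integral_cong refl) (simp flip: eq)
  finally show "(\<integral>w. time_integral (\<lambda>r. h r w) s t \<partial>M) = time_integral (\<lambda>r. \<integral>w. h r w \<partial>M) s t" .
  have sw: "(\<lambda>p. (snd p, fst p)) \<in> measurable (M \<Otimes>\<^sub>M lborel) (borel \<Otimes>\<^sub>M M)" by measurable
  have "(\<lambda>p. ?g (snd p) (fst p)) \<in> borel_measurable (M \<Otimes>\<^sub>M lborel)"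
    using measurable_compose[OF sw meas] by simp
  then show "(\<lambda>w. time_integral (\<lambda>r. h r w) s t) \<in> borel_measurable M"
    unfolding time_integral_def set_lebesgue_integral_def eq
    by (intro lborel.borel_measurable_lebesgue_integral) (simp add: split_beta')
qed

text \<open>Says that \<open>h\<close> minus the time integral of \<open>d\<close> is a martingale,
  tested against bounded variables \<Xi> that are known at the earlier time. It is the drift part of
  Ito's formula; the martingale part is never written as an integral.\<close>

definition weak_ito :: "(real \<Rightarrow> 'w \<Rightarrow> complex) \<Rightarrow> (real \<Rightarrow> 'w \<Rightarrow> complex) \<Rightarrow> bool" where
  "weak_ito h d \<longleftrightarrow> progressive T F h \<and> progressive T F d \<and>
     (\<exists>K. \<forall>r\<in>{0..T}. \<forall>w\<in>space M. norm (h r w) \<le> K \<and> norm (d r w) \<le> K) \<and>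
     (\<forall>s t \<Xi>. 0 \<le> s \<and> s \<le> t \<and> t \<le> T \<and> \<Xi> \<in> borel_measurable (F s) \<and> (\<exists>L. \<forall>w\<in>space M. norm (\<Xi> w) \<le> L) \<longrightarrow>
       (\<integral>w. \<Xi> w * h t w \<partial>M) - (\<integral>w. \<Xi> w * h s w \<partial>M) =
       (\<integral>w. \<Xi> w * time_integral (\<lambda>r. d r w) s t \<partial>M))"

lemma weak_itoD:
  assumes "weak_ito h d" "0 \<le> s" "s \<le> t" "t \<le> T" "\<Xi> \<in> borel_measurable (F s)" "\<And>w. w \<in> space M \<Longrightarrow> norm (\<Xi> w) \<le> L"
  shows "(\<integral>w. \<Xi> w * h t w \<partial>M) - (\<integral>w. \<Xi> w * h s w \<partial>M) =
       (\<integral>w. \<Xi> w * time_integral (\<lambda>r. d r w) s t \<partial>M)"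
  using assms unfolding weak_ito_def by blast

lemma bounded_integrable:
  fixes f :: "'w \<Rightarrow> 'b::{banach, second_countable_topology}"
  assumes "f \<in> borel_measurable M" "\<And>w. w \<in> space M \<Longrightarrow> norm (f w) \<le> K"
  shows "integrable M f"
  by (rule norm_integral_bounded_measurable[OF finite_measure_axioms assms])

lemma weak_ito_add:
  assumes 1: "weak_ito h d" and 2: "weak_ito k e"
  shows "weak_ito (\<lambda>r w. h r w + k r w) (\<lambda>r w. d r w + e r w)"
  unfolding weak_ito_def
proof (intro conjI allI impI)
  have ph: "progressive T F h" "progressive T F d" "progressive T F k" "progressive T F e"
    using 1 2 by (auto simp: weak_ito_def)
  show "progressive T F (\<lambda>r w. h r w + k r w)" "progressive T F (\<lambda>r w. d r w + e r w)"
    by (rule progressive_compose2[OF ph(1) ph(3)], measurable) (rule progressive_compose2[OF ph(2) ph(4)], measurable)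
  obtain K where K: "\<And>r w. r \<in> {0..T} \<Longrightarrow> w \<in> space M \<Longrightarrow> norm (h r w) \<le> K \<and> norm (d r w) \<le> K"
    using 1 unfolding weak_ito_def by blast
  obtain K' where K': "\<And>r w. r \<in> {0..T} \<Longrightarrow> w \<in> space M \<Longrightarrow> norm (k r w) \<le> K' \<and> norm (e r w) \<le> K'"
    using 2 unfolding weak_ito_def by blast
  have "norm (h r w + k r w) \<le> K + K' \<and> norm (d r w + e r w) \<le> K + K'" if "r \<in> {0..T}" "w \<in> space M" for r w
    using K[OF that] K'[OF that] by (meson add_mono norm_triangle_le)
  then show "\<exists>K. \<forall>r\<in>{0..T}. \<forall>w\<in>space M. norm (h r w + k r w) \<le> K \<and> norm (d r w + e r w) \<le> K" by blast
  fix s t :: real and \<Xi> :: "'w \<Rightarrow> complex"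
  assume a: "0 \<le> s \<and> s \<le> t \<and> t \<le> T \<and> \<Xi> \<in> borel_measurable (F s) \<and> (\<exists>L. \<forall>w\<in>space M. norm (\<Xi> w) \<le> L)"
  then obtain L where L: "\<And>w. w \<in> space M \<Longrightarrow> norm (\<Xi> w) \<le> L" by blast
  have \<Xi> [measurable]: "\<Xi> \<in> borel_measurable M" using a by (intro measurable_F[of s]) auto
  have ih: "integrable M (\<lambda>w. \<Xi> w * g r w)"
    if g: "progressive T F g" and B: "\<And>r w. r \<in> {0..T} \<Longrightarrow> w \<in> space M \<Longrightarrow> norm (g r w) \<le> B" and r: "r \<in> {0..T}" for g r B
  proof (rule bounded_integrable)
    have [measurable]: "g r \<in> borel_measurable M" by (rule measurable_F[OF r progressive_adapted[OF g r]])
    show "(\<lambda>w. \<Xi> w * g r w) \<in> borel_measurable M" by measurable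
    fix w assume w: "w \<in> space M"
    show "norm (\<Xi> w * g r w) \<le> L * B"
      unfolding norm_mult using L[OF w] B[OF r w] norm_ge_zero[of "\<Xi> w"]
      by (intro mult_mono) (auto intro: order_trans[OF norm_ge_zero])
  qed
  have iT: "integrable M (\<lambda>w. \<Xi> w * time_integral (\<lambda>r. g r w) s t)"
    if g: "progressive T F g" and B: "\<And>r w. r \<in> {0..T} \<Longrightarrow> w \<in> space M \<Longrightarrow> norm (g r w) \<le> B" for g B
  proof (rule bounded_integrable)
    have [measurable]: "(\<lambda>w. time_integral (\<lambda>r. g r w) s t) \<in> borel_measurable M"
      by (rule fubini_time(2)[OF progressive_imp_joint[OF g] B]) (use a in auto)
    show "(\<lambda>w. \<Xi> w * time_integral (\<lambda>r. g r w) s t) \<in> borel_measurable M" by measurable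
    fix w assume w: "w \<in> space M"
    have "norm (time_integral (\<lambda>r. g r w) s t) \<le> B * (t - s)"
      by (rule norm_time_integral_le[OF progressive_bdd_path[OF g w B]]) (use a w in auto)
    then show "norm (\<Xi> w * time_integral (\<lambda>r. g r w) s t) \<le> L * (B * (t - s))"
      unfolding norm_mult using L[OF w] norm_ge_zero[of "\<Xi> w"]
      by (intro mult_mono) (auto intro: order_trans[OF norm_ge_zero])
  qed
  have T: "time_integral (\<lambda>r. d r w + e r w) s t = time_integral (\<lambda>r. d r w) s t + time_integral (\<lambda>r. e r w) s t"
    if w: "w \<in> space M" for w
    using K K' w a
    by (intro time_integral_add[OF progressive_bdd_path[OF ph(2) w] progressive_bdd_path[OF ph(4) w]]) auto
  have "(\<integral>w. \<Xi> w * (h r w + k r w) \<partial>M) = (\<integral>w. \<Xi> w * h r w \<partial>M) + (\<integral>w. \<Xi> w * k r w \<partial>M)" if "r \<in> {0..T}" for r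
    unfolding distrib_left using K K' that
    by (intro Bochner_Integration.integral_add ih[OF ph(1), of K] ih[OF ph(3), of K']) auto
  moreover have "(\<integral>w. \<Xi> w * time_integral (\<lambda>r. d r w + e r w) s t \<partial>M) =
      (\<integral>w. \<Xi> w * time_integral (\<lambda>r. d r w) s t + \<Xi> w * time_integral (\<lambda>r. e r w) s t \<partial>M)"
    by (intro Bochner_Integration.integral_cong refl) (simp add: T distrib_left)
  moreover have "\<dots> = (\<integral>w. \<Xi> w * time_integral (\<lambda>r. d r w) s t \<partial>M) + (\<integral>w. \<Xi> w * time_integral (\<lambda>r. e r w) s t \<partial>M)"
    using K K' by (intro Bochner_Integration.integral_add iT[OF ph(2), of K] iT[OF ph(4), of K']) auto
  ultimately show "(\<integral>w. \<Xi> w * (h t w + k t w) \<partial>M) - (\<integral>w. \<Xi> w * (h s w + k s w) \<partial>M) =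
      (\<integral>w. \<Xi> w * time_integral (\<lambda>r. d r w + e r w) s t \<partial>M)"
    using weak_itoD[OF 1, of s t \<Xi> L] weak_itoD[OF 2, of s t \<Xi> L] a L by (simp add: algebra_simps)
qed

text \<open>A factor measurable at time 0 is absorbed in the test variable.\<close>

lemma weak_ito_mult:
  assumes 1: "weak_ito h d" and c: "c \<in> borel_measurable (F 0)" "\<And>w. w \<in> space M \<Longrightarrow> norm (c w) \<le> C"
  shows "weak_ito (\<lambda>r w. c w * h r w) (\<lambda>r w. c w * d r w)"
  unfolding weak_ito_def
proof (intro conjI allI impI)
  have ph: "progressive T F h" "progressive T F d" using 1 by (auto simp: weak_ito_def)
  have cF: "c \<in> borel_measurable (F t)" if "t \<in> {0..T}" for t
    using that by (intro measurable_F_mono[OF c(1)]) auto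
  have pc: "progressive T F (\<lambda>r. c)"
    unfolding progressive_def using cF by (auto intro: measurable_compose[OF measurable_snd])
  show "progressive T F (\<lambda>r w. c w * h r w)" "progressive T F (\<lambda>r w. c w * d r w)"
    by (rule progressive_compose2[OF pc ph(1)], measurable) (rule progressive_compose2[OF pc ph(2)], measurable)
  obtain K where K: "\<And>r w. r \<in> {0..T} \<Longrightarrow> w \<in> space M \<Longrightarrow> norm (h r w) \<le> K \<and> norm (d r w) \<le> K"
    using 1 unfolding weak_ito_def by blast
  have "norm (c w * h r w) \<le> C * K \<and> norm (c w * d r w) \<le> C * K" if "r \<in> {0..T}" "w \<in> space M" for r w
    unfolding norm_mult using K[OF that] c(2)[OF that(2)] norm_ge_zero[of "c w"]
    by (intro conjI mult_mono) (auto intro: order_trans[OF norm_ge_zero])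
  then show "\<exists>K. \<forall>r\<in>{0..T}. \<forall>w\<in>space M. norm (c w * h r w) \<le> K \<and> norm (c w * d r w) \<le> K" by blast
  fix s t :: real and \<Xi> :: "'w \<Rightarrow> complex"
  assume a: "0 \<le> s \<and> s \<le> t \<and> t \<le> T \<and> \<Xi> \<in> borel_measurable (F s) \<and> (\<exists>L. \<forall>w\<in>space M. norm (\<Xi> w) \<le> L)"
  then obtain L where L: "\<And>w. w \<in> space M \<Longrightarrow> norm (\<Xi> w) \<le> L" by blast
  have b: "norm (\<Xi> w * c w) \<le> L * C" if "w \<in> space M" for w
    unfolding norm_mult using L[OF that] c(2)[OF that] norm_ge_zero[of "\<Xi> w"]
    by (intro mult_mono) (auto intro: order_trans[OF norm_ge_zero])
  have "(\<integral>w. (\<Xi> w * c w) * h t w \<partial>M) - (\<integral>w. (\<Xi> w * c w) * h s w \<partial>M) =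
      (\<integral>w. (\<Xi> w * c w) * time_integral (\<lambda>r. d r w) s t \<partial>M)"
    by (rule weak_itoD[OF 1 _ _ _ _ b]) (use a cF[of s] in \<open>auto intro!: borel_measurable_times\<close>)
  then show "(\<integral>w. \<Xi> w * (c w * h t w) \<partial>M) - (\<integral>w. \<Xi> w * (c w * h s w) \<partial>M) =
      (\<integral>w. \<Xi> w * time_integral (\<lambda>r. c w * d r w) s t \<partial>M)"
    by (simp add: time_integral_mult_left[where c="c _", simplified mult.commute[of _ "c _"]] mult.assoc)
qed

lemma weak_ito_zero: "weak_ito (\<lambda>r w. 0) (\<lambda>r w. 0)"
  by (auto simp: weak_ito_def progressive_def time_integral_def intro: exI[of _ 0])

lemma weak_ito_sum_list:
  assumes "\<And>u. u \<in> set us \<Longrightarrow> weak_ito (h u) (d u)"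
  shows "weak_ito (\<lambda>r w. \<Sum>u\<leftarrow>us. h u r w) (\<lambda>r w. \<Sum>u\<leftarrow>us. d u r w)"
  using assms by (induction us) (auto intro!: weak_ito_zero weak_ito_add)

end

lemma (in filtered_prob_space) sphase_adapted_process:
  assumes Y: "\<And>t. t \<in> {0..T} \<Longrightarrow> Y t \<in> borel_measurable (F t)"
    and "snd ` set l \<subseteq> {0..T}" and t: "t \<in> {0..T}"
  shows "(\<lambda>w. sphase l t (\<lambda>r. Y r w)) \<in> borel_measurable (F t)"
  using assms(2)
proof (induction l)
  case (Cons u l)
  obtain v r where u: "u = (v, r)" by (cases u)
  have [measurable]: "Y (min r t) \<in> borel_measurable (F t)"
    using Cons.prems t by (intro measurable_F_mono[OF Y]) (auto simp: u)
  have [measurable]: "(\<lambda>w. sphase l t (\<lambda>r. Y r w)) \<in> borel_measurable (F t)" using Cons by auto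
  show ?case unfolding u sphase_Cons by measurable
qed simp

section \<open>Martingales built from stopped phases\<close>

context brownian
begin

lemma sphase_adapted:
  assumes "snd ` set l \<subseteq> {0..T}" "t \<in> {0..T}"
  shows "(\<lambda>w. sphase l t (\<lambda>r. W r w)) \<in> borel_measurable (F t)"
  by (rule sphase_adapted_process[OF _ assms]) (rule W_adapted)

text \<open>On an interval with no time of \<open>l\<close> in its interior, the phase moves by
  \<open>lam l s\<close> against a single Brownian increment. Otherwise the interval is split at
  such a time; both halves have fewer interior times, which is the measure of the induction.\<close>

lemma martingale_phase:
  assumes l: "snd ` set l \<subseteq> {0..T}" and st: "0 \<le> s" "s \<le> t" "t \<le> T"
    and \<Xi>: "\<Xi> \<in> borel_measurable (F s)" "\<And>w. w \<in> space M \<Longrightarrow> norm (\<Xi> w) \<le> K"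
  shows "(\<integral>w. \<Xi> w * cis (sphase l t (\<lambda>r. W r w) - sphase l s (\<lambda>r. W r w)) \<partial>M) =
    (\<integral>w. \<Xi> w \<partial>M) * exp (- (time_integral (\<lambda>r. (norm (lam l r))\<^sup>2) s t / 2))"
  using st \<Xi>
proof (induction "card {r \<in> snd ` set l. s < r \<and> r < t}" arbitrary: s t \<Xi> rule: less_induct)
  case less
  note st = less.prems(1-3) and \<Xi> = less.prems(4,5)
  obtain B where B: "bdd_path T B (\<lambda>r. (norm (lam l r))\<^sup>2)" using bdd_path_lam_square by blast
  show ?case
  proof (cases "\<exists>u\<in>snd ` set l. s < u \<and> u < t")
    case True
    then obtain u where u: "u \<in> snd ` set l" "s < u" "u < t" by blast
    have c1: "card {r \<in> snd ` set l. s < r \<and> r < u} < card {r \<in> snd ` set l. s < r \<and> r < t}"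
      using u by (intro psubset_card_mono psubsetI) auto
    have c2: "card {r \<in> snd ` set l. u < r \<and> r < t} < card {r \<in> snd ` set l. s < r \<and> r < t}"
      using u by (intro psubset_card_mono psubsetI) auto
    let ?p = "\<lambda>t w. sphase l t (\<lambda>r. W r w)"
    let ?q = "time_integral (\<lambda>r. (norm (lam l r))\<^sup>2)"
    have [measurable]: "?p u \<in> borel_measurable (F u)" "?p s \<in> borel_measurable (F u)" "\<Xi> \<in> borel_measurable (F u)"
      using u st \<Xi> sphase_adapted[OF l] by (auto intro!: measurable_F_mono[of _ s _ u])
    \<comment> \<open>The later half is integrated first, with the exponential of the earlier half
      absorbed in the test variable.\<close>
    have "(\<integral>w. (\<Xi> w * cis (?p u w - ?p s w)) * cis (?p t w - ?p u w) \<partial>M) =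
        (\<integral>w. \<Xi> w * cis (?p u w - ?p s w) \<partial>M) * exp (- (?q u t / 2))"
    proof (rule less.hyps[OF c2])
      show "(\<lambda>w. \<Xi> w * cis (?p u w - ?p s w)) \<in> borel_measurable (F u)" by measurable
    qed (use u st \<Xi> in \<open>auto simp: norm_mult\<close>)
    also have "(\<integral>w. \<Xi> w * cis (?p u w - ?p s w) \<partial>M) = (\<integral>w. \<Xi> w \<partial>M) * exp (- (?q s u / 2))"
      by (rule less.hyps[OF c1]) (use u st \<Xi> in auto)
    also have "(\<integral>w. (\<Xi> w * cis (?p u w - ?p s w)) * cis (?p t w - ?p u w) \<partial>M) =
        (\<integral>w. \<Xi> w * cis (?p t w - ?p s w) \<partial>M)"
      by (simp add: mult.assoc cis_mult)
    also have "(\<integral>w. \<Xi> w \<partial>M) * exp (- (?q s u / 2)) * exp (- (?q u t / 2)) = (\<integral>w. \<Xi> w \<partial>M) * exp (- (?q s t / 2))"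
    proof -
      have "?q s t = ?q s u + ?q u t" by (rule time_integral_split[OF B]) (use u st in auto)
      then show ?thesis by (simp add: exp_add[symmetric] add_divide_distrib mult.assoc flip: of_real_mult)
    qed
    finally show ?thesis .
  next
    case False
    then have gap: "r \<le> s \<or> t \<le> r" if "r \<in> snd ` set l" for r using that by force
    show ?thesis
    proof (cases "s = t")
      case True
      then show ?thesis by simp
    next
      case False
      then have st': "s < t" using st by simp
      \<comment> \<open>At the right end \<open>t\<close> the active frequency may already have
        dropped, so that point is excluded.\<close>
      have "time_integral (\<lambda>r. (norm (lam l r))\<^sup>2) s t = time_integral (\<lambda>r. (norm (lam l s))\<^sup>2) s t"
      proof (rule time_integral_cong_AE[OF B bdd_path_const, of _ _ t])
        fix r assume r: "s \<le> r" "r \<le> t" "r \<noteq> t"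
        then have "r < t" by simp
        then have "lam l r = lam l s" using gap by (intro lam_eq[OF r(1)])
        then show "(norm (lam l r))\<^sup>2 = (norm (lam l s))\<^sup>2" by simp
      qed (use st in auto)
      also have "\<dots> = (t - s) * (norm (lam l s))\<^sup>2" using st by (simp add: time_integral_const)
      finally show ?thesis
        using integral_cis_increment[OF st \<Xi>, of "lam l s"]
        by (simp add: sphase_increment[OF st' gap])
    qed
  qed
qed

text \<open>The product rule for a martingale \<open>N\<close> and a process \<open>A\<close> of
  bounded variation. \<open>N\<close> is the phase exponential with its mean decay compensated; the
  correction \<open>(norm (lam l r))^2 / 2\<close> thereby moves into the exponent of
  \<open>A\<close>, whose increments are given by \<open>exp_time_integral\<close>.\<close>

lemma weak_ito_exp:
  assumes l: "snd ` set l \<subseteq> {0..T}" and \<beta>: "progressive T F \<beta>"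
    and B: "\<And>r w. r \<in> {0..T} \<Longrightarrow> w \<in> space M \<Longrightarrow> norm (\<beta> r w) \<le> B"
  shows "weak_ito (\<lambda>r w. cis (sphase l r (\<lambda>r. W r w)) * exp (time_integral (\<lambda>r. \<beta> r w) 0 r))
    (\<lambda>r w. cis (sphase l r (\<lambda>r. W r w)) * exp (time_integral (\<lambda>r. \<beta> r w) 0 r) *
       (\<beta> r w - complex_of_real ((norm (lam l r))\<^sup>2 / 2)))"
proof -
  let ?p = "\<lambda>t w. sphase l t (\<lambda>r. W r w)"
  let ?q = "\<lambda>r. time_integral (\<lambda>r. (norm (lam l r))\<^sup>2) 0 r"
  define \<alpha> where "\<alpha> r w = \<beta> r w - complex_of_real ((norm (lam l r))\<^sup>2 / 2)" for r w
  define A where "A r w = exp (time_integral (\<lambda>r. \<alpha> r w) 0 r)" for r w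
  define N where "N r w = cis (?p r w) * complex_of_real (exp (?q r / 2))" for r w
  obtain L where L: "\<And>s. norm (lam l s) \<le> L" using lam_bounded by blast
  have L2: "(norm (lam l r))\<^sup>2 \<le> L\<^sup>2" for r using L[of r] by (simp add: power_mono)
  have bl: "bdd_path T (L\<^sup>2) (\<lambda>r. (norm (lam l r))\<^sup>2)"
  proof -
    have "(\<lambda>r. (norm (lam l (clip T r)))\<^sup>2) \<in> borel_measurable borel" by measurable
    then show ?thesis using L2 by (auto simp: bdd_path_def)
  qed
  have blc: "bdd_path T (L\<^sup>2) (\<lambda>r. complex_of_real ((norm (lam l r))\<^sup>2 / 2))"
  proof -
    have "(\<lambda>r. complex_of_real ((norm (lam l (clip T r)))\<^sup>2 / 2)) \<in> borel_measurable borel" by measurable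
    moreover have "norm (complex_of_real ((norm (lam l r))\<^sup>2 / 2)) \<le> L\<^sup>2" for r
    proof -
      have "norm (complex_of_real ((norm (lam l r))\<^sup>2 / 2)) = (norm (lam l r))\<^sup>2 / 2"
        unfolding norm_of_real by simp
      then show ?thesis using L2[of r] zero_le_power2[of "norm (lam l r)"] by linarith
    qed
    ultimately show ?thesis unfolding bdd_path_def by blast
  qed
  have T0: "0 \<le> T" using T_pos by simp
  have p\<alpha>: "progressive T F \<alpha>" unfolding \<alpha>_def
  proof (rule progressive_compose2[OF \<beta> progressive_deterministic])
    show "(\<lambda>r. complex_of_real ((norm (lam l r))\<^sup>2 / 2)) \<in> borel_measurable borel" by measurable
  qed measurable
  have \<alpha>b: "norm (\<alpha> r w) \<le> B + L\<^sup>2" if "r \<in> {0..T}" "w \<in> space M" for r w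
  proof -
    have "norm (\<alpha> r w) \<le> norm (\<beta> r w) + norm (complex_of_real ((norm (lam l r))\<^sup>2 / 2))"
      unfolding \<alpha>_def by (rule norm_triangle_ineq4)
    also have "\<dots> \<le> B + L\<^sup>2"
      using B[OF that] blc that(1) by (intro add_mono) (auto simp: bdd_path_def)
    finally show ?thesis .
  qed
  have B0: "0 \<le> B" "0 \<le> L"
  proof -
    obtain w where "w \<in> space M" using not_empty by blast
    then have "norm (\<beta> 0 w) \<le> B" using B T0 by auto
    then show "0 \<le> B" using norm_ge_zero order_trans by blast
    show "0 \<le> L" using L[of 0] norm_ge_zero order_trans by blast
  qed
  \<comment> \<open>\<open>C\<close> bounds the exponentials of the integrals of both \<alpha> and
    \<beta>, since both integrands are bounded by \<open>B + L^2\<close>.\<close>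
  define C where "C = exp ((B + L\<^sup>2) * T)"
  have C: "1 \<le> C" unfolding C_def using B0 T0 by (simp add: mult_nonneg_nonneg)
  have \<alpha>path: "bdd_path T (B + L\<^sup>2) (\<lambda>r. \<alpha> r w)" if "w \<in> space M" for w
    by (rule progressive_bdd_path[OF p\<alpha> that \<alpha>b[OF _ that]])
  have \<beta>path: "bdd_path T B (\<lambda>r. \<beta> r w)" if "w \<in> space M" for w
    by (rule progressive_bdd_path[OF \<beta> that B[OF _ that]])
  have expb: "norm (exp (time_integral \<gamma> 0 r)) \<le> C"
    if "bdd_path T G \<gamma>" "G \<le> B + L\<^sup>2" "0 \<le> G" "r \<in> {0..T}" for \<gamma> :: "real \<Rightarrow> complex" and G r
  proof -
    have "norm (time_integral \<gamma> 0 r) \<le> G * (r - 0)" by (rule norm_time_integral_le[OF that(1)]) (use that in auto)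
    also have "\<dots> \<le> (B + L\<^sup>2) * T" using that by (intro mult_mono) auto
    finally show ?thesis unfolding C_def using norm_exp[of "time_integral \<gamma> 0 r"]
      by (meson exp_le_cancel_iff order_trans)
  qed
  have Ab: "norm (A r w) \<le> C" if "r \<in> {0..T}" "w \<in> space M" for r w
    unfolding A_def by (rule expb[OF \<alpha>path[OF that(2)] _ _ that(1)]) (use B0 in auto)
  have Pb: "norm (exp (time_integral (\<lambda>r. \<beta> r w) 0 r)) \<le> C" if "r \<in> {0..T}" "w \<in> space M" for r w
    by (rule expb[OF \<beta>path[OF that(2)] _ _ that(1)]) (use B0 in auto)
  have prog_exp: "progressive T F (\<lambda>r w. exp (time_integral (\<lambda>r. \<gamma> r w) 0 r))"
    if "progressive T F \<gamma>" "\<And>w. w \<in> space M \<Longrightarrow> bdd_path T G (\<lambda>r. \<gamma> r w)" for \<gamma> :: "real \<Rightarrow> 'w \<Rightarrow> complex" and G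
    by (rule progressive_compose[OF progressive_continuous[OF time_integral_adapted[OF that(1)] time_integral_continuous[OF that(2)]]])
       auto
  have pA: "progressive T F A" unfolding A_def by (rule prog_exp[OF p\<alpha> \<alpha>path])
  have pP: "progressive T F (\<lambda>r w. exp (time_integral (\<lambda>r. \<beta> r w) 0 r))" by (rule prog_exp[OF \<beta> \<beta>path])
  have pp: "progressive T F ?p"
    by (rule progressive_continuous[OF sphase_adapted[OF l] sphase_continuous[OF W_continuous l]])
  have pc: "progressive T F (\<lambda>r w. cis (?p r w))"
    by (rule progressive_compose[OF pp]) measurable
  have ph: "progressive T F (\<lambda>r w. cis (?p r w) * exp (time_integral (\<lambda>r. \<beta> r w) 0 r))"
    by (rule progressive_compose2[OF pc pP]) measurable
  have pd: "progressive T F (\<lambda>r w. cis (?p r w) * exp (time_integral (\<lambda>r. \<beta> r w) 0 r) * \<alpha> r w)"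
    by (rule progressive_compose2[OF ph p\<alpha>]) measurable
  have factor: "cis (?p r w) * exp (time_integral (\<lambda>r. \<beta> r w) 0 r) = N r w * A r w"
    if r: "r \<in> {0..T}" and w: "w \<in> space M" for r w
  proof -
    have "time_integral (\<lambda>r. \<alpha> r w) 0 r =
        time_integral (\<lambda>r. \<beta> r w) 0 r - time_integral (\<lambda>r. complex_of_real ((norm (lam l r))\<^sup>2 / 2)) 0 r"
      unfolding \<alpha>_def by (rule time_integral_diff[OF \<beta>path[OF w] blc]) (use r in auto)
    also have "time_integral (\<lambda>r. complex_of_real ((norm (lam l r))\<^sup>2 / 2)) 0 r = complex_of_real (?q r / 2)"
      unfolding time_integral_def set_lebesgue_integral_def
      by (simp flip: integral_complex_of_real add: scaleR_conv_of_real)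
    finally have "exp (time_integral (\<lambda>r. \<beta> r w) 0 r) = exp (complex_of_real (?q r / 2)) * A r w"
      unfolding A_def by (simp flip: exp_add)
    then show ?thesis unfolding N_def exp_of_real by (simp only: mult.assoc)
  qed
  \<comment> \<open>The decay that \<open>martingale_phase\<close> produces over
    \<open>[s,t]\<close> is exactly compensated by the growth of
    \<open>exp (?q / 2)\<close>.\<close>
  have mart: "(\<integral>w. \<Xi> w * N t w \<partial>M) = (\<integral>w. \<Xi> w * N s w \<partial>M)"
    if st: "0 \<le> s" "s \<le> t" "t \<le> T" and \<Xi>: "\<Xi> \<in> borel_measurable (F s)" "\<And>w. w \<in> space M \<Longrightarrow> norm (\<Xi> w) \<le> K" for s t \<Xi> K
  proof -
    have [measurable]: "?p s \<in> borel_measurable (F s)" by (rule sphase_adapted[OF l]) (use st in simp)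
    note [measurable] = \<Xi>(1)
    have q: "?q t = ?q s + time_integral (\<lambda>r. (norm (lam l r))\<^sup>2) s t"
      by (rule time_integral_split[OF bl]) (use st in auto)
    have "(\<integral>w. \<Xi> w * N t w \<partial>M) = (\<integral>w. (\<Xi> w * cis (?p s w)) * cis (?p t w - ?p s w) * complex_of_real (exp (?q t / 2)) \<partial>M)"
      by (intro Bochner_Integration.integral_cong refl) (simp add: N_def mult.assoc cis_mult)
    also have "\<dots> = (\<integral>w. (\<Xi> w * cis (?p s w)) * cis (?p t w - ?p s w) \<partial>M) * complex_of_real (exp (?q t / 2))"
      by simp
    also have "(\<integral>w. (\<Xi> w * cis (?p s w)) * cis (?p t w - ?p s w) \<partial>M) =
        (\<integral>w. \<Xi> w * cis (?p s w) \<partial>M) * exp (- (time_integral (\<lambda>r. (norm (lam l r))\<^sup>2) s t / 2))"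
      by (rule martingale_phase[OF l st, where K=K]) (use \<Xi> in \<open>auto simp: norm_mult\<close>)
    also have "(\<integral>w. \<Xi> w * cis (?p s w) \<partial>M) * exp (- (time_integral (\<lambda>r. (norm (lam l r))\<^sup>2) s t / 2)) * complex_of_real (exp (?q t / 2)) =
        (\<integral>w. \<Xi> w * cis (?p s w) \<partial>M) * complex_of_real (exp (?q s / 2))"
      unfolding q by (simp add: mult.assoc add_divide_distrib flip: of_real_mult exp_add)
    also have "\<dots> = (\<integral>w. \<Xi> w * N s w \<partial>M)" by (simp add: N_def mult.assoc flip: integral_mult_left_zero)
    finally show ?thesis .
  qed
  define E where "E = exp (L\<^sup>2 * T / 2)"
  have Nb: "norm (N r w) \<le> E" if "r \<in> {0..T}" for r w
  proof -
    have "\<bar>?q r\<bar> \<le> L\<^sup>2 * (r - 0)"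
      using norm_time_integral_le[OF bl, of 0 r] that by simp
    also have "\<dots> \<le> L\<^sup>2 * T" using that by (intro mult_left_mono) auto
    finally show ?thesis by (simp add: N_def norm_mult E_def)
  qed
  have pN: "progressive T F N" unfolding N_def
  proof (rule progressive_compose2[OF pc progressive_deterministic])
    show "(\<lambda>r. complex_of_real (exp (?q r / 2))) \<in> borel_measurable borel"
    proof -
      have "(\<lambda>p. indicator {0..fst p} (snd p) *\<^sub>R (norm (lam l (snd p)))\<^sup>2) =
          (\<lambda>p. (if 0 \<le> snd p \<and> snd p \<le> fst p then 1 else 0) *\<^sub>R (norm (lam l (snd p)))\<^sup>2)"
        by (auto split: split_indicator)
      then have "(\<lambda>p. indicator {0..fst p} (snd p) *\<^sub>R (norm (lam l (snd p)))\<^sup>2) \<in> borel_measurable (borel \<Otimes>\<^sub>M lborel)"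
        by simp
      then have "(\<lambda>r. ?q r) \<in> borel_measurable borel"
        unfolding time_integral_def set_lebesgue_integral_def
        by (intro lborel.borel_measurable_lebesgue_integral) (simp add: split_beta')
      then show ?thesis by measurable
    qed
  qed measurable
  show ?thesis
    unfolding weak_ito_def \<alpha>_def[symmetric]
  proof (intro conjI allI impI)
    have "norm (cis (?p r w) * exp (time_integral (\<lambda>r. \<beta> r w) 0 r)) \<le> C * (1 + (B + L\<^sup>2)) \<and>
        norm (cis (?p r w) * exp (time_integral (\<lambda>r. \<beta> r w) 0 r) * \<alpha> r w) \<le> C * (1 + (B + L\<^sup>2))"
      if rw: "r \<in> {0..T}" "w \<in> space M" for r w
    proof -
      have 1: "norm (cis (?p r w) * exp (time_integral (\<lambda>r. \<beta> r w) 0 r)) \<le> C"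
        using Pb[OF rw] by (simp add: norm_mult)
      have 2: "norm (cis (?p r w) * exp (time_integral (\<lambda>r. \<beta> r w) 0 r)) * norm (\<alpha> r w) \<le> C * (B + L\<^sup>2)"
        using 1 \<alpha>b[OF rw] C by (intro mult_mono) auto
      have "0 \<le> C * (B + L\<^sup>2)" using C B0 by (intro mult_nonneg_nonneg) auto
      then show ?thesis unfolding norm_mult[of "cis _ * _"] distrib_left using 1 2 C
        by (intro conjI) (simp_all only: distrib_left)
    qed
    then show "\<exists>K. \<forall>r\<in>{0..T}. \<forall>w\<in>space M. norm (cis (?p r w) * exp (time_integral (\<lambda>r. \<beta> r w) 0 r)) \<le> K \<and>
        norm (cis (?p r w) * exp (time_integral (\<lambda>r. \<beta> r w) 0 r) * \<alpha> r w) \<le> K" by blast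
    fix s t :: real and \<Xi> :: "'w \<Rightarrow> complex"
    assume a: "0 \<le> s \<and> s \<le> t \<and> t \<le> T \<and> \<Xi> \<in> borel_measurable (F s) \<and> (\<exists>L. \<forall>w\<in>space M. norm (\<Xi> w) \<le> L)"
    then obtain K where K: "\<And>w. w \<in> space M \<Longrightarrow> norm (\<Xi> w) \<le> K" by blast
    have s: "s \<in> {0..T}" and t: "t \<in> {0..T}" and \<Xi>F: "\<Xi> \<in> borel_measurable (F s)" using a by auto
    have \<Xi> [measurable]: "\<Xi> \<in> borel_measurable M" by (rule measurable_F[OF s \<Xi>F])
    have mN [measurable]: "N r \<in> borel_measurable M" and mA [measurable]: "A r \<in> borel_measurable M"
      if "r \<in> {0..T}" for r
      using that measurable_F[OF that progressive_adapted[OF pN that]] measurable_F[OF that progressive_adapted[OF pA that]] by auto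
    have K0: "0 \<le> K" and E0: "0 \<le> E" using K not_empty norm_ge_zero order_trans by (blast, simp add: E_def)
    let ?J = "\<lambda>w. time_integral (\<lambda>r. \<alpha> r w * A r w) s t"
    have pAA: "progressive T F (\<lambda>r w. \<alpha> r w * A r w)"
      by (rule progressive_compose2[OF p\<alpha> pA]) measurable
    have AAb: "norm (\<alpha> r w * A r w) \<le> (B + L\<^sup>2) * C" if "r \<in> {0..T}" "w \<in> space M" for r w
      unfolding norm_mult using \<alpha>b[OF that] Ab[OF that] B0 by (intro mult_mono) auto
    have D: "A t w = A s w + ?J w" if "w \<in> space M" for w
      using exp_time_integral[OF T0 \<alpha>path[OF that], of s t] a by (simp add: A_def algebra_simps)
    have bb: "norm (\<Xi> w * N q w * (\<alpha> r w * A r w)) \<le> K * E * ((B + L\<^sup>2) * C)"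
      if "q \<in> {0..T}" "r \<in> {0..T}" "w \<in> space M" for q r w
      unfolding norm_mult[of "\<Xi> w * N q w"] norm_mult[of "\<Xi> w"]
      using K[OF that(3)] Nb[OF that(1), of w] AAb[OF that(2,3)] K0 E0 by (intro mult_mono) auto
    have jt: "joint (\<lambda>r w. \<Xi> w * N t w * (\<alpha> r w * A r w))"
      by (intro joint_times joint_random \<Xi> mN t progressive_imp_joint[OF p\<alpha>] progressive_imp_joint[OF pA])
    have jr: "joint (\<lambda>r w. \<Xi> w * N r w * (\<alpha> r w * A r w))"
      by (intro joint_times joint_random[OF \<Xi>] progressive_imp_joint[OF pN] progressive_imp_joint[OF p\<alpha>] progressive_imp_joint[OF pA])
    have i1: "integrable M (\<lambda>w. \<Xi> w * N q w * A r w)" if "q \<in> {0..T}" "r \<in> {0..T}" for q r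
    proof (rule bounded_integrable)
      fix w assume w: "w \<in> space M"
      show "norm (\<Xi> w * N q w * A r w) \<le> K * E * C"
        unfolding norm_mult using K[OF w] Nb[OF that(1), of w] Ab[OF that(2) w] K0 E0 by (intro mult_mono) auto
    qed (use that in measurable)
    have i2: "integrable M (\<lambda>w. \<Xi> w * N t w * ?J w)"
    proof (rule bounded_integrable)
      have [measurable]: "?J \<in> borel_measurable M"
        by (rule fubini_time(2)[OF progressive_imp_joint[OF pAA] AAb]) (use a in auto)
      show "(\<lambda>w. \<Xi> w * N t w * ?J w) \<in> borel_measurable M" using mN[OF t] by measurable
      fix w assume w: "w \<in> space M"
      have "norm (?J w) \<le> ((B + L\<^sup>2) * C) * (t - s)"
        by (rule norm_time_integral_le[OF progressive_bdd_path[OF pAA w AAb[OF _ w]]]) (use a in auto)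
      then show "norm (\<Xi> w * N t w * ?J w) \<le> K * E * (((B + L\<^sup>2) * C) * (t - s))"
        unfolding norm_mult using K[OF w] Nb[OF t, of w] K0 E0 by (intro mult_mono) auto
    qed
    \<comment> \<open>Write \<open>A t = A s + J\<close>. In \<open>N t * A s\<close> the martingale
      property lowers \<open>N t\<close> to \<open>N s\<close>. In \<open>N t * J\<close> it lowers
      \<open>N t\<close> to \<open>N r\<close> under the time integral, because the remaining
      factors at time \<open>r\<close> are \<open>F r\<close>-measurable.\<close>
    have "(\<integral>w. \<Xi> w * (cis (?p t w) * exp (time_integral (\<lambda>r. \<beta> r w) 0 t)) \<partial>M) =
        (\<integral>w. \<Xi> w * N t w * A s w + \<Xi> w * N t w * ?J w \<partial>M)"
      by (intro Bochner_Integration.integral_cong refl) (simp add: factor[OF t] D distrib_left mult.assoc)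
    also have "\<dots> = (\<integral>w. \<Xi> w * N t w * A s w \<partial>M) + (\<integral>w. \<Xi> w * N t w * ?J w \<partial>M)"
      by (intro Bochner_Integration.integral_add i1 i2 s t)
    also have "(\<integral>w. \<Xi> w * N t w * A s w \<partial>M) = (\<integral>w. (\<Xi> w * A s w) * N t w \<partial>M)" by (simp add: mult_ac)
    also have "\<dots> = (\<integral>w. (\<Xi> w * A s w) * N s w \<partial>M)"
    proof (rule mart)
      show "(\<lambda>w. \<Xi> w * A s w) \<in> borel_measurable (F s)"
        by (intro borel_measurable_times \<Xi>F progressive_adapted[OF pA s])
      fix w assume w: "w \<in> space M"
      show "norm (\<Xi> w * A s w) \<le> K * C"
        unfolding norm_mult using K[OF w] Ab[OF s w] K0 by (intro mult_mono) auto
    qed (use a in auto)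
    also have "\<dots> = (\<integral>w. \<Xi> w * (cis (?p s w) * exp (time_integral (\<lambda>r. \<beta> r w) 0 s)) \<partial>M)"
      by (intro Bochner_Integration.integral_cong refl) (simp add: factor[OF s] mult_ac)
    also have "(\<integral>w. \<Xi> w * N t w * ?J w \<partial>M) = (\<integral>w. time_integral (\<lambda>r. \<Xi> w * N t w * (\<alpha> r w * A r w)) s t \<partial>M)"
      unfolding time_integral_def by simp
    also have "\<dots> = time_integral (\<lambda>r. \<integral>w. \<Xi> w * N t w * (\<alpha> r w * A r w) \<partial>M) s t"
      by (rule fubini_time(1)[OF jt bb[OF t]]) (use a in auto)
    also have "\<dots> = time_integral (\<lambda>r. \<integral>w. \<Xi> w * N r w * (\<alpha> r w * A r w) \<partial>M) s t"
      unfolding time_integral_def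
    proof (intro set_lebesgue_integral_cong allI impI)
      fix r assume r: "r \<in> {s..t}"
      then have r': "r \<in> {0..T}" using a by auto
      have "(\<integral>w. (\<Xi> w * (\<alpha> r w * A r w)) * N t w \<partial>M) = (\<integral>w. (\<Xi> w * (\<alpha> r w * A r w)) * N r w \<partial>M)"
      proof (rule mart)
        show "(\<lambda>w. \<Xi> w * (\<alpha> r w * A r w)) \<in> borel_measurable (F r)"
          using r a by (intro borel_measurable_times progressive_adapted[OF pA r'] progressive_adapted[OF p\<alpha> r']
              measurable_F_mono[OF \<Xi>F]) auto
        fix w assume w: "w \<in> space M"
        show "norm (\<Xi> w * (\<alpha> r w * A r w)) \<le> K * ((B + L\<^sup>2) * C)"
          unfolding norm_mult[of "\<Xi> w"] using K[OF w] AAb[OF r' w] K0 by (intro mult_mono) auto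
      qed (use r a in auto)
      then show "(\<integral>w. \<Xi> w * N t w * (\<alpha> r w * A r w) \<partial>M) = (\<integral>w. \<Xi> w * N r w * (\<alpha> r w * A r w) \<partial>M)"
        by (simp add: mult_ac)
    qed auto
    also have "\<dots> = (\<integral>w. time_integral (\<lambda>r. \<Xi> w * N r w * (\<alpha> r w * A r w)) s t \<partial>M)"
      by (rule fubini_time(1)[OF jr bb, symmetric]) (use a in auto)
    also have "\<dots> = (\<integral>w. \<Xi> w * time_integral (\<lambda>r. cis (?p r w) * exp (time_integral (\<lambda>r. \<beta> r w) 0 r) * \<alpha> r w) s t \<partial>M)"
    proof (intro Bochner_Integration.integral_cong refl)
      fix w assume w: "w \<in> space M"
      have "time_integral (\<lambda>r. \<Xi> w * N r w * (\<alpha> r w * A r w)) s t =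
          time_integral (\<lambda>r. \<Xi> w * (cis (?p r w) * exp (time_integral (\<lambda>r. \<beta> r w) 0 r) * \<alpha> r w)) s t"
        unfolding time_integral_def[of _ s t]
        by (intro set_lebesgue_integral_cong allI impI) (use a in \<open>auto simp: factor w mult_ac\<close>)
      then show "time_integral (\<lambda>r. \<Xi> w * N r w * (\<alpha> r w * A r w)) s t =
          \<Xi> w * time_integral (\<lambda>r. cis (?p r w) * exp (time_integral (\<lambda>r. \<beta> r w) 0 r) * \<alpha> r w) s t"
        by (simp add: time_integral_def[of _ s t])
    qed
    finally show "(\<integral>w. \<Xi> w * (cis (?p t w) * exp (time_integral (\<lambda>r. \<beta> r w) 0 t)) \<partial>M) -
        (\<integral>w. \<Xi> w * (cis (?p s w) * exp (time_integral (\<lambda>r. \<beta> r w) 0 s)) \<partial>M) =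
        (\<integral>w. \<Xi> w * time_integral (\<lambda>r. cis (?p r w) * exp (time_integral (\<lambda>r. \<beta> r w) 0 r) * \<alpha> r w) s t \<partial>M)"
      by simp
  qed (use ph pd in auto)
qed

end

section \<open>Conditional expectations of trigonometric functions\<close>

text \<open>Given the path \<open>x\<close> up to time \<open>t\<close>, the conditional expectation of \<open>trig_fun ts\<close> under Wiener
  measure is \<open>Gfun T ts t x\<close>; its derivative in the direction of the current increment is
  \<open>- Vfun T ts t x\<close>, so that \<open>drift\<close> is the logarithmic gradient.\<close>

definition kap :: "real \<Rightarrow> ((real ^ 'n) \<times> real) list \<Rightarrow> real \<Rightarrow> real" where
  "kap T l t = exp (- (time_integral (\<lambda>r. (norm (lam l r))\<^sup>2) t T / 2))"

definition Gfun ::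
    "real \<Rightarrow> (('a \<Rightarrow> real) \<times> real \<times> ((real ^ 'n) \<times> real) list) list \<Rightarrow> real \<Rightarrow> (real \<Rightarrow> real ^ 'n) \<Rightarrow> 'a \<Rightarrow> real" where
  "Gfun T ts t x x0 = (\<Sum>(a, b, l)\<leftarrow>ts. a x0 * kap T l t * cos (b + sphase l t x))"

definition Vfun ::
    "real \<Rightarrow> (('a \<Rightarrow> real) \<times> real \<times> ((real ^ 'n) \<times> real) list) list \<Rightarrow> real \<Rightarrow> (real \<Rightarrow> real ^ 'n) \<Rightarrow> 'a \<Rightarrow> real ^ 'n" where
  "Vfun T ts t x x0 = (\<Sum>(a, b, l)\<leftarrow>ts. (a x0 * kap T l t * sin (b + sphase l t x)) *\<^sub>R lam l t)"

definition drift ::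
    "real \<Rightarrow> (('a \<Rightarrow> real) \<times> real \<times> ((real ^ 'n) \<times> real) list) list \<Rightarrow> real \<Rightarrow> (real \<Rightarrow> real ^ 'n) \<Rightarrow> 'a \<Rightarrow> real ^ 'n" where
  "drift T ts t x x0 = - ((1 / Gfun T ts t x x0) *\<^sub>R Vfun T ts t x x0)"

lemma Gfun_Nil [simp]: "Gfun T [] t x x0 = 0"
  and Gfun_Cons: "Gfun T ((a, b, l) # ts) t x x0 = a x0 * kap T l t * cos (b + sphase l t x) + Gfun T ts t x x0"
  by (simp_all add: Gfun_def)

lemma Vfun_Nil [simp]: "Vfun T [] t x x0 = 0"
  and Vfun_Cons: "Vfun T ((a, b, l) # ts) t x x0 =
    (a x0 * kap T l t * sin (b + sphase l t x)) *\<^sub>R lam l t + Vfun T ts t x x0"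
  by (simp_all add: Vfun_def)

lemma time_integral_nonneg:
  "(\<And>r. r \<in> {s..t} \<Longrightarrow> 0 \<le> \<alpha> r) \<Longrightarrow> 0 \<le> time_integral \<alpha> s t" for \<alpha> :: "real \<Rightarrow> real"
  unfolding time_integral_def set_lebesgue_integral_def
  by (rule Bochner_Integration.integral_nonneg) (auto split: split_indicator)

lemma kap_pos: "0 < kap T l t" and kap_le_1: "kap T l t \<le> 1"
  by (auto simp: kap_def intro: time_integral_nonneg)

lemma sphase_T: "snd ` set l \<subseteq> {0..T} \<Longrightarrow> sphase l T x = phase l x"
proof (induction l)
  case (Cons u l)
  obtain v r where u: "u = (v, r)" by (cases u)
  have "min r T = r" using Cons.prems by (auto simp: u)
  then show ?case using Cons by (simp add: u sphase_Cons) (simp add: phase_def)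
qed (simp add: phase_def)

lemma Gfun_T: "trig_valid T ts \<Longrightarrow> Gfun T ts T x x0 = trig_fun ts (x, x0)"
proof (induction ts)
  case (Cons u ts)
  obtain a b l where u: "u = (a, b, l)" by (cases u)
  show ?case using Cons by (simp add: u Gfun_Cons trig_fun_Cons trig_valid_Cons kap_def sphase_T)
qed simp

lemma Gfun_Vfun_bounded:
  assumes "trig_valid T ts"
  shows "\<exists>K. 0 \<le> K \<and> (\<forall>t x x0. \<bar>Gfun T ts t x x0\<bar> \<le> K \<and> norm (Vfun T ts t x x0) \<le> K)"
  using assms
proof (induction ts)
  case Nil
  then show ?case by (auto intro: exI[of _ 0])
next
  case (Cons u us)
  obtain a b l where u: "u = (a, b, l)" by (cases u)
  obtain K where K0: "0 \<le> K" and K: "\<And>t x x0. \<bar>Gfun T us t x x0\<bar> \<le> K" "\<And>t x x0. norm (Vfun T us t x x0) \<le> K"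
    using Cons by (auto simp: u trig_valid_Cons)
  obtain A where A: "\<And>x. \<bar>a x\<bar> \<le> A" using Cons.prems by (auto simp: u trig_valid_Cons bounded_iff)
  have A0: "0 \<le> A" using A order_trans[OF abs_ge_zero] by blast
  obtain L where L: "\<And>s. norm (lam l s) \<le> L" using lam_bounded by blast
  have L0: "0 \<le> L" using L order_trans[OF norm_ge_zero] by blast
  have ak: "\<bar>a x0 * kap T l t\<bar> \<le> A" for x0 t
    using mult_mono[OF A[of x0] kap_le_1[of T l t] A0 less_imp_le[OF kap_pos]] by (simp add: abs_mult abs_of_pos[OF kap_pos])
  \<comment> \<open>One constant serves both sums: a term contributes at most \<open>A\<close> to
    \<open>Gfun\<close> and at most \<open>A * L\<close> to \<open>Vfun\<close>.\<close>
  have G: "\<bar>Gfun T (u # us) t x x0\<bar> \<le> A * (1 + L) + K" for t x x0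
  proof -
    have "\<bar>a x0 * kap T l t * cos (b + sphase l t x)\<bar> \<le> A * 1"
      unfolding abs_mult[of "_ * _"] by (intro mult_mono ak abs_cos_le_one) (use A0 in auto)
    then show ?thesis using K(1)[of t x x0] A0 L0 unfolding u Gfun_Cons by (simp add: distrib_left add_increasing2 abs_triangle_ineq[THEN order_trans] add_mono)
  qed
  have V: "norm (Vfun T (u # us) t x x0) \<le> A * (1 + L) + K" for t x x0
  proof -
    have "\<bar>a x0 * kap T l t * sin (b + sphase l t x)\<bar> \<le> A * 1"
      unfolding abs_mult[of "_ * _"] by (intro mult_mono ak abs_sin_le_one) (use A0 in auto)
    then have "norm ((a x0 * kap T l t * sin (b + sphase l t x)) *\<^sub>R lam l t) \<le> A * L"
      unfolding norm_scaleR using L[of t] A0 by (intro mult_mono) auto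
    then show ?thesis
      unfolding u Vfun_Cons using K(2)[of t x x0] A0
        norm_triangle_ineq[of "(a x0 * kap T l t * sin (b + sphase l t x)) *\<^sub>R lam l t" "Vfun T us t x x0"]
      by (simp add: distrib_left)
  qed
  have "0 \<le> A * (1 + L) + K" using A0 L0 K0 by simp
  then show ?case using G V by blast
qed

text \<open>The argument of \<open>phase\<close> is the path \<open>x\<close> up to time
  \<open>t\<close>, continued by the increments of \<open>w\<close>; past and future contribute
  additively.\<close>

lemma phase_glue:
  assumes "snd ` set l \<subseteq> {0..T}"
  shows "phase l (\<lambda>r. x (min r t) + (w r - w (min r t))) = sphase l t x + (sphase l T w - sphase l t w)"
  using assms
proof (induction l)
  case (Cons u l)
  obtain v r where u: "u = (v, r)" by (cases u)
  have "min r T = r" using Cons.prems by (auto simp: u)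
  then show ?case using Cons
    by (simp add: u sphase_Cons phase_def inner_add_right inner_diff_right)
qed (simp add: phase_def)

context brownian
begin

lemma Gfun_expectation:
  assumes t: "t \<in> {0..T}" and "trig_valid T ts"
  shows "integrable M (\<lambda>w. trig_fun ts (\<lambda>r. x (min r t) + (W r w - W (min r t) w), x0))"
    and "Gfun T ts t x x0 = (\<integral>w. trig_fun ts (\<lambda>r. x (min r t) + (W r w - W (min r t) w), x0) \<partial>M)"
proof -
  have "integrable M (\<lambda>w. trig_fun ts (\<lambda>r. x (min r t) + (W r w - W (min r t) w), x0)) \<and>
    Gfun T ts t x x0 = (\<integral>w. trig_fun ts (\<lambda>r. x (min r t) + (W r w - W (min r t) w), x0) \<partial>M)"
    using assms(2)
  proof (induction ts)
    case (Cons u ts)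
    obtain a b l where u: "u = (a, b, l)" by (cases u)
    have l: "snd ` set l \<subseteq> {0..T}" and v: "trig_valid T ts" using Cons.prems by (auto simp: u trig_valid_Cons)
    let ?D = "\<lambda>w. sphase l T (\<lambda>r. W r w) - sphase l t (\<lambda>r. W r w)"
    have T: "T \<in> {0..T}" using T_pos by simp
    have [measurable]: "?D \<in> borel_measurable M"
      by (intro borel_measurable_diff measurable_F[OF T sphase_adapted[OF l T]] measurable_F[OF t sphase_adapted[OF l t]])
    have i: "integrable M (\<lambda>w. cis (b + sphase l t x) * cis (?D w))"
      by (rule bounded_integrable[where K=1]) (auto simp: norm_mult)
    have "(\<integral>w. cis (b + sphase l t x) * cis (?D w) \<partial>M) = cis (b + sphase l t x) * (\<integral>w. 1 * cis (?D w) \<partial>M)"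
      by simp
    also have "(\<integral>w. 1 * cis (?D w) \<partial>M) = (\<integral>w. 1 \<partial>M) * complex_of_real (kap T l t)"
      unfolding kap_def by (rule martingale_phase[OF l, where K=1]) (use t in auto)
    finally have *: "(\<integral>w. cis (b + sphase l t x) * cis (?D w) \<partial>M) = cis (b + sphase l t x) * complex_of_real (kap T l t)"
      by (simp add: prob_space)
    have c: "cos (b + phase l (\<lambda>r. x (min r t) + (W r w - W (min r t) w))) = Re (cis (b + sphase l t x) * cis (?D w))" for w
      unfolding phase_glue[OF l, of x t "\<lambda>r. W r w"] cis_mult by (simp add: add.assoc)
    have ic: "integrable M (\<lambda>w. cos (b + phase l (\<lambda>r. x (min r t) + (W r w - W (min r t) w))))"
      unfolding c by (rule integrable_Re[OF i])
    have "(\<integral>w. cos (b + phase l (\<lambda>r. x (min r t) + (W r w - W (min r t) w))) \<partial>M) = kap T l t * cos (b + sphase l t x)"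
      unfolding c integral_Re[OF i] * by simp
    then show ?case
      using Cons.IH[OF v] ic by (simp add: u trig_fun_Cons Gfun_Cons mult.assoc)
  qed simp
  then show "integrable M (\<lambda>w. trig_fun ts (\<lambda>r. x (min r t) + (W r w - W (min r t) w), x0))"
    "Gfun T ts t x x0 = (\<integral>w. trig_fun ts (\<lambda>r. x (min r t) + (W r w - W (min r t) w), x0) \<partial>M)" by auto
qed

text \<open>A sum of cosines shows no sign termwise. The bound survives because \<open>Gfun\<close>
  is an average of \<open>trig_fun\<close> over continuous paths.\<close>

lemma Gfun_ge:
  fixes ts :: "(('a::topological_space \<Rightarrow> real) \<times> real \<times> ((real ^ 'n) \<times> real) list) list"
  assumes t: "t \<in> {0..T}" and ts: "trig_valid T ts"
    and pos: "\<And>x x0. continuous_on {0..T} x \<Longrightarrow> \<delta> \<le> trig_fun ts (x, x0)"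
    and x: "continuous_on {0..T} x"
  shows "\<delta> \<le> Gfun T ts t x x0"
proof -
  have "(\<integral>w. \<delta> \<partial>M) \<le> (\<integral>w. trig_fun ts (\<lambda>r. x (min r t) + (W r w - W (min r t) w), x0) \<partial>M)"
  proof (rule integral_mono[OF _ Gfun_expectation(1)[OF t ts]])
    fix w assume w: "w \<in> space M"
    have m: "continuous_on {0..T} (\<lambda>r. y (min r t))" if "continuous_on {0..T} y" for y :: "real \<Rightarrow> real ^ 'n"
      by (rule continuous_on_compose2[OF that]) (use t in \<open>auto intro!: continuous_intros\<close>)
    show "\<delta> \<le> trig_fun ts (\<lambda>r. x (min r t) + (W r w - W (min r t) w), x0)"
      by (intro pos continuous_on_add continuous_on_diff m x W_continuous[OF w])
  qed simp
  then show ?thesis by (simp add: Gfun_expectation(2)[OF t ts] prob_space)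
qed

text \<open>Each term factors because \<open>a (X w)\<close> is known at time 0 and can be part of
  the test variable in \<open>martingale_phase\<close>.\<close>

lemma Gfun_0_expectation:
  assumes ts: "trig_valid T ts" and X: "X \<in> borel_measurable (F 0)"
  shows "(\<integral>w. trig_fun ts (\<lambda>r. W r w, X w) \<partial>M) = (\<integral>w. Gfun T ts 0 (\<lambda>r. 0) (X w) \<partial>M)"
    and "(\<lambda>w. trig_fun ts (\<lambda>r. W r w, X w)) \<in> borel_measurable M"
    and "(\<lambda>w. Gfun T ts 0 (\<lambda>r. 0) (X w)) \<in> borel_measurable M"
proof -
  have XM: "X \<in> borel_measurable M" using T_pos by (intro measurable_F[OF _ X]) auto
  have s0: "sphase l 0 (\<lambda>r. 0) = 0" for l :: "((real ^ 'n) \<times> real) list"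
    by (induction l) (auto simp: sphase_Cons)
  have "(\<integral>w. trig_fun ts (\<lambda>r. W r w, X w) \<partial>M) = (\<integral>w. Gfun T ts 0 (\<lambda>r. 0) (X w) \<partial>M) \<and>
      integrable M (\<lambda>w. trig_fun ts (\<lambda>r. W r w, X w)) \<and>
      integrable M (\<lambda>w. Gfun T ts 0 (\<lambda>r. 0) (X w))"
    using ts
  proof (induction ts)
    case (Cons u ts)
    obtain a b l where u: "u = (a, b, l)" by (cases u)
    have l: "snd ` set l \<subseteq> {0..T}" and v: "trig_valid T ts" and a: "a \<in> borel_measurable borel" "bounded (range a)"
      using Cons.prems by (auto simp: u trig_valid_Cons)
    obtain A where A: "\<And>x. \<bar>a x\<bar> \<le> A" using a(2) by (auto simp: bounded_iff)
    have T: "T \<in> {0..T}" using T_pos by simp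
    have aX0: "(\<lambda>w. a (X w)) \<in> borel_measurable (F 0)" by (rule measurable_compose[OF X a(1)])
    have [measurable]: "(\<lambda>w. a (X w)) \<in> borel_measurable M" by (rule measurable_compose[OF XM a(1)])
    have [measurable]: "(\<lambda>w. phase l (\<lambda>r. W r w)) \<in> borel_measurable M"
      using measurable_F[OF T sphase_adapted[OF l T]] by (simp add: sphase_T[OF l])
    have ph: "phase l (\<lambda>r. W r w) = sphase l T (\<lambda>r. W r w) - sphase l 0 (\<lambda>r. W r w)" if "w \<in> space M" for w
    proof -
      have "sphase l 0 (\<lambda>r. W r w) = 0"
        using l by (induction l) (auto simp: sphase_Cons min_absorb2 W_zero[OF that])
      then show ?thesis by (simp add: sphase_T[OF l])
    qed
    let ?f = "\<lambda>w. complex_of_real (a (X w)) * cis b * cis (phase l (\<lambda>r. W r w))"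
    have i: "integrable M ?f"
      by (rule bounded_integrable[where K=A]) (use A in \<open>auto simp: norm_mult\<close>)
    have ia: "integrable M (\<lambda>w. a (X w))"
      by (rule bounded_integrable[where K=A]) (use A in auto)
    have "(\<integral>w. ?f w \<partial>M) = (\<integral>w. (complex_of_real (a (X w)) * cis b) * cis (sphase l T (\<lambda>r. W r w) - sphase l 0 (\<lambda>r. W r w)) \<partial>M)"
      by (intro Bochner_Integration.integral_cong refl) (simp add: ph)
    also have "\<dots> = (\<integral>w. complex_of_real (a (X w)) * cis b \<partial>M) * complex_of_real (kap T l 0)"
      unfolding kap_def
      by (rule martingale_phase[OF l, where K=A]) (use T_pos A aX0 in \<open>auto simp: norm_mult\<close>)
    also have "\<dots> = complex_of_real (\<integral>w. a (X w) \<partial>M) * cis b * complex_of_real (kap T l 0)"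
      by simp
    finally have *: "(\<integral>w. ?f w \<partial>M) = complex_of_real (\<integral>w. a (X w) \<partial>M) * cis b * complex_of_real (kap T l 0)" .
    have c: "a (X w) * cos (b + phase l (\<lambda>r. W r w)) = Re (?f w)" for w
      by (simp add: mult.assoc cis_mult)
    have "(\<integral>w. a (X w) * cos (b + phase l (\<lambda>r. W r w)) \<partial>M) = (\<integral>w. a (X w) * kap T l 0 * cos (b + sphase l 0 (\<lambda>r. 0)) \<partial>M)"
      unfolding c integral_Re[OF i] * by (simp add: s0)
    moreover have "integrable M (\<lambda>w. a (X w) * cos (b + phase l (\<lambda>r. W r w)))"
      unfolding c by (rule integrable_Re[OF i])
    moreover have "integrable M (\<lambda>w. a (X w) * kap T l 0 * cos (b + sphase l 0 (\<lambda>r. 0)))"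
      using ia by simp
    ultimately show ?case
      using Cons.IH[OF v] by (simp add: u trig_fun_Cons Gfun_Cons)
  qed simp
  then show "(\<integral>w. trig_fun ts (\<lambda>r. W r w, X w) \<partial>M) = (\<integral>w. Gfun T ts 0 (\<lambda>r. 0) (X w) \<partial>M)"
    "(\<lambda>w. trig_fun ts (\<lambda>r. W r w, X w)) \<in> borel_measurable M"
    "(\<lambda>w. Gfun T ts 0 (\<lambda>r. 0) (X w)) \<in> borel_measurable M"
    using borel_measurable_integrable by blast+
qed

end

lemma (in filtered_prob_space) Gfun_Vfun_progressive:
  fixes Y :: "real \<Rightarrow> 'w \<Rightarrow> real ^ 'n"
  assumes ad: "\<And>t. t \<in> {0..T} \<Longrightarrow> Y t \<in> borel_measurable (F t)"
    and ct: "\<And>w. w \<in> space M \<Longrightarrow> continuous_on {0..T} (\<lambda>t. Y t w)"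
    and X: "X \<in> borel_measurable (F 0)" and ts: "trig_valid T ts"
  shows "progressive T F (\<lambda>t w. Gfun T ts t (\<lambda>r. Y r w) (X w))"
    and "progressive T F (\<lambda>t w. Vfun T ts t (\<lambda>r. Y r w) (X w))"
    and "progressive T F (\<lambda>t w. drift T ts t (\<lambda>r. Y r w) (X w))"
proof -
  have "progressive T F (\<lambda>t w. Gfun T ts t (\<lambda>r. Y r w) (X w)) \<and> progressive T F (\<lambda>t w. Vfun T ts t (\<lambda>r. Y r w) (X w))"
    using ts
  proof (induction ts)
    case Nil
    then show ?case by (simp add: progressive_deterministic)
  next
    case (Cons u ts)
    obtain a b l where u: "u = (a, b, l)" by (cases u)
    have l: "snd ` set l \<subseteq> {0..T}" and v: "trig_valid T ts" and a: "a \<in> borel_measurable borel"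
      using Cons.prems by (auto simp: u trig_valid_Cons)
    have IH: "progressive T F (\<lambda>t w. Gfun T ts t (\<lambda>r. Y r w) (X w))" "progressive T F (\<lambda>t w. Vfun T ts t (\<lambda>r. Y r w) (X w))"
      using Cons.IH[OF v] by auto
    have aX: "(\<lambda>w. a (X w)) \<in> borel_measurable (F t)" if "t \<in> {0..T}" for t
      by (rule measurable_F_mono[OF measurable_compose[OF X a]]) (use that in auto)
    have p1: "progressive T F (\<lambda>t w. a (X w))"
      unfolding progressive_def by (intro ballI measurable_compose[OF measurable_snd aX])
    have "(\<lambda>t. time_integral (\<lambda>r. (norm (lam l r))\<^sup>2) t T) \<in> borel_measurable borel"
    proof -
      have "(\<lambda>p. indicator {fst p..T} (snd p) *\<^sub>R (norm (lam l (snd p)))\<^sup>2) =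
          (\<lambda>p. (if fst p \<le> snd p \<and> snd p \<le> T then 1 else 0) *\<^sub>R (norm (lam l (snd p)))\<^sup>2)"
        by (auto split: split_indicator)
      then have "(\<lambda>p. indicator {fst p..T} (snd p) *\<^sub>R (norm (lam l (snd p)))\<^sup>2) \<in> borel_measurable (borel \<Otimes>\<^sub>M lborel)"
        by simp
      then show ?thesis
        unfolding time_integral_def set_lebesgue_integral_def
        by (intro lborel.borel_measurable_lebesgue_integral) (simp add: split_beta')
    qed
    note [measurable] = this
    have p2: "progressive T F (\<lambda>t w. kap T l t)"
      unfolding kap_def by (intro progressive_deterministic) measurable
    have p3: "progressive T F (\<lambda>t w. sphase l t (\<lambda>r. Y r w))"
    proof (rule progressive_continuous)
      show "(\<lambda>w. sphase l t (\<lambda>r. Y r w)) \<in> borel_measurable (F t)" if "t \<in> {0..T}" for t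
        by (rule sphase_adapted_process[OF _ l that]) (rule ad)
      show "continuous_on {0..T} (\<lambda>t. sphase l t (\<lambda>r. Y r w))" if "w \<in> space M" for w
        by (rule sphase_continuous[OF ct[OF that] l])
    qed
    have p4: "progressive T F (\<lambda>t w. cos (b + sphase l t (\<lambda>r. Y r w)))" "progressive T F (\<lambda>t w. sin (b + sphase l t (\<lambda>r. Y r w)))"
      by (rule progressive_compose[OF p3], measurable)+
    have p5: "progressive T F (\<lambda>t w. a (X w) * kap T l t)"
      by (rule progressive_compose2[OF p1 p2]) measurable
    have p6: "progressive T F (\<lambda>t w. a (X w) * kap T l t * cos (b + sphase l t (\<lambda>r. Y r w)))"
      by (rule progressive_compose2[OF p5 p4(1)]) measurable
    have p7: "progressive T F (\<lambda>t w. a (X w) * kap T l t * sin (b + sphase l t (\<lambda>r. Y r w)))"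
      by (rule progressive_compose2[OF p5 p4(2)]) measurable
    have p8: "progressive T F (\<lambda>t w. (a (X w) * kap T l t * sin (b + sphase l t (\<lambda>r. Y r w))) *\<^sub>R lam l t)"
      by (rule progressive_compose2[OF p7 progressive_deterministic[OF lam_measurable]]) measurable
    show ?case unfolding u Gfun_Cons Vfun_Cons
      by (intro conjI; rule progressive_compose2[OF p6 IH(1)] progressive_compose2[OF p8 IH(2)]) measurable
  qed
  then show G: "progressive T F (\<lambda>t w. Gfun T ts t (\<lambda>r. Y r w) (X w))"
    and V: "progressive T F (\<lambda>t w. Vfun T ts t (\<lambda>r. Y r w) (X w))" by auto
  show "progressive T F (\<lambda>t w. drift T ts t (\<lambda>r. Y r w) (X w))"
    unfolding drift_def by (rule progressive_compose2[OF G V]) measurable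
qed

section \<open>Change of measure\<close>

lemma bdd_path_add: "bdd_path T K \<alpha> \<Longrightarrow> bdd_path T L \<beta> \<Longrightarrow> bdd_path T (K + L) (\<lambda>r. \<alpha> r + \<beta> r)"
  by (auto simp: bdd_path_def intro: norm_triangle_le add_mono)

lemma bdd_path_diff: "bdd_path T K \<alpha> \<Longrightarrow> bdd_path T L \<beta> \<Longrightarrow> bdd_path T (K + L) (\<lambda>r. \<alpha> r - \<beta> r)"
  by (auto simp: bdd_path_def intro: order_trans[OF norm_triangle_ineq4] add_mono)

lemma bdd_path_times:
  fixes \<alpha> \<beta> :: "real \<Rightarrow> 'b::{real_normed_field, banach, second_countable_topology}"
  shows "bdd_path T K \<alpha> \<Longrightarrow> bdd_path T L \<beta> \<Longrightarrow> bdd_path T (K * L) (\<lambda>r. \<alpha> r * \<beta> r)"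
  by (auto simp: bdd_path_def norm_mult intro!: mult_mono intro: order_trans[OF norm_ge_zero])

lemma bdd_path_inner:
  fixes \<alpha> \<beta> :: "real \<Rightarrow> 'b::euclidean_space"
  assumes "bdd_path T K \<alpha>" "bdd_path T L \<beta>" shows "bdd_path T (K * L) (\<lambda>r. \<alpha> r \<bullet> \<beta> r)"
proof -
  have "\<bar>\<alpha> r \<bullet> \<beta> r\<bar> \<le> K * L" if "r \<in> {0..T}" for r
  proof -
    have "norm (\<alpha> r) \<le> K" "norm (\<beta> r) \<le> L" using assms that by (auto simp: bdd_path_def)
    then have "norm (\<alpha> r) * norm (\<beta> r) \<le> K * L"
      by (intro mult_mono) (auto intro: order_trans[OF norm_ge_zero])
    then show ?thesis using Cauchy_Schwarz_ineq2[of "\<alpha> r" "\<beta> r"] by linarith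
  qed
  then show ?thesis using assms by (auto simp: bdd_path_def)
qed

lemma bdd_path_of_real: "bdd_path T K \<alpha> \<Longrightarrow> bdd_path T K (\<lambda>r. complex_of_real (\<alpha> r))"
  by (auto simp: bdd_path_def)

lemma bdd_path_lam: "(\<And>s. norm (lam l s) \<le> K) \<Longrightarrow> bdd_path T K (lam l)"
  by (auto simp: bdd_path_def intro: measurable_compose[OF clip_measurable lam_measurable])

lemma time_integral_inner:
  fixes \<alpha> :: "real \<Rightarrow> 'b::euclidean_space"
  assumes "bdd_path T K \<alpha>" "0 \<le> s" "t \<le> T"
  shows "time_integral (\<lambda>r. v \<bullet> \<alpha> r) s t = v \<bullet> time_integral \<alpha> s t"
proof -
  have i: "integrable lborel (\<lambda>r. indicator {s..t} r *\<^sub>R \<alpha> r)"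
    using bdd_path_integrable[OF assms(1), of "{s..t}"] assms by (auto simp: set_integrable_def)
  have "time_integral (\<lambda>r. v \<bullet> \<alpha> r) s t = (\<integral>r. v \<bullet> (indicator {s..t} r *\<^sub>R \<alpha> r) \<partial>lborel)"
    unfolding time_integral_def set_lebesgue_integral_def by simp
  also have "\<dots> = v \<bullet> time_integral \<alpha> s t"
    unfolding time_integral_def set_lebesgue_integral_def by (rule integral_inner_right) (rule i)
  finally show ?thesis .
qed

lemma time_integral_of_real: "time_integral (\<lambda>r. complex_of_real (\<alpha> r)) s t = complex_of_real (time_integral \<alpha> s t)"
proof -
  have "time_integral (\<lambda>r. complex_of_real (\<alpha> r)) s t = (\<integral>r. complex_of_real (indicator {s..t} r *\<^sub>R \<alpha> r) \<partial>lborel)"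
    unfolding time_integral_def set_lebesgue_integral_def
    by (intro Bochner_Integration.integral_cong refl) (simp add: scaleR_conv_of_real)
  then show ?thesis unfolding time_integral_def set_lebesgue_integral_def by (simp only: integral_complex_of_real)
qed

lemma exp_time_integral_complex:
  assumes A: "bdd_path T K A" and B: "bdd_path T L B" and t: "t \<in> {0..T}"
  shows "exp (time_integral (\<lambda>r. complex_of_real (A r) + \<i> * complex_of_real (B r)) 0 t) =
    complex_of_real (exp (time_integral A 0 t)) * cis (time_integral B 0 t)"
proof -
  have "time_integral (\<lambda>r. complex_of_real (A r) + \<i> * complex_of_real (B r)) 0 t =
      time_integral (\<lambda>r. complex_of_real (A r)) 0 t + time_integral (\<lambda>r. \<i> * complex_of_real (B r)) 0 t"
    by (rule time_integral_add[OF bdd_path_of_real[OF A] bdd_path_times[OF bdd_path_const bdd_path_of_real[OF B]]])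
       (use t in auto)
  also have "time_integral (\<lambda>r. \<i> * complex_of_real (B r)) 0 t = \<i> * complex_of_real (time_integral B 0 t)"
    using time_integral_mult_left[of "\<lambda>r. complex_of_real (B r)" \<i> 0 t]
    by (simp add: mult.commute time_integral_of_real)
  finally show ?thesis by (simp add: time_integral_of_real exp_add exp_of_real cis_conv_exp)
qed

lemma time_integral_step:
  fixes \<psi> :: "real \<Rightarrow> real ^ 'n"
  assumes \<psi>: "bdd_path T K \<psi>" and u: "u \<in> {0..T}" and r: "r \<in> {0..T}"
  shows "time_integral (\<lambda>q. (if q < u then v else 0) \<bullet> \<psi> q) 0 r = v \<bullet> time_integral \<psi> 0 (min u r)"
proof -
  let ?s = "\<lambda>q. if q < u then v else 0"
  have "(\<lambda>r. ?s (clip T r)) \<in> borel_measurable borel" by measurable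
  then have s: "bdd_path T (norm v) ?s" by (auto simp: bdd_path_def)
  note s\<psi> = bdd_path_inner[OF s \<psi>] and v\<psi> = bdd_path_inner[OF bdd_path_const[of T v] \<psi>]
  have 1: "time_integral (\<lambda>q. ?s q \<bullet> \<psi> q) 0 p = v \<bullet> time_integral \<psi> 0 p" if "p \<in> {0..T}" "p \<le> u" for p
  proof -
    have "time_integral (\<lambda>q. ?s q \<bullet> \<psi> q) 0 p = time_integral (\<lambda>q. v \<bullet> \<psi> q) 0 p"
      by (rule time_integral_cong_AE[OF s\<psi> v\<psi>, of _ _ p]) (use that in auto)
    then show ?thesis using time_integral_inner[OF \<psi>] that by simp
  qed
  show ?thesis
  proof (cases "r \<le> u")
    case True
    then show ?thesis using 1[OF r] by (simp add: min_absorb2)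
  next
    case False
    have "time_integral (\<lambda>q. ?s q \<bullet> \<psi> q) u r = time_integral (\<lambda>q. 0) u r"
      by (rule time_integral_cong_AE[OF s\<psi> bdd_path_const, of _ _ u]) (use u r in auto)
    then have "time_integral (\<lambda>q. ?s q \<bullet> \<psi> q) u r = 0" using False by (simp add: time_integral_const)
    moreover have "time_integral (\<lambda>q. ?s q \<bullet> \<psi> q) 0 r =
        time_integral (\<lambda>q. ?s q \<bullet> \<psi> q) 0 u + time_integral (\<lambda>q. ?s q \<bullet> \<psi> q) u r"
      by (rule time_integral_split[OF s\<psi>]) (use u r False in auto)
    ultimately show ?thesis using 1[OF u] False by (simp add: min_absorb1)
  qed
qed

text \<open>A drift added to the path shifts the stopped phase by the drift paired with the active
  frequency; a single pair stops contributing at its own time, as \<open>time_integral_step\<close>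
  shows.\<close>

lemma sphase_drifted:
  fixes \<psi> :: "real \<Rightarrow> real ^ 'n"
  assumes \<psi>: "bdd_path T K \<psi>" and l: "snd ` set l \<subseteq> {0..T}" and r: "r \<in> {0..T}"
  shows "sphase l r (\<lambda>q. w q + time_integral \<psi> 0 q) = sphase l r w + time_integral (\<lambda>q. lam l q \<bullet> \<psi> q) 0 r"
  using l
proof (induction l)
  case Nil
  then show ?case using r by (simp add: time_integral_const)
next
  case (Cons p l)
  obtain v u where p: "p = (v, u)" by (cases p)
  have u: "u \<in> {0..T}" and l: "snd ` set l \<subseteq> {0..T}" using Cons.prems by (auto simp: p)
  obtain L where L: "\<And>s. norm (lam l s) \<le> L" using lam_bounded by blast
  have "(\<lambda>r. if clip T r < u then v else 0) \<in> borel_measurable borel" by measurable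
  then have s: "bdd_path T (norm v) (\<lambda>q. if q < u then v else 0)" by (auto simp: bdd_path_def)
  have "time_integral (\<lambda>q. (if q < u then v else 0) \<bullet> \<psi> q + lam l q \<bullet> \<psi> q) 0 r =
      time_integral (\<lambda>q. (if q < u then v else 0) \<bullet> \<psi> q) 0 r + time_integral (\<lambda>q. lam l q \<bullet> \<psi> q) 0 r"
    by (rule time_integral_add[OF bdd_path_inner[OF s \<psi>] bdd_path_inner[OF bdd_path_lam[OF L] \<psi>]]) (use r in auto)
  then show ?case
    unfolding p sphase_Cons lam_Cons inner_add_left inner_add_right Cons.IH[OF l] time_integral_step[OF \<psi> u r]
    by simp
qed

text \<open>Used with the zero control for the upper bound and with truncated controls for the lower
  bound. Boundedness of \<psi> keeps all exponents and densities below bounded; \<open>G\<close> and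
  its logarithmic gradient \<phi> are evaluated along the controlled path \<open>Y\<close>.\<close>

locale girsanov = brownian M T F W
  for M :: "'w measure" and T F and W :: "real \<Rightarrow> 'w \<Rightarrow> real ^ 'n" +
  fixes X :: "'w \<Rightarrow> 'a::topological_space" and \<psi> :: "real \<Rightarrow> 'w \<Rightarrow> real ^ 'n"
    and ts :: "(('a \<Rightarrow> real) \<times> real \<times> ((real ^ 'n) \<times> real) list) list" and \<delta> K\<psi> :: real
  assumes X: "X \<in> borel_measurable (F 0)"
    and \<psi>: "progressive T F \<psi>"
    and \<psi>_bound: "\<And>r w. r \<in> {0..T} \<Longrightarrow> w \<in> space M \<Longrightarrow> norm (\<psi> r w) \<le> K\<psi>"
    and ts: "trig_valid T ts" and \<delta>_pos: "0 < \<delta>"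
    and trig_ge: "\<And>x x0. continuous_on {0..T} x \<Longrightarrow> \<delta> \<le> trig_fun ts (x, x0)"
begin

definition Y :: "real \<Rightarrow> 'w \<Rightarrow> real ^ 'n" where
  "Y r w = W r w + time_integral (\<lambda>q. \<psi> q w) 0 r"

definition G :: "real \<Rightarrow> 'w \<Rightarrow> real" where
  "G r w = Gfun T ts r (\<lambda>q. Y q w) (X w)"

definition \<phi> :: "real \<Rightarrow> 'w \<Rightarrow> real ^ 'n" where
  "\<phi> r w = drift T ts r (\<lambda>q. Y q w) (X w)"

text \<open>Along \<open>Y\<close> the process \<open>G\<close> has drift
  \<open>G * (\<phi> \<bullet> \<psi>)\<close>. The exponential removes it, so that formally
  \<open>dZ = Z \<phi> dW\<close>.\<close>

definition Z :: "real \<Rightarrow> 'w \<Rightarrow> real" where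
  "Z r w = G r w * exp (- time_integral (\<lambda>q. \<phi> q w \<bullet> \<psi> q w) 0 r)"

text \<open>The Girsanov transform of \<open>W\<close> for the density process \<open>Z\<close>.
  Using \<phi> as a control on top of \<open>Wt\<close> gives back \<open>W\<close>, which is how
  the near-optimal system reproduces the original path.\<close>

definition Wt :: "real \<Rightarrow> 'w \<Rightarrow> real ^ 'n" where
  "Wt r w = W r w - time_integral (\<lambda>q. \<phi> q w) 0 r"

lemma \<psi>_path: "w \<in> space M \<Longrightarrow> bdd_path T K\<psi> (\<lambda>r. \<psi> r w)"
  by (rule progressive_bdd_path[OF \<psi>]) (auto intro: \<psi>_bound)

lemma Y_adapted: "t \<in> {0..T} \<Longrightarrow> Y t \<in> borel_measurable (F t)"
  unfolding Y_def[abs_def] by (intro borel_measurable_add W_adapted time_integral_adapted[OF \<psi>])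

lemma Y_continuous: "w \<in> space M \<Longrightarrow> continuous_on {0..T} (\<lambda>t. Y t w)"
  unfolding Y_def by (intro continuous_on_add W_continuous time_integral_continuous[OF \<psi>_path])

lemma G_ge: "r \<in> {0..T} \<Longrightarrow> w \<in> space M \<Longrightarrow> \<delta> \<le> G r w"
  unfolding G_def by (rule Gfun_ge[OF _ ts trig_ge Y_continuous])

lemma G_progressive: "progressive T F G"
  unfolding G_def[abs_def] by (rule Gfun_Vfun_progressive(1)[OF _ _ X ts]) (auto intro: Y_adapted Y_continuous)

lemma \<phi>_progressive: "progressive T F \<phi>"
  unfolding \<phi>_def[abs_def] by (rule Gfun_Vfun_progressive(3)[OF _ _ X ts]) (auto intro: Y_adapted Y_continuous)

lemma \<phi>_bounded: "\<exists>K. \<forall>r\<in>{0..T}. \<forall>w\<in>space M. norm (\<phi> r w) \<le> K"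
proof -
  obtain K where K: "0 \<le> K" "\<And>t x x0. norm (Vfun T ts t x x0) \<le> K" using Gfun_Vfun_bounded[OF ts] by blast
  have "norm (\<phi> r w) \<le> K / \<delta>" if "r \<in> {0..T}" "w \<in> space M" for r w
  proof -
    have "norm (\<phi> r w) = norm (Vfun T ts r (\<lambda>q. Y q w) (X w)) / G r w"
      unfolding \<phi>_def drift_def G_def[symmetric] using G_ge[OF that] \<delta>_pos by simp
    also have "\<dots> \<le> K / \<delta>" using K G_ge[OF that] \<delta>_pos by (intro frac_le) auto
    finally show ?thesis .
  qed
  then show ?thesis by blast
qed

definition K\<phi> :: real where "K\<phi> = (SOME K. \<forall>r\<in>{0..T}. \<forall>w\<in>space M. norm (\<phi> r w) \<le> K)"

lemma \<phi>_bound: "r \<in> {0..T} \<Longrightarrow> w \<in> space M \<Longrightarrow> norm (\<phi> r w) \<le> K\<phi>"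
  using someI_ex[OF \<phi>_bounded] unfolding K\<phi>_def by blast

lemma \<phi>_path: "w \<in> space M \<Longrightarrow> bdd_path T K\<phi> (\<lambda>r. \<phi> r w)"
  by (rule progressive_bdd_path[OF \<phi>_progressive]) (auto intro: \<phi>_bound)

lemma \<phi>\<psi>_path: "w \<in> space M \<Longrightarrow> bdd_path T (K\<phi> * K\<psi>) (\<lambda>r. \<phi> r w \<bullet> \<psi> r w)"
  by (rule bdd_path_inner[OF \<phi>_path \<psi>_path])

lemma \<phi>\<psi>_progressive: "progressive T F (\<lambda>r w. \<phi> r w \<bullet> \<psi> r w)"
  by (rule progressive_compose2[OF \<phi>_progressive \<psi>]) measurable

lemma Wt_adapted: "t \<in> {0..T} \<Longrightarrow> Wt t \<in> borel_measurable (F t)"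
  unfolding Wt_def[abs_def] by (intro borel_measurable_diff W_adapted time_integral_adapted[OF \<phi>_progressive])

lemma Wt_continuous: "w \<in> space M \<Longrightarrow> continuous_on {0..T} (\<lambda>t. Wt t w)"
  unfolding Wt_def by (intro continuous_on_diff W_continuous time_integral_continuous[OF \<phi>_path])

lemma Z_adapted: "t \<in> {0..T} \<Longrightarrow> Z t \<in> borel_measurable (F t)"
  unfolding Z_def[abs_def]
  by (intro borel_measurable_times progressive_adapted[OF G_progressive] borel_measurable_exp[THEN measurable_compose[rotated]]
      borel_measurable_uminus time_integral_adapted[OF \<phi>\<psi>_progressive])

lemma Z_bounds: "\<exists>c C. 0 < c \<and> (\<forall>r\<in>{0..T}. \<forall>w\<in>space M. c \<le> Z r w \<and> Z r w \<le> C)"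
proof -
  obtain K where K: "0 \<le> K" "\<And>t x x0. \<bar>Gfun T ts t x x0\<bar> \<le> K" using Gfun_Vfun_bounded[OF ts] by blast
  define B where "B = \<bar>K\<phi> * K\<psi>\<bar> * T"
  have "\<delta> * exp (- B) \<le> Z r w \<and> Z r w \<le> K * exp B" if r: "r \<in> {0..T}" and w: "w \<in> space M" for r w
  proof -
    let ?I = "time_integral (\<lambda>q. \<phi> q w \<bullet> \<psi> q w) 0 r"
    have "\<bar>?I\<bar> \<le> K\<phi> * K\<psi> * (r - 0)" using norm_time_integral_le[OF \<phi>\<psi>_path[OF w], of 0 r] r by simp
    also have "\<dots> \<le> B" unfolding B_def using r by (intro mult_mono) auto
    finally have I: "- B \<le> - ?I" "- ?I \<le> B" by auto
    have g: "\<delta> \<le> G r w" "G r w \<le> K" using G_ge[OF r w] K(2)[of r "\<lambda>q. Y q w" "X w"] by (auto simp: G_def)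
    show ?thesis unfolding Z_def using I g \<delta>_pos K by (intro conjI mult_mono) auto
  qed
  moreover have "0 < \<delta> * exp (- B)" using \<delta>_pos by simp
  ultimately show ?thesis by blast
qed

text \<open>Girsanov's theorem in Fourier form: the compensated exponential of \<open>Wt\<close>,
  weighted by \<open>Z\<close>, is a martingale. Every cosine in \<open>G\<close> is half the sum of
  two exponentials, \<open>\<sigma> = 1\<close> and \<open>\<sigma> = -1\<close>, each of the form
  treated by \<open>weak_ito_exp\<close>; the drifts sum to zero because \<phi> is the logarithmic
  gradient of \<open>G\<close>.\<close>

lemma key_martingale:
  assumes st: "0 \<le> s" "s \<le> t" "t \<le> T"
    and \<Xi>: "\<Xi> \<in> borel_measurable (F s)" "\<And>w. w \<in> space M \<Longrightarrow> norm (\<Xi> w) \<le> L"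
  shows "(\<integral>w. \<Xi> w * (cis (\<eta> \<bullet> Wt t w) * complex_of_real (exp ((norm \<eta>)\<^sup>2 / 2 * t) * Z t w)) \<partial>M) =
    (\<integral>w. \<Xi> w * (cis (\<eta> \<bullet> Wt s w) * complex_of_real (exp ((norm \<eta>)\<^sup>2 / 2 * s) * Z s w)) \<partial>M)"
proof -
  define E where "E r w = cis (\<eta> \<bullet> Wt r w) *
    complex_of_real (exp ((norm \<eta>)\<^sup>2 / 2 * r) * exp (- time_integral (\<lambda>q. \<phi> q w \<bullet> \<psi> q w) 0 r))" for r w
  \<comment> \<open>The integral of \<open>A\<close> supplies the growth of \<open>kap\<close>, the
    compensator for \<eta> and the exponential weight in \<open>Z\<close>. The integral of
    \<open>B\<close> turns \<open>W\<close> into \<open>Y\<close> inside the phase of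
    \<open>l\<close> and into \<open>Wt\<close> in the factor with \<eta>.\<close>
  define A where "A l r w = (norm (lam l r))\<^sup>2 / 2 + (norm \<eta>)\<^sup>2 / 2 - \<phi> r w \<bullet> \<psi> r w"
    for l :: "((real ^ 'n) \<times> real) list" and r w
  define B where "B \<sigma> l r w = \<sigma> * (lam l r \<bullet> \<psi> r w) - \<eta> \<bullet> \<phi> r w" for \<sigma> :: real and l r w
  \<comment> \<open>The pair \<open>(\<eta>, T)\<close> adds \<open>\<eta> \<bullet> W\<close> to
    the phase; its frequency is active at every time before \<open>T\<close>.\<close>
  define ls where "ls \<sigma> l = (\<eta>, T) # map (\<lambda>(v, r). (\<sigma> *\<^sub>R v, r)) l" for \<sigma> :: real and l :: "((real ^ 'n) \<times> real) list"
  let ?\<beta> = "\<lambda>\<sigma> l r w. complex_of_real (A l r w) + \<i> * complex_of_real (B \<sigma> l r w)"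
  define P where "P \<sigma> l r w = cis (sphase (ls \<sigma> l) r (\<lambda>r. W r w)) * exp (time_integral (\<lambda>r. ?\<beta> \<sigma> l r w) 0 r)" for \<sigma> l r w
  define c where "c \<sigma> a b l w = complex_of_real (a (X w) * kap T l 0 / 2) * cis (\<sigma> * b)"
    for \<sigma> b :: real and a and l :: "((real ^ 'n) \<times> real) list" and w
  define h where "h \<sigma> u r w = (case u of (a, b, l) \<Rightarrow> c \<sigma> a b l w * P \<sigma> l r w)" for \<sigma> u r w
  define d where "d \<sigma> u r w = (case u of (a, b, l) \<Rightarrow>
    c \<sigma> a b l w * (P \<sigma> l r w * (?\<beta> \<sigma> l r w - complex_of_real ((norm (lam (ls \<sigma> l) r))\<^sup>2 / 2))))" for \<sigma> u r w
  have ls_phase: "sphase (ls \<sigma> l) r w = \<eta> \<bullet> w (min T r) + \<sigma> * sphase l r w" for \<sigma> l r w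
    unfolding ls_def sphase_Cons by (induction l) (auto simp: sphase_Cons algebra_simps)
  have ls_lam: "lam (ls \<sigma> l) r = (if r < T then \<eta> else 0) + \<sigma> *\<^sub>R lam l r" for \<sigma> l r
    unfolding ls_def lam_Cons by (induction l) (auto simp: lam_Cons algebra_simps)
  have ls_valid: "snd ` set (ls \<sigma> l) \<subseteq> {0..T}" if "snd ` set l \<subseteq> {0..T}" for \<sigma> l
    using that T_pos unfolding ls_def by force
  have pA: "bdd_path T (L'\<^sup>2 + (norm \<eta>)\<^sup>2 + K\<phi> * K\<psi>) (\<lambda>r. A l r w)"
    if w: "w \<in> space M" and L': "\<And>s. norm (lam l s) \<le> L'" for l w L'
  proof -
    have "(\<lambda>r. (norm (lam l (clip T r)))\<^sup>2 / 2) \<in> borel_measurable borel" by measurable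
    moreover have "norm ((norm (lam l r))\<^sup>2 / 2) \<le> L'\<^sup>2" for r
    proof -
      have "norm ((norm (lam l r))\<^sup>2 / 2) = (norm (lam l r))\<^sup>2 / 2" by simp
      then show ?thesis
        using power_mono[OF L'[of r] norm_ge_zero, of 2] zero_le_power2[of "norm (lam l r)"] by linarith
    qed
    ultimately have 1: "bdd_path T (L'\<^sup>2) (\<lambda>r. (norm (lam l r))\<^sup>2 / 2)" unfolding bdd_path_def by blast
    have "bdd_path T ((norm \<eta>)\<^sup>2) (\<lambda>r. (norm \<eta>)\<^sup>2 / 2)" by (auto simp: bdd_path_def)
    from bdd_path_diff[OF bdd_path_add[OF 1 this] \<phi>\<psi>_path[OF w]] show ?thesis unfolding A_def .
  qed
  have pB: "bdd_path T (\<bar>\<sigma>\<bar> * (L' * K\<psi>) + norm \<eta> * K\<phi>) (\<lambda>r. B \<sigma> l r w)"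
    if w: "w \<in> space M" and L': "\<And>s. norm (lam l s) \<le> L'" for l w L' \<sigma>
    using bdd_path_diff[OF bdd_path_times[OF bdd_path_const[of T \<sigma>] bdd_path_inner[OF bdd_path_lam[OF L'] \<psi>_path[OF w]]]
        bdd_path_inner[OF bdd_path_const[of T \<eta>] \<phi>_path[OF w]]]
    unfolding B_def by simp
  have prog_\<beta>: "progressive T F (?\<beta> \<sigma> l)" for \<sigma> l
  proof -
    have 1: "progressive T F (\<lambda>r w. lam l r \<bullet> \<psi> r w)"
      by (rule progressive_compose2[OF progressive_deterministic[OF lam_measurable] \<psi>]) measurable
    have 2: "progressive T F (B \<sigma> l)" unfolding B_def
      by (rule progressive_compose2[OF 1 \<phi>_progressive]) measurable
    have 3: "progressive T F (\<lambda>r w. (norm (lam l r))\<^sup>2 / 2 + (norm \<eta>)\<^sup>2 / 2)"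
      by (rule progressive_deterministic) measurable
    have 4: "progressive T F (A l)" unfolding A_def
      by (rule progressive_compose2[OF 3 \<phi>\<psi>_progressive]) measurable
    show ?thesis by (rule progressive_compose2[OF 4 2]) measurable
  qed
  have wi: "weak_ito (h \<sigma> u) (d \<sigma> u)" if u: "u \<in> set ts" for \<sigma> u
  proof -
    obtain a b l where ul: "u = (a, b, l)" by (cases u)
    have l: "snd ` set l \<subseteq> {0..T}" and a: "a \<in> borel_measurable borel" "bounded (range a)"
      using bspec[OF ts[unfolded trig_valid_def] u] by (simp_all add: ul)
    obtain A' where A': "\<And>x. \<bar>a x\<bar> \<le> A'" using a(2) by (auto simp: bounded_iff)
    obtain L' where L': "\<And>s. norm (lam l s) \<le> L'" using lam_bounded by blast
    have "weak_ito (P \<sigma> l) (\<lambda>r w. P \<sigma> l r w * (?\<beta> \<sigma> l r w - complex_of_real ((norm (lam (ls \<sigma> l) r))\<^sup>2 / 2)))"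
      unfolding P_def
    proof (rule weak_ito_exp[OF ls_valid[OF l] prog_\<beta>])
      fix r w assume r: "r \<in> {0..T}" and w: "w \<in> space M"
      have "norm (?\<beta> \<sigma> l r w) \<le> \<bar>A l r w\<bar> + \<bar>B \<sigma> l r w\<bar>"
        by (rule order_trans[OF norm_triangle_ineq]) (simp add: norm_mult)
      also have "\<dots> \<le> (L'\<^sup>2 + (norm \<eta>)\<^sup>2 + K\<phi> * K\<psi>) + (\<bar>\<sigma>\<bar> * (L' * K\<psi>) + norm \<eta> * K\<phi>)"
        using pA[OF w L'] pB[OF w L', of \<sigma>] r by (intro add_mono) (auto simp: bdd_path_def)
      finally show "norm (?\<beta> \<sigma> l r w) \<le> (L'\<^sup>2 + (norm \<eta>)\<^sup>2 + K\<phi> * K\<psi>) + (\<bar>\<sigma>\<bar> * (L' * K\<psi>) + norm \<eta> * K\<phi>)" .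
    qed
    moreover have "c \<sigma> a b l \<in> borel_measurable (F 0)"
      unfolding c_def[abs_def] using measurable_compose[OF X a(1)] by measurable
    moreover have "norm (c \<sigma> a b l w) \<le> A'" for w
    proof -
      have "\<bar>a (X w)\<bar> * kap T l 0 \<le> A' * 1"
        using A'[of "X w"] kap_le_1[of T l 0] kap_pos[of T l 0] by (intro mult_mono) auto
      moreover have "norm (c \<sigma> a b l w) = \<bar>a (X w)\<bar> * kap T l 0 / 2"
        unfolding c_def norm_mult norm_of_real using kap_pos[of T l 0] by (simp add: abs_mult)
      ultimately show ?thesis using A'[of "X w"] by linarith
    qed
    ultimately show ?thesis unfolding h_def d_def ul prod.case by (rule weak_ito_mult)
  qed
  have P_eq: "c \<sigma> a b l w * P \<sigma> l r w = E r w * complex_of_real (a (X w) * kap T l r / 2) * cis (\<sigma> * (b + sphase l r (\<lambda>q. Y q w)))"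
    if r: "r \<in> {0..T}" and w: "w \<in> space M" and l: "snd ` set l \<subseteq> {0..T}" for \<sigma> a b l r w
  proof -
    obtain L' where L': "\<And>s. norm (lam l s) \<le> L'" using lam_bounded by blast
    have b1: "bdd_path T (L'\<^sup>2) (\<lambda>r. (norm (lam l r))\<^sup>2)"
    proof -
      have "(\<lambda>r. (norm (lam l (clip T r)))\<^sup>2) \<in> borel_measurable borel" by measurable
      then show ?thesis using L' by (auto simp: bdd_path_def intro!: power_mono)
    qed
    let ?q = "\<lambda>s t. time_integral (\<lambda>r. (norm (lam l r))\<^sup>2) s t"
    have b2: "bdd_path T (L'\<^sup>2 * norm (1 / 2 :: real)) (\<lambda>r. (norm (lam l r))\<^sup>2 * (1 / 2))"
      by (rule bdd_path_times[OF b1 bdd_path_const])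
    note b3 = bdd_path_const[of T "(norm \<eta>)\<^sup>2 / 2"]
    have "time_integral (\<lambda>r. A l r w) 0 r =
        time_integral (\<lambda>r. (norm (lam l r))\<^sup>2 * (1 / 2) + (norm \<eta>)\<^sup>2 / 2) 0 r - time_integral (\<lambda>q. \<phi> q w \<bullet> \<psi> q w) 0 r"
      using time_integral_diff[OF bdd_path_add[OF b2 b3] \<phi>\<psi>_path[OF w], of 0 r] r by (simp add: A_def)
    also have "time_integral (\<lambda>r. (norm (lam l r))\<^sup>2 * (1 / 2) + (norm \<eta>)\<^sup>2 / 2) 0 r = ?q 0 r * (1 / 2) + (norm \<eta>)\<^sup>2 / 2 * r"
    proof -
      have "time_integral (\<lambda>r. (norm (lam l r))\<^sup>2 * (1 / 2) + (norm \<eta>)\<^sup>2 / 2) 0 r =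
          time_integral (\<lambda>r. (norm (lam l r))\<^sup>2 * (1 / 2)) 0 r + time_integral (\<lambda>r. (norm \<eta>)\<^sup>2 / 2) 0 r"
        by (rule time_integral_add[OF b2 b3]) (use r in auto)
      moreover have "time_integral (\<lambda>r. (norm \<eta>)\<^sup>2 / 2) 0 r = (norm \<eta>)\<^sup>2 / 2 * r"
        using r by (simp add: time_integral_const)
      ultimately show ?thesis unfolding time_integral_mult_left by (simp only:)
    qed
    finally have IA: "time_integral (\<lambda>r. A l r w) 0 r = ?q 0 r / 2 + (norm \<eta>)\<^sup>2 / 2 * r - time_integral (\<lambda>q. \<phi> q w \<bullet> \<psi> q w) 0 r"
      by simp
    have IB: "time_integral (\<lambda>r. B \<sigma> l r w) 0 r = \<sigma> * time_integral (\<lambda>r. lam l r \<bullet> \<psi> r w) 0 r - \<eta> \<bullet> time_integral (\<lambda>r. \<phi> r w) 0 r"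
    proof -
      have "time_integral (\<lambda>r. B \<sigma> l r w) 0 r = time_integral (\<lambda>r. \<sigma> * (lam l r \<bullet> \<psi> r w)) 0 r - time_integral (\<lambda>r. \<eta> \<bullet> \<phi> r w) 0 r"
        unfolding B_def
        by (rule time_integral_diff[OF bdd_path_times[OF bdd_path_const bdd_path_inner[OF bdd_path_lam[OF L'] \<psi>_path[OF w]]]
              bdd_path_inner[OF bdd_path_const \<phi>_path[OF w]]]) (use r in auto)
      then show ?thesis using r time_integral_mult_left[of "\<lambda>r. lam l r \<bullet> \<psi> r w" \<sigma> 0 r] time_integral_inner[OF \<phi>_path[OF w], of 0 r \<eta>]
        by (simp add: mult.commute)
    qed
    have Yp: "sphase l r (\<lambda>q. Y q w) = sphase l r (\<lambda>q. W q w) + time_integral (\<lambda>q. lam l q \<bullet> \<psi> q w) 0 r"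
      unfolding Y_def by (rule sphase_drifted[OF \<psi>_path[OF w] l r])
    have kap: "kap T l 0 * exp (?q 0 r / 2) = kap T l r"
    proof -
      have "?q 0 T = ?q 0 r + ?q r T" by (rule time_integral_split[OF b1]) (use r in auto)
      then show ?thesis by (simp add: kap_def add_divide_distrib flip: exp_add)
    qed
    have "c \<sigma> a b l w * P \<sigma> l r w =
      complex_of_real (a (X w) * kap T l 0 / 2) * cis (\<sigma> * b) * (cis (\<eta> \<bullet> W r w + \<sigma> * sphase l r (\<lambda>r. W r w)) *
        (complex_of_real (exp (?q 0 r / 2 + (norm \<eta>)\<^sup>2 / 2 * r - time_integral (\<lambda>q. \<phi> q w \<bullet> \<psi> q w) 0 r)) *
         cis (\<sigma> * time_integral (\<lambda>r. lam l r \<bullet> \<psi> r w) 0 r - \<eta> \<bullet> time_integral (\<lambda>r. \<phi> r w) 0 r)))"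
      unfolding c_def P_def exp_time_integral_complex[OF pA[OF w L'] pB[OF w L'] r] IA IB ls_phase
      using r by (simp add: min_absorb2)
    also have "\<dots> = complex_of_real (a (X w) * (kap T l 0 * exp (?q 0 r / 2)) / 2 * (exp ((norm \<eta>)\<^sup>2 / 2 * r) * exp (- time_integral (\<lambda>q. \<phi> q w \<bullet> \<psi> q w) 0 r))) *
        (cis (\<sigma> * b) * cis (\<eta> \<bullet> W r w + \<sigma> * sphase l r (\<lambda>r. W r w)) *
         cis (\<sigma> * time_integral (\<lambda>r. lam l r \<bullet> \<psi> r w) 0 r - \<eta> \<bullet> time_integral (\<lambda>r. \<phi> r w) 0 r))"
      unfolding diff_conv_add_uminus[of "_ + _"] exp_add by (simp add: mult_ac)
    also have "cis (\<sigma> * b) * cis (\<eta> \<bullet> W r w + \<sigma> * sphase l r (\<lambda>r. W r w)) *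
         cis (\<sigma> * time_integral (\<lambda>r. lam l r \<bullet> \<psi> r w) 0 r - \<eta> \<bullet> time_integral (\<lambda>r. \<phi> r w) 0 r) =
        cis (\<eta> \<bullet> Wt r w) * cis (\<sigma> * (b + sphase l r (\<lambda>q. Y q w)))"
      unfolding cis_mult Yp Wt_def by (rule arg_cong[of _ _ cis]) (simp add: algebra_simps)
    finally show ?thesis unfolding kap E_def by (simp add: mult_ac)
  qed
  have h_pair: "h 1 (a, b, l) r w + h (- 1) (a, b, l) r w =
      E r w * complex_of_real (a (X w) * kap T l r * cos (b + sphase l r (\<lambda>q. Y q w)))"
    if r: "r \<in> {0..T}" and w: "w \<in> space M" and l: "snd ` set l \<subseteq> {0..T}" for a b l r w
  proof -
    have "cis (1 * x) + cis (- 1 * x) = complex_of_real (2 * cos x)" for x by (simp add: complex_eq_iff)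
    then have "z / 2 * cis (1 * x) + z / 2 * cis (- 1 * x) = z * complex_of_real (cos x)" for x and z :: complex
      by (metis (no_types, lifting) distrib_left mult.commute mult.left_commute nonzero_mult_div_cancel_left of_real_mult
          of_real_numeral times_divide_eq_right times_divide_eq_left zero_neq_numeral)
    from this[of "E r w * complex_of_real (a (X w) * kap T l r)" "b + sphase l r (\<lambda>q. Y q w)"]
    show ?thesis unfolding h_def prod.case P_eq[OF r w l] by (simp add: mult_ac)
  qed
  \<comment> \<open>Restricted to \<open>r < T\<close>, since at \<open>T\<close> itself the
    frequency \<eta> has dropped out of \<open>lam\<close>.\<close>
  have d_pair: "d 1 (a, b, l) r w + d (- 1) (a, b, l) r w =
      - (E r w * (complex_of_real (((a (X w) * kap T l r * sin (b + sphase l r (\<lambda>q. Y q w))) *\<^sub>R lam l r) \<bullet> \<psi> r w)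
        + \<i> * complex_of_real (((a (X w) * kap T l r * sin (b + sphase l r (\<lambda>q. Y q w))) *\<^sub>R lam l r) \<bullet> \<eta>)
        + complex_of_real (a (X w) * kap T l r * cos (b + sphase l r (\<lambda>q. Y q w)))
          * (complex_of_real (\<phi> r w \<bullet> \<psi> r w) + \<i> * complex_of_real (\<eta> \<bullet> \<phi> r w))))"
    if r: "r \<in> {0..T}" "r < T" and w: "w \<in> space M" and l: "snd ` set l \<subseteq> {0..T}" for a b l r w
  proof -
    let ?k = "a (X w) * kap T l r" and ?\<theta> = "b + sphase l r (\<lambda>q. Y q w)"
    have \<beta>: "?\<beta> \<sigma> l r w - complex_of_real ((norm (lam (ls \<sigma> l) r))\<^sup>2 / 2) =
        complex_of_real (- \<sigma> * (lam l r \<bullet> \<eta>) - \<phi> r w \<bullet> \<psi> r w) + \<i> * complex_of_real (\<sigma> * (lam l r \<bullet> \<psi> r w) - \<eta> \<bullet> \<phi> r w)"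
      if "\<sigma>\<^sup>2 = 1" for \<sigma>
    proof -
      have "(norm (\<eta> + \<sigma> *\<^sub>R lam l r))\<^sup>2 = (norm \<eta>)\<^sup>2 + 2 * \<sigma> * (lam l r \<bullet> \<eta>) + \<sigma>\<^sup>2 * (norm (lam l r))\<^sup>2"
        unfolding power2_norm_eq_inner by (simp add: inner_add_left inner_add_right inner_commute power2_eq_square algebra_simps)
      then have "A l r w - (norm (lam (ls \<sigma> l) r))\<^sup>2 / 2 = - \<sigma> * (lam l r \<bullet> \<eta>) - \<phi> r w \<bullet> \<psi> r w"
        using that r(2) unfolding A_def ls_lam by (simp add: field_simps)
      then have "complex_of_real (A l r w) - complex_of_real ((norm (lam (ls \<sigma> l) r))\<^sup>2 / 2) =
          complex_of_real (- \<sigma> * (lam l r \<bullet> \<eta>) - \<phi> r w \<bullet> \<psi> r w)"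
        by (simp only: of_real_diff[symmetric])
      then show ?thesis unfolding B_def by (metis (no_types) add.commute add_diff_eq)
    qed
    have cs: "cis (1 * x) = complex_of_real (cos x) + \<i> * complex_of_real (sin x)"
      "cis (- 1 * x) = complex_of_real (cos x) - \<i> * complex_of_real (sin x)" for x
      by (simp_all add: complex_eq_iff)
    \<comment> \<open>Here \<open>C\<close> and \<open>S\<close> are the cosine and sine of the
      shifted phase, \<open>p = lam \<bullet> \<eta>\<close>,
      \<open>q = \<phi> \<bullet> \<psi>\<close>, \<open>w = lam \<bullet> \<psi>\<close> and
      \<open>v = \<eta> \<bullet> \<phi>\<close>.\<close>
    have alg: "E * (k / 2) * (C + \<i> * S) * ((- p - q) + \<i> * (w - v)) + E * (k / 2) * (C - \<i> * S) * ((p - q) + \<i> * (- w - v)) =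
        - (E * (k * S * w + \<i> * (k * S * p) + k * C * (q + \<i> * v)))" for E k C S p q w v :: complex
      by (simp add: field_simps)
    have "d \<sigma> (a, b, l) r w = E r w * complex_of_real (?k / 2) * cis (\<sigma> * ?\<theta>) *
       (complex_of_real (- \<sigma> * (lam l r \<bullet> \<eta>) - \<phi> r w \<bullet> \<psi> r w) + \<i> * complex_of_real (\<sigma> * (lam l r \<bullet> \<psi> r w) - \<eta> \<bullet> \<phi> r w))"
      if "\<sigma>\<^sup>2 = 1" for \<sigma>
      unfolding d_def prod.case mult.assoc[symmetric] P_eq[OF r(1) w l] \<beta>[OF that] ..
    note dd = this
    have d1: "d 1 (a, b, l) r w =
        E r w * (complex_of_real ?k / 2) * (complex_of_real (cos ?\<theta>) + \<i> * complex_of_real (sin ?\<theta>)) *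
          ((- complex_of_real (lam l r \<bullet> \<eta>) - complex_of_real (\<phi> r w \<bullet> \<psi> r w)) +
           \<i> * (complex_of_real (lam l r \<bullet> \<psi> r w) - complex_of_real (\<eta> \<bullet> \<phi> r w)))"
      using dd[of 1] unfolding cs by simp
    have d2: "d (- 1) (a, b, l) r w = E r w * (complex_of_real ?k / 2) * (complex_of_real (cos ?\<theta>) - \<i> * complex_of_real (sin ?\<theta>)) *
          ((complex_of_real (lam l r \<bullet> \<eta>) - complex_of_real (\<phi> r w \<bullet> \<psi> r w)) +
           \<i> * (- complex_of_real (lam l r \<bullet> \<psi> r w) - complex_of_real (\<eta> \<bullet> \<phi> r w)))"
      using dd[of "-1"] unfolding cs by simp
    show ?thesis unfolding d1 d2 alg by (simp add: inner_scaleR_left mult.assoc)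
  qed
  have hsum: "(\<Sum>u\<leftarrow>us. h 1 u r w + h (- 1) u r w) = E r w * complex_of_real (Gfun T us r (\<lambda>q. Y q w) (X w))"
    if r: "r \<in> {0..T}" and w: "w \<in> space M" and us: "trig_valid T us" for us r w
    using us
  proof (induction us)
    case (Cons u us)
    obtain a b l where u: "u = (a, b, l)" by (cases u)
    have l: "snd ` set l \<subseteq> {0..T}" and v: "trig_valid T us" using Cons.prems by (auto simp: u trig_valid_Cons)
    show ?case using Cons.IH[OF v] unfolding u Gfun_Cons list.map sum_list.Cons h_pair[OF r w l]
      by (simp add: distrib_left)
  qed simp
  have dsum: "(\<Sum>u\<leftarrow>us. d 1 u r w + d (- 1) u r w) =
      - (E r w * (complex_of_real (Vfun T us r (\<lambda>q. Y q w) (X w) \<bullet> \<psi> r w) + \<i> * complex_of_real (Vfun T us r (\<lambda>q. Y q w) (X w) \<bullet> \<eta>)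
        + complex_of_real (Gfun T us r (\<lambda>q. Y q w) (X w)) * (complex_of_real (\<phi> r w \<bullet> \<psi> r w) + \<i> * complex_of_real (\<eta> \<bullet> \<phi> r w))))"
    if r: "r \<in> {0..T}" "r < T" and w: "w \<in> space M" and us: "trig_valid T us" for us r w
    using us
  proof (induction us)
    case (Cons u us)
    obtain a b l where u: "u = (a, b, l)" by (cases u)
    have l: "snd ` set l \<subseteq> {0..T}" and v: "trig_valid T us" using Cons.prems by (auto simp: u trig_valid_Cons)
    show ?case unfolding u Gfun_Cons Vfun_Cons list.map sum_list.Cons d_pair[OF r w l] Cons.IH[OF v]
      by (simp add: inner_add_left algebra_simps)
  qed simp
  have dzero: "(\<Sum>u\<leftarrow>ts. d 1 u r w + d (- 1) u r w) = 0" if r: "r \<in> {0..T}" "r < T" and w: "w \<in> space M" for r w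
  proof -
    have "G r w \<noteq> 0" using G_ge[OF r(1) w] \<delta>_pos by auto
    \<comment> \<open>With \<open>V = - G \<phi>\<close> the gradient terms cancel the terms in
      which \<phi> is multiplied by \<open>G\<close>.\<close>
    then have V: "Vfun T ts r (\<lambda>q. Y q w) (X w) = - (G r w *\<^sub>R \<phi> r w)"
      unfolding \<phi>_def drift_def G_def by simp
    show ?thesis unfolding dsum[OF r w ts] V G_def[symmetric]
      by (simp add: inner_commute[of \<eta>] algebra_simps)
  qed
  have W: "weak_ito (\<lambda>r w. \<Sum>u\<leftarrow>ts. h 1 u r w + h (- 1) u r w) (\<lambda>r w. \<Sum>u\<leftarrow>ts. d 1 u r w + d (- 1) u r w)"
    by (rule weak_ito_sum_list) (intro weak_ito_add wi)
  have tz: "time_integral (\<lambda>r. \<Sum>u\<leftarrow>ts. d 1 u r w + d (- 1) u r w) s t = 0" if w: "w \<in> space M" for w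
    unfolding time_integral_def set_lebesgue_integral_def
  proof (rule integral_eq_zero_AE)
    \<comment> \<open>The single time \<open>T\<close>, which \<open>dzero\<close> leaves out, has
      measure zero.\<close>
    show "AE r in lborel. indicator {s..t} r *\<^sub>R (\<Sum>u\<leftarrow>ts. d 1 u r w + d (- 1) u r w) = 0"
      using AE_lborel_singleton[of T] by eventually_elim (use st dzero[OF _ _ w] in \<open>auto split: split_indicator\<close>)
  qed
  have "(\<integral>w. \<Xi> w * time_integral (\<lambda>r. \<Sum>u\<leftarrow>ts. d 1 u r w + d (- 1) u r w) s t \<partial>M) = (\<integral>w. 0 \<partial>M)"
    by (intro Bochner_Integration.integral_cong refl) (simp add: tz)
  with weak_itoD[OF W st \<Xi>]
  have "(\<integral>w. \<Xi> w * (\<Sum>u\<leftarrow>ts. h 1 u t w + h (- 1) u t w) \<partial>M) = (\<integral>w. \<Xi> w * (\<Sum>u\<leftarrow>ts. h 1 u s w + h (- 1) u s w) \<partial>M)"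
    by simp
  moreover have "(\<integral>w. \<Xi> w * (\<Sum>u\<leftarrow>ts. h 1 u r w + h (- 1) u r w) \<partial>M) =
      (\<integral>w. \<Xi> w * (cis (\<eta> \<bullet> Wt r w) * complex_of_real (exp ((norm \<eta>)\<^sup>2 / 2 * r) * Z r w)) \<partial>M)" if "r \<in> {0..T}" for r
    by (intro Bochner_Integration.integral_cong refl) (simp add: hsum[OF that _ ts] E_def Z_def G_def mult_ac)
  ultimately show ?thesis using st by simp
qed

end

section \<open>A lower bound for the entropy of a drifted Brownian motion\<close>

context brownian
begin

text \<open>\<open>u k\<close> is known at the left end of its interval, so the last factor has
  conditional mean 1 and the product is integrated from the last increment backwards.\<close>

lemma nn_integral_simple_exponential:
  fixes u :: "nat \<Rightarrow> 'w \<Rightarrow> real ^ 'n"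
  assumes h: "0 < h" and u: "\<And>k. k < n \<Longrightarrow> u k \<in> borel_measurable (F (real k * h))" and n: "real n * h \<le> T"
  shows "(\<integral>\<^sup>+w. ennreal (exp (\<Sum>k<n. u k w \<bullet> (W (real (Suc k) * h) w - W (real k * h) w) - h * (norm (u k w))\<^sup>2 / 2)) \<partial>M) = 1"
  using u n
proof (induction n)
  case 0
  then show ?case by (simp add: emeasure_space_1)
next
  case (Suc n)
  let ?I = "\<lambda>k w. u k w \<bullet> (W (real (Suc k) * h) w - W (real k * h) w) - h * (norm (u k w))\<^sup>2 / 2"
  have st: "0 \<le> real n * h" "real n * h < real (Suc n) * h" "real (Suc n) * h \<le> T" "real (Suc n) * h - real n * h = h"
    using h Suc.prems(2) by (auto simp: algebra_simps)
  have \<Xi>: "(\<lambda>w. ennreal (exp (\<Sum>k<n. ?I k w))) \<in> borel_measurable (F (real n * h))"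
  proof -
    have "?I k \<in> borel_measurable (F (real n * h))" if k: "k < n" for k
    proof -
      have kn: "real k * h \<le> real n * h" "real (Suc k) * h \<le> real n * h" using k h by (auto intro!: mult_right_mono)
      have [measurable]: "u k \<in> borel_measurable (F (real n * h))"
        by (rule measurable_F_mono[OF Suc.prems(1)]) (use k kn st h in auto)
      have [measurable]: "W (real (Suc k) * h) \<in> borel_measurable (F (real n * h))" "W (real k * h) \<in> borel_measurable (F (real n * h))"
      proof -
        have *: "W t \<in> borel_measurable (F (real n * h))" if "0 \<le> t" "t \<le> real n * h" for t
          using that st by (intro measurable_F_mono[OF W_adapted]) auto
        show "W (real (Suc k) * h) \<in> borel_measurable (F (real n * h))" "W (real k * h) \<in> borel_measurable (F (real n * h))"
          using kn h by (auto intro!: * simp del: of_nat_Suc)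
      qed
      show ?thesis by measurable
    qed
    then show ?thesis by (auto intro!: borel_measurable_sum)
  qed
  have "(\<integral>\<^sup>+w. ennreal (exp (\<Sum>k<Suc n. ?I k w)) \<partial>M) =
      (\<integral>\<^sup>+w. ennreal (exp (\<Sum>k<n. ?I k w)) * ennreal (exp (u n w \<bullet> (W (real (Suc n) * h) w - W (real n * h) w) - (real (Suc n) * h - real n * h) * (norm (u n w))\<^sup>2 / 2)) \<partial>M)"
    unfolding st(4) by (simp add: exp_add ennreal_mult')
  also have "\<dots> = (\<integral>\<^sup>+w. ennreal (exp (\<Sum>k<n. ?I k w)) \<partial>M)"
    by (rule nn_integral_exp_increment[OF st(1-3) Suc.prems(1) \<Xi>]) simp
  also have "\<dots> = 1"
    by (rule Suc.IH) (use Suc.prems st in auto)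
  finally show ?case .
qed

text \<open>The integral of a bounded simple process against Brownian motion has mean zero. All is
  derived from \<open>E exp (e S - e^2 q) = 1\<close>: by \<open>1 + x \<le> exp x\<close> it gives
  \<open>e * E S \<le> e^2 * Q\<close> for either sign of \<open>e\<close>, and letting
  \<open>e\<close> tend to 0 leaves \<open>E S = 0\<close>.\<close>

lemma simple_integral:
  fixes u :: "nat \<Rightarrow> 'w \<Rightarrow> real ^ 'n"
  assumes h: "0 < h" and u: "\<And>k. k < n \<Longrightarrow> u k \<in> borel_measurable (F (real k * h))" and n: "real n * h \<le> T"
    and K: "\<And>k w. k < n \<Longrightarrow> w \<in> space M \<Longrightarrow> norm (u k w) \<le> K"
  defines "S \<equiv> \<lambda>w. \<Sum>k<n. u k w \<bullet> (W (real (Suc k) * h) w - W (real k * h) w)"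
  shows "integrable M S" "(\<integral>w. S w \<partial>M) = 0"
proof -
  define q where "q w = (\<Sum>k<n. h * (norm (u k w))\<^sup>2 / 2)" for w
  define Q where "Q = real n * (h * K\<^sup>2 / 2)"
  have kT: "real k * h \<in> {0..T}" if "k \<le> n" for k
  proof -
    have "real k * h \<le> real n * h" using that h by (intro mult_right_mono) auto
    then have "real k * h \<le> T" using n by linarith
    then show ?thesis using h by simp
  qed
  have uM [measurable]: "u k \<in> borel_measurable M" if "k < n" for k
    by (rule measurable_F[OF kT u]) (use that in auto)
  have WM [measurable]: "W (real k * h) \<in> borel_measurable M" if "k \<le> n" for k
    using W_measurable[OF kT[OF that]] .
  have Sm [measurable]: "S \<in> borel_measurable M"
    unfolding S_def by (intro borel_measurable_sum borel_measurable_inner borel_measurable_diff uM WM) auto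
  have qm [measurable]: "q \<in> borel_measurable M"
    unfolding q_def by (intro borel_measurable_sum borel_measurable_divide borel_measurable_times borel_measurable_power
        borel_measurable_norm[THEN measurable_compose[rotated]] uM borel_measurable_const) auto
  have q: "0 \<le> q w" "q w \<le> Q" if "w \<in> space M" for w
  proof -
    show "0 \<le> q w" unfolding q_def using h by (intro sum_nonneg) auto
    have "q w \<le> (\<Sum>k<n. h * K\<^sup>2 / 2)"
      unfolding q_def using h K that by (intro sum_mono divide_right_mono mult_left_mono power_mono) auto
    then show "q w \<le> Q" by (simp add: Q_def)
  qed
  have one: "(\<integral>\<^sup>+w. ennreal (exp (e * S w - e\<^sup>2 * q w)) \<partial>M) = 1" for e
  proof -
    have "e * S w - e\<^sup>2 * q w = (\<Sum>k<n. (e *\<^sub>R u k w) \<bullet> (W (real (Suc k) * h) w - W (real k * h) w) - h * (norm (e *\<^sub>R u k w))\<^sup>2 / 2)" for w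
      unfolding S_def q_def sum_distrib_left sum_subtractf[symmetric]
      by (intro sum.cong refl) (simp add: power_mult_distrib)
    moreover have "(\<integral>\<^sup>+w. ennreal (exp (\<Sum>k<n. (e *\<^sub>R u k w) \<bullet> (W (real (Suc k) * h) w - W (real k * h) w) - h * (norm (e *\<^sub>R u k w))\<^sup>2 / 2)) \<partial>M) = 1"
      by (rule nn_integral_simple_exponential[OF h _ n]) (intro borel_measurable_scaleR borel_measurable_const u)
    ultimately show ?thesis by simp
  qed
  have ie: "integrable M (\<lambda>w. exp (e * S w - e\<^sup>2 * q w))" "(\<integral>w. exp (e * S w - e\<^sup>2 * q w) \<partial>M) = 1" for e
  proof -
    show i: "integrable M (\<lambda>w. exp (e * S w - e\<^sup>2 * q w))"
      using one[of e] by (intro integrableI_nonneg) auto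
    show "(\<integral>w. exp (e * S w - e\<^sup>2 * q w) \<partial>M) = 1"
      using one[of e] by (subst integral_eq_nn_integral) auto
  qed
  show iS: "integrable M S"
  proof (rule Bochner_Integration.integrable_bound)
    show "integrable M (\<lambda>w. exp Q * (exp (1 * S w - 1\<^sup>2 * q w) + exp (- 1 * S w - (- 1)\<^sup>2 * q w)))"
      by (intro integrable_mult_right Bochner_Integration.integrable_add ie)
    \<comment> \<open>\<open>|S|\<close> is at most \<open>exp S + exp (- S)\<close>, and both are
      controlled by the exponentials of mean 1 up to the factor \<open>exp Q\<close> that bounds the
      compensator.\<close>
    show "AE w in M. norm (S w) \<le> norm (exp Q * (exp (1 * S w - 1\<^sup>2 * q w) + exp (- 1 * S w - (- 1)\<^sup>2 * q w)))"
    proof (rule AE_I2)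
      fix w assume w: "w \<in> space M"
      have e1: "exp (S w) \<le> exp Q * exp (1 * S w - 1\<^sup>2 * q w)" "exp (- S w) \<le> exp Q * exp (- 1 * S w - (- 1)\<^sup>2 * q w)"
        using q[OF w] by (simp_all flip: exp_add)
      have "\<bar>S w\<bar> \<le> exp (S w) + exp (- S w)"
        using exp_ge_add_one_self[of "S w"] exp_ge_add_one_self[of "- S w"] exp_gt_zero[of "S w"] exp_gt_zero[of "- S w"]
        by linarith
      also have "\<dots> \<le> exp Q * (exp (1 * S w - 1\<^sup>2 * q w) + exp (- 1 * S w - (- 1)\<^sup>2 * q w))"
        using e1 unfolding distrib_left by (rule add_mono)
      finally show "norm (S w) \<le> norm (exp Q * (exp (1 * S w - 1\<^sup>2 * q w) + exp (- 1 * S w - (- 1)\<^sup>2 * q w)))"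
        by simp
    qed
  qed simp
  have iq: "integrable M q"
    by (rule bounded_integrable[where K=Q]) (use q in auto)
  have est: "e * (\<integral>w. S w \<partial>M) \<le> e\<^sup>2 * Q" for e
  proof -
    have "(\<integral>w. 1 + (e * S w - e\<^sup>2 * q w) \<partial>M) \<le> (\<integral>w. exp (e * S w - e\<^sup>2 * q w) \<partial>M)"
      using iS iq by (intro integral_mono ie) auto
    moreover have "(\<integral>w. 1 + (e * S w - e\<^sup>2 * q w) \<partial>M) = 1 + (e * (\<integral>w. S w \<partial>M) - e\<^sup>2 * (\<integral>w. q w \<partial>M))"
      using iS iq by (simp add: prob_space)
    moreover have "(\<integral>w. q w \<partial>M) \<le> (\<integral>w. Q \<partial>M)"
      using q iq by (intro integral_mono) auto
    ultimately have "e * (\<integral>w. S w \<partial>M) \<le> e\<^sup>2 * (\<integral>w. q w \<partial>M)" "(\<integral>w. q w \<partial>M) \<le> Q"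
      using ie(2)[of e] by (auto simp: prob_space)
    then show ?thesis using mult_left_mono[of "\<integral>w. q w \<partial>M" Q "e\<^sup>2"] zero_le_power2[of e] by linarith
  qed
  let ?m = "\<integral>w. S w \<partial>M"
  have Q0: "0 \<le> Q" unfolding Q_def using h by simp
  have "\<bar>?m\<bar> \<le> 0 + e" if e: "0 < e" for e
  proof -
    \<comment> \<open>The estimate bounds the mean by \<open>?d * Q\<close>, which is at most
      \<open>e\<close> for this choice; the added 1 avoids a division by zero.\<close>
    let ?d = "e / (Q + 1)"
    have d: "0 < ?d" "?d * Q \<le> e" using e Q0 by (auto simp: field_simps)
    have "?d * ?m \<le> ?d * (?d * Q)" "?d * - ?m \<le> ?d * (?d * Q)"
      using est[of ?d] est[of "- ?d"] by (simp_all add: power2_eq_square mult.assoc)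
    then have "?m \<le> ?d * Q" "- ?m \<le> ?d * Q" using d(1) by (simp_all only: mult_le_cancel_left_pos)
    then show ?thesis using d(2) by linarith
  qed
  then have "\<bar>?m\<bar> \<le> 0" by (rule field_le_epsilon)
  then show "?m = 0" by simp
qed

end

section \<open>Riemann sums of the drift and the entropy inequality\<close>

lemma time_integral_partition:
  assumes \<alpha>: "bdd_path T K \<alpha>" and h: "0 \<le> h" and n: "real n * h \<le> T"
  shows "time_integral \<alpha> 0 (real n * h) = (\<Sum>k<n. time_integral \<alpha> (real k * h) (real (Suc k) * h))"
  using n
proof (induction n)
  case (Suc n)
  have m: "real n * h \<le> real (Suc n) * h" using h by (intro mult_right_mono) auto
  have "time_integral \<alpha> 0 (real (Suc n) * h) = time_integral \<alpha> 0 (real n * h) + time_integral \<alpha> (real n * h) (real (Suc n) * h)"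
    by (rule time_integral_split[OF \<alpha>]) (use m h Suc.prems in auto)
  then show ?case using Suc m by simp
qed simp

lemma floor_grid:
  fixes h r :: real
  assumes h: "0 < h"
  shows "real_of_int \<lfloor>r / h\<rfloor> * h \<le> r" "r - h \<le> real_of_int \<lfloor>r / h\<rfloor> * h"
    "real k * h \<le> r \<Longrightarrow> r < real (Suc k) * h \<Longrightarrow> \<lfloor>r / h\<rfloor> = int k"
proof -
  have "real_of_int \<lfloor>r / h\<rfloor> \<le> r / h" by linarith
  then show "real_of_int \<lfloor>r / h\<rfloor> * h \<le> r" by (simp only: pos_le_divide_eq[OF h])
  have "r / h \<le> real_of_int \<lfloor>r / h\<rfloor> + 1" by linarith
  then have "r \<le> (real_of_int \<lfloor>r / h\<rfloor> + 1) * h" by (simp only: pos_divide_le_eq[OF h])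
  then show "r - h \<le> real_of_int \<lfloor>r / h\<rfloor> * h" by (simp add: distrib_right)
  assume "real k * h \<le> r" "r < real (Suc k) * h"
  then show "\<lfloor>r / h\<rfloor> = int k"
    using h by (intro floor_unique) (simp_all add: pos_le_divide_eq pos_divide_less_eq add.commute)
qed

text \<open>\<open>D N\<close> is the exponent of a discretised exponential martingale in which the
  Brownian increments are replaced by integrals of the drift. It is the integral of
  \<open>\<phi>(g) \<bullet> \<phi>(r) - |\<phi>(g)|^2 / 2\<close>, with \<open>g\<close> the grid
  point below \<open>r\<close>; where \<phi> is continuous this tends to
  \<open>|\<phi>(r)|^2 / 2\<close>, and the finite set \<open>J\<close> has measure zero.\<close>

lemma riemann_drift_limit:
  fixes \<phi> :: "real \<Rightarrow> real ^ 'n"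
  assumes T: "0 < T" and \<phi>: "bdd_path T K \<phi>" and J: "finite J"
    and cont: "\<And>r. r \<in> {0..T} - J \<Longrightarrow> continuous (at r within {0..T}) \<phi>"
  defines "D \<equiv> \<lambda>N. let h = T / real (Suc N) in
    \<Sum>k<Suc N. \<phi> (real k * h) \<bullet> time_integral \<phi> (real k * h) (real (Suc k) * h) - h * (norm (\<phi> (real k * h)))\<^sup>2 / 2"
  shows "D \<longlonglongrightarrow> time_integral (\<lambda>r. (norm (\<phi> r))\<^sup>2) 0 T / 2"
    and "\<bar>D N\<bar> \<le> 2 * K\<^sup>2 * T"
proof -
  define g where "g N r = real_of_int \<lfloor>r / (T / real (Suc N))\<rfloor> * (T / real (Suc N))" for N r
  define a where "a N r = \<phi> (g N r) \<bullet> \<phi> r - (norm (\<phi> (g N r)))\<^sup>2 / 2" for N r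
  have hpos: "0 < T / real (Suc N)" for N using T by simp
  have g_le: "g N r \<le> r" and g_ge: "r - T / real (Suc N) \<le> g N r" for N r
  proof -
    show "g N r \<le> r" "r - T / real (Suc N) \<le> g N r"
      unfolding g_def using floor_grid[OF hpos[of N]] by auto
  qed
  have g_nonneg: "0 \<le> g N r" if "0 \<le> r" for N r
    unfolding g_def using that T by (intro mult_nonneg_nonneg) (auto intro!: divide_nonneg_pos)
  have g_mem: "g N r \<in> {0..T}" if "r \<in> {0..T}" for N r
    using g_nonneg[of r N] g_le[of N r] that by auto
  have g_step: "g N r = real k * (T / real (Suc N))" if "real k * (T / real (Suc N)) \<le> r" "r < real (Suc k) * (T / real (Suc N))" for N k r
  proof -
    show ?thesis unfolding g_def floor_grid(3)[OF hpos that] by simp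
  qed
  have gm [measurable]: "g N \<in> borel_measurable borel" for N unfolding g_def[abs_def] by measurable
  have \<phi>m [measurable]: "(\<lambda>r. \<phi> (clip T r)) \<in> borel_measurable borel" using \<phi> by (simp add: bdd_path_def)
  have \<phi>g: "bdd_path T K (\<lambda>r. \<phi> (g N r))" for N
    unfolding bdd_path_def
  proof (intro conjI ballI)
    have "\<phi> (g N (clip T r)) = \<phi> (clip T (g N (clip T r)))" for r
      using g_mem[of "clip T r" N] clip_mem[of T r] T by (simp add: clip_id)
    moreover have "(\<lambda>r. \<phi> (clip T (g N (clip T r)))) \<in> borel_measurable borel"
      using measurable_compose[OF measurable_compose[OF clip_measurable gm] \<phi>m] by simp
    ultimately show "(\<lambda>r. \<phi> (g N (clip T r))) \<in> borel_measurable borel" by simp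
    show "norm (\<phi> (g N r)) \<le> K" if "r \<in> {0..T}" for r using \<phi> g_mem[OF that] by (auto simp: bdd_path_def)
  qed
  have sq: "bdd_path T (K * K / 2) (\<lambda>r. (norm (\<phi>' r))\<^sup>2 / 2)" if "bdd_path T K \<phi>'" for \<phi>' :: "real \<Rightarrow> real ^ 'n"
  proof -
    have "bdd_path T (K * K) (\<lambda>r. \<phi>' r \<bullet> \<phi>' r)" by (rule bdd_path_inner[OF that that])
    then show ?thesis by (auto simp: bdd_path_def power2_norm_eq_inner)
  qed
  have pa: "bdd_path T (K * K + K * K / 2) (a N)" for N
    unfolding a_def by (rule bdd_path_diff[OF bdd_path_inner[OF \<phi>g \<phi>] sq[OF \<phi>g]])
  have D_eq: "D N = time_integral (a N) 0 T" for N
  proof -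
    let ?h = "T / real (Suc N)"
    have "time_integral (a N) 0 (real (Suc N) * ?h) = (\<Sum>k<Suc N. time_integral (a N) (real k * ?h) (real (Suc k) * ?h))"
      by (rule time_integral_partition[OF pa]) (use T in auto)
    also have "\<dots> = (\<Sum>k<Suc N. \<phi> (real k * ?h) \<bullet> time_integral \<phi> (real k * ?h) (real (Suc k) * ?h) - ?h * (norm (\<phi> (real k * ?h)))\<^sup>2 / 2)"
    proof (intro sum.cong refl)
      fix k assume "k \<in> {..<Suc N}"
      then have k: "k < Suc N" by simp
      have "real (Suc k) * ?h \<le> real (Suc N) * ?h" using k T by (intro mult_right_mono) auto
      then have kT: "0 \<le> real k * ?h" "real (Suc k) * ?h \<le> T" using T by auto
      have kk: "real k * ?h \<le> real (Suc k) * ?h" using T by (intro mult_right_mono) auto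
      let ?v = "\<phi> (real k * ?h)"
      note b1 = bdd_path_inner[OF bdd_path_const[of T ?v] \<phi>] and b2 = bdd_path_const[of T "(norm ?v)\<^sup>2 / 2"]
      have "time_integral (a N) (real k * ?h) (real (Suc k) * ?h) =
          time_integral (\<lambda>r. ?v \<bullet> \<phi> r - (norm ?v)\<^sup>2 / 2) (real k * ?h) (real (Suc k) * ?h)"
        by (rule time_integral_cong_AE[OF pa bdd_path_diff[OF b1 b2] kT, of "real (Suc k) * ?h"])
           (simp add: a_def g_step)
      also have "\<dots> = time_integral (\<lambda>r. ?v \<bullet> \<phi> r) (real k * ?h) (real (Suc k) * ?h) -
          time_integral (\<lambda>r. (norm ?v)\<^sup>2 / 2) (real k * ?h) (real (Suc k) * ?h)"
        by (rule time_integral_diff[OF b1 b2 kT])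
      also have "\<dots> = ?v \<bullet> time_integral \<phi> (real k * ?h) (real (Suc k) * ?h) - (real (Suc k) * ?h - real k * ?h) *\<^sub>R ((norm ?v)\<^sup>2 / 2)"
        unfolding time_integral_inner[OF \<phi> kT] time_integral_const[OF kk] ..
      also have "real (Suc k) * ?h - real k * ?h = ?h" unfolding left_diff_distrib[symmetric] by simp
      finally show "time_integral (a N) (real k * ?h) (real (Suc k) * ?h) =
          ?v \<bullet> time_integral \<phi> (real k * ?h) (real (Suc k) * ?h) - ?h * (norm ?v)\<^sup>2 / 2" by simp
    qed
    also have "real (Suc N) * ?h = T" by simp
    finally show ?thesis unfolding D_def Let_def by simp
  qed
  show "\<bar>D N\<bar> \<le> 2 * K\<^sup>2 * T"
  proof -
    have "\<bar>D N\<bar> \<le> (K * K + K * K / 2) * (T - 0)"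
      unfolding D_eq using norm_time_integral_le[OF pa, of 0 T] T by simp
    also have "\<dots> \<le> (2 * K\<^sup>2) * T" using T by (intro mult_mono) (simp_all add: power2_eq_square)
    finally show ?thesis .
  qed
  have lim: "(\<lambda>N. a N r) \<longlonglongrightarrow> (norm (\<phi> r))\<^sup>2 / 2" if r: "r \<in> {0..T} - J" for r
  proof -
    have "(\<lambda>N. g N r) \<longlonglongrightarrow> r"
    proof (rule tendsto_sandwich[of "\<lambda>N. r - T / real (Suc N)" _ _ "\<lambda>N. r"])
      have "(\<lambda>N. r - T / real (Suc N)) \<longlonglongrightarrow> r - 0"
        by (intro tendsto_diff tendsto_const LIMSEQ_Suc lim_const_over_n)
      then show "(\<lambda>N. r - T / real (Suc N)) \<longlonglongrightarrow> r" by simp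
      show "\<forall>\<^sub>F N in sequentially. r - T / real (Suc N) \<le> g N r" "\<forall>\<^sub>F N in sequentially. g N r \<le> r"
        by (intro always_eventually allI g_le g_ge)+
    qed simp
    then have "(\<lambda>N. \<phi> (g N r)) \<longlonglongrightarrow> \<phi> r"
      using g_mem r by (intro continuous_within_tendsto_compose'[OF cont[OF r]]) blast+
    then have "(\<lambda>N. a N r) \<longlonglongrightarrow> \<phi> r \<bullet> \<phi> r - (norm (\<phi> r))\<^sup>2 / 2"
      unfolding a_def by (intro tendsto_intros) auto
    then show ?thesis by (simp add: power2_norm_eq_inner)
  qed
  have "(\<lambda>N. \<integral>r. indicator {0..T} r *\<^sub>R a N r \<partial>lborel) \<longlonglongrightarrow> (\<integral>r. indicator {0..T} r *\<^sub>R ((norm (\<phi> r))\<^sup>2 / 2) \<partial>lborel)"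
  proof (rule integral_dominated_convergence[where w="\<lambda>r. (K * K + K * K / 2) * indicator {0..T} r"])
    show "(\<lambda>r. indicator {0..T} r *\<^sub>R ((norm (\<phi> r))\<^sup>2 / 2)) \<in> borel_measurable lborel"
      using bdd_path_indicator_measurable[OF sq[OF \<phi>], of "{0..T}"] by simp
    show "(\<lambda>r. indicator {0..T} r *\<^sub>R a N r) \<in> borel_measurable lborel" for N
      using bdd_path_indicator_measurable[OF pa, of "{0..T}"] by simp
    show "integrable lborel (\<lambda>r. (K * K + K * K / 2) * indicator {0..T} r)"
      using T by (intro integrable_mult_right integrable_real_indicator) auto
    have "AE r in lborel. r \<notin> J"
      using J by (intro AE_not_in finite_imp_null_set_lborel)
    then show "AE r in lborel. (\<lambda>N. indicator {0..T} r *\<^sub>R a N r) \<longlonglongrightarrow> indicator {0..T} r *\<^sub>R ((norm (\<phi> r))\<^sup>2 / 2)"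
      by eventually_elim (use lim in \<open>auto split: split_indicator\<close>)
    show "AE r in lborel. norm (indicator {0..T} r *\<^sub>R a N r) \<le> (K * K + K * K / 2) * indicator {0..T} r" for N
      using pa[of N] by (auto simp: bdd_path_def split: split_indicator)
  qed
  moreover have "(\<integral>r. indicator {0..T} r *\<^sub>R ((norm (\<phi> r))\<^sup>2 / 2) \<partial>lborel) = time_integral (\<lambda>r. (norm (\<phi> r))\<^sup>2) 0 T / 2"
    unfolding time_integral_def set_lebesgue_integral_def by simp
  ultimately show "D \<longlonglongrightarrow> time_integral (\<lambda>r. (norm (\<phi> r))\<^sup>2) 0 T / 2"
    unfolding D_eq[abs_def] time_integral_def[of "a _"] set_lebesgue_integral_def by simp
qed

text \<open>The exponent \<open>S\<close> of the discretised exponential martingale has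
  \<open>E exp S = 1\<close> under \<open>M\<close>, that is \<open>E (exp S / R) = 1\<close> under
  \<nu>. By \<open>x + 1 \<le> exp x\<close> at \<open>x = S - ln R\<close>, the \<nu>-mean of
  \<open>S\<close> is at most that of \<open>ln R\<close>. Under \<nu> the increments of
  \<open>W\<close> are those of the Brownian motion \<open>V\<close> plus integrals of \<phi>, so
  the mean of \<open>S\<close> is that of \<open>D N\<close>, which tends to the mean of half the
  energy.\<close>

theorem drift_energy_le_entropy:
  fixes W V :: "real \<Rightarrow> 'w \<Rightarrow> real ^ 'n"
  assumes W: "brownian M T F W" and V: "brownian \<nu> T F V"
    and \<nu>: "\<nu> = density M (\<lambda>w. ennreal (R w))" and R: "R \<in> borel_measurable M"
    and c: "0 < c" "\<And>w. w \<in> space M \<Longrightarrow> c \<le> R w" "\<And>w. w \<in> space M \<Longrightarrow> R w \<le> C"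
    and \<phi>: "progressive T F \<phi>" and K: "\<And>r w. r \<in> {0..T} \<Longrightarrow> w \<in> space M \<Longrightarrow> norm (\<phi> r w) \<le> K"
    and VW: "\<And>t w. t \<in> {0..T} \<Longrightarrow> w \<in> space M \<Longrightarrow> V t w = W t w - time_integral (\<lambda>r. \<phi> r w) 0 t"
    and J: "finite J" and cont: "\<And>r w. r \<in> {0..T} - J \<Longrightarrow> w \<in> space M \<Longrightarrow> continuous (at r within {0..T}) (\<lambda>r. \<phi> r w)"
  shows "(\<integral>w. time_integral (\<lambda>r. (norm (\<phi> r w))\<^sup>2) 0 T / 2 \<partial>\<nu>) \<le> (\<integral>w. ln (R w) \<partial>\<nu>)"
proof -
  interpret W: brownian M T F W by (rule W)
  interpret V: brownian \<nu> T F V by (rule V)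
  have sp: "space \<nu> = space M" and st: "sets \<nu> = sets M" by (simp_all add: \<nu>)
  have bmeq: "(borel_measurable \<nu> :: ('w \<Rightarrow> 'b::topological_space) set) = borel_measurable M"
    by (rule measurable_cong_sets) (simp_all add: st)
  have T: "0 < T" by (rule W.T_pos)
  have Rpos: "0 < R w" if "w \<in> space M" for w using c that by (meson less_le_trans)
  note [measurable] = R
  have path: "bdd_path T K (\<lambda>r. \<phi> r w)" if "w \<in> space M" for w
    by (rule W.progressive_bdd_path[OF \<phi> that]) (rule K[OF _ that])
  define D where "D N w = (let h = T / real (Suc N) in
    \<Sum>k<Suc N. \<phi> (real k * h) w \<bullet> time_integral (\<lambda>r. \<phi> r w) (real k * h) (real (Suc k) * h) - h * (norm (\<phi> (real k * h) w))\<^sup>2 / 2)" for N w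
  have Dlim: "(\<lambda>N. D N w) \<longlonglongrightarrow> time_integral (\<lambda>r. (norm (\<phi> r w))\<^sup>2) 0 T / 2" if w: "w \<in> space M" for w
    unfolding D_def by (rule riemann_drift_limit(1)[OF T path[OF w] J cont[OF _ w]])
  have Db: "\<bar>D N w\<bar> \<le> 2 * K\<^sup>2 * T" if w: "w \<in> space M" for N w
    unfolding D_def by (rule riemann_drift_limit(2)[OF T path[OF w] J cont[OF _ w]])
  have lnR: "integrable \<nu> (\<lambda>w. ln (R w))"
  proof (rule V.bounded_integrable)
    show "(\<lambda>w. ln (R w)) \<in> borel_measurable \<nu>" unfolding bmeq by measurable
    fix w assume "w \<in> space \<nu>"
    then have w: "w \<in> space M" by (simp add: sp)
    have "ln c \<le> ln (R w)" "ln (R w) \<le> ln C"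
      using c(1) c(2)[OF w] c(3)[OF w] Rpos[OF w] by (simp_all add: ln_mono)
    then show "norm (ln (R w)) \<le> max \<bar>ln c\<bar> \<bar>ln C\<bar>" by auto
  qed
  have main: "D N \<in> borel_measurable \<nu> \<and> (\<integral>w. D N w \<partial>\<nu>) \<le> (\<integral>w. ln (R w) \<partial>\<nu>)" for N
  proof -
    let ?h = "T / real (Suc N)"
    have h: "0 < ?h" using T by simp
    have n: "real (Suc N) * ?h \<le> T" by simp
    have kT: "real k * ?h \<in> {0..T}" if "k \<le> Suc N" for k
    proof -
      have "real k * ?h \<le> real (Suc N) * ?h" using that h by (intro mult_right_mono) auto
      then show ?thesis using T by auto
    qed
    let ?u = "\<lambda>k. \<phi> (real k * ?h)"
    have u: "?u k \<in> borel_measurable (F (real k * ?h))" if "k < Suc N" for k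
      by (rule W.progressive_adapted[OF \<phi> kT]) (use that in simp)
    have uK: "norm (?u k w) \<le> K" if "k < Suc N" "w \<in> space M" for k w
      using K[OF kT that(2), of k] that(1) by simp
    have uK': "norm (?u k w) \<le> K" if "k < Suc N" "w \<in> space \<nu>" for k w
      using uK that by (simp add: sp)
    define SV where "SV w = (\<Sum>k<Suc N. ?u k w \<bullet> (V (real (Suc k) * ?h) w - V (real k * ?h) w))" for w
    define S where "S w = (\<Sum>k<Suc N. ?u k w \<bullet> (W (real (Suc k) * ?h) w - W (real k * ?h) w) - ?h * (norm (?u k w))\<^sup>2 / 2)" for w
    have SV: "integrable \<nu> SV" "(\<integral>w. SV w \<partial>\<nu>) = 0"
      unfolding SV_def[abs_def] using V.simple_integral[OF h u n uK'] by auto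
    have S_eq: "S w = SV w + D N w" if w: "w \<in> space M" for w
    proof -
      have "W (real (Suc k) * ?h) w - W (real k * ?h) w =
          (V (real (Suc k) * ?h) w - V (real k * ?h) w) + time_integral (\<lambda>r. \<phi> r w) (real k * ?h) (real (Suc k) * ?h)"
        if k: "k < Suc N" for k
      proof -
        have m: "real k * ?h \<le> real (Suc k) * ?h" using h by (intro mult_right_mono) auto
        have "time_integral (\<lambda>r. \<phi> r w) 0 (real (Suc k) * ?h) =
            time_integral (\<lambda>r. \<phi> r w) 0 (real k * ?h) + time_integral (\<lambda>r. \<phi> r w) (real k * ?h) (real (Suc k) * ?h)"
          using m kT[of k] kT[of "Suc k"] k by (intro time_integral_split[OF path[OF w]]) auto
        then show ?thesis using VW[OF kT w, of k] VW[OF kT w, of "Suc k"] k by simp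
      qed
      then show ?thesis
        unfolding S_def SV_def D_def Let_def sum.distrib[symmetric]
        by (intro sum.cong refl) (simp add: inner_add_right)
    qed
    have Wm: "W (real k * ?h) \<in> borel_measurable M" if "k \<le> Suc N" for k by (rule W.W_measurable[OF kT[OF that]])
    have um: "?u k \<in> borel_measurable M" if "k < Suc N" for k
      by (rule W.measurable_F[OF kT u[OF that]]) (use that in simp)
    have Sm [measurable]: "S \<in> borel_measurable M"
      unfolding S_def[abs_def]
      by (intro borel_measurable_sum borel_measurable_diff borel_measurable_inner borel_measurable_divide borel_measurable_times
          borel_measurable_power borel_measurable_norm[THEN measurable_compose[rotated]] um Wm borel_measurable_const) auto
    have SVm: "SV \<in> borel_measurable M" using borel_measurable_integrable[OF SV(1)] unfolding bmeq .
    have Dm: "D N \<in> borel_measurable M"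
      using borel_measurable_diff[OF Sm SVm] by (rule measurable_cong[THEN iffD1, rotated]) (simp add: S_eq)
    have iD: "integrable \<nu> (D N)"
      by (rule V.bounded_integrable[where K="2 * K\<^sup>2 * T"]) (use Dm Db in \<open>auto simp: bmeq sp\<close>)
    have iS: "integrable \<nu> S" "(\<integral>w. S w \<partial>\<nu>) = (\<integral>w. D N w \<partial>\<nu>)"
    proof -
      have "integrable \<nu> (\<lambda>w. SV w + D N w)" using SV(1) iD by simp
      then show "integrable \<nu> S" by (rule Bochner_Integration.integrable_cong[THEN iffD2, rotated -1]) (auto simp: S_eq sp)
      have "(\<integral>w. S w \<partial>\<nu>) = (\<integral>w. SV w + D N w \<partial>\<nu>)" by (intro Bochner_Integration.integral_cong refl) (simp add: S_eq sp)
      then show "(\<integral>w. S w \<partial>\<nu>) = (\<integral>w. D N w \<partial>\<nu>)" using SV iD by simp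
    qed
    \<comment> \<open>Dividing by the density \<open>R\<close> returns the integral from \<nu> to
      \<open>M\<close>, under which \<open>W\<close> is Brownian.\<close>
    have nn: "(\<integral>\<^sup>+w. ennreal (exp (S w) / R w) \<partial>\<nu>) = 1"
    proof -
      have "(\<integral>\<^sup>+w. ennreal (exp (S w) / R w) \<partial>\<nu>) = (\<integral>\<^sup>+w. ennreal (R w) * ennreal (exp (S w) / R w) \<partial>M)"
        unfolding \<nu> by (rule nn_integral_density) auto
      also have "\<dots> = (\<integral>\<^sup>+w. ennreal (exp (S w)) \<partial>M)"
        by (intro nn_integral_cong) (use Rpos in \<open>auto simp flip: ennreal_mult' simp: less_imp_le less_imp_neq[symmetric]\<close>)
      also have "\<dots> = 1" unfolding S_def by (rule W.nn_integral_simple_exponential[OF h u n])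
      finally show ?thesis .
    qed
    have me: "(\<lambda>w. exp (S w) / R w) \<in> borel_measurable \<nu>" unfolding bmeq by measurable
    have pe: "AE w in \<nu>. 0 \<le> exp (S w) / R w" by (rule AE_I2) (use Rpos in \<open>auto simp: sp less_imp_le\<close>)
    have ie: "integrable \<nu> (\<lambda>w. exp (S w) / R w)" using nn by (intro integrableI_nonneg me pe) auto
    have ie1: "(\<integral>w. exp (S w) / R w \<partial>\<nu>) = 1" using nn by (subst integral_eq_nn_integral[OF me pe]) auto
    have "(\<integral>w. S w - ln (R w) \<partial>\<nu>) \<le> (\<integral>w. exp (S w) / R w - 1 \<partial>\<nu>)"
    proof (intro integral_mono Bochner_Integration.integrable_diff iS lnR ie)
      fix w assume "w \<in> space \<nu>"
      then have "0 < R w" using Rpos by (simp add: sp)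
      then show "S w - ln (R w) \<le> exp (S w) / R w - 1"
        using exp_ge_add_one_self[of "S w - ln (R w)"] by (simp add: exp_diff)
    qed simp
    then have "(\<integral>w. S w \<partial>\<nu>) - (\<integral>w. ln (R w) \<partial>\<nu>) \<le> 1 - 1"
      using iS lnR ie ie1 by (simp add: V.prob_space)
    then show ?thesis using iS(2) Dm by (simp add: bmeq)
  qed
  have "(\<lambda>N. \<integral>w. D N w \<partial>\<nu>) \<longlonglongrightarrow> (\<integral>w. time_integral (\<lambda>r. (norm (\<phi> r w))\<^sup>2) 0 T / 2 \<partial>\<nu>)"
  proof (rule integral_dominated_convergence[where w="\<lambda>_. 2 * K\<^sup>2 * T"])
    show "D N \<in> borel_measurable \<nu>" for N using main by auto
    show "(\<lambda>w. time_integral (\<lambda>r. (norm (\<phi> r w))\<^sup>2) 0 T / 2) \<in> borel_measurable \<nu>"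
      by (rule borel_measurable_LIMSEQ_real[of _ D]) (use Dlim main in \<open>auto simp: sp\<close>)
  qed (use Dlim Db in \<open>auto simp: sp\<close>)
  then show ?thesis
    by (rule LIMSEQ_le_const2) (use main in auto)
qed

section \<open>Girsanov's theorem for trigonometric densities\<close>

lemma lam_continuous:
  assumes "s \<notin> snd ` set l"
  shows "continuous (at s within S) (lam l)"
  using assms
proof (induction l)
  case Nil
  then show ?case by (simp add: lam_def[abs_def])
next
  case (Cons p l)
  obtain v r where p: "p = (v, r)" by (cases p)
  have "s \<noteq> r" using Cons.prems by (simp add: p)
  have "\<forall>\<^sub>F q in at s within S. (if q < r then v else 0) = (if s < r then v else 0)"
  proof (cases "s < r")
    case True
    have "\<forall>\<^sub>F q in at s within S. q < r" using order_tendstoD(2)[OF tendsto_ident_at True] .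
    then show ?thesis by eventually_elim (use True in simp)
  next
    case False
    then have "r < s" using \<open>s \<noteq> r\<close> by simp
    have "\<forall>\<^sub>F q in at s within S. r < q" using order_tendstoD(1)[OF tendsto_ident_at \<open>r < s\<close>] .
    then show ?thesis by eventually_elim (use False in simp)
  qed
  then have "continuous (at s within S) (\<lambda>q. if q < r then v else 0)"
    unfolding continuous_within by (rule tendsto_eventually)
  then have "continuous (at s within S) (\<lambda>q. (if q < r then v else 0) + lam l q)"
    using Cons by (intro continuous_add) auto
  then show ?case by (simp add: p lam_Cons[abs_def])
qed

lemma kap_continuous: "continuous_on {0..T} (kap T l)"
proof -
  obtain K where K: "bdd_path T K (\<lambda>r. (norm (lam l r))\<^sup>2)" using bdd_path_lam_square by blast
  let ?q = "time_integral (\<lambda>r. (norm (lam l r))\<^sup>2)"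
  have *: "exp (- ((?q 0 T - ?q 0 t) / 2)) = kap T l t" if "t \<in> {0..T}" for t
    using time_integral_split[OF K, of 0 t T] that by (simp add: kap_def)
  have "continuous_on {0..T} (\<lambda>t. exp (- ((?q 0 T - ?q 0 t) / 2)))"
    by (intro continuous_intros time_integral_continuous[OF K]) simp
  then show ?thesis by (rule continuous_on_eq) (rule *)
qed

text \<open>Only \<open>lam\<close> jumps, at the finitely many times occurring in
  \<open>ts\<close>; \<open>kap\<close> and the stopped phases are continuous.\<close>

lemma drift_continuous:
  assumes x: "continuous_on {0..T} x" and ts: "trig_valid T ts"
    and r: "r \<in> {0..T} - (\<Union>(a, b, l)\<in>set ts. snd ` set l)" and nz: "Gfun T ts r x x0 \<noteq> 0"
  shows "continuous (at r within {0..T}) (\<lambda>t. drift T ts t x x0)"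
proof -
  have rT: "r \<in> {0..T}" using r by simp
  have "continuous (at r within {0..T}) (\<lambda>t. Gfun T ts t x x0) \<and> continuous (at r within {0..T}) (\<lambda>t. Vfun T ts t x x0)"
    using ts r
  proof (induction ts)
    case Nil
    then show ?case by simp
  next
    case (Cons u ts)
    obtain a b l where u: "u = (a, b, l)" by (cases u)
    have l: "snd ` set l \<subseteq> {0..T}" and v: "trig_valid T ts" using Cons.prems(1) by (auto simp: u trig_valid_Cons)
    have rl: "r \<notin> snd ` set l" and r': "r \<in> {0..T} - (\<Union>(a, b, l)\<in>set ts. snd ` set l)"
      using Cons.prems(2) unfolding u by auto
    have c: "continuous (at r within {0..T}) (kap T l)" "continuous (at r within {0..T}) (\<lambda>t. sphase l t x)"
      using kap_continuous[of T l] sphase_continuous[OF x l] rT by (auto simp: continuous_on_eq_continuous_within)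
    show ?case unfolding u Gfun_Cons Vfun_Cons
      using Cons.IH[OF v r'] c lam_continuous[OF rl, of "{0..T}"]
      by (auto intro!: continuous_intros)
  qed
  then show ?thesis
    unfolding drift_def using nz by (auto intro!: continuous_intros)
qed

context girsanov
begin

text \<open>This is \<open>key_martingale\<close> with the exponential at time \<open>s\<close>
  absorbed in the test variable. For \<open>\<eta> = 0\<close> it is the martingale property of
  \<open>Z\<close>.\<close>

lemma Z_martingale:
  assumes st: "0 \<le> s" "s \<le> t" "t \<le> T"
    and \<Xi>: "\<Xi> \<in> borel_measurable (F s)" "\<And>w. w \<in> space M \<Longrightarrow> norm (\<Xi> w) \<le> L"
  shows "(\<integral>w. \<Xi> w * (complex_of_real (Z t w) * cis (\<eta> \<bullet> (Wt t w - Wt s w))) \<partial>M) =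
    (\<integral>w. \<Xi> w * complex_of_real (Z s w) \<partial>M) * exp (- ((t - s) * (norm \<eta>)\<^sup>2 / 2))"
proof -
  let ?e = "\<lambda>r. complex_of_real (exp ((norm \<eta>)\<^sup>2 / 2 * r))"
  have [measurable]: "Wt s \<in> borel_measurable (F s)" using st by (intro Wt_adapted) auto
  note [measurable] = \<Xi>(1)
  have "(\<integral>w. (\<Xi> w * cis (- (\<eta> \<bullet> Wt s w))) * (cis (\<eta> \<bullet> Wt t w) * complex_of_real (exp ((norm \<eta>)\<^sup>2 / 2 * t) * Z t w)) \<partial>M) =
    (\<integral>w. (\<Xi> w * cis (- (\<eta> \<bullet> Wt s w))) * (cis (\<eta> \<bullet> Wt s w) * complex_of_real (exp ((norm \<eta>)\<^sup>2 / 2 * s) * Z s w)) \<partial>M)"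
    by (rule key_martingale[OF st, where L=L]) (use \<Xi>(2) in \<open>auto simp: norm_mult\<close>)
  note a = this
  have b: "(\<Xi> w * cis (- (\<eta> \<bullet> Wt s w))) * (cis (\<eta> \<bullet> Wt t w) * complex_of_real (exp ((norm \<eta>)\<^sup>2 / 2 * t) * Z t w)) =
      \<Xi> w * (complex_of_real (Z t w) * cis (\<eta> \<bullet> (Wt t w - Wt s w))) * ?e t" for w
  proof -
    have "cis (- (\<eta> \<bullet> Wt s w)) * cis (\<eta> \<bullet> Wt t w) = cis (\<eta> \<bullet> (Wt t w - Wt s w))"
      unfolding cis_mult by (simp add: inner_diff_right)
    then show ?thesis by (simp add: mult_ac)
  qed
  have c: "(\<Xi> w * cis (- (\<eta> \<bullet> Wt s w))) * (cis (\<eta> \<bullet> Wt s w) * complex_of_real (exp ((norm \<eta>)\<^sup>2 / 2 * s) * Z s w)) =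
      \<Xi> w * complex_of_real (Z s w) * ?e s" for w
  proof -
    have "cis (- (\<eta> \<bullet> Wt s w)) * cis (\<eta> \<bullet> Wt s w) = 1" unfolding cis_mult by simp
    then show ?thesis by (simp add: mult_ac)
  qed
  from a have "(\<integral>w. \<Xi> w * (complex_of_real (Z t w) * cis (\<eta> \<bullet> (Wt t w - Wt s w))) \<partial>M) * ?e t =
      (\<integral>w. \<Xi> w * complex_of_real (Z s w) \<partial>M) * ?e s"
    unfolding b c by (simp only: integral_mult_left_zero)
  then have "(\<integral>w. \<Xi> w * (complex_of_real (Z t w) * cis (\<eta> \<bullet> (Wt t w - Wt s w))) \<partial>M) =
      (\<integral>w. \<Xi> w * complex_of_real (Z s w) \<partial>M) * (?e s / ?e t)" by (simp add: field_simps)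
  also have "?e s / ?e t = exp (- ((t - s) * (norm \<eta>)\<^sup>2 / 2))"
    unfolding of_real_divide[symmetric] exp_diff[symmetric]
    by (simp add: field_simps)
  finally show ?thesis .
qed

text \<open>Dividing by \<open>Z 0\<close> rather than by its mean normalises conditionally on
  \<open>F 0\<close>: \<nu> agrees with \<open>M\<close> there, so the law of \<open>X\<close> is
  unchanged and the tilt of the initial law can be treated separately.\<close>

definition ratio :: "'w \<Rightarrow> real" where "ratio w = Z T w / Z 0 w"

definition \<nu> :: "'w measure" where "\<nu> = density M (\<lambda>w. ennreal (ratio w))"

lemma T_mem: "T \<in> {0..T}" and zero_mem: "0 \<in> {0..T}"
  using T_pos by auto

lemma Z_pos: "r \<in> {0..T} \<Longrightarrow> w \<in> space M \<Longrightarrow> 0 < Z r w"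
  using Z_bounds by (meson less_le_trans)

lemma ratio_bounds: "\<exists>c C. 0 < c \<and> (\<forall>w\<in>space M. c \<le> ratio w \<and> ratio w \<le> C)"
proof -
  obtain c C where c: "0 < c" "\<And>r w. r \<in> {0..T} \<Longrightarrow> w \<in> space M \<Longrightarrow> c \<le> Z r w \<and> Z r w \<le> C"
    using Z_bounds by blast
  have "c / C \<le> ratio w \<and> ratio w \<le> C / c" if "w \<in> space M" for w
    unfolding ratio_def using c(1) c(2)[OF T_mem that] c(2)[OF zero_mem that] by (intro conjI frac_le) auto
  moreover obtain w where "w \<in> space M" using not_empty by blast
  then have "0 < c / C" using c(1) c(2)[OF T_mem] by (metis divide_pos_pos less_le_trans)
  ultimately show ?thesis by blast
qed

lemma ratio_pos: "w \<in> space M \<Longrightarrow> 0 < ratio w"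
  unfolding ratio_def using Z_pos T_mem zero_mem by simp

lemma ratio_measurable [measurable]: "ratio \<in> borel_measurable M"
  unfolding ratio_def[abs_def]
  by (intro borel_measurable_divide measurable_F[OF _ Z_adapted] T_mem zero_mem)

lemma space_\<nu>: "space \<nu> = space M" and sets_\<nu>: "sets \<nu> = sets M"
  by (simp_all add: \<nu>_def)

lemma integral_\<nu>:
  fixes f :: "'w \<Rightarrow> 'b::{banach, second_countable_topology}"
  assumes "f \<in> borel_measurable M"
  shows "(\<integral>w. f w \<partial>\<nu>) = (\<integral>w. ratio w *\<^sub>R f w \<partial>M)"
  unfolding \<nu>_def using assms ratio_pos by (intro integral_density) (auto intro: less_imp_le)

lemma inverse_Z0: "(\<lambda>w. complex_of_real (1 / Z 0 w)) \<in> borel_measurable (F 0)"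
    "\<exists>L. \<forall>w\<in>space M. norm (complex_of_real (1 / Z 0 w)) \<le> L"
proof -
  note [measurable] = Z_adapted[OF zero_mem]
  show "(\<lambda>w. complex_of_real (1 / Z 0 w)) \<in> borel_measurable (F 0)" by measurable
  obtain c C where c: "0 < c" "\<And>r w. r \<in> {0..T} \<Longrightarrow> w \<in> space M \<Longrightarrow> c \<le> Z r w \<and> Z r w \<le> C"
    using Z_bounds by blast
  have "norm (complex_of_real (1 / Z 0 w)) \<le> 1 / c" if "w \<in> space M" for w
    unfolding norm_of_real using c(1) c(2)[OF zero_mem that] by (simp add: frac_le)
  then show "\<exists>L. \<forall>w\<in>space M. norm (complex_of_real (1 / Z 0 w)) \<le> L" by blast
qed

text \<open>The test variable is the indicator of \<open>A\<close> divided by \<open>Z 0\<close>.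
  The case \<open>\<eta> = 0\<close> lowers \<open>Z T\<close> to \<open>Z t\<close>, then the
  increment over \<open>[s,t]\<close> is evaluated, and finally \<open>Z s\<close> is raised to
  \<open>Z T\<close> again to recover the \<nu>-measure of \<open>A\<close>.\<close>

lemma integral_\<nu>_increment:
  assumes st: "0 \<le> s" "s \<le> t" "t \<le> T" and A: "A \<in> sets (F s)"
  shows "(\<integral>w. indicator A w *\<^sub>R cis (\<eta> \<bullet> (Wt t w - Wt s w)) \<partial>\<nu>) =
    (\<integral>w. indicator A w * ratio w \<partial>M) * exp (- ((t - s) * (norm \<eta>)\<^sup>2 / 2))"
proof -
  have s: "s \<in> {0..T}" and t: "t \<in> {0..T}" using st by auto
  have AM [measurable]: "A \<in> sets M" using A sets_F[OF s] by auto
  have At: "A \<in> sets (F t)" using A sets_F_mono[OF st] by auto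
  have [measurable]: "Wt t \<in> borel_measurable M" "Wt s \<in> borel_measurable M"
    by (intro measurable_F[OF _ Wt_adapted] s t)+
  obtain L where L: "\<And>w. w \<in> space M \<Longrightarrow> norm (complex_of_real (1 / Z 0 w)) \<le> L"
    using inverse_Z0(2) by blast
  have L0: "0 \<le> L" using L not_empty norm_ge_zero order_trans by blast
  define \<Xi> where "\<Xi> w = complex_of_real (indicator A w) * complex_of_real (1 / Z 0 w)" for w
  have \<Xi>s: "\<Xi> \<in> borel_measurable (F r)" if "s \<le> r" "r \<le> T" for r
  proof -
    have [measurable]: "A \<in> sets (F r)" using A sets_F_mono[OF st(1) that] by auto
    have [measurable]: "(\<lambda>w. complex_of_real (1 / Z 0 w)) \<in> borel_measurable (F r)"
      by (rule measurable_F_mono[OF inverse_Z0(1)]) (use that st in auto)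
    show ?thesis unfolding \<Xi>_def by measurable
  qed
  have \<Xi>b: "norm (\<Xi> w) \<le> L" if "w \<in> space M" for w
    using L[OF that] L0 by (simp add: \<Xi>_def norm_mult split: split_indicator)
  let ?c = "\<lambda>w. cis (\<eta> \<bullet> (Wt t w - Wt s w))"
  have mt: "(\<lambda>w. \<Xi> w * ?c w) \<in> borel_measurable (F t)"
  proof -
    have [measurable]: "Wt t \<in> borel_measurable (F t)" "Wt s \<in> borel_measurable (F t)"
      using st by (auto intro!: measurable_F_mono[OF Wt_adapted])
    note [measurable] = \<Xi>s[OF st(2,3)]
    show ?thesis by measurable
  qed
  have rt: "complex_of_real (indicator A w) * complex_of_real (ratio w) = \<Xi> w * complex_of_real (Z T w)" for w
    by (simp add: \<Xi>_def ratio_def)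
  have "(\<integral>w. indicator A w *\<^sub>R ?c w \<partial>\<nu>) = (\<integral>w. ratio w *\<^sub>R (indicator A w *\<^sub>R ?c w) \<partial>M)"
    by (rule integral_\<nu>) measurable
  also have "\<dots> = (\<integral>w. (\<Xi> w * ?c w) * (complex_of_real (Z T w) * cis (0 \<bullet> (Wt T w - Wt t w))) \<partial>M)"
    by (intro Bochner_Integration.integral_cong refl) (simp add: scaleR_conv_of_real rt[symmetric] \<Xi>_def ratio_def)
  also have "\<dots> = (\<integral>w. (\<Xi> w * ?c w) * complex_of_real (Z t w) \<partial>M) * exp (- ((T - t) * (norm (0 :: real ^ 'n))\<^sup>2 / 2))"
    by (rule Z_martingale[OF _ _ _ mt, where L=L]) (use st \<Xi>b in \<open>auto simp: norm_mult\<close>)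
  also have "\<dots> = (\<integral>w. \<Xi> w * (complex_of_real (Z t w) * ?c w) \<partial>M)" by (simp add: mult_ac)
  also have "\<dots> = (\<integral>w. \<Xi> w * complex_of_real (Z s w) \<partial>M) * exp (- ((t - s) * (norm \<eta>)\<^sup>2 / 2))"
    by (rule Z_martingale[OF st \<Xi>s \<Xi>b]) (use st in auto)
  also have "(\<integral>w. \<Xi> w * complex_of_real (Z s w) \<partial>M) =
      (\<integral>w. \<Xi> w * complex_of_real (Z s w) \<partial>M) * exp (- ((T - s) * (norm (0 :: real ^ 'n))\<^sup>2 / 2))" by simp
  also have "\<dots> = (\<integral>w. \<Xi> w * (complex_of_real (Z T w) * cis (0 \<bullet> (Wt T w - Wt s w))) \<partial>M)"
    by (rule Z_martingale[OF _ _ _ \<Xi>s \<Xi>b, symmetric]) (use st in auto)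
  also have "\<dots> = (\<integral>w. complex_of_real (indicator A w * ratio w) \<partial>M)"
    by (simp add: rt[symmetric])
  also have "\<dots> = complex_of_real (\<integral>w. indicator A w * ratio w \<partial>M)" by (rule integral_complex_of_real)
  finally show ?thesis by simp
qed

lemma measure_\<nu>:
  assumes "A \<in> sets M"
  shows "emeasure \<nu> A = ennreal (\<integral>w. indicator A w * ratio w \<partial>M)"
proof -
  note [measurable] = assms
  obtain c C where c: "0 < c" "\<And>w. w \<in> space M \<Longrightarrow> c \<le> ratio w \<and> ratio w \<le> C" using ratio_bounds by blast
  have i: "integrable M (\<lambda>w. indicator A w * ratio w)"
  proof (rule bounded_integrable[where K=C])
    fix w assume "w \<in> space M"
    from c(2)[OF this] c(1) show "norm (indicator A w * ratio w) \<le> C"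
      by (simp split: split_indicator)
  qed measurable
  have "emeasure \<nu> A = (\<integral>\<^sup>+w. ennreal (ratio w) * indicator A w \<partial>M)"
    unfolding \<nu>_def by (rule emeasure_density) auto
  also have "\<dots> = (\<integral>\<^sup>+w. ennreal (indicator A w * ratio w) \<partial>M)"
    by (intro nn_integral_cong) (simp split: split_indicator)
  also have "\<dots> = ennreal (\<integral>w. indicator A w * ratio w \<partial>M)"
    by (rule nn_integral_eq_integral[OF i], rule AE_I2) (simp add: less_imp_le[OF ratio_pos] split: split_indicator)
  finally show ?thesis .
qed

text \<open>For \<open>A\<close> in \<open>F 0\<close> the indicator divided by \<open>Z 0\<close>
  is an admissible test variable at time 0, and the martingale property from 0 to \<open>T\<close>
  replaces the ratio by 1.\<close>

lemma \<nu>_eq_on_F0: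
  assumes A: "A \<in> sets (F 0)"
  shows "emeasure \<nu> A = emeasure M A"
proof -
  have AM [measurable]: "A \<in> sets M" using A sets_F[OF zero_mem] by auto
  note [measurable] = inverse_Z0(1) A
  obtain L where L: "\<And>w. w \<in> space M \<Longrightarrow> norm (complex_of_real (1 / Z 0 w)) \<le> L"
    using inverse_Z0(2) by blast
  have L0: "0 \<le> L" using L not_empty norm_ge_zero order_trans by blast
  define \<Xi> where "\<Xi> w = complex_of_real (indicator A w) * complex_of_real (1 / Z 0 w)" for w
  have \<Xi>: "\<Xi> \<in> borel_measurable (F 0)" unfolding \<Xi>_def by measurable
  have "complex_of_real (\<integral>w. indicator A w * ratio w \<partial>M) = (\<integral>w. complex_of_real (indicator A w * ratio w) \<partial>M)"
    by (rule integral_complex_of_real[symmetric])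
  also have "\<dots> = (\<integral>w. \<Xi> w * (complex_of_real (Z T w) * cis (0 \<bullet> (Wt T w - Wt 0 w))) \<partial>M)"
    by (simp add: \<Xi>_def ratio_def)
  also have "\<dots> = (\<integral>w. \<Xi> w * complex_of_real (Z 0 w) \<partial>M) * exp (- ((T - 0) * (norm (0 :: real ^ 'n))\<^sup>2 / 2))"
    by (rule Z_martingale[OF _ _ _ \<Xi>, where L=L]) (use T_pos L L0 in \<open>auto simp: \<Xi>_def norm_mult split: split_indicator\<close>)
  also have "\<dots> = (\<integral>w. complex_of_real (indicator A w) \<partial>M)"
  proof -
    have "(\<integral>w. \<Xi> w * complex_of_real (Z 0 w) \<partial>M) = (\<integral>w. complex_of_real (indicator A w) \<partial>M)"
      by (intro Bochner_Integration.integral_cong refl) (use Z_pos[OF zero_mem] in \<open>force simp: \<Xi>_def\<close>)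
    then show ?thesis by simp
  qed
  also have "\<dots> = complex_of_real (\<integral>w. indicator A w \<partial>M)" by (rule integral_complex_of_real)
  also have "(\<integral>w. indicator A w \<partial>M) = measure M A" using AM by simp
  finally have "(\<integral>w. indicator A w * ratio w \<partial>M) = measure M A" by (simp only: of_real_eq_iff)
  then show ?thesis by (simp add: measure_\<nu>[OF AM] emeasure_eq_measure)
qed

lemma prob_space_\<nu>: "prob_space \<nu>"
proof (rule prob_spaceI)
  have "space M \<in> sets (F 0)" using space_F[OF zero_mem] sets.top[of "F 0"] by simp
  from \<nu>_eq_on_F0[OF this] show "emeasure \<nu> (space \<nu>) = 1" by (simp add: space_\<nu> emeasure_space_1)
qed

lemma brownian_\<nu>: "brownian \<nu> T F Wt"
proof -
  interpret N: prob_space \<nu> by (rule prob_space_\<nu>)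
  have filt: "filtration_upto T \<nu> F"
    using filtration by (simp add: filtration_upto_def subalgebra_def space_\<nu> sets_\<nu>)
  interpret N: filtered_prob_space \<nu> T F
    by unfold_locales (use T_pos filt in auto)
  have "brownian_motion T \<nu> F Wt"
  proof (rule N.brownian_motionI)
    show "Wt t \<in> borel_measurable (F t)" if "t \<in> {0..T}" for t by (rule Wt_adapted[OF that])
    show "Wt 0 w = 0 \<and> continuous_on {0..T} (\<lambda>t. Wt t w)" if "w \<in> space \<nu>" for w
      using that Wt_continuous W_zero by (simp add: space_\<nu> Wt_def)
    fix s t A and \<eta> :: "real ^ 'n" assume st: "0 \<le> s" "s < t" "t \<le> T" and A: "A \<in> sets (F s)"
    have "A \<in> sets M" using A sets_F[of s] st by auto
    have nn: "0 \<le> (\<integral>w. indicator A w * ratio w \<partial>M)"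
      by (rule Bochner_Integration.integral_nonneg_AE, rule AE_I2)
        (simp add: less_imp_le[OF ratio_pos] split: split_indicator)
    have "measure \<nu> A = (\<integral>w. indicator A w * ratio w \<partial>M)"
      unfolding measure_def measure_\<nu>[OF \<open>A \<in> sets M\<close>] using nn by simp
    then show "(\<integral>w. indicator A w *\<^sub>R cis (\<eta> \<bullet> (Wt t w - Wt s w)) \<partial>\<nu>) =
        complex_of_real (measure \<nu> A) * exp (- ((t - s) * (norm \<eta>)\<^sup>2 / 2))"
      using integral_\<nu>_increment[OF _ _ _ A, of t \<eta>] st by simp
  qed
  then show ?thesis by unfold_locales
qed

lemma \<phi>_cont:
  assumes "r \<in> {0..T} - (\<Union>(a, b, l)\<in>set ts. snd ` set l)" "w \<in> space M"
  shows "continuous (at r within {0..T}) (\<lambda>r. \<phi> r w)"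
  unfolding \<phi>_def
proof (rule drift_continuous[OF Y_continuous[OF assms(2)] ts assms(1)])
  have "0 < G r w" using G_ge[of r w] assms \<delta>_pos by (auto intro: less_le_trans)
  then show "Gfun T ts r (\<lambda>q. Y q w) (X w) \<noteq> 0" by (simp add: G_def)
qed

lemma energy_le_\<nu>:
  "(\<integral>w. time_integral (\<lambda>r. (norm (\<phi> r w))\<^sup>2) 0 T / 2 \<partial>\<nu>) \<le> (\<integral>w. ln (ratio w) \<partial>\<nu>)"
proof -
  obtain c C where c: "0 < c" "\<And>w. w \<in> space M \<Longrightarrow> c \<le> ratio w \<and> ratio w \<le> C" using ratio_bounds by blast
  have J: "finite (\<Union>(a, b, l)\<in>set ts. snd ` set l)" by auto
  show ?thesis
    by (rule drift_energy_le_entropy[OF brownian_axioms brownian_\<nu> \<nu>_def ratio_measurable c(1) _ _ \<phi>_progressive \<phi>_bound _ J \<phi>_cont])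
       (use c Wt_def in auto)
qed

text \<open>The same inequality with the measures exchanged: \<open>M\<close> has density
  \<open>1 / ratio\<close> with respect to \<nu>, and \<open>W = Wt + \<integral> \<phi>\<close>
  arises from \<open>Wt\<close> through the drift \<open>- \<phi>\<close>.\<close>

lemma energy_le_M:
  "(\<integral>w. time_integral (\<lambda>r. (norm (\<phi> r w))\<^sup>2) 0 T / 2 \<partial>M) \<le> (\<integral>w. - ln (ratio w) \<partial>M)"
proof -
  obtain c C where c: "0 < c" "\<And>w. w \<in> space M \<Longrightarrow> c \<le> ratio w \<and> ratio w \<le> C" using ratio_bounds by blast
  have J: "finite (\<Union>(a, b, l)\<in>set ts. snd ` set l)" by auto
  have C: "0 < C" using c not_empty by (meson all_not_in_conv less_le_trans)
  have M: "M = density \<nu> (\<lambda>w. ennreal (1 / ratio w))"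
  proof -
    have "density \<nu> (\<lambda>w. ennreal (1 / ratio w)) = density M (\<lambda>w. ennreal (ratio w) * ennreal (1 / ratio w))"
      unfolding \<nu>_def by (rule density_density_eq) auto
    also have "\<dots> = density M (\<lambda>w. 1)"
    proof (rule density_cong)
      show "AE w in M. ennreal (ratio w) * ennreal (1 / ratio w) = 1"
      proof (rule AE_I2)
        fix w assume "w \<in> space M"
        from ratio_pos[OF this] show "ennreal (ratio w) * ennreal (1 / ratio w) = 1"
          by (simp flip: ennreal_mult)
      qed
    qed auto
    finally show ?thesis by (simp add: density_1)
  qed
  have np: "progressive T F (\<lambda>r w. - \<phi> r w)" by (rule progressive_compose[OF \<phi>_progressive]) measurable
  have m: "(\<lambda>w. 1 / ratio w) \<in> borel_measurable \<nu>"
    by (simp cong: measurable_cong_sets add: sets_\<nu>)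
  have "(\<integral>w. time_integral (\<lambda>r. (norm (- \<phi> r w))\<^sup>2) 0 T / 2 \<partial>M) \<le> (\<integral>w. ln (1 / ratio w) \<partial>M)"
  proof (rule drift_energy_le_entropy[OF brownian_\<nu> brownian_axioms M m, of "1 / C" "1 / c" _ K\<phi> "\<Union>(a, b, l)\<in>set ts. snd ` set l"])
    show "0 < 1 / C" using C by simp
    fix w assume "w \<in> space \<nu>"
    then have w: "w \<in> space M" by (simp add: space_\<nu>)
    show "1 / C \<le> 1 / ratio w" "1 / ratio w \<le> 1 / c"
      using c(1) c(2)[OF w] ratio_pos[OF w] by (auto intro!: frac_le)
    show "norm (- \<phi> r w) \<le> K\<phi>" if "r \<in> {0..T}" for r using \<phi>_bound[OF that w] by simp
    show "W t w = Wt t w - time_integral (\<lambda>r. - \<phi> r w) 0 t" if "t \<in> {0..T}" for t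
      unfolding Wt_def time_integral_def set_lebesgue_integral_def by simp
    show "continuous (at r within {0..T}) (\<lambda>r. - \<phi> r w)" if "r \<in> {0..T} - (\<Union>(a, b, l)\<in>set ts. snd ` set l)" for r
      by (intro continuous_minus \<phi>_cont[OF that w])
  qed (use np J in auto)
  moreover have "(\<integral>w. ln (1 / ratio w) \<partial>M) = (\<integral>w. - ln (ratio w) \<partial>M)"
  proof (intro Bochner_Integration.integral_cong refl)
    fix w assume "w \<in> space M"
    from ratio_pos[OF this] show "ln (1 / ratio w) = - ln (ratio w)" by (simp add: ln_div)
  qed
  ultimately show ?thesis by simp
qed

end

section \<open>The lower bound\<close>

text \<open>The Gibbs variational inequality: \<open>ln x \<le> x - 1\<close> is integrated under
  \<mu> at \<open>x = (g / c) / r\<close>, where \<open>r\<close> is the density of \<mu> and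
  \<open>c\<close> is the mean of \<open>g\<close> under \<rho>.\<close>

lemma relative_entropy_variational:
  fixes g :: "'a \<Rightarrow> real"
  assumes \<rho>: "prob_space \<rho>" and \<mu>: "prob_space \<mu>" and s: "sets \<mu> = sets \<rho>"
    and ac: "absolutely_continuous \<rho> \<mu>" and int: "integrable \<mu> (entropy_density (exp 1) \<rho> \<mu>)"
    and g: "g \<in> borel_measurable \<rho>" "0 < \<delta>" "\<And>x. x \<in> space \<rho> \<Longrightarrow> \<delta> \<le> g x" "\<And>x. x \<in> space \<rho> \<Longrightarrow> g x \<le> C"
  shows "- ln (\<integral>x. g x \<partial>\<rho>) \<le> KL_divergence (exp 1) \<rho> \<mu> + (\<integral>x. - ln (g x) \<partial>\<mu>)"
proof -
  interpret \<rho>: prob_space \<rho> by (rule \<rho>)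
  interpret \<mu>: prob_space \<mu> by (rule \<mu>)
  have sp: "space \<mu> = space \<rho>" by (rule sets_eq_imp_space_eq[OF s])
  have bm: "(borel_measurable \<mu> :: ('a \<Rightarrow> 'b::topological_space) set) = borel_measurable \<rho>" by (rule measurable_cong_sets) (simp_all add: s)
  define D where "D = RN_deriv \<rho> \<mu>"
  define r where "r x = enn2real (D x)" for x
  have Dm [measurable]: "D \<in> borel_measurable \<rho>" by (simp add: D_def)
  have rm [measurable]: "r \<in> borel_measurable \<rho>" unfolding r_def[abs_def] by measurable
  note [measurable] = g(1)
  have dens: "density \<rho> D = \<mu>" unfolding D_def by (rule \<rho>.density_RN_deriv[OF ac s])
  have fin: "AE x in \<rho>. D x \<noteq> \<infinity>" unfolding D_def by (rule \<rho>.RN_deriv_finite[OF \<mu>.sigma_finite_measure_axioms ac s])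
  have Dpos: "AE x in \<mu>. 0 < D x"
    using AE_density[OF Dm, of "\<lambda>x. 0 < D x"] unfolding dens by simp
  have fin': "AE x in \<mu>. D x \<noteq> \<infinity>"
    using AE_density[OF Dm, of "\<lambda>x. D x \<noteq> \<infinity>"] fin unfolding dens by auto
  have rpos: "AE x in \<mu>. 0 < r x"
    using Dpos fin' by eventually_elim (auto simp: r_def enn2real_positive_iff less_top)
  define c where "c = (\<integral>x. g x \<partial>\<rho>)"
  have gi: "integrable \<rho> g"
    by (rule norm_integral_bounded_measurable[OF \<rho>.finite_measure_axioms g(1), of C]) (use g in fastforce)
  have "(\<integral>x. \<delta> \<partial>\<rho>) \<le> c" unfolding c_def by (rule integral_mono) (use g(3) gi in auto)
  then have "\<delta> \<le> c" by (simp add: \<rho>.prob_space)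
  then have c: "0 < c" using g(2) by simp
  let ?h = "\<lambda>x. g x / c / r x"
  have "(\<integral>\<^sup>+x. ennreal (?h x) \<partial>\<mu>) = (\<integral>\<^sup>+x. D x * ennreal (?h x) \<partial>\<rho>)"
    using nn_integral_density[OF Dm, of "\<lambda>x. ennreal (?h x)"] unfolding dens by simp
  also have "\<dots> \<le> (\<integral>\<^sup>+x. ennreal (g x / c) \<partial>\<rho>)"
  proof (rule nn_integral_mono_AE)
    \<comment> \<open>There is equality where the density is positive; where it vanishes the left
      side is 0. The mass of \<open>?h\<close> under \<mu> is therefore at most 1.\<close>
    show "AE x in \<rho>. D x * ennreal (?h x) \<le> ennreal (g x / c)"
      using fin AE_space
    proof eventually_elim
      case (elim x)
      have "D x = ennreal (r x)" using elim(1) by (simp add: r_def less_top)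
      have r0: "0 \<le> r x" by (simp add: r_def)
      have g0: "0 \<le> g x / c" using g(2) g(3)[OF elim(2)] c by simp
      have "D x * ennreal (?h x) = ennreal (r x * ?h x)"
        unfolding \<open>D x = ennreal (r x)\<close> using r0 divide_nonneg_nonneg[OF g0 r0] by (intro ennreal_mult[symmetric])
      also have "\<dots> \<le> ennreal (g x / c)" using g0 by (intro ennreal_leI) (cases "r x = 0", auto)
      finally show ?case .
    qed
  qed
  also have "\<dots> = ennreal (\<integral>x. g x / c \<partial>\<rho>)"
  proof (rule nn_integral_eq_integral)
    show "AE x in \<rho>. 0 \<le> g x / c"
    proof (rule AE_I2)
      fix x assume "x \<in> space \<rho>"
      from g(3)[OF this] g(2) c show "0 \<le> g x / c" by simp
    qed
  qed (use gi in simp)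
  also have "(\<integral>x. g x / c \<partial>\<rho>) = 1" using c by (simp add: c_def)
  finally have nn: "(\<integral>\<^sup>+x. ennreal (?h x) \<partial>\<mu>) \<le> 1" by simp
  have hm: "?h \<in> borel_measurable \<mu>" unfolding bm by measurable
  have h0: "AE x in \<mu>. 0 \<le> ?h x"
  proof (rule AE_I2)
    fix x assume "x \<in> space \<mu>"
    then have "0 < g x" using g(2) g(3)[of x] by (simp add: sp)
    then show "0 \<le> ?h x" using c by (simp add: r_def)
  qed
  have hi: "integrable \<mu> ?h" using nn by (intro integrableI_nonneg hm h0) (auto intro: le_less_trans)
  have "ennreal (\<integral>x. ?h x \<partial>\<mu>) \<le> ennreal 1" using nn nn_integral_eq_integral[OF hi h0] by simp
  then have h1: "(\<integral>x. ?h x \<partial>\<mu>) \<le> 1" by simp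
  have ed: "entropy_density (exp 1) \<rho> \<mu> x = ln (r x)" for x
    unfolding entropy_density_def r_def D_def by (simp add: log_def)
  have ir: "integrable \<mu> (\<lambda>x. ln (r x))" using int unfolding ed[abs_def] .
  have il: "integrable \<mu> (\<lambda>x. ln (g x))"
  proof (rule norm_integral_bounded_measurable[OF \<mu>.finite_measure_axioms])
    show "(\<lambda>x. ln (g x)) \<in> borel_measurable \<mu>" unfolding bm by measurable
    fix x assume "x \<in> space \<mu>"
    then have "\<delta> \<le> g x" "g x \<le> C" using g by (auto simp: sp)
    then have "ln \<delta> \<le> ln (g x)" "ln (g x) \<le> ln C" using g(2) by (simp_all add: ln_mono)
    then show "norm (ln (g x)) \<le> max \<bar>ln \<delta>\<bar> \<bar>ln C\<bar>" by auto
  qed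
  have "(\<integral>x. ln (g x) - ln c - ln (r x) \<partial>\<mu>) \<le> (\<integral>x. ?h x - 1 \<partial>\<mu>)"
  proof (rule integral_mono_AE)
    show "AE x in \<mu>. ln (g x) - ln c - ln (r x) \<le> ?h x - 1"
      using rpos AE_space
    proof eventually_elim
      case (elim x)
      then have "0 < g x" using g(2) g(3)[of x] by (simp add: sp)
      then have h: "0 < ?h x" using c elim(1) by (intro divide_pos_pos)
      have "ln (?h x) = ln (g x) - ln c - ln (r x)"
        using \<open>0 < g x\<close> c elim(1) by (simp only: ln_divide_pos divide_pos_pos)
      then show ?case using ln_le_minus_one[OF h] by linarith
    qed
  qed (use il ir hi in auto)
  then have "(\<integral>x. ln (g x) \<partial>\<mu>) - ln c - (\<integral>x. ln (r x) \<partial>\<mu>) \<le> 0"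
    using il ir hi h1 by (simp add: \<mu>.prob_space)
  moreover have "KL_divergence (exp 1) \<rho> \<mu> = (\<integral>x. ln (r x) \<partial>\<mu>)"
    unfolding KL_divergence_def ed[abs_def] ..
  ultimately show ?thesis by (simp add: c_def)
qed

section \<open>Trigonometric approximation on continuous paths\<close>

abbreviation path_measure_space :: "real \<Rightarrow> ((real \<Rightarrow> real ^ 'n) \<times> 'a::topological_space) measure" where
  "path_measure_space T \<equiv> restrict_space (path_sigma T) (cpaths T \<times> UNIV)"

lemma space_path_measure_space: "space (path_measure_space T) = cpaths T \<times> UNIV"
  using cpaths_subset by (auto simp: space_restrict_space)

lemma measurable_path_measure_spaceI:
  assumes "\<And>t. t \<in> {0..T} \<Longrightarrow> (\<lambda>w. Y w t) \<in> borel_measurable N" "X \<in> borel_measurable N"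
    "\<And>w. w \<in> space N \<Longrightarrow> Y w \<in> cpaths T"
  shows "(\<lambda>w. (Y w, X w)) \<in> measurable N (path_measure_space T)"
proof (rule measurable_restrict_space2)
  show "(\<lambda>w. (Y w, X w)) \<in> space N \<rightarrow> cpaths T \<times> UNIV" by (auto intro: assms(3))
  show "(\<lambda>w. (Y w, X w)) \<in> measurable N (path_sigma T)"
  proof (rule measurable_path_sigmaI[OF assms(1,2)])
    fix w assume "w \<in> space N"
    from assms(3)[OF this] show "Y w \<in> extensional {0..T}" by (simp add: cpaths_def)
  qed
qed

lemma phase_cong: "(\<And>r. r \<in> snd ` set l \<Longrightarrow> x r = y r) \<Longrightarrow> phase l x = phase l y"
proof (induction l)
  case (Cons p l)
  obtain v r where p: "p = (v, r)" by (cases p)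
  have "x r = y r" using Cons.prems[of r] by (simp add: p)
  then show ?case using Cons by (simp add: p phase_def)
qed (simp add: phase_def)

lemma trig_fun_cong:
  assumes "trig_valid T ts" "\<And>r. r \<in> {0..T} \<Longrightarrow> x r = y r"
  shows "trig_fun ts (x, x0) = trig_fun ts (y, x0)"
  using assms(1)
proof (induction ts)
  case (Cons u ts)
  obtain a b l where u: "u = (a, b, l)" by (cases u)
  have "phase l x = phase l y"
    by (rule phase_cong) (use Cons.prems assms(2) in \<open>auto simp: u trig_valid_Cons\<close>)
  then show ?case using Cons by (simp add: u trig_fun_Cons trig_valid_Cons)
qed simp

lemma phase_tendsto:
  assumes "\<And>r. r \<in> snd ` set l \<Longrightarrow> (\<lambda>n. Y n r) \<longlonglongrightarrow> y r"
  shows "(\<lambda>n. phase l (Y n)) \<longlonglongrightarrow> phase l y"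
  using assms
proof (induction l)
  case (Cons p l)
  obtain v r where p: "p = (v, r)" by (cases p)
  have "(\<lambda>n. Y n r) \<longlonglongrightarrow> y r" using Cons.prems[of r] by (simp add: p)
  moreover have "(\<lambda>n. phase l (Y n)) \<longlonglongrightarrow> phase l y" using Cons by simp
  ultimately have "(\<lambda>n. v \<bullet> Y n r + phase l (Y n)) \<longlonglongrightarrow> v \<bullet> y r + phase l y" by (intro tendsto_intros)
  then show ?case by (simp add: p phase_def)
qed (simp add: phase_def)

lemma trig_fun_tendsto:
  assumes "trig_valid T ts" "\<And>r. r \<in> {0..T} \<Longrightarrow> (\<lambda>n. Y n r) \<longlonglongrightarrow> y r"
  shows "(\<lambda>n. trig_fun ts (Y n, x0)) \<longlonglongrightarrow> trig_fun ts (y, x0)"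
  using assms(1)
proof (induction ts)
  case (Cons u ts)
  obtain a b l where u: "u = (a, b, l)" by (cases u)
  have "(\<lambda>n. phase l (Y n)) \<longlonglongrightarrow> phase l y"
    by (rule phase_tendsto) (use Cons.prems assms(2) in \<open>auto simp: u trig_valid_Cons\<close>)
  then show ?case using Cons by (auto simp: u trig_fun_Cons trig_valid_Cons intro!: tendsto_intros)
qed simp

text \<open>One approximant for both laws. Its bounds hold on every path continuous on
  \<open>[0,T]\<close>, extensional or not, because a trigonometric function reads only values in
  \<open>[0,T]\<close>; the lower bound makes its logarithm a Lipschitz function.\<close>

lemma trig_approximation:
  fixes f :: "(real \<Rightarrow> real ^ 'n) \<times> 'a::second_countable_topology \<Rightarrow> real"
  assumes fin: "finite_measure m1" "finite_measure m2"
    and s: "sets m1 = sets (path_measure_space T)" "sets m2 = sets (path_measure_space T)"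
    and f: "f \<in> borel_measurable (path_measure_space T)" "\<And>p. p \<in> cpaths T \<times> UNIV \<Longrightarrow> \<bar>f p\<bar> \<le> K"
    and e: "0 < e"
  shows "\<exists>ts. trig_valid T ts \<and> (\<forall>x x0. continuous_on {0..T} x \<longrightarrow> exp (- K) / 2 \<le> trig_fun ts (x, x0)) \<and>
    (\<forall>x x0. continuous_on {0..T} x \<longrightarrow> trig_fun ts (x, x0) \<le> exp K + 1) \<and>
    (\<integral>p. \<bar>exp (- f p) - trig_fun ts p\<bar> \<partial>m1) < e \<and> (\<integral>p. \<bar>exp (- f p) - trig_fun ts p\<bar> \<partial>m2) < e"
proof -
  interpret A: measured_function_algebra "cpaths T \<times> (UNIV :: 'a set)" "trig_functions T" m1 m2
    by (rule trig_measured_algebra[OF cpaths_subset fin s])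
  \<comment> \<open>An overshoot of at most \<open>exp (- K) / 2\<close> keeps the approximant above
    half of the lower bound \<open>exp (- K)\<close>.\<close>
  define e' where "e' = min e (exp (- K) / 2)"
  have e': "0 < e'" "e' \<le> e" "e' \<le> exp (- K) / 2" using e by (auto simp: e'_def)
  have bm: "borel_measurable m1 = borel_measurable (path_measure_space T)"
    by (rule measurable_cong_sets) (simp_all add: s)
  have fm: "(\<lambda>p. exp (- f p)) \<in> borel_measurable m1" unfolding bm using f(1) by measurable
  have b: "exp (- K) \<le> exp (- f p)" "exp (- f p) \<le> exp K" if "p \<in> cpaths T \<times> UNIV" for p
    using f(2)[OF that] by auto
  have K: "exp (- K) \<le> exp K" and K1: "exp (- K) \<le> 1"
  proof -
    \<comment> \<open>The zero path is a point at which \<open>f\<close> is bounded by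
      \<open>K\<close>, whence \<open>K\<close> is nonnegative.\<close>
    have "continuous_on {0..T} (\<lambda>t\<in>{0..T}. 0 :: real ^ 'n)" by (rule continuous_on_eq[OF continuous_on_const[of _ 0]]) simp
    then have "(\<lambda>t\<in>{0..T}. 0) \<in> (cpaths T :: (real \<Rightarrow> real ^ 'n) set)" by (simp add: cpaths_def)
    then have "((\<lambda>t\<in>{0..T}. 0) :: real \<Rightarrow> real ^ 'n, undefined) \<in> cpaths T \<times> (UNIV :: 'a set)" by simp
    from f(2)[OF this] have "0 \<le> K" by linarith
    then show "exp (- K) \<le> exp K" "exp (- K) \<le> 1" by simp_all
  qed
  have "\<exists>g\<in>trig_functions T. (\<forall>x\<in>cpaths T \<times> UNIV. exp (- K) - e' \<le> g x) \<and> (\<forall>x\<in>cpaths T \<times> UNIV. g x \<le> exp K + e') \<and>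
    (\<integral>x. \<bar>exp (- f x) - g x\<bar> \<partial>m1) < e' \<and> (\<integral>x. \<bar>exp (- f x) - g x\<bar> \<partial>m2) < e'"
  proof (rule A.L1_approximation[OF fm b K e'(1)])
    fix g assume "g \<in> trig_functions T" "\<And>x. x \<in> cpaths T \<times> UNIV \<Longrightarrow> exp (- K) - e' \<le> g x"
      "\<And>x. x \<in> cpaths T \<times> UNIV \<Longrightarrow> g x \<le> exp K + e'" "(\<integral>x. \<bar>exp (- f x) - g x\<bar> \<partial>m1) < e'" "(\<integral>x. \<bar>exp (- f x) - g x\<bar> \<partial>m2) < e'"
    then show ?thesis by (intro bexI[of _ g] conjI ballI)
  qed
  then obtain g where g: "g \<in> trig_functions T" "\<forall>x\<in>cpaths T \<times> UNIV. exp (- K) - e' \<le> g x"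
    "\<forall>x\<in>cpaths T \<times> UNIV. g x \<le> exp K + e'" "(\<integral>x. \<bar>exp (- f x) - g x\<bar> \<partial>m1) < e'" "(\<integral>x. \<bar>exp (- f x) - g x\<bar> \<partial>m2) < e'" by blast
  obtain ts where ts: "g = trig_fun ts" "trig_valid T ts" using g(1) by (auto simp: trig_functions_def)
  show ?thesis
  proof (intro exI[of _ ts] conjI allI impI)
    fix x :: "real \<Rightarrow> real ^ 'n" and x0 :: 'a assume x: "continuous_on {0..T} x"
    have "continuous_on {0..T} (restrict x {0..T})" by (rule continuous_on_eq[OF x]) simp
    then have mem: "(restrict x {0..T}, x0) \<in> cpaths T \<times> UNIV" by (simp add: cpaths_def)
    have eq: "g (restrict x {0..T}, x0) = trig_fun ts (x, x0)"
      unfolding ts(1) by (rule trig_fun_cong[OF ts(2)]) simp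
    show "exp (- K) / 2 \<le> trig_fun ts (x, x0)" using bspec[OF g(2) mem] e'(3) unfolding eq by linarith
    show "trig_fun ts (x, x0) \<le> exp K + 1" using bspec[OF g(3) mem] e'(3) K1 unfolding eq by linarith
  next
    show "trig_valid T ts" by (rule ts(2))
    show "(\<integral>p. \<bar>exp (- f p) - trig_fun ts p\<bar> \<partial>m1) < e" "(\<integral>p. \<bar>exp (- f p) - trig_fun ts p\<bar> \<partial>m2) < e"
      using g(4,5) e'(2) unfolding ts(1)[symmetric] by linarith+
  qed
qed

text \<open>At time 0 every time in the stopped phase is cut down to 0, so the path enters only
  through its starting value.\<close>

lemma Gfun_0:
  assumes "trig_valid T ts" "x 0 = 0"
  shows "Gfun T ts 0 x x0 = Gfun T ts 0 (\<lambda>r. 0) x0"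
  using assms(1)
proof (induction ts)
  case (Cons u ts)
  obtain a b l where u: "u = (a, b, l)" by (cases u)
  have l: "snd ` set l \<subseteq> {0..T}" using Cons.prems by (simp add: u trig_valid_Cons)
  have "sphase l 0 x = sphase l 0 (\<lambda>r. 0)"
    unfolding sphase_def
  proof (rule phase_cong)
    fix r assume "r \<in> snd ` set l"
    then have "min r 0 = 0" using l by auto
    then show "x (min r 0) = 0" using assms(2) by simp
  qed
  then show ?case using Cons by (simp add: u Gfun_Cons trig_valid_Cons)
qed simp

lemma Gfun_measurable:
  assumes "trig_valid T ts"
  shows "(\<lambda>x0. Gfun T ts t x x0) \<in> borel_measurable borel"
  using assms
proof (induction ts)
  case (Cons u ts)
  obtain a b l where u: "u = (a, b, l)" by (cases u)
  have [measurable]: "a \<in> borel_measurable borel" "(\<lambda>x0. Gfun T ts t x x0) \<in> borel_measurable borel"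
    using Cons by (auto simp: u trig_valid_Cons)
  show ?case unfolding u Gfun_Cons by measurable
next
  case Nil
  have eq: "Gfun T [] t x = (\<lambda>x0. 0)" by (rule ext) simp
  show ?case unfolding eq by (rule borel_measurable_const)
qed

context girsanov
begin

lemma G_T: "G T w = trig_fun ts (\<lambda>q. Y q w, X w)"
  unfolding G_def by (rule Gfun_T[OF ts])

lemma Z_0: "w \<in> space M \<Longrightarrow> Z 0 w = Gfun T ts 0 (\<lambda>r. 0) (X w)"
  unfolding Z_def G_def using Gfun_0[OF ts, of "\<lambda>q. Y q w"] W_zero by (simp add: Y_def)

lemma ln_ratio:
  assumes "w \<in> space M"
  shows "ln (ratio w) = ln (G T w) - time_integral (\<lambda>q. \<phi> q w \<bullet> \<psi> q w) 0 T - ln (Gfun T ts 0 (\<lambda>r. 0) (X w))"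
proof -
  have "0 < G T w" using G_ge[OF T_mem assms] \<delta>_pos by simp
  then have "ln (Z T w) = ln (G T w) - time_integral (\<lambda>q. \<phi> q w \<bullet> \<psi> q w) 0 T"
    unfolding Z_def by (simp add: ln_mult)
  then show ?thesis
    unfolding ratio_def using Z_pos[OF T_mem assms] Z_pos[OF zero_mem assms] by (simp add: ln_div Z_0[OF assms])
qed

lemma G_measurable: "r \<in> {0..T} \<Longrightarrow> G r \<in> borel_measurable M"
  by (intro measurable_F[OF _ progressive_adapted[OF G_progressive]])

lemma ln_G_integrable: "r \<in> {0..T} \<Longrightarrow> integrable M (\<lambda>w. ln (G r w))"
proof -
  assume r: "r \<in> {0..T}"
  obtain K where K: "0 \<le> K" "\<And>t x x0. \<bar>Gfun T ts t x x0\<bar> \<le> K" using Gfun_Vfun_bounded[OF ts] by blast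
  note [measurable] = G_measurable[OF r]
  show ?thesis
  proof (rule bounded_integrable)
    fix w assume w: "w \<in> space M"
    have "\<delta> \<le> G r w" "G r w \<le> K" using G_ge[OF r w] K(2)[of r "\<lambda>q. Y q w" "X w"] by (auto simp: G_def)
    then have "ln \<delta> \<le> ln (G r w)" "ln (G r w) \<le> ln K" using \<delta>_pos by (simp_all add: ln_mono)
    then show "norm (ln (G r w)) \<le> max \<bar>ln \<delta>\<bar> \<bar>ln K\<bar>" by auto
  qed measurable
qed

lemma square_path: "bdd_path T K \<alpha> \<Longrightarrow> bdd_path T (K * K) (\<lambda>r. (norm (\<alpha> r))\<^sup>2)" for \<alpha> :: "real \<Rightarrow> real ^ 'n"
  using bdd_path_inner[of T K \<alpha> K \<alpha>] by (simp add: power2_norm_eq_inner)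

lemma time_integral_integrable:
  fixes h :: "real \<Rightarrow> 'w \<Rightarrow> real"
  assumes "progressive T F h" "\<And>r w. r \<in> {0..T} \<Longrightarrow> w \<in> space M \<Longrightarrow> norm (h r w) \<le> K"
  shows "integrable M (\<lambda>w. time_integral (\<lambda>r. h r w) 0 T)"
proof (rule bounded_integrable)
  show "(\<lambda>w. time_integral (\<lambda>r. h r w) 0 T) \<in> borel_measurable M"
    by (rule measurable_F[OF T_mem time_integral_adapted[OF assms(1) T_mem]])
  fix w assume w: "w \<in> space M"
  show "norm (time_integral (\<lambda>r. h r w) 0 T) \<le> K * (T - 0)"
    by (rule norm_time_integral_le[OF progressive_bdd_path[OF assms(1) w assms(2)[OF _ w]]]) (use T_pos in auto)
qed

text \<open>\<open>energy_le_M\<close> bounds half the \<phi>-energy by the mean of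
  \<open>- ln ratio\<close>, which contains the integral of \<open>\<phi> \<bullet> \<psi>\<close>.
  Replacing this product by half of \<open>|\<phi>|^2 + |\<psi>|^2\<close> produces the same
  \<phi>-energy on the right; it cancels, and half the \<psi>-energy remains.\<close>

lemma ln_lower:
  "(\<integral>w. - ln (Gfun T ts 0 (\<lambda>r. 0) (X w)) \<partial>M) \<le>
    (\<integral>w. - ln (trig_fun ts (\<lambda>q. Y q w, X w)) \<partial>M) + (\<integral>w. time_integral (\<lambda>r. (norm (\<psi> r w))\<^sup>2) 0 T / 2 \<partial>M)"
proof -
  have psq: "progressive T F (\<lambda>r w. (norm (h r w))\<^sup>2)" if "progressive T F h" for h :: "real \<Rightarrow> 'w \<Rightarrow> real ^ 'n"
    by (rule progressive_compose[OF that]) measurable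
  have i\<phi>: "integrable M (\<lambda>w. time_integral (\<lambda>r. (norm (\<phi> r w))\<^sup>2) 0 T / 2)"
    using \<phi>_bound by (intro integrable_divide time_integral_integrable[OF psq[OF \<phi>_progressive], of "K\<phi>\<^sup>2"]) (auto intro!: power_mono)
  have i\<psi>: "integrable M (\<lambda>w. time_integral (\<lambda>r. (norm (\<psi> r w))\<^sup>2) 0 T / 2)"
    using \<psi>_bound by (intro integrable_divide time_integral_integrable[OF psq[OF \<psi>], of "K\<psi>\<^sup>2"]) (auto intro!: power_mono)
  have i\<phi>\<psi>: "integrable M (\<lambda>w. time_integral (\<lambda>r. \<phi> r w \<bullet> \<psi> r w) 0 T)"
    by (rule time_integral_integrable[OF \<phi>\<psi>_progressive, of "K\<phi> * K\<psi>"]) (use \<phi>\<psi>_path in \<open>auto simp: bdd_path_def\<close>)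
  have iG: "integrable M (\<lambda>w. ln (G T w))" by (rule ln_G_integrable[OF T_mem])
  have G0: "G 0 w = Gfun T ts 0 (\<lambda>r. 0) (X w)" if "w \<in> space M" for w
    unfolding Z_0[OF that, symmetric] Z_def by simp
  have iG0: "integrable M (\<lambda>w. ln (Gfun T ts 0 (\<lambda>r. 0) (X w)))"
    by (rule Bochner_Integration.integrable_cong[THEN iffD1, OF refl _ ln_G_integrable[OF zero_mem]]) (simp add: G0)
  have "(\<integral>w. - ln (ratio w) \<partial>M) =
      (\<integral>w. - ln (G T w) + time_integral (\<lambda>q. \<phi> q w \<bullet> \<psi> q w) 0 T + ln (Gfun T ts 0 (\<lambda>r. 0) (X w)) \<partial>M)"
    by (intro Bochner_Integration.integral_cong refl) (simp add: ln_ratio)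
  also have "\<dots> \<le> (\<integral>w. - ln (G T w) + (time_integral (\<lambda>r. (norm (\<phi> r w))\<^sup>2) 0 T / 2 + time_integral (\<lambda>r. (norm (\<psi> r w))\<^sup>2) 0 T / 2)
      + ln (Gfun T ts 0 (\<lambda>r. 0) (X w)) \<partial>M)"
  proof (rule integral_mono)
    fix w assume w: "w \<in> space M"
    note b1 = square_path[OF \<phi>_path[OF w]] and b2 = square_path[OF \<psi>_path[OF w]]
    have "0 \<le> time_integral (\<lambda>r. (norm (\<phi> r w))\<^sup>2 + (norm (\<psi> r w))\<^sup>2 - (\<phi> r w \<bullet> \<psi> r w) * 2) 0 T"
    proof (rule time_integral_nonneg)
      fix r
      have "0 \<le> (\<phi> r w - \<psi> r w) \<bullet> (\<phi> r w - \<psi> r w)" by simp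
      then show "0 \<le> (norm (\<phi> r w))\<^sup>2 + (norm (\<psi> r w))\<^sup>2 - (\<phi> r w \<bullet> \<psi> r w) * 2"
        by (simp add: power2_norm_eq_inner inner_diff_left inner_diff_right inner_commute)
    qed
    also have "\<dots> = time_integral (\<lambda>r. (norm (\<phi> r w))\<^sup>2) 0 T + time_integral (\<lambda>r. (norm (\<psi> r w))\<^sup>2) 0 T -
        time_integral (\<lambda>r. \<phi> r w \<bullet> \<psi> r w) 0 T * 2"
    proof -
      have "time_integral (\<lambda>r. (norm (\<phi> r w))\<^sup>2 + (norm (\<psi> r w))\<^sup>2 - (\<phi> r w \<bullet> \<psi> r w) * 2) 0 T =
          time_integral (\<lambda>r. (norm (\<phi> r w))\<^sup>2 + (norm (\<psi> r w))\<^sup>2) 0 T - time_integral (\<lambda>r. (\<phi> r w \<bullet> \<psi> r w) * 2) 0 T"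
        by (rule time_integral_diff[OF bdd_path_add[OF b1 b2] bdd_path_times[OF \<phi>\<psi>_path[OF w] bdd_path_const]]) simp_all
      then show ?thesis unfolding time_integral_mult_left using time_integral_add[OF b1 b2, of 0 T] by simp
    qed
    finally show "- ln (G T w) + time_integral (\<lambda>q. \<phi> q w \<bullet> \<psi> q w) 0 T + ln (Gfun T ts 0 (\<lambda>r. 0) (X w)) \<le>
        - ln (G T w) + (time_integral (\<lambda>r. (norm (\<phi> r w))\<^sup>2) 0 T / 2 + time_integral (\<lambda>r. (norm (\<psi> r w))\<^sup>2) 0 T / 2)
      + ln (Gfun T ts 0 (\<lambda>r. 0) (X w))" by simp
  qed (use iG iG0 i\<phi> i\<psi> i\<phi>\<psi> in auto)
  finally show ?thesis using energy_le_M iG iG0 i\<phi> i\<psi> by (simp add: G_T)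
qed

end

section \<open>From bounded to square-integrable controls\<close>

lemma time_integral_continuous_integrable:
  fixes \<alpha> :: "real \<Rightarrow> 'b::{banach, second_countable_topology}"
  assumes i: "set_integrable lborel {0..T} \<alpha>"
  shows "continuous_on {0..T} (time_integral \<alpha> 0)"
  unfolding continuous_on_sequentially
proof (intro allI ballI impI)
  fix s t assume t: "t \<in> {0..T}" and "(\<forall>n. s n \<in> {0..T}) \<and> s \<longlonglongrightarrow> t"
  then have s: "\<And>n. s n \<in> {0..T}" "s \<longlonglongrightarrow> t" by auto
  let ?g = "\<lambda>r. indicator {0..T} r *\<^sub>R \<alpha> r"
  have g: "integrable lborel ?g" using i by (simp add: set_integrable_def)
  note [measurable] = borel_measurable_integrable[OF g]
  have eq: "indicator {0..u} r *\<^sub>R \<alpha> r = indicator {0..u} r *\<^sub>R ?g r" if "u \<in> {0..T}" for u r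
    using that by (auto split: split_indicator)
  have "(\<lambda>n. \<integral>r. indicator {0..s n} r *\<^sub>R ?g r \<partial>lborel) \<longlonglongrightarrow> (\<integral>r. indicator {0..t} r *\<^sub>R ?g r \<partial>lborel)"
  proof (rule integral_dominated_convergence[OF _ _ integrable_norm[OF g]])
    show "AE r in lborel. (\<lambda>n. indicator {0..s n} r *\<^sub>R ?g r) \<longlonglongrightarrow> indicator {0..t} r *\<^sub>R ?g r"
      using AE_lborel_singleton[of t]
    proof eventually_elim
      case (elim r)
      have "\<forall>\<^sub>F n in sequentially. (indicator {0..s n} r :: real) = indicator {0..t} r"
      proof (cases "r < t")
        case True
        then have "\<forall>\<^sub>F n in sequentially. r < s n" using order_tendstoD(1)[OF s(2)] by auto
        then show ?thesis by eventually_elim (use True in \<open>auto split: split_indicator\<close>)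
      next
        case False
        then have "t < r" using elim by simp
        then have "\<forall>\<^sub>F n in sequentially. s n < r" using order_tendstoD(2)[OF s(2)] by auto
        then show ?thesis by eventually_elim (use \<open>t < r\<close> in \<open>auto split: split_indicator\<close>)
      qed
      then have "\<forall>\<^sub>F n in sequentially. indicator {0..s n} r *\<^sub>R ?g r = indicator {0..t} r *\<^sub>R ?g r"
        by eventually_elim simp
      then show ?case by (rule tendsto_eventually)
    qed
    show "AE r in lborel. norm (indicator {0..s n} r *\<^sub>R ?g r) \<le> norm (?g r)" for n
      by (auto split: split_indicator)
  qed measurable
  then show "(time_integral \<alpha> 0 \<circ> s) \<longlonglongrightarrow> time_integral \<alpha> 0 t"
    unfolding time_integral_def set_lebesgue_integral_def o_def eq[OF t] eq[OF s(1)] .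
qed

context brownian
begin

definition energy :: "(real \<Rightarrow> 'w \<Rightarrow> real ^ 'n) \<Rightarrow> 'w \<Rightarrow> real" where
  "energy \<psi> w = time_integral (\<lambda>r. (norm (\<psi> r w))\<^sup>2) 0 T"

text \<open>Off this set the time integrals may take the default value 0 and the controlled path may
  fail to be continuous; for a control it has full measure.\<close>

definition good :: "(real \<Rightarrow> 'w \<Rightarrow> real ^ 'n) \<Rightarrow> 'w set" where
  "good \<psi> = {w \<in> space M. (\<integral>\<^sup>+r\<in>{0..T}. ennreal ((norm (\<psi> r w))\<^sup>2) \<partial>lborel) < \<infinity>}"

definition controlled :: "(real \<Rightarrow> 'w \<Rightarrow> real ^ 'n) \<Rightarrow> real \<Rightarrow> 'w \<Rightarrow> real ^ 'n" where
  "controlled \<psi> t w = W t w + time_integral (\<lambda>r. \<psi> r w) 0 t"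

lemma control_facts:
  assumes \<psi>: "\<psi> \<in> controls T M F"
  shows "progressive T F \<psi>" "good \<psi> \<in> sets M" "AE w in M. w \<in> good \<psi>" "integrable M (energy \<psi>)"
    and "\<And>w. w \<in> good \<psi> \<Longrightarrow> set_integrable lborel {0..T} (\<lambda>r. \<psi> r w)"
    and "\<And>w. w \<in> good \<psi> \<Longrightarrow> set_integrable lborel {0..T} (\<lambda>r. (norm (\<psi> r w))\<^sup>2)"
proof -
  have T: "T \<in> {0..T}" using T_pos by simp
  show p: "progressive T F \<psi>" using \<psi> by (simp add: controls_def progressively_measurable_iff)
  have fin: "(\<integral>\<^sup>+w. (\<integral>\<^sup>+r\<in>{0..T}. ennreal ((norm (\<psi> r w))\<^sup>2) \<partial>lborel) \<partial>M) < \<infinity>"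
    using \<psi> by (simp add: controls_def)
  have psq: "progressive T F (\<lambda>r w. (norm (\<psi> r w))\<^sup>2)" by (rule progressive_compose[OF p]) measurable
  have eq: "ennreal ((norm (\<psi> r w))\<^sup>2) * indicator {0..T} r = ennreal ((norm (\<psi> (clip T r) w))\<^sup>2) * indicator {0..T} r" for r w
    by (auto simp: clip_id split: split_indicator)
  have sw: "(\<lambda>p. (snd p, fst p)) \<in> measurable (M \<Otimes>\<^sub>M lborel) (borel \<Otimes>\<^sub>M M)" by measurable
  have m1: "(\<lambda>p. (norm (\<psi> (clip T (snd p)) (fst p)))\<^sup>2) \<in> borel_measurable (M \<Otimes>\<^sub>M lborel)"
    using measurable_compose[OF sw progressive_joint[OF psq T]] by simp
  have inner: "(\<lambda>w. \<integral>\<^sup>+r\<in>{0..T}. ennreal ((norm (\<psi> r w))\<^sup>2) \<partial>lborel) \<in> borel_measurable M"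
    unfolding eq
  proof (rule lborel.borel_measurable_nn_integral)
    note [measurable] = m1
    have "(\<lambda>p. ennreal ((norm (\<psi> (clip T (snd p)) (fst p)))\<^sup>2) * indicator {0..T} (snd p)) \<in> borel_measurable (M \<Otimes>\<^sub>M lborel)"
      by measurable
    then show "(\<lambda>(w, r). ennreal ((norm (\<psi> (clip T r) w))\<^sup>2) * indicator {0..T} r) \<in> borel_measurable (M \<Otimes>\<^sub>M lborel)"
      by (simp add: split_beta')
  qed
  show "good \<psi> \<in> sets M" unfolding good_def using inner by measurable
  have "AE w in M. (\<integral>\<^sup>+r\<in>{0..T}. ennreal ((norm (\<psi> r w))\<^sup>2) \<partial>lborel) \<noteq> \<infinity>"
    by (rule nn_integral_noteq_infinite[OF inner]) (use fin in auto)
  then show "AE w in M. w \<in> good \<psi>" using AE_space by eventually_elim (simp add: good_def less_top)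
  have sec: "(\<lambda>r. indicator {0..T} r *\<^sub>R \<psi> r w) \<in> borel_measurable lborel" if "w \<in> space M" for w
  proof -
    have [measurable]: "(\<lambda>r. \<psi> (clip T r) w) \<in> borel_measurable borel" by (rule progressive_section[OF p T that])
    have "(\<lambda>r. indicator {0..T} r *\<^sub>R \<psi> (clip T r) w) \<in> borel_measurable lborel" by measurable
    moreover have "(\<lambda>r. indicator {0..T} r *\<^sub>R \<psi> (clip T r) w) = (\<lambda>r. indicator {0..T} r *\<^sub>R \<psi> r w)"
      by (auto simp: fun_eq_iff clip_id split: split_indicator)
    ultimately show ?thesis by simp
  qed
  have secsq: "(\<lambda>r. indicator {0..T} r *\<^sub>R (norm (\<psi> r w))\<^sup>2) \<in> borel_measurable lborel" if "w \<in> space M" for w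
  proof -
    have "(\<lambda>r. (norm (indicator {0..T} r *\<^sub>R \<psi> r w))\<^sup>2) \<in> borel_measurable lborel" using sec[OF that] by measurable
    moreover have "(\<lambda>r. (norm (indicator {0..T} r *\<^sub>R \<psi> r w))\<^sup>2) = (\<lambda>r. indicator {0..T} r *\<^sub>R (norm (\<psi> r w))\<^sup>2)"
      by (auto simp: fun_eq_iff split: split_indicator)
    ultimately show ?thesis by simp
  qed
  have nn: "(\<integral>\<^sup>+r\<in>{0..T}. ennreal ((norm (\<psi> r w))\<^sup>2) \<partial>lborel) = (\<integral>\<^sup>+r. ennreal (indicator {0..T} r *\<^sub>R (norm (\<psi> r w))\<^sup>2) \<partial>lborel)" for w
    by (intro nn_integral_cong) (simp split: split_indicator)
  show sq: "set_integrable lborel {0..T} (\<lambda>r. (norm (\<psi> r w))\<^sup>2)" if "w \<in> good \<psi>" for w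
    unfolding set_integrable_def
    by (rule integrableI_nonneg[OF secsq]) (use that nn[of w] in \<open>auto simp: good_def\<close>)
  show "set_integrable lborel {0..T} (\<lambda>r. \<psi> r w)" if w: "w \<in> good \<psi>" for w
    unfolding set_integrable_def
  proof (rule Bochner_Integration.integrable_bound)
    show "integrable lborel (\<lambda>r. indicator {0..T} r + indicator {0..T} r *\<^sub>R (norm (\<psi> r w))\<^sup>2)"
      using sq[OF w] T_pos by (intro Bochner_Integration.integrable_add) (auto simp: set_integrable_def)
    show "(\<lambda>r. indicator {0..T} r *\<^sub>R \<psi> r w) \<in> borel_measurable lborel" using sec w by (simp add: good_def)
    \<comment> \<open>On a bounded interval square integrability thus gives integrability.\<close>
    have "x \<le> 1 + x\<^sup>2" for x :: real
      using zero_le_power2[of "x - 1"] by (simp add: power2_diff) (smt (verit) zero_le_power2)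
    then show "AE r in lborel. norm (indicator {0..T} r *\<^sub>R \<psi> r w) \<le> norm (indicator {0..T} r + indicator {0..T} r *\<^sub>R (norm (\<psi> r w))\<^sup>2)"
      by (auto split: split_indicator)
  qed
  show "integrable M (energy \<psi>)"
  proof (rule integrableI_nonneg)
    show m: "energy \<psi> \<in> borel_measurable M"
      unfolding energy_def[abs_def] by (rule measurable_F[OF T time_integral_adapted[OF psq T]])
    show "AE w in M. 0 \<le> energy \<psi> w" unfolding energy_def by (intro AE_I2 time_integral_nonneg) auto
    \<comment> \<open>Off \<open>good\<close> the right side is infinite, so the default value of
      the integral on the left is harmless.\<close>
    have le: "ennreal (energy \<psi> w) \<le> (\<integral>\<^sup>+r\<in>{0..T}. ennreal ((norm (\<psi> r w))\<^sup>2) \<partial>lborel)" if "w \<in> space M" for w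
    proof (cases "w \<in> good \<psi>")
      case True
      have "ennreal (energy \<psi> w) = (\<integral>\<^sup>+r. ennreal (indicator {0..T} r *\<^sub>R (norm (\<psi> r w))\<^sup>2) \<partial>lborel)"
        unfolding energy_def time_integral_def set_lebesgue_integral_def
        by (rule nn_integral_eq_integral[symmetric]) (use sq[OF True] in \<open>auto simp: set_integrable_def\<close>)
      then show ?thesis by (simp add: nn)
    next
      case False
      then have "\<not> (\<integral>\<^sup>+r\<in>{0..T}. ennreal ((norm (\<psi> r w))\<^sup>2) \<partial>lborel) < \<infinity>" using that by (simp add: good_def)
      then show ?thesis by (simp add: less_top[symmetric])
    qed
    have "(\<integral>\<^sup>+w. ennreal (energy \<psi> w) \<partial>M) \<le> (\<integral>\<^sup>+w. (\<integral>\<^sup>+r\<in>{0..T}. ennreal ((norm (\<psi> r w))\<^sup>2) \<partial>lborel) \<partial>M)"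
      by (rule nn_integral_mono) (rule le)
    then show "(\<integral>\<^sup>+w. ennreal (energy \<psi> w) \<partial>M) < \<infinity>" using fin by (rule le_less_trans)
  qed
qed

lemma controlled_continuous:
  assumes "\<psi> \<in> controls T M F" "w \<in> good \<psi>"
  shows "continuous_on {0..T} (\<lambda>t. controlled \<psi> t w)"
proof -
  have "w \<in> space M" using assms by (simp add: good_def)
  then show ?thesis unfolding controlled_def
    by (intro continuous_on_add W_continuous time_integral_continuous_integrable control_facts(5)[OF assms])
qed

text \<open>Values of \<psi> of norm above \<open>K\<close> are set to 0. This preserves progressive
  measurability, does not increase the energy on \<open>good\<close>, and makes the controlled paths
  converge there at every time. The logarithm of \<open>trig_fun ts\<close> is bounded and depends
  continuously on finitely many path values, so dominated convergence applies.\<close>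

lemma trig_lower_bound:
  fixes ts :: "(('a::topological_space \<Rightarrow> real) \<times> real \<times> ((real ^ 'n) \<times> real) list) list"
  assumes \<psi>: "\<psi> \<in> controls T M F" and X: "X \<in> borel_measurable (F 0)" and ts: "trig_valid T ts"
    and \<delta>: "0 < \<delta>" and ge: "\<And>x x0. continuous_on {0..T} x \<Longrightarrow> \<delta> \<le> trig_fun ts (x, x0)"
  shows "(\<integral>w. - ln (Gfun T ts 0 (\<lambda>r. 0) (X w)) \<partial>M) \<le>
    (\<integral>w. - ln (trig_fun ts (\<lambda>q. controlled \<psi> q w, X w)) \<partial>M) + (\<integral>w. energy \<psi> w / 2 \<partial>M)"
proof -
  have T: "T \<in> {0..T}" using T_pos by simp
  note facts = control_facts[OF \<psi>]
  define \<psi>K where "\<psi>K K r w = (if norm (\<psi> r w) \<le> real K then \<psi> r w else 0)" for K :: nat and r w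
  have pK: "progressive T F (\<psi>K K)" for K
    unfolding \<psi>K_def by (rule progressive_compose[OF facts(1), of "\<lambda>v. if norm v \<le> real K then v else 0"]) measurable
  have gK: "girsanov M T F W X (\<psi>K K) ts \<delta> (real K)" for K
    by (intro girsanov.intro brownian_axioms girsanov_axioms.intro X pK ts \<delta> ge) (auto simp: \<psi>K_def)
  obtain C where C: "\<And>p. \<bar>trig_fun ts p\<bar> \<le> C" using trig_fun_bounded[OF ts] by blast
  have lb: "norm (- ln (trig_fun ts (x, x0))) \<le> max \<bar>ln \<delta>\<bar> \<bar>ln C\<bar>" if "continuous_on {0..T} x" for x x0
  proof -
    have "\<delta> \<le> trig_fun ts (x, x0)" "trig_fun ts (x, x0) \<le> C" using ge[OF that] C[of "(x, x0)"] by auto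
    then have "ln \<delta> \<le> ln (trig_fun ts (x, x0))" "ln (trig_fun ts (x, x0)) \<le> ln C" using \<delta> by (simp_all add: ln_mono)
    then show ?thesis by auto
  qed
  have cK: "continuous_on {0..T} (\<lambda>t. controlled (\<psi>K K) t w)" if "w \<in> space M" for K w
    using girsanov.Y_continuous[OF gK that] by (simp add: girsanov.Y_def[OF gK] controlled_def)
  have XM: "X \<in> borel_measurable M" using T_pos by (intro measurable_F[OF _ X]) auto
  have cm: "(\<lambda>w. trig_fun ts (\<lambda>q. controlled (\<psi>K K) q w, X w)) \<in> borel_measurable M" for K
    using girsanov.G_measurable[OF gK T, of K] unfolding girsanov.G_T[OF gK, abs_def] girsanov.Y_def[OF gK] controlled_def .
  have eK: "energy (\<psi>K K) w \<le> energy \<psi> w" if w: "w \<in> good \<psi>" for K w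
  proof -
    have sp: "w \<in> space M" using w by (simp add: good_def)
    have "bdd_path T (real K * real K) (\<lambda>r. (norm (\<psi>K K r w))\<^sup>2)"
      by (rule girsanov.square_path[OF gK girsanov.\<psi>_path[OF gK sp]])
    then have "set_integrable lborel {0..T} (\<lambda>r. (norm (\<psi>K K r w))\<^sup>2)" by (rule bdd_path_integrable) auto
    then show ?thesis unfolding energy_def time_integral_def set_lebesgue_integral_def
      using facts(6)[OF w] by (intro integral_mono) (auto simp: set_integrable_def \<psi>K_def split: split_indicator)
  qed
  have ineq: "(\<integral>w. - ln (Gfun T ts 0 (\<lambda>r. 0) (X w)) \<partial>M) \<le>
      (\<integral>w. - ln (trig_fun ts (\<lambda>q. controlled (\<psi>K K) q w, X w)) \<partial>M) + (\<integral>w. energy \<psi> w / 2 \<partial>M)" for K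
  proof -
    have psq: "progressive T F (\<lambda>r w. (norm (\<psi>K K r w))\<^sup>2)" by (rule progressive_compose[OF pK]) measurable
    have sb: "norm ((norm (\<psi>K K r w))\<^sup>2) \<le> (real K)\<^sup>2" for r w
      using power_mono[of "norm (\<psi> r w)" "real K" 2] by (simp add: \<psi>K_def)
    have "integrable M (\<lambda>w. time_integral (\<lambda>r. (norm (\<psi>K K r w))\<^sup>2) 0 T)"
      by (rule girsanov.time_integral_integrable[OF gK psq]) (rule sb)
    then have iK: "integrable M (energy (\<psi>K K))" by (simp add: energy_def[abs_def])
    have "(\<integral>w. energy (\<psi>K K) w / 2 \<partial>M) \<le> (\<integral>w. energy \<psi> w / 2 \<partial>M)"
    proof (rule integral_mono_AE)
      show "AE w in M. energy (\<psi>K K) w / 2 \<le> energy \<psi> w / 2" using facts(3) by eventually_elim (simp add: eK)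
    qed (use iK facts(4) in auto)
    then show ?thesis
      using girsanov.ln_lower[OF gK, of K] unfolding girsanov.Y_def[OF gK] controlled_def energy_def by linarith
  qed
  have tK: "(\<lambda>K. controlled (\<psi>K K) t w) \<longlonglongrightarrow> controlled \<psi> t w" if w: "w \<in> good \<psi>" and t: "t \<in> {0..T}" for t w
  proof -
    have sp: "w \<in> space M" using w by (simp add: good_def)
    have it: "set_integrable lborel {0..t} (\<lambda>r. \<psi> r w)"
      by (rule set_integrable_subset[OF facts(5)[OF w]]) (use t in auto)
    have "(\<lambda>K. \<integral>r. indicator {0..t} r *\<^sub>R \<psi>K K r w \<partial>lborel) \<longlonglongrightarrow> (\<integral>r. indicator {0..t} r *\<^sub>R \<psi> r w \<partial>lborel)"
    proof (rule integral_dominated_convergence[where w="\<lambda>r. norm (indicator {0..t} r *\<^sub>R \<psi> r w)"])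
      show "(\<lambda>r. indicator {0..t} r *\<^sub>R \<psi> r w) \<in> borel_measurable lborel" using it by (simp add: set_integrable_def)
      show "(\<lambda>r. indicator {0..t} r *\<^sub>R \<psi>K K r w) \<in> borel_measurable lborel" for K
        using bdd_path_indicator_measurable[OF girsanov.\<psi>_path[OF gK sp], of "{0..t}"] t by simp
      show "integrable lborel (\<lambda>r. norm (indicator {0..t} r *\<^sub>R \<psi> r w))"
        using it unfolding set_integrable_def by (rule integrable_norm)
      show "AE r in lborel. (\<lambda>K. indicator {0..t} r *\<^sub>R \<psi>K K r w) \<longlonglongrightarrow> indicator {0..t} r *\<^sub>R \<psi> r w"
      proof (rule AE_I2)
        fix r
        obtain N :: nat where "norm (\<psi> r w) \<le> real N" using real_arch_simple by blast
        then have "\<forall>K\<ge>N. \<psi>K K r w = \<psi> r w" by (auto simp: \<psi>K_def)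
        then have "\<forall>\<^sub>F K in sequentially. indicator {0..t} r *\<^sub>R \<psi>K K r w = indicator {0..t} r *\<^sub>R \<psi> r w"
          by (auto simp: eventually_sequentially)
        then show "(\<lambda>K. indicator {0..t} r *\<^sub>R \<psi>K K r w) \<longlonglongrightarrow> indicator {0..t} r *\<^sub>R \<psi> r w"
          by (rule tendsto_eventually)
      qed
    qed (auto simp: \<psi>K_def split: split_indicator)
    then show ?thesis unfolding controlled_def time_integral_def set_lebesgue_integral_def by (intro tendsto_intros)
  qed
  have lim: "AE w in M. (\<lambda>K. - ln (trig_fun ts (\<lambda>q. controlled (\<psi>K K) q w, X w))) \<longlonglongrightarrow> - ln (trig_fun ts (\<lambda>q. controlled \<psi> q w, X w))"
    using facts(3)
  proof eventually_elim
    case (elim w)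
    have "0 < trig_fun ts (\<lambda>q. controlled \<psi> q w, X w)" using ge[OF controlled_continuous[OF \<psi> elim]] \<delta> by (rule less_le_trans[rotated])
    moreover have "(\<lambda>K. trig_fun ts (\<lambda>q. controlled (\<psi>K K) q w, X w)) \<longlonglongrightarrow> trig_fun ts (\<lambda>q. controlled \<psi> q w, X w)"
      by (rule trig_fun_tendsto[OF ts]) (rule tK[OF elim])
    ultimately show ?case by (intro tendsto_minus tendsto_ln) auto
  qed
  have mlim: "(\<lambda>w. trig_fun ts (\<lambda>q. controlled \<psi> q w, X w)) \<in> borel_measurable M"
  proof -
    have c: "(\<lambda>w. controlled \<psi> r w) \<in> borel_measurable M" if "r \<in> {0..T}" for r
      unfolding controlled_def by (intro borel_measurable_add W_measurable measurable_F[OF _ time_integral_adapted[OF facts(1)]] that)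
    have "(\<lambda>w. (\<lambda>q\<in>{0..T}. controlled \<psi> q w, X w)) \<in> measurable M (path_sigma T)"
      by (rule measurable_path_sigmaI) (use c XM in auto)
    moreover have "trig_fun ts \<in> borel_measurable (path_sigma T)"
      by (rule measurable_trig_functions) (use ts in \<open>auto simp: trig_functions_def\<close>)
    ultimately have "(\<lambda>w. trig_fun ts (\<lambda>q\<in>{0..T}. controlled \<psi> q w, X w)) \<in> borel_measurable M"
      by (rule measurable_compose)
    moreover have "trig_fun ts (\<lambda>q\<in>{0..T}. controlled \<psi> q w, X w) = trig_fun ts (\<lambda>q. controlled \<psi> q w, X w)" for w
      by (rule trig_fun_cong[OF ts]) simp
    ultimately show ?thesis by simp
  qed
  have "(\<lambda>K. \<integral>w. - ln (trig_fun ts (\<lambda>q. controlled (\<psi>K K) q w, X w)) \<partial>M) \<longlonglongrightarrow> (\<integral>w. - ln (trig_fun ts (\<lambda>q. controlled \<psi> q w, X w)) \<partial>M)"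
    by (rule integral_dominated_convergence[where w="\<lambda>_. max \<bar>ln \<delta>\<bar> \<bar>ln C\<bar>",
          OF borel_measurable_uminus[OF borel_measurable_ln[OF mlim]] borel_measurable_uminus[OF borel_measurable_ln[OF cm]] _ lim])
       (simp, rule AE_I2, rule lb, rule cK)
  then have "(\<lambda>K. (\<integral>w. - ln (trig_fun ts (\<lambda>q. controlled (\<psi>K K) q w, X w)) \<partial>M) + (\<integral>w. energy \<psi> w / 2 \<partial>M)) \<longlonglongrightarrow>
      (\<integral>w. - ln (trig_fun ts (\<lambda>q. controlled \<psi> q w, X w)) \<partial>M) + (\<integral>w. energy \<psi> w / 2 \<partial>M)"
    by (intro tendsto_intros)
  then show ?thesis by (rule LIMSEQ_le_const) (use ineq in auto)
qed

end

lemma abs_ln_diff_le: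
  fixes a b :: real
  assumes "0 < \<delta>" "\<delta> \<le> a" "\<delta> \<le> b"
  shows "\<bar>ln a - ln b\<bar> \<le> \<bar>a - b\<bar> / \<delta>"
proof -
  have *: "ln x - ln y \<le> \<bar>x - y\<bar> / \<delta>" if "\<delta> \<le> x" "\<delta> \<le> y" for x y :: real
  proof -
    have xy: "0 < x" "0 < y" using assms(1) that by auto
    have "ln x - ln y = ln (x / y)" using xy by (simp add: ln_divide_pos)
    also have "\<dots> \<le> x / y - 1" using xy by (intro ln_le_minus_one divide_pos_pos)
    also have "\<dots> = (x - y) / y" using xy by (simp add: diff_divide_distrib)
    also have "\<dots> \<le> \<bar>x - y\<bar> / y" using xy by (intro divide_right_mono) auto
    also have "\<dots> \<le> \<bar>x - y\<bar> / \<delta>" using assms(1) that by (intro divide_left_mono mult_pos_pos xy) auto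
    finally show ?thesis .
  qed
  from *[OF assms(2,3)] *[OF assms(3,2)] show ?thesis by (simp add: abs_minus_commute abs_le_iff)
qed

lemma measurable_trig_fun:
  fixes ts :: "(('a::topological_space \<Rightarrow> real) \<times> real \<times> ((real ^ 'n) \<times> real) list) list"
  assumes "trig_valid T ts"
  shows "trig_fun ts \<in> borel_measurable (path_measure_space T)"
  by (rule measurable_restrict_space1, rule measurable_trig_functions) (use assms in \<open>auto simp: trig_functions_def\<close>)

text \<open>On a null set all of whose subsets are measurable, a function may be altered at will
  within the target space.\<close>

lemma measurable_modification:
  assumes g: "g \<in> measurable M N" and Q: "Q \<in> null_sets M" "\<And>A. A \<subseteq> Q \<Longrightarrow> A \<in> sets M"
    and eq: "\<And>x. x \<in> space M - Q \<Longrightarrow> h x = g x" and h: "\<And>x. x \<in> space M \<Longrightarrow> h x \<in> space N"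
  shows "h \<in> measurable M N"
proof (rule measurableI)
  fix S assume S: "S \<in> sets N"
  have eq': "h -` S \<inter> space M = (g -` S \<inter> space M - Q) \<union> (h -` S \<inter> space M \<inter> Q)" using eq by auto
  have "g -` S \<inter> space M - Q \<in> sets M" using measurable_sets[OF g S] Q(1) by auto
  moreover have "h -` S \<inter> space M \<inter> Q \<in> sets M" by (rule Q(2)) auto
  ultimately have "(g -` S \<inter> space M - Q) \<union> (h -` S \<inter> space M \<inter> Q) \<in> sets M" by (rule sets.Un)
  with eq' show "h -` S \<inter> space M \<in> sets M" by (rule ssubst)
qed (rule h)

context brownian
begin

text \<open>The zero path is substituted off \<open>good\<close>, so that the result always lies in
  the set of paths on which \<open>f\<close> is measurable and bounded.\<close>

definition regular_path :: "(real \<Rightarrow> 'w \<Rightarrow> real ^ 'n) \<Rightarrow> 'w \<Rightarrow> real \<Rightarrow> real ^ 'n" where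
  "regular_path \<psi> w = (\<lambda>t\<in>{0..T}. if w \<in> good \<psi> then controlled \<psi> t w else 0)"

lemma regular_path_cpaths:
  assumes "\<psi> \<in> controls T M F"
  shows "regular_path \<psi> w \<in> cpaths T"
proof -
  have "continuous_on {0..T} (\<lambda>t. if w \<in> good \<psi> then controlled \<psi> t w else 0)"
    using controlled_continuous[OF assms, of w] by (cases "w \<in> good \<psi>") auto
  then have "continuous_on {0..T} (regular_path \<psi> w)" unfolding regular_path_def by (rule continuous_on_eq) simp
  then show ?thesis by (simp add: cpaths_def regular_path_def)
qed

lemma regular_path_measurable:
  assumes \<psi>: "\<psi> \<in> controls T M F" and X: "X \<in> borel_measurable M"
  shows "(\<lambda>w. (regular_path \<psi> w, X w)) \<in> measurable M (path_measure_space T)"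
proof (rule measurable_path_measure_spaceI[OF _ X])
  fix t assume t: "t \<in> {0..T}"
  have [measurable]: "(\<lambda>w. controlled \<psi> t w) \<in> borel_measurable M"
    unfolding controlled_def
    by (intro borel_measurable_add W_measurable measurable_F[OF _ time_integral_adapted[OF control_facts(1)[OF \<psi>]]] t)
  have [measurable]: "good \<psi> \<in> sets M" by (rule control_facts(2)[OF \<psi>])
  have "(\<lambda>w. if w \<in> good \<psi> then controlled \<psi> t w else 0) \<in> borel_measurable M" by measurable
  then show "(\<lambda>w. regular_path \<psi> w t) \<in> borel_measurable M" using t by (simp add: regular_path_def)
qed (rule regular_path_cpaths[OF \<psi>])

lemma bad_null:
  assumes \<psi>: "\<psi> \<in> controls T M F"
  shows "space M - good \<psi> \<in> null_sets M"
proof -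
  have "space M - good \<psi> \<in> sets M" using control_facts(2)[OF \<psi>] by simp
  moreover have "AE w in M. w \<notin> space M - good \<psi>" using control_facts(3)[OF \<psi>] by eventually_elim simp
  ultimately show ?thesis by (simp only: AE_iff_null_sets)
qed

text \<open>Completeness makes \<open>h\<close> measurable although nothing is known about it on the
  null set off \<open>good\<close>.\<close>

lemma complete_modification:
  fixes h :: "'w \<Rightarrow> real"
  assumes compl: "complete_filtration M F" and \<psi>: "\<psi> \<in> controls T M F"
    and g: "g \<in> borel_measurable M" and eq: "\<And>w. w \<in> good \<psi> \<Longrightarrow> h w = g w"
  shows "h \<in> borel_measurable M" "(\<integral>w. h w \<partial>M) = (\<integral>w. g w \<partial>M)"
proof -
  show h: "h \<in> borel_measurable M"
  proof (rule measurable_modification[OF g bad_null[OF \<psi>]])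
    fix A assume "A \<subseteq> space M - good \<psi>"
    then have "A \<in> sets (F 0)" using compl bad_null[OF \<psi>] unfolding complete_filtration_def by blast
    then show "A \<in> sets M" using sets_F[of 0] T_pos by auto
  qed (use eq in auto)
  show "(\<integral>w. h w \<partial>M) = (\<integral>w. g w \<partial>M)"
    by (rule integral_cong_AE[OF h g]) (use control_facts(3)[OF \<psi>] eq in \<open>auto elim!: eventually_mono\<close>)
qed

text \<open>Along the regular path both summands are integrable, so the single integral in
  \<open>control_cost\<close> can be split.\<close>

lemma control_cost_eq:
  assumes compl: "complete_filtration M F" and \<psi>: "\<psi> \<in> controls T M F" and X: "X \<in> borel_measurable M"
    and f: "f \<in> borel_measurable (path_measure_space T)" "\<And>p. p \<in> cpaths T \<times> UNIV \<Longrightarrow> \<bar>f p\<bar> \<le> K"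
  shows "control_cost T f M W X \<psi> = (\<integral>w. energy \<psi> w / 2 \<partial>M) + (\<integral>w. f (regular_path \<psi> w, X w) \<partial>M)"
proof -
  have m: "(\<lambda>w. f (regular_path \<psi> w, X w)) \<in> borel_measurable M"
    by (rule measurable_compose[OF regular_path_measurable[OF \<psi> X] f(1)])
  have i: "integrable M (\<lambda>w. f (regular_path \<psi> w, X w))"
    by (rule bounded_integrable[OF m, of K]) (simp add: f(2) regular_path_cpaths[OF \<psi>])
  have e: "integrable M (\<lambda>w. energy \<psi> w / 2)" by (intro integrable_divide control_facts(4)[OF \<psi>])
  have "control_cost T f M W X \<psi> = (\<integral>w. energy \<psi> w / 2 + f (regular_path \<psi> w, X w) \<partial>M)"
    unfolding control_cost_def
  proof (rule complete_modification(2)[OF compl \<psi>])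
    show "(\<lambda>w. energy \<psi> w / 2 + f (regular_path \<psi> w, X w)) \<in> borel_measurable M"
      by (intro borel_measurable_add borel_measurable_integrable e m)
    fix w assume "w \<in> good \<psi>"
    then have "controlled_path T W \<psi> w = regular_path \<psi> w"
      by (auto simp: controlled_path_def regular_path_def controlled_def time_integral_def fun_eq_iff)
    then show "1 / 2 * (LBINT s:{0..T}. (norm (\<psi> s w))\<^sup>2) + f (controlled_path T W \<psi> w, X w) =
        energy \<psi> w / 2 + f (regular_path \<psi> w, X w)"
      by (simp add: energy_def time_integral_def)
  qed
  also have "\<dots> = (\<integral>w. energy \<psi> w / 2 \<partial>M) + (\<integral>w. f (regular_path \<psi> w, X w) \<partial>M)"
    by (rule Bochner_Integration.integral_add[OF e i])
  finally show ?thesis .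
qed

lemma brownian_path_measurable:
  assumes "X \<in> borel_measurable M"
  shows "(\<lambda>w. (\<lambda>t\<in>{0..T}. W t w, X w)) \<in> measurable M (path_measure_space T)"
proof (rule measurable_path_measure_spaceI[OF _ assms])
  fix w assume "w \<in> space M"
  then have "continuous_on {0..T} (\<lambda>t\<in>{0..T}. W t w)" by (rule continuous_on_eq[OF W_continuous]) simp
  then show "(\<lambda>t\<in>{0..T}. W t w) \<in> cpaths T" by (simp add: cpaths_def)
qed (use W_measurable in simp)

text \<open>Let \<open>g\<close> be trigonometric and close to \<open>exp (- f)\<close>. The Gibbs
  inequality bounds \<open>- ln\<close> of the mean of \<open>G 0\<close> by entropy plus the mean
  of \<open>- ln (G 0)\<close> under the law of \<open>X\<close>; \<open>trig_lower_bound\<close>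
  bounds the latter by the cost with \<open>- ln g\<close> in place of \<open>f\<close>. Replacing
  \<open>g\<close> by \<open>exp (- f)\<close> under the two laws costs \<open>e / 2\<close>
  each.\<close>

lemma control_lower_bound:
  fixes X :: "'w \<Rightarrow> 'a::second_countable_topology" and B :: "real \<Rightarrow> 'v \<Rightarrow> real ^ 'n"
  assumes ref: "brownian M0 T F0 B" "X0 \<in> borel_measurable (F0 0)"
    and compl: "complete_filtration M F" and X: "X \<in> borel_measurable (F 0)" and \<psi>: "\<psi> \<in> controls T M F"
    and ac: "absolutely_continuous (distr M0 borel X0) (distr M borel X)"
    and int: "integrable (distr M borel X) (entropy_density (exp 1) (distr M0 borel X0) (distr M borel X))"
    and f: "f \<in> borel_measurable (path_measure_space T)" "\<And>p. p \<in> cpaths T \<times> UNIV \<Longrightarrow> \<bar>f p\<bar> \<le> K"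
  shows "- ln (\<integral>w. exp (- f (\<lambda>t\<in>{0..T}. B t w, X0 w)) \<partial>M0) \<le>
    KL_divergence (exp 1) (distr M0 borel X0) (distr M borel X) + control_cost T f M W X \<psi>"
proof (rule field_le_epsilon)
  fix e :: real assume e: "0 < e"
  interpret R: brownian M0 T F0 B by (rule ref(1))
  have XM: "X \<in> borel_measurable M" using T_pos by (intro measurable_F[OF _ X]) auto
  have X0M: "X0 \<in> borel_measurable M0" using T_pos by (intro R.measurable_F[OF _ ref(2)]) auto
  define \<delta> where "\<delta> = exp (- K) / 2"
  have \<delta>: "0 < \<delta>" by (simp add: \<delta>_def)
  define pb where "pb w = (\<lambda>t\<in>{0..T}. B t w, X0 w)" for w
  define py where "py w = (regular_path \<psi> w, X w)" for w
  have pb: "pb \<in> measurable M0 (path_measure_space T)"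
    unfolding pb_def[abs_def] by (rule R.brownian_path_measurable[OF X0M])
  have py: "py \<in> measurable M (path_measure_space T)"
    unfolding py_def[abs_def] by (rule regular_path_measurable[OF \<psi> XM])
  define m1 where "m1 = distr M0 (path_measure_space T) pb"
  define m2 where "m2 = distr M (path_measure_space T) py"
  interpret m1: prob_space m1 unfolding m1_def by (rule R.prob_space_distr[OF pb])
  interpret m2: prob_space m2 unfolding m2_def by (rule prob_space_distr[OF py])
  have s1: "sets m1 = sets (path_measure_space T)" and s2: "sets m2 = sets (path_measure_space T)"
    by (simp_all add: m1_def m2_def)
  \<comment> \<open>The logarithm is Lipschitz with constant \<open>1 / \<delta>\<close> above
    \<delta>, so an \<open>L^1\<close> distance of \<open>e * \<delta> / 2\<close> becomes an error
    of \<open>e / 2\<close>.\<close>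
  have "0 < e * \<delta> / 2" using e \<delta> by simp
  from trig_approximation[OF m1.finite_measure_axioms m2.finite_measure_axioms s1 s2 f this]
  obtain ts where ts: "trig_valid T ts" "\<And>x x0. continuous_on {0..T} x \<Longrightarrow> exp (- K) / 2 \<le> trig_fun ts (x, x0)"
    "(\<integral>p. \<bar>exp (- f p) - trig_fun ts p\<bar> \<partial>m1) < e * \<delta> / 2" "(\<integral>p. \<bar>exp (- f p) - trig_fun ts p\<bar> \<partial>m2) < e * \<delta> / 2"
    by blast
  note ge = ts(2)[folded \<delta>_def]
  obtain C where C: "\<And>p. \<bar>trig_fun ts p\<bar> \<le> C" using trig_fun_bounded[OF ts(1)] by blast
  note tm = measurable_trig_fun[OF ts(1)]
  have em: "(\<lambda>p. exp (- f p)) \<in> borel_measurable (path_measure_space T)" using f(1) by measurable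
  have lm: "(\<lambda>p. - ln (trig_fun ts p)) \<in> borel_measurable (path_measure_space T)" using tm by measurable
  have bnd: "\<bar>f p\<bar> \<le> K" "\<bar>exp (- f p)\<bar> \<le> exp K" "\<delta> \<le> exp (- f p)" "\<delta> \<le> trig_fun ts p"
    "\<bar>- ln (trig_fun ts p)\<bar> \<le> max \<bar>ln \<delta>\<bar> \<bar>ln C\<bar>" "\<bar>\<bar>exp (- f p) - trig_fun ts p\<bar>\<bar> \<le> exp K + C" if p: "p \<in> cpaths T \<times> UNIV" for p
  proof -
    obtain x x0 where px: "p = (x, x0)" "x \<in> cpaths T" using p by auto
    show 1: "\<bar>f p\<bar> \<le> K" by (rule f(2)[OF p])
    then show 2: "\<bar>exp (- f p)\<bar> \<le> exp K" by simp
    have "exp (- K) \<le> exp (- f p)" using 1 by simp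
    moreover have "\<delta> \<le> exp (- K)" by (simp add: \<delta>_def)
    ultimately show "\<delta> \<le> exp (- f p)" by linarith
    show g: "\<delta> \<le> trig_fun ts p" using ge[of x x0] px by (simp add: cpaths_def)
    have "trig_fun ts p \<le> C" using C[of p] by simp
    then have "ln \<delta> \<le> ln (trig_fun ts p)" "ln (trig_fun ts p) \<le> ln C" using \<delta> g by (simp_all add: ln_mono)
    then show "\<bar>- ln (trig_fun ts p)\<bar> \<le> max \<bar>ln \<delta>\<bar> \<bar>ln C\<bar>" by auto
    show "\<bar>\<bar>exp (- f p) - trig_fun ts p\<bar>\<bar> \<le> exp K + C" using 2 C[of p] by linarith
  qed
  have int_m: "integrable m h" if "finite_measure m" "sets m = sets (path_measure_space T)"
    "h \<in> borel_measurable (path_measure_space T)" "\<And>p. p \<in> cpaths T \<times> UNIV \<Longrightarrow> \<bar>h p\<bar> \<le> L"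
    for m and h :: "(real \<Rightarrow> real ^ 'n) \<times> 'a \<Rightarrow> real" and L
  proof (rule norm_integral_bounded_measurable[OF that(1)])
    show "h \<in> borel_measurable m" unfolding measurable_cong_sets[OF that(2) refl] by (rule that(3))
    fix p assume "p \<in> space m"
    then have "p \<in> cpaths T \<times> UNIV" using sets_eq_imp_space_eq[OF that(2)] by (simp add: space_path_measure_space)
    from that(4)[OF this] show "norm (h p) \<le> L" by simp
  qed
  note i1 = int_m[OF m1.finite_measure_axioms s1] and i2 = int_m[OF m2.finite_measure_axioms s2]
  have sp: "space m1 = cpaths T \<times> UNIV" "space m2 = cpaths T \<times> UNIV"
    using sets_eq_imp_space_eq[OF s1] sets_eq_imp_space_eq[OF s2] by (simp_all add: space_path_measure_space)
  have dm: "(\<lambda>p. \<bar>exp (- f p) - trig_fun ts p\<bar>) \<in> borel_measurable (path_measure_space T)" using em tm by measurable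
  have C': "\<bar>trig_fun ts p\<bar> \<le> C" if "p \<in> cpaths T \<times> UNIV" for p by (rule C)
  define a where "a = (\<integral>p. exp (- f p) \<partial>m1)"
  define b where "b = (\<integral>p. trig_fun ts p \<partial>m1)"
  have "(\<integral>p. \<delta> \<partial>m1) \<le> a" "(\<integral>p. \<delta> \<partial>m1) \<le> b" unfolding a_def b_def
    by (rule integral_mono, simp, rule i1[OF em bnd(2)], simp, simp add: sp bnd(3),
        rule integral_mono, simp, rule i1[OF tm C'], simp, simp add: sp bnd(4))
  then have ab: "\<delta> \<le> a" "\<delta> \<le> b" by (simp_all add: m1.prob_space)
  have "\<bar>a - b\<bar> = \<bar>\<integral>p. exp (- f p) - trig_fun ts p \<partial>m1\<bar>" unfolding a_def b_def
    by (subst Bochner_Integration.integral_diff[OF i1[OF em bnd(2)] i1[OF tm C']]) simp_all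
  also have "\<dots> \<le> (\<integral>p. \<bar>exp (- f p) - trig_fun ts p\<bar> \<partial>m1)" by (rule integral_abs_bound)
  finally have "\<bar>a - b\<bar> \<le> e * \<delta> / 2" using ts(3) by simp
  then have "\<bar>a - b\<bar> / \<delta> \<le> e / 2" using \<delta> by (simp add: field_simps)
  with abs_ln_diff_le[OF \<delta> ab] have 1: "- ln a \<le> - ln b + e / 2" by linarith
  have a_eq: "a = (\<integral>w. exp (- f (\<lambda>t\<in>{0..T}. B t w, X0 w)) \<partial>M0)"
    unfolding a_def m1_def by (subst integral_distr[OF pb em]) (simp add: pb_def)
  have "b = (\<integral>w. trig_fun ts (\<lambda>t\<in>{0..T}. B t w, X0 w) \<partial>M0)"
    unfolding b_def m1_def by (subst integral_distr[OF pb tm]) (simp add: pb_def)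
  also have "\<dots> = (\<integral>w. trig_fun ts (\<lambda>t. B t w, X0 w) \<partial>M0)"
    by (intro Bochner_Integration.integral_cong refl trig_fun_cong[OF ts(1)]) simp
  also have "\<dots> = (\<integral>w. Gfun T ts 0 (\<lambda>r. 0) (X0 w) \<partial>M0)" by (rule R.Gfun_0_expectation(1)[OF ts(1) ref(2)])
  also have "\<dots> = (\<integral>x0. Gfun T ts 0 (\<lambda>r. 0) x0 \<partial>distr M0 borel X0)"
    by (rule integral_distr[OF X0M Gfun_measurable[OF ts(1)], symmetric])
  finally have b_eq: "b = (\<integral>x0. Gfun T ts 0 (\<lambda>r. 0) x0 \<partial>distr M0 borel X0)" .
  obtain L where L: "\<And>t x x0. \<bar>Gfun T ts t x x0\<bar> \<le> L" using Gfun_Vfun_bounded[OF ts(1)] by blast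
  have "- ln b \<le> KL_divergence (exp 1) (distr M0 borel X0) (distr M borel X) + (\<integral>x0. - ln (Gfun T ts 0 (\<lambda>r. 0) x0) \<partial>distr M borel X)"
    unfolding b_eq
  proof (rule relative_entropy_variational[OF R.prob_space_distr[OF X0M] prob_space_distr[OF XM] _ ac int _ \<delta>])
    show "Gfun T ts 0 (\<lambda>r. 0) \<in> borel_measurable (distr M0 borel X0)"
      using Gfun_measurable[OF ts(1), of 0 "\<lambda>r. 0"] by simp
    show "\<delta> \<le> Gfun T ts 0 (\<lambda>r. 0) x0" for x0 using T_pos by (intro Gfun_ge[OF _ ts(1) ge]) auto
    show "Gfun T ts 0 (\<lambda>r. 0) x0 \<le> L" for x0 using L[of 0 "\<lambda>r. 0" x0] by simp
  qed simp
  also have "(\<integral>x0. - ln (Gfun T ts 0 (\<lambda>r. 0) x0) \<partial>distr M borel X) = (\<integral>w. - ln (Gfun T ts 0 (\<lambda>r. 0) (X w)) \<partial>M)"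
    by (rule integral_distr[OF XM borel_measurable_uminus[OF borel_measurable_ln[OF Gfun_measurable[OF ts(1)]]]])
  also have "\<dots> \<le> (\<integral>w. - ln (trig_fun ts (\<lambda>q. controlled \<psi> q w, X w)) \<partial>M) + (\<integral>w. energy \<psi> w / 2 \<partial>M)"
    by (rule trig_lower_bound[OF \<psi> X ts(1) \<delta> ge])
  also have "(\<integral>w. - ln (trig_fun ts (\<lambda>q. controlled \<psi> q w, X w)) \<partial>M) = (\<integral>w. - ln (trig_fun ts (py w)) \<partial>M)"
  proof (rule complete_modification(2)[OF compl \<psi>])
    show "(\<lambda>w. - ln (trig_fun ts (py w))) \<in> borel_measurable M" by (rule measurable_compose[OF py lm])
    fix w assume w: "w \<in> good \<psi>"
    have "trig_fun ts (\<lambda>q. controlled \<psi> q w, X w) = trig_fun ts (py w)"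
      unfolding py_def by (rule trig_fun_cong[OF ts(1)]) (simp add: regular_path_def w)
    then show "- ln (trig_fun ts (\<lambda>q. controlled \<psi> q w, X w)) = - ln (trig_fun ts (py w))" by simp
  qed
  also have "(\<integral>w. - ln (trig_fun ts (py w)) \<partial>M) = (\<integral>p. - ln (trig_fun ts p) \<partial>m2)"
    unfolding m2_def by (rule integral_distr[OF py lm, symmetric])
  finally have 2: "- ln b \<le> KL_divergence (exp 1) (distr M0 borel X0) (distr M borel X) +
      ((\<integral>p. - ln (trig_fun ts p) \<partial>m2) + (\<integral>w. energy \<psi> w / 2 \<partial>M))" by simp
  have if2: "integrable m2 f" by (rule i2[OF f(1) bnd(1)])
  have id2: "integrable m2 (\<lambda>p. \<bar>exp (- f p) - trig_fun ts p\<bar> / \<delta>)"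
    by (intro integrable_divide i2[OF dm bnd(6)])
  \<comment> \<open>As \<open>- f\<close> is the logarithm of \<open>exp (- f)\<close>, the
    Lipschitz bound compares \<open>- ln (trig_fun ts p)\<close> with \<open>f p\<close>
    pointwise.\<close>
  have "(\<integral>p. - ln (trig_fun ts p) \<partial>m2) \<le> (\<integral>p. f p + \<bar>exp (- f p) - trig_fun ts p\<bar> / \<delta> \<partial>m2)"
  proof (rule integral_mono)
    show "integrable m2 (\<lambda>p. - ln (trig_fun ts p))" by (rule i2[OF lm bnd(5)])
    show "integrable m2 (\<lambda>p. f p + \<bar>exp (- f p) - trig_fun ts p\<bar> / \<delta>)" using if2 id2 by (rule Bochner_Integration.integrable_add)
    fix p assume "p \<in> space m2"
    then have p: "p \<in> cpaths T \<times> UNIV" by (simp add: sp)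
    show "- ln (trig_fun ts p) \<le> f p + \<bar>exp (- f p) - trig_fun ts p\<bar> / \<delta>"
      using abs_ln_diff_le[OF \<delta> bnd(3,4)[OF p]] by simp
  qed
  also have "\<dots> = (\<integral>p. f p \<partial>m2) + (\<integral>p. \<bar>exp (- f p) - trig_fun ts p\<bar> \<partial>m2) / \<delta>"
    using Bochner_Integration.integral_add[OF if2 id2] by simp
  also have "\<dots> \<le> (\<integral>p. f p \<partial>m2) + e / 2"
  proof -
    have "(\<integral>p. \<bar>exp (- f p) - trig_fun ts p\<bar> \<partial>m2) / \<delta> \<le> (e * \<delta> / 2) / \<delta>"
      using ts(4) \<delta> by (intro divide_right_mono) auto
    then show ?thesis using \<delta> by simp
  qed
  also have "(\<integral>p. f p \<partial>m2) = (\<integral>w. f (py w) \<partial>M)"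
    unfolding m2_def by (rule integral_distr[OF py f(1)])
  finally have 3: "(\<integral>p. - ln (trig_fun ts p) \<partial>m2) \<le> (\<integral>w. f (py w) \<partial>M) + e / 2" .
  have 4: "control_cost T f M W X \<psi> = (\<integral>w. energy \<psi> w / 2 \<partial>M) + (\<integral>w. f (py w) \<partial>M)"
    unfolding py_def by (rule control_cost_eq[OF compl \<psi> XM f])
  show "- ln (\<integral>w. exp (- f (\<lambda>t\<in>{0..T}. B t w, X0 w)) \<partial>M0) \<le>
    KL_divergence (exp 1) (distr M0 borel X0) (distr M borel X) + control_cost T f M W X \<psi> + e"
    unfolding a_eq[symmetric] 4 using 1 2 3 by linarith
qed

end

lemma system_lower_bound:
  fixes X0 :: "'v \<Rightarrow> 'a::second_countable_topology" and B :: "real \<Rightarrow> 'v \<Rightarrow> real ^ 'n"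
  assumes ref: "brownian M0 T F0 B" "X0 \<in> borel_measurable (F0 0)"
    and sys: "(\<mu>, M, W, X, F) \<in> control_systems T" and \<psi>: "\<psi> \<in> controls T M F"
    and f: "f \<in> borel_measurable (path_measure_space T)" "\<And>p. p \<in> cpaths T \<times> UNIV \<Longrightarrow> \<bar>f p\<bar> \<le> K"
  shows "ereal (- ln (\<integral>w. exp (- f (\<lambda>t\<in>{0..T}. B t w, X0 w)) \<partial>M0)) \<le>
    relative_entropy \<mu> (distr M0 borel X0) + ereal (control_cost T f M W X \<psi>)"
proof (cases "absolutely_continuous (distr M0 borel X0) \<mu> \<and> integrable \<mu> (entropy_density (exp 1) (distr M0 borel X0) \<mu>)")
  case True
  interpret R: brownian M0 T F0 B by (rule ref(1))
  have s: "prob_space M" "filtration_upto T M F" "complete_filtration M F" "brownian_motion T M F W"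
    "X \<in> borel_measurable (F 0)" and \<mu>: "\<mu> = distr M borel X"
    using sys by (auto simp: control_systems_def usual_conditions_def)
  interpret brownian M T F W
    by (intro brownian.intro filtered_prob_space.intro filtered_prob_space_axioms.intro brownian_axioms.intro s R.T_pos)
  show ?thesis
    using control_lower_bound[OF ref s(3,5) \<psi> _ _ f] True by (simp add: relative_entropy_def \<mu>)
next
  case False
  then have "relative_entropy \<mu> (distr M0 borel X0) = \<infinity>" by (auto simp: relative_entropy_def)
  then show ?thesis by simp
qed

section \<open>The upper bound\<close>

context filtered_prob_space
begin

text \<open>Control systems ask for right-continuity, which the given filtration may lack.
  \<open>sigma\<close> only packages the intersection, already a \<sigma>-algebra, as a measure; no
  time lies beyond \<open>T\<close>, so \<open>F T\<close> itself is kept there.\<close>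

definition right_filtration :: "real \<Rightarrow> 'w measure" where
  "right_filtration t = (if t < T then sigma (space M) (\<Inter>u\<in>{t<..T}. sets (F u)) else F T)"

lemma right_filtration:
  assumes "0 \<le> t" "t < T"
  shows "sets (right_filtration t) = (\<Inter>u\<in>{t<..T}. sets (F u))" "space (right_filtration t) = space M"
proof -
  let ?I = "\<Inter>u\<in>{t<..T}. sets (F u)"
  have T: "T \<in> {t<..T}" using assms by simp
  have sub: "?I \<subseteq> Pow (space M)"
  proof
    fix A assume "A \<in> ?I"
    then have "A \<in> sets (F T)" using T by blast
    then show "A \<in> Pow (space M)" using sets.sets_into_space[of A "F T"] space_F[of T] T_pos by auto
  qed
  have eq: "sigma_sets (space M) ?I = ?I"
  proof (rule antisym)
    have "sigma_sets (space M) ?I \<subseteq> sets (F u)" if u: "u \<in> {t<..T}" for u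
    proof -
      have "space (F u) = space M" using u assms by (intro space_F) auto
      moreover have "?I \<subseteq> sets (F u)" using u by blast
      ultimately show ?thesis using sets.sigma_sets_subset[of ?I "F u"] by simp
    qed
    then show "sigma_sets (space M) ?I \<subseteq> ?I" by blast
  qed (rule sigma_sets_superset_generator)
  show "sets (right_filtration t) = ?I" "space (right_filtration t) = space M"
    using assms eq sub by (simp_all add: right_filtration_def sets_measure_of space_measure_of)
qed

lemma right_filtration_T: "right_filtration T = F T"
  by (simp add: right_filtration_def)

lemma sets_right_filtration_le: "0 \<le> t \<Longrightarrow> t < u \<Longrightarrow> u \<le> T \<Longrightarrow> sets (right_filtration t) \<subseteq> sets (F u)"
  by (subst right_filtration(1)) auto

lemma sets_F_le_right: "t \<in> {0..T} \<Longrightarrow> sets (F t) \<subseteq> sets (right_filtration t)"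
proof (cases "t < T")
  case True
  assume "t \<in> {0..T}"
  then have t: "0 \<le> t" by simp
  have "sets (F t) \<subseteq> sets (F u)" if "u \<in> {t<..T}" for u using that t by (intro sets_F_mono) auto
  then show ?thesis unfolding right_filtration(1)[OF t True] by (rule INT_greatest)
qed (simp add: right_filtration_def)

lemma space_right_filtration: "t \<in> {0..T} \<Longrightarrow> space (right_filtration t) = space M"
  using right_filtration(2)[of t] space_F[of T] by (cases "t < T") (auto simp: right_filtration_def)

lemma sets_right_filtration_mono:
  assumes "0 \<le> s" "s \<le> t" "t \<le> T"
  shows "sets (right_filtration s) \<subseteq> sets (right_filtration t)"
proof (cases "s = t")
  case False
  then have "sets (right_filtration s) \<subseteq> sets (F t)" using assms by (intro sets_right_filtration_le) auto
  also have "\<dots> \<subseteq> sets (right_filtration t)" using assms by (intro sets_F_le_right) auto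
  finally show ?thesis .
qed simp

lemma measurable_right_filtration: "t \<in> {0..T} \<Longrightarrow> f \<in> measurable (F t) N \<Longrightarrow> f \<in> measurable (right_filtration t) N"
  by (rule measurable_from_subalg[of _ "F t"])
    (simp_all add: subalgebra_def sets_F_le_right space_right_filtration space_F del: atLeastAtMost_iff)

lemma filtration_right: "filtration_upto T M right_filtration"
  unfolding filtration_upto_def
proof (intro conjI ballI allI impI)
  fix t assume t: "t \<in> {0..T}"
  have "sets (right_filtration t) \<subseteq> sets (right_filtration T)" using t by (intro sets_right_filtration_mono) auto
  also have "\<dots> \<subseteq> sets M" unfolding right_filtration_T using T_pos by (intro sets_F) auto
  finally show "subalgebra M (right_filtration t)" using t by (simp add: subalgebra_def space_right_filtration del: atLeastAtMost_iff)
qed (use sets_right_filtration_mono in auto)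

lemma filtered_right: "filtered_prob_space M T right_filtration"
  by unfold_locales (rule T_pos, rule filtration_right)

text \<open>Stated for a second measure \<open>N\<close>, because completeness has to hold under the
  tilted measure; that follows when every null set of \<open>N\<close> is one of
  \<open>M\<close>.\<close>

lemma usual_conditions_right:
  assumes "complete_filtration M F" "null_sets N \<subseteq> null_sets M"
  shows "usual_conditions T N right_filtration"
  unfolding usual_conditions_def
proof (intro conjI ballI)
  have "sets (F 0) \<subseteq> sets (right_filtration 0)" using T_pos by (intro sets_F_le_right) auto
  then show "complete_filtration N right_filtration"
    using assms unfolding complete_filtration_def by blast
  fix t assume t: "t \<in> {0..<T}"
  show "sets (right_filtration t) = (\<Inter>u\<in>{t<..T}. sets (right_filtration u))"
  proof (intro antisym INT_greatest)
    show "sets (right_filtration t) \<subseteq> sets (right_filtration u)" if "u \<in> {t<..T}" for u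
      using t that by (intro sets_right_filtration_mono) auto
    \<comment> \<open>For \<open>v > t\<close> the midpoint \<open>(t + v) / 2\<close> is still
      later than \<open>t\<close>, and its right limit is contained in \<open>F v\<close>.\<close>
    have "(\<Inter>u\<in>{t<..T}. sets (right_filtration u)) \<subseteq> sets (F v)" if v: "v \<in> {t<..T}" for v
    proof -
      have "sets (right_filtration ((t + v) / 2)) \<subseteq> sets (F v)" using t v by (intro sets_right_filtration_le) auto
      moreover have "(t + v) / 2 \<in> {t<..T}" using t v by auto
      ultimately show ?thesis by blast
    qed
    then have "(\<Inter>u\<in>{t<..T}. sets (right_filtration u)) \<subseteq> (\<Inter>v\<in>{t<..T}. sets (F v))" by (rule INT_greatest)
    also have "\<dots> = sets (right_filtration t)" using t by (intro right_filtration(1)[symmetric]) auto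
    finally show "(\<Inter>u\<in>{t<..T}. sets (right_filtration u)) \<subseteq> sets (right_filtration t)" .
  qed
qed

end

section \<open>Brownian motion under the enlarged filtration and under reweighting\<close>

context brownian
begin

text \<open>An event of the right limit at \<open>s\<close> belongs to \<open>F u\<close> for every
  later \<open>u\<close> up to \<open>T\<close>. The Fourier identity holds for increments from
  \<open>u\<close> to \<open>t\<close>, and path continuity lets \<open>u\<close> decrease to
  \<open>s\<close>.\<close>

lemma brownian_right: "brownian M T right_filtration W"
proof -
  interpret R: filtered_prob_space M T right_filtration by (rule filtered_right)
  have "brownian_motion T M right_filtration W"
  proof (rule R.brownian_motionI)
    show "W t \<in> borel_measurable (right_filtration t)" if "t \<in> {0..T}" for t
      by (rule measurable_right_filtration[OF that W_adapted[OF that]])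
    show "W 0 w = 0 \<and> continuous_on {0..T} (\<lambda>t. W t w)" if "w \<in> space M" for w
      using that W_zero W_continuous by simp
    fix s t A and \<eta> :: "real ^ 'n" assume st: "0 \<le> s" "s < t" "t \<le> T" and A: "A \<in> sets (right_filtration s)"
    \<comment> \<open>The first point is \<open>u 0 = t\<close>, which is admissible because
      \<open>integral_cis_increment\<close> allows a trivial interval.\<close>
    define u where "u n = s + (t - s) * inverse (real (Suc n))" for n
    have lim: "u \<longlonglongrightarrow> s"
      using tendsto_add[OF tendsto_const tendsto_mult[OF tendsto_const LIMSEQ_inverse_real_of_nat], of s "t - s"]
      by (simp add: u_def[abs_def])
    have u: "s < u n" "u n \<le> t" for n
    proof -
      have i: "0 < inverse (real (Suc n))" "inverse (real (Suc n)) \<le> 1" by (simp_all add: inverse_le_1_iff)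
      show "s < u n" unfolding u_def using mult_pos_pos[of "t - s", OF _ i(1)] st by simp
      show "u n \<le> t" unfolding u_def using mult_left_mono[OF i(2), of "t - s"] st by (smt (verit) mult_cancel_left2)
    qed
    have um: "u n \<in> {0..T}" for n using u[of n] st by auto
    have Au: "A \<in> sets (F (u n))" for n
      using sets_right_filtration_le[of s "u n"] u[of n] st A by auto
    have AM [measurable]: "A \<in> sets M" using Au[of 0] sets_F[OF um] by blast
    have Wm [measurable]: "W r \<in> borel_measurable M" if "r \<in> {0..T}" for r by (rule W_measurable[OF that])
    have sm: "s \<in> {0..T}" and tm: "t \<in> {0..T}" using st by auto
    have eq: "(\<integral>w. indicator A w *\<^sub>R cis (\<eta> \<bullet> (W t w - W (u n) w)) \<partial>M) =
        complex_of_real (measure M A) * exp (- ((t - u n) * (norm \<eta>)\<^sup>2 / 2))" for n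
    proof -
      note [measurable] = Au[of n]
      have "(\<integral>w. complex_of_real (indicator A w) * cis (\<eta> \<bullet> (W t w - W (u n) w)) \<partial>M) =
          (\<integral>w. complex_of_real (indicator A w) \<partial>M) * exp (- ((t - u n) * (norm \<eta>)\<^sup>2 / 2))"
        by (rule integral_cis_increment[where K=1]) (use um[of n] u[of n] st in \<open>auto split: split_indicator\<close>)
      moreover have "(\<integral>w. complex_of_real (indicator A w) \<partial>M) = complex_of_real (measure M A)" by simp
      ultimately show ?thesis by (simp only: scaleR_conv_of_real)
    qed
    have "(\<lambda>n. \<integral>w. indicator A w *\<^sub>R cis (\<eta> \<bullet> (W t w - W (u n) w)) \<partial>M) \<longlonglongrightarrow>
        (\<integral>w. indicator A w *\<^sub>R cis (\<eta> \<bullet> (W t w - W s w)) \<partial>M)"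
    proof (rule integral_dominated_convergence[where w="\<lambda>_. 1"])
      show "AE w in M. (\<lambda>n. indicator A w *\<^sub>R cis (\<eta> \<bullet> (W t w - W (u n) w))) \<longlonglongrightarrow> indicator A w *\<^sub>R cis (\<eta> \<bullet> (W t w - W s w))"
      proof (rule AE_I2)
        fix w assume "w \<in> space M"
        from continuous_on_tendsto_compose[OF W_continuous[OF this] lim sm]
        have "(\<lambda>n. W (u n) w) \<longlonglongrightarrow> W s w" using um by simp
        then show "(\<lambda>n. indicator A w *\<^sub>R cis (\<eta> \<bullet> (W t w - W (u n) w))) \<longlonglongrightarrow> indicator A w *\<^sub>R cis (\<eta> \<bullet> (W t w - W s w))"
          by (intro tendsto_intros tendsto_cis)
      qed
      show "(\<lambda>w. indicator A w *\<^sub>R cis (\<eta> \<bullet> (W t w - W s w))) \<in> borel_measurable M"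
        using Wm[OF sm] Wm[OF tm] by measurable
      show "(\<lambda>w. indicator A w *\<^sub>R cis (\<eta> \<bullet> (W t w - W (u n) w))) \<in> borel_measurable M" for n
        using Wm[OF um] Wm[OF tm] by measurable
    qed (auto split: split_indicator)
    moreover have "(\<lambda>n. complex_of_real (measure M A) * exp (- ((t - u n) * (norm \<eta>)\<^sup>2 / 2))) \<longlonglongrightarrow>
        complex_of_real (measure M A) * exp (- ((t - s) * (norm \<eta>)\<^sup>2 / 2))"
      by (intro tendsto_intros lim) simp
    ultimately show "(\<integral>w. indicator A w *\<^sub>R cis (\<eta> \<bullet> (W t w - W s w)) \<partial>M) =
        complex_of_real (measure M A) * exp (- ((t - s) * (norm \<eta>)\<^sup>2 / 2))"
      unfolding eq by (rule LIMSEQ_unique)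
  qed
  then show ?thesis by unfold_locales
qed

text \<open>A density measurable at time 0 is absorbed in the test variable, so increments keep
  their conditional law.\<close>

lemma brownian_reweight:
  assumes h: "h \<in> borel_measurable (F 0)" "\<And>w. w \<in> space M \<Longrightarrow> 0 \<le> h w" "\<And>w. w \<in> space M \<Longrightarrow> h w \<le> C"
    and one: "(\<integral>w. h w \<partial>M) = 1"
  shows "brownian (density M (\<lambda>w. ennreal (h w))) T F W"
proof -
  let ?N = "density M (\<lambda>w. ennreal (h w))"
  have hM [measurable]: "h \<in> borel_measurable M" using T_pos by (intro measurable_F[OF _ h(1)]) auto
  have hb: "norm (h w) \<le> C" if "w \<in> space M" for w using h(2,3)[OF that] by simp
  have hi: "integrable M h" by (rule bounded_integrable[OF hM hb])
  have "emeasure ?N (space ?N) = (\<integral>\<^sup>+w. ennreal (h w) \<partial>M)"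
    by (subst emeasure_density) (auto intro!: nn_integral_cong)
  also have "\<dots> = 1" by (subst nn_integral_eq_integral[OF hi]) (use h(2) one in auto)
  finally interpret N: prob_space ?N by (rule prob_spaceI)
  have "filtration_upto T ?N F" using filtration by (simp add: filtration_upto_def subalgebra_def)
  then interpret N: filtered_prob_space ?N T F by unfold_locales (rule T_pos)
  have "brownian_motion T ?N F W"
  proof (rule N.brownian_motionI)
    show "W t \<in> borel_measurable (F t)" if "t \<in> {0..T}" for t by (rule W_adapted[OF that])
    show "W 0 w = 0 \<and> continuous_on {0..T} (\<lambda>t. W t w)" if "w \<in> space ?N" for w
      using that W_zero W_continuous by simp
    fix s t A and \<eta> :: "real ^ 'n" assume st: "0 \<le> s" "s < t" "t \<le> T" and A [measurable]: "A \<in> sets (F s)"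
    have AM [measurable]: "A \<in> sets M" using A sets_F[of s] st by auto
    have [measurable]: "W s \<in> borel_measurable M" "W t \<in> borel_measurable M" using st by (auto intro!: W_measurable)
    have hs [measurable]: "h \<in> borel_measurable (F s)" using st by (intro measurable_F_mono[OF h(1)]) auto
    let ?\<Xi> = "\<lambda>w. complex_of_real (h w * indicator A w)"
    have \<Xi>: "?\<Xi> \<in> borel_measurable (F s)" by measurable
    have \<Xi>b: "norm (?\<Xi> w) \<le> C" if "w \<in> space M" for w
      using hb[OF that] h(2,3)[OF that] by (auto split: split_indicator)
    have "measure ?N A = (\<integral>w. indicator A w \<partial>?N)" by simp
    also have "\<dots> = (\<integral>w. h w * indicator A w \<partial>M)"
      by (subst integral_real_density) (use h(2) in auto)
    finally have m: "complex_of_real (measure ?N A) = (\<integral>w. ?\<Xi> w \<partial>M)" by (simp only: integral_complex_of_real)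
    have "(\<integral>w. indicator A w *\<^sub>R cis (\<eta> \<bullet> (W t w - W s w)) \<partial>?N) =
        (\<integral>w. h w *\<^sub>R (indicator A w *\<^sub>R cis (\<eta> \<bullet> (W t w - W s w))) \<partial>M)"
      by (rule integral_density) (use h(2) in auto)
    also have "\<dots> = (\<integral>w. ?\<Xi> w * cis (\<eta> \<bullet> (W t w - W s w)) \<partial>M)" by (simp add: scaleR_conv_of_real mult.assoc)
    also have "\<dots> = (\<integral>w. ?\<Xi> w \<partial>M) * exp (- ((t - s) * (norm \<eta>)\<^sup>2 / 2))"
      by (rule integral_cis_increment[OF _ _ _ \<Xi> \<Xi>b]) (use st in auto)
    finally show "(\<integral>w. indicator A w *\<^sub>R cis (\<eta> \<bullet> (W t w - W s w)) \<partial>?N) =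
        complex_of_real (measure ?N A) * exp (- ((t - s) * (norm \<eta>)\<^sup>2 / 2))" unfolding m .
  qed
  then show ?thesis by unfold_locales
qed

text \<open>Independence of \<open>F 0\<close> and the whole path is obtained by comparing the law
  of the path on \<open>A\<close> with \<open>P(A)\<close> times its law through characteristic
  functions, using \<open>martingale_phase\<close> from time 0. The second component of
  \<open>P\<close> is the dummy initial point that \<open>path_sigma\<close> carries.\<close>

lemma path_independent:
  assumes A: "A \<in> sets (F 0)" and Q: "Q \<in> sets (\<Pi>\<^sub>M t\<in>{0..T}. (borel :: (real ^ 'n) measure))"
  shows "prob (A \<inter> ((\<lambda>w. \<lambda>t\<in>{0..T}. W t w) -` Q \<inter> space M)) = prob A * prob ((\<lambda>w. \<lambda>t\<in>{0..T}. W t w) -` Q \<inter> space M)"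
proof -
  define P where "P w = ((\<lambda>t\<in>{0..T}. W t w), 0::real)" for w
  have zero: "0 \<in> {0..T}" using T_pos by simp
  have AM [measurable]: "A \<in> sets M" using A sets_F[OF zero] by auto
  have P [measurable]: "P \<in> measurable M (path_sigma T)"
    unfolding P_def[abs_def] by (rule measurable_path_sigmaI) (use W_measurable in auto)
  let ?d1 = "density M (indicator A)" and ?d2 = "density M (\<lambda>_. ennreal (prob A))"
  let ?m1 = "distr ?d1 (path_sigma T) P" and ?m2 = "distr ?d2 (path_sigma T) P"
  have fd: "finite_measure ?d1" "finite_measure ?d2"
    by (intro finite_measureI; simp add: emeasure_density emeasure_eq_measure ennreal_mult_eq_top_iff)+
  have char: "(\<integral>w. h w *\<^sub>R cis (phase l (\<lambda>t\<in>{0..T}. W t w)) \<partial>M) =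
      complex_of_real (\<integral>w. h w \<partial>M) * exp (- (time_integral (\<lambda>r. (norm (lam l r))\<^sup>2) 0 T / 2))"
    if h: "h \<in> borel_measurable (F 0)" "\<And>w. \<bar>h w\<bar> \<le> 1" and l: "snd ` set l \<subseteq> {0..T}" for h :: "'w \<Rightarrow> real" and l
  proof -
    have "(\<integral>w. complex_of_real (h w) * cis (sphase l T (\<lambda>r. W r w) - sphase l 0 (\<lambda>r. W r w)) \<partial>M) =
        (\<integral>w. complex_of_real (h w) \<partial>M) * exp (- (time_integral (\<lambda>r. (norm (lam l r))\<^sup>2) 0 T / 2))"
      by (rule martingale_phase[OF l, where K=1]) (use T_pos h in auto)
    moreover have "sphase l T (\<lambda>r. W r w) - sphase l 0 (\<lambda>r. W r w) = phase l (\<lambda>t\<in>{0..T}. W t w)" if "w \<in> space M" for w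
    proof -
      have "sphase l 0 (\<lambda>r. W r w) = phase l (\<lambda>r. 0)"
        unfolding sphase_def by (rule phase_cong) (use l W_zero[OF that] in \<open>auto simp: min_absorb2 subset_iff\<close>)
      moreover have "phase l (\<lambda>r. 0) = 0" by (induction l) (auto simp: phase_def)
      moreover have "phase l (\<lambda>t\<in>{0..T}. W t w) = phase l (\<lambda>r. W r w)" by (rule phase_cong) (use l in auto)
      ultimately show ?thesis using sphase_T[OF l] by simp
    qed
    ultimately show ?thesis
      by (simp add: scaleR_conv_of_real cong: Bochner_Integration.integral_cong)
  qed
  have "?m1 = ?m2"
  proof (rule path_measure_eqI)
    show "finite_measure ?m1" "finite_measure ?m2"
      by (rule finite_measure.finite_measure_distr[OF fd(1)], simp, rule finite_measure.finite_measure_distr[OF fd(2)], simp)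
    fix a :: "real \<Rightarrow> real" and l :: "((real ^ 'n) \<times> real) list"
    assume a: "a \<in> borel_measurable borel" and l: "snd ` set l \<subseteq> {0..T}"
    have m: "(\<lambda>p. complex_of_real (a (snd p)) * cis (phase l (fst p))) \<in> borel_measurable (path_sigma T)"
    proof -
      have [measurable]: "(\<lambda>p. phase l (fst p)) \<in> borel_measurable (path_sigma T :: ((real \<Rightarrow> real ^ 'n) \<times> real) measure)"
        using measurable_phase[OF l] by (simp add: path_sigma_def)
      have [measurable]: "(\<lambda>p. a (snd p)) \<in> borel_measurable (path_sigma T :: ((real \<Rightarrow> real ^ 'n) \<times> real) measure)"
        unfolding path_sigma_def using a by measurable
      show ?thesis by measurable
    qed
    have mc: "(\<lambda>w. cis (phase l (\<lambda>t\<in>{0..T}. W t w))) \<in> borel_measurable M"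
    proof -
      have [measurable]: "(\<lambda>p. phase l (fst p)) \<in> borel_measurable (path_sigma T :: ((real \<Rightarrow> real ^ 'n) \<times> real) measure)"
        using measurable_phase[OF l] by (simp add: path_sigma_def)
      have "(\<lambda>w. cis (phase l (fst (P w)))) \<in> borel_measurable M" by measurable
      then show ?thesis by (simp add: P_def)
    qed
    have "(\<integral>p. complex_of_real (a (snd p)) * cis (phase l (fst p)) \<partial>?m1) =
        complex_of_real (a 0) * (\<integral>w. indicator A w *\<^sub>R cis (phase l (\<lambda>t\<in>{0..T}. W t w)) \<partial>M)"
    proof -
      have "?d1 = density M (\<lambda>w. ennreal (indicator A w))" by (simp add: ennreal_indicator)
      then have "(\<integral>w. cis (phase l (\<lambda>t\<in>{0..T}. W t w)) \<partial>?d1) = (\<integral>w. indicator A w *\<^sub>R cis (phase l (\<lambda>t\<in>{0..T}. W t w)) \<partial>M)"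
        using integral_density[OF mc, of "indicator A"] by simp
      then show ?thesis by (subst integral_distr[OF _ m]) (simp_all add: P_def)
    qed
    moreover have "(\<integral>p. complex_of_real (a (snd p)) * cis (phase l (fst p)) \<partial>?m2) =
        complex_of_real (a 0) * (\<integral>w. prob A *\<^sub>R cis (phase l (\<lambda>t\<in>{0..T}. W t w)) \<partial>M)"
    proof -
      have "(\<integral>w. cis (phase l (\<lambda>t\<in>{0..T}. W t w)) \<partial>?d2) = (\<integral>w. prob A *\<^sub>R cis (phase l (\<lambda>t\<in>{0..T}. W t w)) \<partial>M)"
        by (rule integral_density[OF mc]) auto
      then show ?thesis by (subst integral_distr[OF _ m]) (simp_all add: P_def)
    qed
    moreover have "(\<integral>w. indicator A w *\<^sub>R cis (phase l (\<lambda>t\<in>{0..T}. W t w)) \<partial>M) = (\<integral>w. prob A *\<^sub>R cis (phase l (\<lambda>t\<in>{0..T}. W t w)) \<partial>M)"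
      using char[OF _ _ l, of "indicator A"] char[OF _ _ l, of "\<lambda>_. prob A"] A
      by (simp add: prob_space)
    ultimately show "(\<integral>p. complex_of_real (a (snd p)) * cis (phase l (fst p)) \<partial>?m1) =
        (\<integral>p. complex_of_real (a (snd p)) * cis (phase l (fst p)) \<partial>?m2)" by simp
  qed simp_all
  then have eq: "emeasure ?m1 (Q \<times> UNIV) = emeasure ?m2 (Q \<times> UNIV)" by simp
  have QU: "Q \<times> UNIV \<in> sets (path_sigma T :: ((real \<Rightarrow> real ^ 'n) \<times> real) measure)"
    unfolding path_sigma_def using Q by auto
  have pre: "P -` (Q \<times> UNIV) = (\<lambda>w. \<lambda>t\<in>{0..T}. W t w) -` Q" by (auto simp: P_def)
  have PQ: "(\<lambda>w. \<lambda>t\<in>{0..T}. W t w) -` Q \<inter> space M \<in> sets M"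
    using measurable_sets[OF P QU] by (simp add: pre)
  let ?E = "(\<lambda>w. \<lambda>t\<in>{0..T}. W t w) -` Q \<inter> space M"
  have "emeasure ?m1 (Q \<times> UNIV) = emeasure ?d1 ?E" by (subst emeasure_distr) (simp_all add: QU pre)
  also have "\<dots> = (\<integral>\<^sup>+w. indicator (A \<inter> ?E) w \<partial>M)"
    by (subst emeasure_density) (auto simp: PQ intro!: nn_integral_cong split: split_indicator)
  also have "\<dots> = emeasure M (A \<inter> ?E)" using PQ by simp
  finally have 1: "emeasure ?m1 (Q \<times> UNIV) = ennreal (prob (A \<inter> ?E))" by (simp add: emeasure_eq_measure)
  have "emeasure ?m2 (Q \<times> UNIV) = emeasure ?d2 ?E" by (subst emeasure_distr) (simp_all add: QU pre)
  also have "\<dots> = ennreal (prob A) * emeasure M ?E"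
    using PQ by (subst emeasure_density) (auto simp: nn_integral_cmult)
  finally have 2: "emeasure ?m2 (Q \<times> UNIV) = ennreal (prob A * prob ?E)" by (simp add: emeasure_eq_measure ennreal_mult)
  show ?thesis using eq unfolding 1 2 by simp
qed

end

lemma relative_entropy_density:
  assumes \<rho>: "prob_space \<rho>" and g: "g \<in> borel_measurable \<rho>" "0 < \<delta>" "\<And>x. x \<in> space \<rho> \<Longrightarrow> \<delta> \<le> g x" "\<And>x. x \<in> space \<rho> \<Longrightarrow> g x \<le> C"
    and \<mu>: "\<mu> = density \<rho> (\<lambda>x. ennreal (g x))" "prob_space \<mu>"
  shows "relative_entropy \<mu> \<rho> = ereal (\<integral>x. ln (g x) \<partial>\<mu>)"
proof -
  interpret \<rho>: prob_space \<rho> by (rule \<rho>)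
  interpret \<mu>: prob_space \<mu> by (rule \<mu>(2))
  have gm: "(\<lambda>x. ennreal (g x)) \<in> borel_measurable \<rho>" using g(1) by measurable
  have s: "sets \<mu> = sets \<rho>" "space \<mu> = space \<rho>" by (simp_all add: \<mu>(1))
  have ac: "absolutely_continuous \<rho> \<mu>" unfolding \<mu>(1) by (rule absolutely_continuousI_density[OF gm])
  have "AE x in \<rho>. ennreal (g x) = RN_deriv \<rho> \<mu> x" by (rule \<rho>.RN_deriv_unique[OF gm \<mu>(1)[symmetric]])
  then have "AE x in \<mu>. ennreal (g x) = RN_deriv \<rho> \<mu> x" by (rule absolutely_continuous_AE[OF s(1) ac])
  then have ae: "AE x in \<mu>. entropy_density (exp 1) \<rho> \<mu> x = ln (g x)"
    using AE_space
  proof eventually_elim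
    case (elim x)
    then have "0 \<le> g x" using g(2) g(3)[of x] by (simp add: s)
    then have "enn2real (RN_deriv \<rho> \<mu> x) = g x" unfolding elim(1)[symmetric] by simp
    then show ?case by (simp add: entropy_density_def log_def)
  qed
  have em: "entropy_density (exp 1) \<rho> \<mu> \<in> borel_measurable \<mu>"
    unfolding measurable_cong_sets[OF s(1) refl] by simp
  have lm: "(\<lambda>x. ln (g x)) \<in> borel_measurable \<mu>"
    unfolding measurable_cong_sets[OF s(1) refl] by (rule borel_measurable_ln[OF g(1)])
  have li: "integrable \<mu> (\<lambda>x. ln (g x))"
  proof (rule norm_integral_bounded_measurable[OF \<mu>.finite_measure_axioms lm])
    fix x assume "x \<in> space \<mu>"
    then have "\<delta> \<le> g x" "g x \<le> C" using g(3,4) by (auto simp: s)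
    then have "ln \<delta> \<le> ln (g x)" "ln (g x) \<le> ln C" using g(2) by (simp_all add: ln_mono)
    then show "norm (ln (g x)) \<le> max \<bar>ln \<delta>\<bar> \<bar>ln C\<bar>" by auto
  qed
  have "integrable \<mu> (entropy_density (exp 1) \<rho> \<mu>)"
    using integrable_cong_AE[OF em lm ae] li by simp
  moreover have "KL_divergence (exp 1) \<rho> \<mu> = (\<integral>x. ln (g x) \<partial>\<mu>)"
    unfolding KL_divergence_def by (rule integral_cong_AE[OF em lm ae])
  ultimately show ?thesis using ac by (simp add: relative_entropy_def)
qed

text \<open>A positive density creates no new null sets, so completeness of the filtration survives
  the change of measure.\<close>

lemma null_sets_density_pos:
  fixes h :: "'a \<Rightarrow> real"
  assumes h: "h \<in> borel_measurable M" "\<And>x. x \<in> space M \<Longrightarrow> 0 < h x"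
  shows "null_sets (density M (\<lambda>x. ennreal (h x))) \<subseteq> null_sets M"
proof
  fix A assume "A \<in> null_sets (density M (\<lambda>x. ennreal (h x)))"
  then have A: "A \<in> sets M" "AE x in M. x \<in> A \<longrightarrow> ennreal (h x) = 0"
    using h(1) by (auto simp: null_sets_density_iff)
  have "AE x in M. x \<notin> A" using A(2) AE_space
  proof eventually_elim
    case (elim x)
    then show ?case using h(2)[of x] by (auto simp: ennreal_eq_0_iff)
  qed
  then show "A \<in> null_sets M" using A(1) by (simp add: AE_iff_null_sets)
qed

section \<open>The near-optimal system\<close>

context girsanov
begin

lemma control_\<phi>: "\<phi> \<in> controls T \<nu> F"
proof -
  interpret N: brownian \<nu> T F Wt by (rule brownian_\<nu>)
  have "(\<integral>\<^sup>+s\<in>{0..T}. ennreal ((norm (\<phi> s w))\<^sup>2) \<partial>lborel) \<le> ennreal (K\<phi>\<^sup>2 * T)" if w: "w \<in> space M" for w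
  proof -
    have "(\<integral>\<^sup>+s\<in>{0..T}. ennreal ((norm (\<phi> s w))\<^sup>2) \<partial>lborel) \<le> (\<integral>\<^sup>+s. ennreal (K\<phi>\<^sup>2) * indicator {0..T} s \<partial>lborel)"
    proof (rule nn_integral_mono)
      fix s
      have "ennreal ((norm (\<phi> s w))\<^sup>2) \<le> ennreal (K\<phi>\<^sup>2)" if "s \<in> {0..T}"
        by (intro ennreal_leI power_mono \<phi>_bound[OF that w]) simp
      then show "ennreal ((norm (\<phi> s w))\<^sup>2) * indicator {0..T} s \<le> ennreal (K\<phi>\<^sup>2) * indicator {0..T} s"
        by (cases "s \<in> {0..T}") simp_all
    qed
    also have "\<dots> = ennreal (K\<phi>\<^sup>2 * T)" using T_pos by (simp add: nn_integral_cmult_indicator ennreal_mult)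
    finally show ?thesis .
  qed
  then have "(\<integral>\<^sup>+w. (\<integral>\<^sup>+s\<in>{0..T}. ennreal ((norm (\<phi> s w))\<^sup>2) \<partial>lborel) \<partial>\<nu>) \<le> (\<integral>\<^sup>+w. ennreal (K\<phi>\<^sup>2 * T) \<partial>\<nu>)"
    by (intro nn_integral_mono) (simp add: space_\<nu>)
  also have "\<dots> < \<infinity>" by (simp add: N.emeasure_space_1)
  finally show ?thesis using \<phi>_progressive by (simp add: controls_def progressively_measurable_iff)
qed

lemma distr_\<nu>_X: "distr \<nu> borel X = distr M borel X"
proof (rule measure_eqI)
  fix A assume "A \<in> sets (distr \<nu> borel X)"
  then have A: "A \<in> sets borel" by simp
  have XM: "X \<in> borel_measurable M" by (rule measurable_F[OF zero_mem X])
  then have XN: "X \<in> borel_measurable \<nu>" unfolding measurable_cong_sets[OF sets_\<nu> refl] .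
  have "X -` A \<inter> space M \<in> sets (F 0)" using measurable_sets[OF X A] space_F[OF zero_mem] by simp
  from \<nu>_eq_on_F0[OF this] show "emeasure (distr \<nu> borel X) A = emeasure (distr M borel X) A"
    by (simp add: emeasure_distr[OF XN A] emeasure_distr[OF XM A] space_\<nu>)
qed simp

end

text \<open>Independence of \<open>X\<close> and the path comes from
  \<open>path_independent\<close>, because preimages under \<open>X\<close> lie in
  \<open>F 0\<close>.\<close>

lemma (in brownian) control_systemI:
  assumes X: "X \<in> borel_measurable (F 0)" and u: "usual_conditions T M F"
  shows "(distr M borel X, M, W, X, F) \<in> control_systems T"
proof -
  let ?P = "\<lambda>w. \<lambda>t\<in>{0..T}. W t w" and ?N = "\<Pi>\<^sub>M t\<in>{0..T}. (borel :: (real ^ 'n) measure)"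
  have zero: "0 \<in> {0..T}" using T_pos by simp
  have XM: "X \<in> borel_measurable M" by (rule measurable_F[OF zero X])
  have PM: "?P \<in> measurable M ?N" by (rule measurable_restrict) (rule W_measurable)
  have sX: "sets (vimage_algebra (space M) X borel) = {X -` A \<inter> space M | A. A \<in> sets borel}"
    by (rule sets_vimage_algebra2) simp
  have sP: "sets (vimage_algebra (space M) ?P ?N) = {?P -` A \<inter> space M | A. A \<in> sets ?N}"
    by (rule sets_vimage_algebra2) (use measurable_space[OF PM] in blast)
  have "indep_set (sets (vimage_algebra (space M) X borel)) (sets (vimage_algebra (space M) ?P ?N))"
    unfolding indep_sets2_eq sX sP
  proof (intro conjI ballI)
    show "{X -` A \<inter> space M | A. A \<in> sets borel} \<subseteq> events" using measurable_sets[OF XM] by blast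
    show "{?P -` A \<inter> space M | A. A \<in> sets ?N} \<subseteq> events" using measurable_sets[OF PM] by blast
    fix a b assume "a \<in> {X -` A \<inter> space M | A. A \<in> sets borel}" "b \<in> {?P -` A \<inter> space M | A. A \<in> sets ?N}"
    then obtain A B where a: "a = X -` A \<inter> space M" "A \<in> sets borel" and b: "b = ?P -` B \<inter> space M" "B \<in> sets ?N" by blast
    have "a \<in> sets (F 0)" using measurable_sets[OF X a(2)] space_F[OF zero] a(1) by simp
    from path_independent[OF this b(2)] show "prob (a \<inter> b) = prob a * prob b" unfolding b(1) .
  qed
  then show ?thesis
    using u X bm filtration prob_space_axioms prob_space_distr[OF XM] by (simp add: control_systems_def)
qed

text \<open>\<open>M\<close> is first reweighted by \<open>h = g (X) / c\<close>, which tilts the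
  initial law; then Girsanov's theorem is applied with zero control. The total density is
  \<open>S / c\<close> and the controlled path is the original \<open>W\<close>. In entropy plus
  energy the means of \<open>ln (g (X))\<close> cancel, which leaves at most the mean of
  \<open>ln S\<close> under the new measure minus \<open>ln c\<close>.\<close>

lemma (in brownian) control_upper_bound:
  fixes X :: "'w \<Rightarrow> 'a::second_countable_topology"
  assumes compl: "complete_filtration M F" and X: "X \<in> borel_measurable (F 0)"
    and f: "f \<in> borel_measurable (path_measure_space T)" "\<And>p. p \<in> cpaths T \<times> UNIV \<Longrightarrow> \<bar>f p\<bar> \<le> K" and e: "0 < e"
  shows "\<exists>\<mu> N (V :: real \<Rightarrow> 'w \<Rightarrow> real ^ 'n) H \<psi>. (\<mu>, N, V, X, H) \<in> control_systems T \<and> \<psi> \<in> controls T N H \<and>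
    relative_entropy \<mu> (distr M borel X) + ereal (control_cost T f N V X \<psi>) \<le>
    ereal (- ln (\<integral>w. exp (- f (\<lambda>t\<in>{0..T}. W t w, X w)) \<partial>M) + e)"
proof -
  have zero: "0 \<in> {0..T}" using T_pos by simp
  have XM: "X \<in> borel_measurable M" by (rule measurable_F[OF zero X])
  interpret R: brownian M T right_filtration W by (rule brownian_right)
  have XR: "X \<in> borel_measurable (right_filtration 0)" by (rule measurable_right_filtration[OF zero X])
  define \<delta> where "\<delta> = exp (- K) / 2"
  have \<delta>: "0 < \<delta>" by (simp add: \<delta>_def)
  define C where "C = exp K + 1"
  define pb where "pb w = (\<lambda>t\<in>{0..T}. W t w, X w)" for w
  have pb: "pb \<in> measurable M (path_measure_space T)"
    unfolding pb_def[abs_def] by (rule brownian_path_measurable[OF XM])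
  have pbc: "pb w \<in> cpaths T \<times> UNIV" if "w \<in> space M" for w
    using measurable_space[OF pb that] by (simp add: space_path_measure_space)
  define m1 where "m1 = distr M (path_measure_space T) pb"
  interpret m1: prob_space m1 unfolding m1_def by (rule prob_space_distr[OF pb])
  have s1: "sets m1 = sets (path_measure_space T)" by (simp add: m1_def)
  have C0: "0 < C" by (simp add: C_def add_pos_pos)
  \<comment> \<open>Two errors occur: \<open>D / \<delta>\<close> in replacing \<open>ln c\<close>
    by \<open>ln a\<close>, and \<open>C / (\<delta> * \<delta>) * D\<close> in replacing
    \<open>- ln S\<close> by \<open>f\<close> under the new measure. This \<open>e'\<close> keeps
    their sum within \<open>e\<close>.\<close>
  define e' where "e' = e / (1 / \<delta> + C / (\<delta> * \<delta>))"
  have den: "0 < 1 / \<delta> + C / (\<delta> * \<delta>)" using \<delta> C0 by (simp add: add_pos_pos)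
  then have e': "0 < e'" "e' * (1 / \<delta> + C / (\<delta> * \<delta>)) = e" using e by (simp_all add: e'_def)
  from trig_approximation[OF m1.finite_measure_axioms m1.finite_measure_axioms s1 s1 f e'(1)]
  obtain ts where ts: "trig_valid T ts" "\<And>x x0. continuous_on {0..T} x \<Longrightarrow> exp (- K) / 2 \<le> trig_fun ts (x, x0)"
    "\<And>x x0. continuous_on {0..T} x \<Longrightarrow> trig_fun ts (x, x0) \<le> exp K + 1"
    "(\<integral>p. \<bar>exp (- f p) - trig_fun ts p\<bar> \<partial>m1) < e'"
    by blast
  note ge = ts(2)[folded \<delta>_def] and le = ts(3)[folded C_def]
  note tm = measurable_trig_fun[OF ts(1)]
  have em: "(\<lambda>p. exp (- f p)) \<in> borel_measurable (path_measure_space T)" using f(1) by measurable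
  have dm: "(\<lambda>p. \<bar>exp (- f p) - trig_fun ts p\<bar>) \<in> borel_measurable (path_measure_space T)" using em tm by measurable
  define S where "S w = trig_fun ts (pb w)" for w
  have S_eq: "S w = trig_fun ts (\<lambda>r. W r w, X w)" for w
    unfolding S_def pb_def by (rule trig_fun_cong[OF ts(1)]) simp
  have Sm [measurable]: "S \<in> borel_measurable M" unfolding S_def[abs_def] by (rule measurable_compose[OF pb tm])
  have fm [measurable]: "(\<lambda>w. f (pb w)) \<in> borel_measurable M" by (rule measurable_compose[OF pb f(1)])
  have S_bounds: "\<delta> \<le> S w" "S w \<le> C" if "w \<in> space M" for w
    using ge[OF W_continuous[OF that]] le[OF W_continuous[OF that]] by (simp_all add: S_eq)
  have f_bounds: "\<bar>f (pb w)\<bar> \<le> K" "\<delta> \<le> exp (- f (pb w))" "exp (- f (pb w)) \<le> exp K" if "w \<in> space M" for w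
  proof -
    show 1: "\<bar>f (pb w)\<bar> \<le> K" by (rule f(2)[OF pbc[OF that]])
    then have "exp (- K) \<le> exp (- f (pb w))" by simp
    moreover have "\<delta> \<le> exp (- K)" by (simp add: \<delta>_def)
    ultimately show "\<delta> \<le> exp (- f (pb w))" by linarith
    show "exp (- f (pb w)) \<le> exp K" using 1 by simp
  qed
  have Si: "integrable M S" by (rule bounded_integrable[OF Sm, of C]) (use S_bounds \<delta> in fastforce)
  have ei: "integrable M (\<lambda>w. exp (- f (pb w)))"
    by (rule bounded_integrable[of _ "exp K"]) (use f_bounds(3) in auto)
  define D where "D = (\<integral>w. \<bar>exp (- f (pb w)) - S w\<bar> \<partial>M)"
  have Di: "integrable M (\<lambda>w. \<bar>exp (- f (pb w)) - S w\<bar>)" using ei Si by (intro integrable_abs Bochner_Integration.integrable_diff)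
  have D: "D < e'" using ts(4) unfolding m1_def by (subst (asm) integral_distr[OF pb dm]) (simp add: D_def S_def)
  define c where "c = (\<integral>w. S w \<partial>M)"
  define a where "a = (\<integral>w. exp (- f (pb w)) \<partial>M)"
  have "(\<integral>w. \<delta> \<partial>M) \<le> c" "(\<integral>w. \<delta> \<partial>M) \<le> a" unfolding a_def c_def
    by (rule integral_mono[OF _ Si], simp, rule S_bounds(1), assumption,
        rule integral_mono[OF _ ei], simp, rule f_bounds(2), assumption)
  then have ac: "\<delta> \<le> a" "\<delta> \<le> c" by (simp_all add: prob_space)
  then have c0: "0 < c" using \<delta> by simp
  have "\<bar>a - c\<bar> = \<bar>\<integral>w. exp (- f (pb w)) - S w \<partial>M\<bar>" unfolding a_def c_def
    by (subst Bochner_Integration.integral_diff[OF ei Si]) simp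
  also have "\<dots> \<le> D" unfolding D_def by (rule integral_abs_bound)
  finally have "\<bar>ln a - ln c\<bar> \<le> D / \<delta>"
    using abs_ln_diff_le[OF \<delta> ac] divide_right_mono[of "\<bar>a - c\<bar>" D \<delta>] \<delta> by linarith
  then have 1: "- ln c \<le> - ln a + D / \<delta>" by linarith

  define g where "g x0 = Gfun T ts 0 (\<lambda>r. 0) x0" for x0
  have gm [measurable]: "g \<in> borel_measurable borel" unfolding g_def[abs_def] by (rule Gfun_measurable[OF ts(1)])
  obtain L where L: "\<And>t x x0. \<bar>Gfun T ts t x x0\<bar> \<le> L" using Gfun_Vfun_bounded[OF ts(1)] by blast
  have g: "\<delta> \<le> g x0" "g x0 \<le> L" for x0
    using Gfun_ge[OF zero ts(1) ge, of "\<lambda>r. 0" x0] L[of 0 "\<lambda>r. 0" x0] by (simp_all add: g_def)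
  have cg: "c = (\<integral>w. g (X w) \<partial>M)"
    unfolding c_def S_eq g_def by (rule Gfun_0_expectation(1)[OF ts(1) X])
  define h where "h w = g (X w) / c" for w
  have hR: "h \<in> borel_measurable (right_filtration 0)"
    unfolding h_def[abs_def] using measurable_compose[OF XR gm] by measurable
  have hM [measurable]: "h \<in> borel_measurable M" unfolding h_def[abs_def] using XM by measurable
  have h_pos: "0 < h w" for w using g(1)[of "X w"] \<delta> c0 by (simp add: h_def)
  define M' where "M' = density M (\<lambda>w. ennreal (h w))"
  have bM': "brownian M' T right_filtration W" unfolding M'_def
  proof (rule R.brownian_reweight[OF hR])
    show "0 \<le> h w" for w using h_pos[of w] by simp
    show "h w \<le> L / c" for w unfolding h_def by (intro divide_right_mono g(2)) (use c0 in simp)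
    show "(\<integral>w. h w \<partial>M) = 1" unfolding h_def using cg c0 by simp
  qed
  have spM': "space M' = space M" "sets M' = sets M" by (simp_all add: M'_def)
  interpret G: girsanov M' T right_filtration W X "\<lambda>r w. 0" ts \<delta> 0
    by (intro girsanov.intro bM' girsanov_axioms.intro XR ts(1) \<delta> ge progressive_deterministic) simp_all
  \<comment> \<open>With zero control the path along which the drift is evaluated is
    \<open>W\<close> itself.\<close>
  have YW: "G.Y r w = W r w" for r w by (simp add: G.Y_def time_integral_def set_lebesgue_integral_def)
  have GT: "G.G T w = S w" for w by (simp add: G.G_T YW S_eq)
  have lnr: "ln (G.ratio w) = ln (S w) - ln (g (X w))" if "w \<in> space M" for w
    using G.ln_ratio[of w] that by (simp add: spM' GT g_def time_integral_def set_lebesgue_integral_def)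
  \<comment> \<open>The initial tilt is proportional to \<open>g (X w)\<close> and the conditional
    tilt is \<open>S w / g (X w)\<close>, so the product is the normalised functional.\<close>
  have ratio: "h w * G.ratio w = S w / c" if w: "w \<in> space M" for w
  proof -
    have S0: "0 < S w" and g0: "0 < g (X w)" using S_bounds(1)[OF w] g(1)[of "X w"] \<delta> by auto
    have "ln (G.ratio w) = ln (S w / g (X w))" using lnr[OF w] S0 g0 by (simp add: ln_divide_pos)
    moreover have "0 < G.ratio w" using G.ratio_pos[of w] w by (simp add: spM')
    ultimately have "G.ratio w = S w / g (X w)" using S0 g0 by simp
    then show ?thesis using g0 by (simp add: h_def)
  qed
  interpret N: brownian G.\<nu> T right_filtration G.Wt by (rule G.brownian_\<nu>)
  have setsN: "sets G.\<nu> = sets M" "space G.\<nu> = space M" by (simp_all add: G.sets_\<nu> G.space_\<nu> spM')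
  have mN: "k \<in> borel_measurable G.\<nu>" if "k \<in> borel_measurable M" for k :: "'w \<Rightarrow> real"
    using that unfolding measurable_cong_sets[OF setsN(1) refl] .
  have intN: "(\<integral>w. k w \<partial>G.\<nu>) = (\<integral>w. S w / c * k w \<partial>M)" if k: "k \<in> borel_measurable M" for k :: "'w \<Rightarrow> real"
  proof -
    have kM': "k \<in> borel_measurable M'" using k unfolding measurable_cong_sets[OF spM'(2) refl] .
    have rM: "G.ratio \<in> borel_measurable M" using G.ratio_measurable unfolding measurable_cong_sets[OF spM'(2) refl] .
    have "(\<integral>w. k w \<partial>G.\<nu>) = (\<integral>w. G.ratio w * k w \<partial>M')" using G.integral_\<nu>[OF kM'] by simp
    also have "\<dots> = (\<integral>w. h w *\<^sub>R (G.ratio w * k w) \<partial>M)"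
      unfolding M'_def by (rule integral_density) (use k rM h_pos in \<open>auto intro: less_imp_le\<close>)
    also have "\<dots> = (\<integral>w. S w / c * k w \<partial>M)"
      by (intro Bochner_Integration.integral_cong refl) (simp add: ratio[symmetric])
    finally show ?thesis .
  qed
  have bN: "integrable G.\<nu> k" if "k \<in> borel_measurable M" "\<And>w. w \<in> space M \<Longrightarrow> \<bar>k w\<bar> \<le> B" for k :: "'w \<Rightarrow> real" and B
    by (rule N.bounded_integrable[OF mN[OF that(1)]]) (use that(2) setsN(2) in simp)
  have ln_bound: "\<bar>ln (S w)\<bar> \<le> max \<bar>ln \<delta>\<bar> \<bar>ln C\<bar>" if "w \<in> space M" for w
  proof -
    have "ln \<delta> \<le> ln (S w)" "ln (S w) \<le> ln C" using S_bounds[OF that] \<delta> by (simp_all add: ln_mono)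
    then show ?thesis by auto
  qed
  have ln_bound': "\<bar>ln (g x0)\<bar> \<le> max \<bar>ln \<delta>\<bar> \<bar>ln L\<bar>" for x0
  proof -
    have "ln \<delta> \<le> ln (g x0)" "ln (g x0) \<le> ln L" using g[of x0] \<delta> by (simp_all add: ln_mono)
    then show ?thesis by auto
  qed
  have iS: "integrable G.\<nu> (\<lambda>w. ln (S w))" by (rule bN[OF _ ln_bound]) measurable
  have gXm: "(\<lambda>w. ln (g (X w))) \<in> borel_measurable M" using XM by measurable
  have ig: "integrable G.\<nu> (\<lambda>w. ln (g (X w)))" by (rule bN[OF gXm ln_bound'])
  have if': "integrable G.\<nu> (\<lambda>w. f (pb w))" by (rule bN[OF fm f_bounds(1)])

  \<comment> \<open>The Girsanov step leaves the law of \<open>X\<close> unchanged, so only the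
    reweighting by \<open>h\<close> is visible in it.\<close>
  have \<mu>: "distr G.\<nu> borel X = density (distr M borel X) (\<lambda>x0. ennreal (g x0 / c))"
  proof -
    have gc: "(\<lambda>x0. ennreal (g x0 / c)) \<in> borel_measurable borel" by measurable
    show ?thesis unfolding G.distr_\<nu>_X unfolding M'_def h_def by (rule density_distr[OF gc XM, symmetric])
  qed
  have XN: "X \<in> borel_measurable G.\<nu>" using XM unfolding measurable_cong_sets[OF setsN(1) refl] .
  have "relative_entropy (distr G.\<nu> borel X) (distr M borel X) = ereal (\<integral>x0. ln (g x0 / c) \<partial>distr G.\<nu> borel X)"
  proof (rule relative_entropy_density[OF prob_space_distr[OF XM] _ _ _ _ \<mu> N.prob_space_distr[OF XN]])
    show "(\<lambda>x0. g x0 / c) \<in> borel_measurable (distr M borel X)" by measurable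
    show "0 < \<delta> / c" using \<delta> c0 by simp
    show "\<delta> / c \<le> g x0 / c" "g x0 / c \<le> L / c" for x0 using g[of x0] c0 by (simp_all add: divide_right_mono)
  qed
  also have "(\<integral>x0. ln (g x0 / c) \<partial>distr G.\<nu> borel X) = (\<integral>w. ln (g (X w) / c) \<partial>G.\<nu>)"
    by (rule integral_distr[OF XN]) measurable
  also have "\<dots> = (\<integral>w. ln (g (X w)) - ln c \<partial>G.\<nu>)"
  proof (intro Bochner_Integration.integral_cong refl)
    fix w
    have "0 < g (X w)" using g(1)[of "X w"] \<delta> by simp
    then show "ln (g (X w) / c) = ln (g (X w)) - ln c" using c0 by (simp add: ln_divide_pos)
  qed
  also have "\<dots> = (\<integral>w. ln (g (X w)) \<partial>G.\<nu>) - ln c" using ig by (simp add: N.prob_space)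
  finally have RE: "relative_entropy (distr G.\<nu> borel X) (distr M borel X) = ereal ((\<integral>w. ln (g (X w)) \<partial>G.\<nu>) - ln c)" .

  have nullN: "null_sets G.\<nu> \<subseteq> null_sets M"
  proof -
    have "null_sets M' \<subseteq> null_sets M" unfolding M'_def by (rule null_sets_density_pos[OF hM h_pos])
    moreover have "null_sets G.\<nu> \<subseteq> null_sets M'"
      unfolding G.\<nu>_def by (rule null_sets_density_pos[OF G.ratio_measurable G.ratio_pos])
    ultimately show ?thesis by blast
  qed
  have uc: "usual_conditions T G.\<nu> right_filtration" by (rule usual_conditions_right[OF compl nullN])
  then have complN: "complete_filtration G.\<nu> right_filtration" by (simp add: usual_conditions_def)
  have sys: "(distr G.\<nu> borel X, G.\<nu>, G.Wt, X, right_filtration) \<in> control_systems T"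
    by (rule N.control_systemI[OF XR uc])

  have "control_cost T f G.\<nu> G.Wt X G.\<phi> = (\<integral>w. N.energy G.\<phi> w / 2 \<partial>G.\<nu>) + (\<integral>w. f (N.regular_path G.\<phi> w, X w) \<partial>G.\<nu>)"
    by (rule N.control_cost_eq[OF complN G.control_\<phi> XN f])
  also have "(\<integral>w. f (N.regular_path G.\<phi> w, X w) \<partial>G.\<nu>) = (\<integral>w. f (pb w) \<partial>G.\<nu>)"
  proof (rule integral_cong_AE)
    show "(\<lambda>w. f (N.regular_path G.\<phi> w, X w)) \<in> borel_measurable G.\<nu>"
      by (rule measurable_compose[OF N.regular_path_measurable[OF G.control_\<phi> XN] f(1)])
    show "(\<lambda>w. f (pb w)) \<in> borel_measurable G.\<nu>" by (rule mN[OF fm])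
    \<comment> \<open>Adding the integral of the control to \<open>G.Wt\<close> gives back
      \<open>W\<close>.\<close>
    show "AE w in G.\<nu>. f (N.regular_path G.\<phi> w, X w) = f (pb w)"
      using N.control_facts(3)[OF G.control_\<phi>]
      by eventually_elim (simp add: N.regular_path_def N.controlled_def pb_def G.Wt_def)
  qed
  also have "(\<integral>w. N.energy G.\<phi> w / 2 \<partial>G.\<nu>) \<le> (\<integral>w. ln (G.ratio w) \<partial>G.\<nu>)"
    using G.energy_le_\<nu> unfolding N.energy_def .
  also have "(\<integral>w. ln (G.ratio w) \<partial>G.\<nu>) = (\<integral>w. ln (S w) - ln (g (X w)) \<partial>G.\<nu>)"
    by (intro Bochner_Integration.integral_cong refl) (simp add: lnr setsN(2))
  also have "\<dots> = (\<integral>w. ln (S w) \<partial>G.\<nu>) - (\<integral>w. ln (g (X w)) \<partial>G.\<nu>)" by (rule Bochner_Integration.integral_diff[OF iS ig])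
  finally have cost: "control_cost T f G.\<nu> G.Wt X G.\<phi> \<le>
      (\<integral>w. ln (S w) \<partial>G.\<nu>) - (\<integral>w. ln (g (X w)) \<partial>G.\<nu>) + (\<integral>w. f (pb w) \<partial>G.\<nu>)" by simp
  have "(\<integral>w. ln (S w) \<partial>G.\<nu>) + (\<integral>w. f (pb w) \<partial>G.\<nu>) = (\<integral>w. ln (S w) + f (pb w) \<partial>G.\<nu>)"
    by (rule Bochner_Integration.integral_add[OF iS if', symmetric])
  also have "\<dots> = (\<integral>w. S w / c * (ln (S w) + f (pb w)) \<partial>M)" by (rule intN) measurable
  \<comment> \<open>The density \<open>S / c\<close> is at most \<open>C / \<delta>\<close>, and
    \<open>ln S + f\<close> is at most \<open>1 / \<delta>\<close> times the distance of
    \<open>S\<close> to \<open>exp (- f)\<close>.\<close>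
  also have "\<dots> \<le> (\<integral>w. C / (\<delta> * \<delta>) * \<bar>exp (- f (pb w)) - S w\<bar> \<partial>M)"
  proof (rule integral_mono)
    have nb: "norm (S w / c * (ln (S w) + f (pb w))) \<le> C / c * (max \<bar>ln \<delta>\<bar> \<bar>ln C\<bar> + K)" if "w \<in> space M" for w
    proof -
      have "\<bar>S w / c\<bar> \<le> C / c" using S_bounds[OF that] \<delta> c0 by (simp add: divide_right_mono)
      moreover have "\<bar>ln (S w) + f (pb w)\<bar> \<le> max \<bar>ln \<delta>\<bar> \<bar>ln C\<bar> + K"
        using ln_bound[OF that] f_bounds(1)[OF that] by linarith
      ultimately show ?thesis unfolding real_norm_def abs_mult using C0 c0 by (intro mult_mono) simp_all
    qed
    show "integrable M (\<lambda>w. S w / c * (ln (S w) + f (pb w)))"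
      by (rule bounded_integrable[OF _ nb]) measurable
    show "integrable M (\<lambda>w. C / (\<delta> * \<delta>) * \<bar>exp (- f (pb w)) - S w\<bar>)" using Di by simp
    fix w assume w: "w \<in> space M"
    have "ln (S w) + f (pb w) \<le> \<bar>exp (- f (pb w)) - S w\<bar> / \<delta>"
      using abs_ln_diff_le[OF \<delta> f_bounds(2)[OF w] S_bounds(1)[OF w]] by simp
    then have "S w / c * (ln (S w) + f (pb w)) \<le> S w / c * (\<bar>exp (- f (pb w)) - S w\<bar> / \<delta>)"
      using S_bounds(1)[OF w] \<delta> c0 by (intro mult_left_mono) auto
    also have "\<dots> \<le> C / \<delta> * (\<bar>exp (- f (pb w)) - S w\<bar> / \<delta>)"
      using S_bounds[OF w] \<delta> c0 C0 ac by (intro mult_right_mono frac_le) auto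
    finally show "S w / c * (ln (S w) + f (pb w)) \<le> C / (\<delta> * \<delta>) * \<bar>exp (- f (pb w)) - S w\<bar>" by simp
  qed
  also have "\<dots> = C / (\<delta> * \<delta>) * D" by (simp add: D_def)
  finally have 2: "(\<integral>w. ln (S w) \<partial>G.\<nu>) + (\<integral>w. f (pb w) \<partial>G.\<nu>) \<le> C / (\<delta> * \<delta>) * D" .
  have "(\<integral>w. ln (g (X w)) \<partial>G.\<nu>) - ln c + control_cost T f G.\<nu> G.Wt X G.\<phi> \<le> - ln a + (1 / \<delta> + C / (\<delta> * \<delta>)) * D"
    using cost 1 2 by (simp add: distrib_right)
  also have "(1 / \<delta> + C / (\<delta> * \<delta>)) * D \<le> (1 / \<delta> + C / (\<delta> * \<delta>)) * e'" using D den by (intro mult_left_mono) auto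
  also have "\<dots> = e" using e'(2) by (simp add: mult.commute)
  finally have "relative_entropy (distr G.\<nu> borel X) (distr M borel X) + ereal (control_cost T f G.\<nu> G.Wt X G.\<phi>) \<le> ereal (- ln a + e)"
    unfolding RE by simp
  then show ?thesis using sys G.control_\<phi> unfolding a_def pb_def by blast
qed

(* The infimum over all systems, whatever their sample space: it equals the left-hand side already
   over the sample-point type 'w of the given space, and no system on any other type 'b
   (an arbitrary type variable) has a smaller cost. *)
theorem proposition4p1:
  fixes T :: real
    and M :: "'w measure"
    and F :: "real \<Rightarrow> 'w measure"
    and B :: "real \<Rightarrow> 'w \<Rightarrow> real ^ 'n"
    and X :: "'w \<Rightarrow> 'a::polish_space"
    and \<rho> :: "'a measure"
    and f :: "(real \<Rightarrow> real ^ 'n) \<times> 'a \<Rightarrow> real"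
  assumes "0 < T"
    and "prob_space M" and "filtration_upto T M F" and "complete_filtration M F"
    and "brownian_motion T M F B"
    and "X \<in> borel_measurable (F 0)" and "distr M borel X = \<rho>"
    and "f \<in> borel_measurable (borel_of (path_init_topology T))"
    and "bounded (f ` topspace (path_init_topology T))"
  shows "ereal (- ln (\<integral>\<omega>. exp (- f (\<lambda>t\<in>{0..T}. B t \<omega>, X \<omega>)) \<partial>M))
           = variational_value TYPE('w) T f \<rho>
       \<and> ereal (- ln (\<integral>\<omega>. exp (- f (\<lambda>t\<in>{0..T}. B t \<omega>, X \<omega>)) \<partial>M))
           \<le> variational_value TYPE('b) T f \<rho>"
proof -
  interpret brownian M T F B
    by (intro brownian.intro filtered_prob_space.intro filtered_prob_space_axioms.intro brownian_axioms.intro assms)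
  have f: "f \<in> borel_measurable (path_measure_space T)"
    by (rule borel_of_path_init_measurable[OF assms(1,8)])
  obtain K where K: "\<And>p. p \<in> cpaths T \<times> UNIV \<Longrightarrow> \<bar>f p\<bar> \<le> K"
    using assms(9) unfolding bounded_iff topspace_path_init by auto
  let ?L = "- ln (\<integral>w. exp (- f (\<lambda>t\<in>{0..T}. B t w, X w)) \<partial>M)"
  have lower: "ereal ?L \<le> relative_entropy \<mu> \<rho> + ereal (control_cost T f N V Y \<psi>)"
    if "(\<mu>, N, V, Y, H) \<in> control_systems T" "\<psi> \<in> controls T N H" for \<mu> N V Y H \<psi>
    unfolding assms(7)[symmetric] by (rule system_lower_bound[OF brownian_axioms assms(6) that f K])
  \<comment> \<open>The type variable \<open>'c\<close> is generalised once this is proved, so one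
    fact yields the bound for both types of sample points.\<close>
  have lower_value: "ereal ?L \<le> variational_value (t :: 'c itself) T f \<rho>" for t
    unfolding variational_value_def by (intro INF_greatest) (auto intro!: INF_greatest lower)
  \<comment> \<open>The near-optimal system has the sample-point type of the given space, hence
    takes part in the infimum over \<open>'w\<close>.\<close>
  have "variational_value TYPE('w) T f \<rho> \<le> ereal ?L"
  proof (rule ereal_le_epsilon2)
    fix e :: real assume "0 < e"
    from control_upper_bound[OF assms(4,6) f K this]
    obtain \<mu> N V H and \<psi> :: "real \<Rightarrow> 'w \<Rightarrow> real ^ 'n" where sys: "(\<mu>, N, V, X, H) \<in> control_systems T" "\<psi> \<in> controls T N H"
      and c: "relative_entropy \<mu> \<rho> + ereal (control_cost T f N V X \<psi>) \<le> ereal (?L + e)"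
      unfolding assms(7) by blast
    have "variational_value TYPE('w) T f \<rho> \<le> relative_entropy \<mu> \<rho> + ereal (control_cost T f N V X \<psi>)"
      unfolding variational_value_def by (rule INF_lower2[OF sys(1)], simp, rule INF_lower[OF sys(2)])
    also note c
    finally show "variational_value TYPE('w) T f \<rho> \<le> ereal ?L + ereal e" by simp
  qed
  with lower_value[of "TYPE('w)"] lower_value[of "TYPE('b)"] show ?thesis by (simp add: order_antisym)
qed

end
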